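(* Let $S$ be a set of graphs. If $S$ contains a graph on three or more vertices, then $S$-ERGM-PARTITION is $\#\mathsf{P}$-hard; otherwise (all graphs in $S$ have at most two vertices) $S$-ERGM-PARTITION can be solved in polynomial time.
   Context: An ERGM on the vertex set $V=\{1,\dots,n\}$ is given by a finite list of features $f$ (functions from simple graphs on $V$ to nonnegative integers) with integer weights $w_f$; the density of a graph $G$ on $V$ is $d(G)=\prod_f 2^{f(G)w_f}$ and the partition function is $Z=\sum_G d(G)$ over all simple graphs $G$ on $V$. For a set $S$ of graphs, an ERGM uses features from $S$ if each feature is either a subgraph indicator feature (for $F\in S$ on $k$ vertices and a specified ordered $k$-tuple of distinct vertices, the $0$-$1$ indicator that the tuple induces a copy of $F$ with the given vertex correspondence) or a subgraph count feature (for $F\in S$, the number of induced subgraphs isomorphic to $F$). $S$-ERGM-PARTITION is the problem: given such an ERGM (integer weights in binary), output its partition function $Z$. $\#\mathsf{P}$-hard means every $\#\mathsf{P}$ function is polynomial-time reducible to it.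
   Formalization: With binary weights Z can have exponentially many bits (one edge count of weight w on 2 vertices: Z=1+2^w), so "polynomial time" is read as: Z in binary in time polynomial in input plus output length, and Z as a product of sums of powers of two in time polynomial in the input. *)

theory Defs
  imports Complex_Main "HOL-Computational_Algebra.Polynomial"
begin

section \<open>Multi-tape (oracle) Turing machines\<close>

text \<open>
  States and tape symbols are numbered; symbol 0 is the blank, 1 and 2 are the bits 0 and 1,
  further symbols are auxiliary. Tapes are infinite to the right. Tape 0 holds the input,
  tape 1 the output, tape 2 is the oracle tape.
\<close>

datatype move = Go_Left | Go_Right | Go_Nowhere

type_synonym tape = "(nat \<Rightarrow> nat) \<times> nat"

type_synonym config = "nat \<times> tape list"

record machine =
  num_tapes :: nat
  num_states :: nat
  num_syms :: nat
  start_state :: nat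
  halt_state :: nat
  query_state :: "nat option"
  resume_state :: nat
  delta :: "nat \<Rightarrow> nat list \<Rightarrow> nat \<times> (nat \<times> move) list"

definition oracle_machine :: "machine \<Rightarrow> bool" where
  "oracle_machine M \<longleftrightarrow>
     3 \<le> num_tapes M \<and> 3 \<le> num_syms M \<and>
     start_state M < num_states M \<and> halt_state M < num_states M \<and>
     resume_state M < num_states M \<and>
     (\<forall>q<num_states M. \<forall>ss. length ss = num_tapes M \<and> set ss \<subseteq> {..<num_syms M} \<longrightarrow>
        (case delta M q ss of (q', acts) \<Rightarrow>
           q' < num_states M \<and> length acts = num_tapes M \<and> fst ` set acts \<subseteq> {..<num_syms M}))"

definition turing_machine :: "machine \<Rightarrow> bool" where
  "turing_machine M \<longleftrightarrow> oracle_machine M \<and> query_state M = None"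

fun move_head :: "move \<Rightarrow> nat \<Rightarrow> nat" where
  "move_head Go_Left h = h - 1"
| "move_head Go_Right h = h + 1"
| "move_head Go_Nowhere h = h"

fun scan :: "tape \<Rightarrow> nat" where
  "scan (f, h) = f h"

fun act :: "nat \<times> move \<Rightarrow> tape \<Rightarrow> tape" where
  "act (s, m) (f, h) = (f(h := s), move_head m h)"

definition word_tape :: "bool list \<Rightarrow> tape" where
  "word_tape w = ((\<lambda>i. if i < length w then (if w ! i then 2 else 1) else 0), 0)"

text \<open>The word on a tape: the bits from cell 0 up to the first cell that does not hold a bit.\<close>

definition tape_word :: "tape \<Rightarrow> bool list" where
  "tape_word t = map (\<lambda>i. fst t i = 2) [0..<(LEAST i. fst t i \<notin> {1, 2})]"

text \<open>
  In the query state the word on the oracle tape is replaced, in a single step, by the oracle's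
  answer. The halting state is never left, so \<open>t\<close> steps below means at most \<open>t\<close> steps.
\<close>

definition step :: "(bool list \<Rightarrow> bool list) \<Rightarrow> machine \<Rightarrow> config \<Rightarrow> config" where
  "step A M = (\<lambda>(q, ts).
     if q = halt_state M then (q, ts)
     else if query_state M = Some q then (resume_state M, ts[2 := word_tape (A (tape_word (ts ! 2)))])
     else (case delta M q (map scan ts) of (q', acts) \<Rightarrow> (q', map2 act acts ts)))"

definition init_config :: "machine \<Rightarrow> bool list \<Rightarrow> config" where
  "init_config M x = (start_state M, word_tape x # replicate (num_tapes M - 1) (word_tape []))"

definition outputs_within ::
    "(bool list \<Rightarrow> bool list) \<Rightarrow> machine \<Rightarrow> bool list \<Rightarrow> bool list \<Rightarrow> nat \<Rightarrow> bool" where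
  "outputs_within A M x y t \<longleftrightarrow>
     (case (step A M ^^ t) (init_config M x) of (q, ts) \<Rightarrow>
        q = halt_state M \<and> tape_word (ts ! 1) = y)"

abbreviation no_oracle :: "bool list \<Rightarrow> bool list" where
  "no_oracle \<equiv> \<lambda>_. []"


section \<open>Encodings\<close>

text \<open>Binary notation, least significant bit first, without leading zeros.\<close>

fun bin :: "nat \<Rightarrow> bool list" where
  "bin n = (if n = 0 then [] else odd n # bin (n div 2))"

declare bin.simps [simp del]

definition enc_list :: "('a \<Rightarrow> bool list) \<Rightarrow> 'a list \<Rightarrow> bool list" where
  "enc_list e xs = concat (map (\<lambda>x. True # e x) xs) @ [False]"

definition enc_unary :: "nat \<Rightarrow> bool list" where
  "enc_unary n = replicate n True @ [False]"

definition enc_word :: "bool list \<Rightarrow> bool list" where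
  "enc_word w = enc_list (\<lambda>b. [b]) w"

definition enc_nat :: "nat \<Rightarrow> bool list" where
  "enc_nat n = enc_word (bin n)"

definition enc_int :: "int \<Rightarrow> bool list" where
  "enc_int i = (i < 0) # enc_nat (nat \<bar>i\<bar>)"

definition enc_rat :: "rat \<Rightarrow> bool list" where
  "enc_rat r = (case quotient_of r of (a, b) \<Rightarrow> enc_int a @ enc_int b)"

definition enc_pair :: "bool list \<Rightarrow> bool list \<Rightarrow> bool list" where
  "enc_pair x y = enc_word x @ y"


section \<open>Polynomial time and #P\<close>

text \<open>
  A problem is the set of all pairs of an instance and an acceptable output for it; words that
  are not the first component of a pair are not instances, and nothing is demanded on them.
\<close>

type_synonym problem = "(bool list \<times> bool list) set"

definition poly_time_fun :: "(bool list \<Rightarrow> bool list) \<Rightarrow> bool" where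
  "poly_time_fun g \<longleftrightarrow>
     (\<exists>M (p :: nat poly). turing_machine M \<and>
        (\<forall>x. outputs_within no_oracle M x (g x) (poly p (length x))))"

definition poly_time_solvable :: "problem \<Rightarrow> bool" where
  "poly_time_solvable R \<longleftrightarrow>
     (\<exists>M (p :: nat poly). turing_machine M \<and>
        (\<forall>x\<in>Domain R. \<exists>y. (x, y) \<in> R \<and> outputs_within no_oracle M x y (poly p (length x))))"

text \<open>For problems whose outputs may be too long to be written in time polynomial in the input.\<close>

definition output_poly_time_solvable :: "problem \<Rightarrow> bool" where
  "output_poly_time_solvable R \<longleftrightarrow>
     (\<exists>M (p :: nat poly). turing_machine M \<and>
        (\<forall>x\<in>Domain R. \<exists>y. (x, y) \<in> R \<and>
           outputs_within no_oracle M x y (poly p (length x + length y))))"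

definition sharpP :: "(bool list \<Rightarrow> nat) set" where
  "sharpP = {f. \<exists>V (p :: nat poly). poly_time_fun V \<and>
     (\<forall>x. f x = card {y. length y = poly p (length x) \<and> V (enc_pair x y) = [True]})}"

definition oracle_for :: "problem \<Rightarrow> (bool list \<Rightarrow> bool list) \<Rightarrow> bool" where
  "oracle_for R A \<longleftrightarrow> (\<forall>x\<in>Domain R. (x, A x) \<in> R)"

text \<open>
  Turing reducibility. The time bound depends on the input only, not on the length of
  the oracle's answers.
\<close>

definition poly_time_reducible :: "(bool list \<Rightarrow> nat) \<Rightarrow> problem \<Rightarrow> bool" where
  "poly_time_reducible f R \<longleftrightarrow>
     (\<exists>M (p :: nat poly). oracle_machine M \<and>
        (\<forall>A. oracle_for R A \<longrightarrow>
           (\<forall>x. outputs_within A M x (bin (f x)) (poly p (length x)))))"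

definition sharpP_hard :: "problem \<Rightarrow> bool" where
  "sharpP_hard R \<longleftrightarrow> (\<forall>f\<in>sharpP. poly_time_reducible f R)"


section \<open>Exponential random graph models\<close>

text \<open>Vertices are numbered from 0: a graph of order \<open>n\<close> has the vertex set \<open>{..<n}\<close>.\<close>

datatype graph = Graph (graph_order: nat) (graph_edges: "nat set set")

definition simple_graph :: "graph \<Rightarrow> bool" where
  "simple_graph G \<longleftrightarrow> graph_edges G \<subseteq> {e. e \<subseteq> {..<graph_order G} \<and> card e = 2}"

definition graphs_on :: "nat \<Rightarrow> graph set" where
  "graphs_on n = {G. simple_graph G \<and> graph_order G = n}"

definition induces_copy :: "graph \<Rightarrow> (nat \<Rightarrow> nat) \<Rightarrow> graph \<Rightarrow> bool" where
  "induces_copy F v G \<longleftrightarrow>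
     (\<forall>i<graph_order F. \<forall>j<graph_order F. {i, j} \<in> graph_edges F \<longleftrightarrow> {v i, v j} \<in> graph_edges G)"

datatype feature = Indicator graph "nat list" | Count graph

fun feature_value :: "feature \<Rightarrow> graph \<Rightarrow> nat" where
  "feature_value (Indicator F vs) G = (if induces_copy F (\<lambda>i. vs ! i) G then 1 else 0)"
| "feature_value (Count F) G =
     card {U. U \<subseteq> {..<graph_order G} \<and> (\<exists>v. bij_betw v {..<graph_order F} U \<and> induces_copy F v G)}"

fun feature_from :: "graph set \<Rightarrow> nat \<Rightarrow> feature \<Rightarrow> bool" where
  "feature_from S n (Indicator F vs) \<longleftrightarrow>
     F \<in> S \<and> length vs = graph_order F \<and> distinct vs \<and> set vs \<subseteq> {..<n}"
| "feature_from S n (Count F) \<longleftrightarrow> F \<in> S"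

datatype ergm = ERGM (num_vertices: nat) (weighted_features: "(feature \<times> int) list")

definition uses_features_from :: "graph set \<Rightarrow> ergm \<Rightarrow> bool" where
  "uses_features_from S m \<longleftrightarrow>
     (\<forall>(f, w)\<in>set (weighted_features m). feature_from S (num_vertices m) f)"

definition density :: "ergm \<Rightarrow> graph \<Rightarrow> rat" where
  "density m G = (\<Prod>(f, w)\<leftarrow>weighted_features m. 2 powi (int (feature_value f G) * w))"

definition partition_function :: "ergm \<Rightarrow> rat" where
  "partition_function m = (\<Sum>G\<in>graphs_on (num_vertices m). density m G)"

definition enc_graph :: "graph \<Rightarrow> bool list" where
  "enc_graph G = enc_unary (graph_order G) @ [{i, j} \<in> graph_edges G. j \<leftarrow> [0..<graph_order G], i \<leftarrow> [0..<j]]"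

fun enc_feature :: "feature \<Rightarrow> bool list" where
  "enc_feature (Indicator F vs) = True # enc_graph F @ enc_list enc_nat vs"
| "enc_feature (Count F) = False # enc_graph F"

definition enc_ergm :: "ergm \<Rightarrow> bool list" where
  "enc_ergm m = enc_unary (num_vertices m) @
     enc_list (\<lambda>(f, w). enc_feature f @ enc_int w) (weighted_features m)"

text \<open>The encoding is unambiguous, so the problems below are well defined.\<close>

lemma bin_inject: "bin m = bin n \<Longrightarrow> m = n"
proof (induction m arbitrary: n rule: less_induct)
  case (less m)
  show ?case
  proof (cases "m = 0 \<or> n = 0")
    case True
    with less.prems show ?thesis
      using bin.simps[of m] bin.simps[of n] by (auto split: if_splits)
  next
    case False
    then have "bin m = odd m # bin (m div 2)" "bin n = odd n # bin (n div 2)"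
      using bin.simps[of m] bin.simps[of n] by auto
    with less.prems have o: "odd m \<longleftrightarrow> odd n" and b: "bin (m div 2) = bin (n div 2)"
      by auto
    have "m div 2 = n div 2"
      using less.IH[OF _ b] False by simp
    with o show ?thesis
      by presburger
  qed
qed

lemma enc_list_prefix:
  assumes "\<And>x y u v. x \<in> X \<Longrightarrow> y \<in> X \<Longrightarrow> e x @ u = e y @ v \<Longrightarrow> x = y \<and> u = v"
    and "set xs \<subseteq> X" "set ys \<subseteq> X" "enc_list e xs @ u = enc_list e ys @ v"
  shows "xs = ys \<and> u = v"
  using assms(2-)
proof (induction xs arbitrary: ys)
  case Nil
  then show ?case by (cases ys) (auto simp: enc_list_def)
next
  case (Cons x xs)
  then obtain y ys' where ys: "ys = y # ys'"
    by (cases ys) (auto simp: enc_list_def)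
  have "e x @ (enc_list e xs @ u) = e y @ (enc_list e ys' @ v)"
    using Cons.prems(3) by (simp add: ys enc_list_def)
  then have "x = y" "enc_list e xs @ u = enc_list e ys' @ v"
    using assms(1)[of x y] Cons.prems(1,2) ys by fastforce+
  then show ?case
    using Cons.IH[of ys'] Cons.prems(1,2) ys by simp
qed

lemma enc_unary_prefix: "enc_unary m @ u = enc_unary n @ v \<Longrightarrow> m = n \<and> u = v"
proof (induction m arbitrary: n)
  case 0
  then show ?case by (cases n) (auto simp: enc_unary_def)
next
  case (Suc m)
  then show ?case by (cases n) (auto simp: enc_unary_def)
qed

lemma enc_nat_prefix: "enc_nat m @ u = enc_nat n @ v \<Longrightarrow> m = n \<and> u = v"
  unfolding enc_nat_def enc_word_def
  using enc_list_prefix[of UNIV "\<lambda>b. [b]" "bin m" "bin n" u v] bin_inject[of m n] by simp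

lemma enc_int_prefix: "enc_int i @ u = enc_int j @ v \<Longrightarrow> i = j \<and> u = v"
  using enc_nat_prefix[of "nat \<bar>i\<bar>" u "nat \<bar>j\<bar>" v] by (auto simp: enc_int_def)

lemma enc_graph_prefix:
  assumes "simple_graph F" "simple_graph G" "enc_graph F @ u = enc_graph G @ v"
  shows "F = G \<and> u = v"
proof -
  define bits where "bits k E = [{i, j} \<in> E. j \<leftarrow> [0..<k], i \<leftarrow> [0..<j]]"
    for k :: nat and E :: "nat set set"
  have len: "length (bits k E) = length (bits k E')" for k E E'
    by (simp add: bits_def length_concat comp_def)
  have eq: "{i, j} \<in> E \<longleftrightarrow> {i, j} \<in> E'" if "bits k E = bits k E'" "i < j" "j < k" for i j k E E'
    using that
  proof (induction k)
    case (Suc k)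
    have s: "bits (Suc k) D = bits k D @ map (\<lambda>i. {i, k} \<in> D) [0..<k]" for D
      by (simp add: bits_def)
    show ?case
    proof (cases "j = k")
      case True
      with Suc.prems show ?thesis using len[of k E E'] by (simp add: s)
    next
      case False
      with Suc show ?thesis using len[of k E E'] by (simp add: s)
    qed
  qed simp
  have "enc_unary (graph_order F) @ (bits (graph_order F) (graph_edges F) @ u) =
        enc_unary (graph_order G) @ (bits (graph_order G) (graph_edges G) @ v)"
    using assms(3) by (simp add: enc_graph_def bits_def)
  from enc_unary_prefix[OF this] have o: "graph_order F = graph_order G"
    and b: "bits (graph_order F) (graph_edges F) @ u = bits (graph_order F) (graph_edges G) @ v"
    by auto
  from b have b': "bits (graph_order F) (graph_edges F) = bits (graph_order F) (graph_edges G)"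
    and uv: "u = v"
    using len[of "graph_order F" "graph_edges F" "graph_edges G"] by auto
  have "e \<in> graph_edges F \<longleftrightarrow> e \<in> graph_edges G" for e
  proof (cases "e \<subseteq> {..<graph_order F} \<and> card e = 2")
    case True
    then obtain a c where "e = {a, c}" "a \<noteq> c" by (auto simp: card_2_iff)
    then obtain i j where "e = {i, j}" "i < j"
      by (metis insert_commute linorder_neqE_nat)
    with True eq[OF b', of i j] show ?thesis by auto
  next
    case False
    then show ?thesis using assms(1,2) o by (auto simp: simple_graph_def)
  qed
  then have "graph_edges F = graph_edges G" by blast
  with o uv show ?thesis by (intro conjI graph.expand) auto
qed

lemma enc_feature_prefix:
  assumes "\<forall>F\<in>S. simple_graph F" "feature_from S n f" "feature_from S n g"
    and "enc_feature f @ u = enc_feature g @ v"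
  shows "f = g \<and> u = v"
proof (cases f; cases g)
  fix F vs G ws assume fg: "f = Indicator F vs" "g = Indicator G ws"
  then have "F = G \<and> enc_list enc_nat vs @ u = enc_list enc_nat ws @ v"
    using assms by (intro enc_graph_prefix) auto
  moreover from this have "vs = ws \<and> u = v"
    using enc_list_prefix[of UNIV enc_nat vs ws u v, OF enc_nat_prefix] by simp
  ultimately show ?thesis
    using fg by simp
next
  fix F G assume "f = Count F" "g = Count G"
  then show ?thesis
    using assms enc_graph_prefix[of F G u v] by auto
qed (use assms in auto)

lemma enc_ergm_inject:
  assumes "\<forall>F\<in>S. simple_graph F" "uses_features_from S m" "uses_features_from S m'"
    and "enc_ergm m = enc_ergm m'"
  shows "m = m'"
proof -
  let ?e = "\<lambda>(f, w). enc_feature f @ enc_int w"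
  let ?X = "{(f, w :: int). feature_from S (num_vertices m) f}"
  have n: "num_vertices m = num_vertices m'"
    and l: "enc_list ?e (weighted_features m) = enc_list ?e (weighted_features m')"
    using assms(4) unfolding enc_ergm_def by (auto dest: enc_unary_prefix)
  have "weighted_features m = weighted_features m' \<and> ([] :: bool list) = []"
  proof (rule enc_list_prefix[of ?X ?e])
    fix x y u v assume "x \<in> ?X" "y \<in> ?X" and e: "?e x @ u = ?e y @ v"
    then obtain f w g z where xy: "x = (f, w)" "y = (g, z)"
      and "feature_from S (num_vertices m) f" "feature_from S (num_vertices m) g"
      by auto
    with e have "f = g \<and> enc_int w @ u = enc_int z @ v"
      by (intro enc_feature_prefix[OF assms(1)]) auto
    with xy show "x = y \<and> u = v"
      using enc_int_prefix by blast
  qed (use assms(2,3) n l in \<open>auto simp: uses_features_from_def\<close>)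
  with n show ?thesis by (intro ergm.expand) auto
qed

lemma finite_graphs_on: "finite (graphs_on n)"
proof -
  have "graphs_on n \<subseteq> Graph n ` Pow (Pow {..<n})"
  proof
    fix G assume "G \<in> graphs_on n"
    then have "G = Graph n (graph_edges G)" "graph_edges G \<in> Pow (Pow {..<n})"
      by (auto simp: graphs_on_def simple_graph_def)
    then show "G \<in> Graph n ` Pow (Pow {..<n})" by blast
  qed
  then show ?thesis by (rule finite_subset) simp
qed

definition ergm_partition :: "graph set \<Rightarrow> problem" where
  "ergm_partition S =
     {(enc_ergm m, enc_rat (partition_function m)) | m. uses_features_from S m}"

text \<open>
  Weights are written in binary, so the binary notation of the partition function can be
  exponentially longer than the model: an edge-count feature of weight \<open>w\<close> on two vertices gives \<open>1 + 2 ^ w\<close>.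
  In the following variant it is instead written exactly as a product of sums of powers of two,
  with the exponents in binary.
\<close>

definition factored_value :: "int list list \<Rightarrow> rat" where
  "factored_value ess = (\<Prod>es\<leftarrow>ess. \<Sum>e\<leftarrow>es. 2 powi e)"

definition ergm_partition_factored :: "graph set \<Rightarrow> problem" where
  "ergm_partition_factored S =
     {(enc_ergm m, enc_list (enc_list enc_int) ess) | m ess.
        uses_features_from S m \<and> factored_value ess = partition_function m}"

end

theory Submission
  imports Defs "HOL-Library.FuncSet"
begin

text \<open>
  Hardness. The accepting computations of the verifier of a #P function correspond to the tilings of
  a square grid under local constraints, with one tiling for each accepted witness. Let \<open>F\<close> have
  \<open>k \<ge> 3\<close> vertices. The model has two vertices 0 and 1 in the role of the first vertex of \<open>F\<close>,
  \<open>m\<close> vertices \<open>u\<^sub>i\<close> and \<open>m\<close> vertices \<open>v\<^sub>j\<close> in the roles of the second and the third, and one vertex for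
  each further role. Large weights on the indicators at \<open>(1, u\<^sub>i, v\<^sub>j, \<dots>)\<close> force all pairs of vertices
  of different roles that avoid 0 to look as in \<open>F\<close>; what remains is the set \<open>X\<close> of those \<open>i\<close> and the
  set \<open>Y\<close> of those \<open>j\<close> for which 0 is joined correctly to \<open>u\<^sub>i\<close> and \<open>v\<^sub>j\<close>. Weights \<open>c i j\<close> on
  the indicators at \<open>(0, u\<^sub>i, v\<^sub>j, \<dots>)\<close> then give \<open>\<Sum>i\<in>X. \<Sum>j\<in>Y. c i j\<close>, and \<open>c\<close> is chosen such that
  the maximum is attained exactly if \<open>X = Y\<close> encodes a tiling. All weights are scaled so that the
  number of maxima can be read off from the leading bits of the partition function.

  Easiness. A feature on at most two vertices depends on at most one pair of vertices, or is a
  sum of such features, so the partition function is a product over the pairs of sums of two powers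
  of two, up to a power of two. Written as \<open>2 ^ k * p / 2 ^ l\<close> with odd \<open>p\<close>, the factors can be multiplied
  out one by one without any intermediate result longer than the final one, up to a polynomial.
\<close>


section \<open>A small imperative language with step-counting semantics\<close>

section \<open>Structured programs on bit stacks\<close>

text \<open>All constraints must be printed by a machine. The tile set and its tables are fixed with
  the verifier and hence compiled into the program; only sizes and cell codes vary. With cells
  numbered row by row, constraints link index differences \<open>1\<close>, \<open>G - 1\<close>,
  \<open>G\<close>, \<open>G + 1\<close> only, including pairs that wrap round the edges; borders
  free of heads make these harmless. A copy of \<open>F\<close> at \<open>(0, u, v, ...)\<close>
  tests two edges at 0 at once, so the energy is bilinear in \<open>X\<close> and \<open>Y\<close>;
  rewards only on the diagonal of \<open>c\<close> enforce \<open>X = Y\<close>. The scale is the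
  squared number of vertices: large enough for \<open>2 ^ scale\<close> to exceed the number of
  relevant edge sets, small enough for the oracle's answer to have polynomial length, as the time
  bound may not depend on that answer. In the easy case, powers of two that cancel in the end could
  make intermediate products far longer than the result. They are kept apart as binary exponents,
  and only the odd part \<open>p\<close> is written out: it never shrinks, and being odd it survives
  in the reduced numerator.\<close>

datatype cond = NE nat | TT nat

text \<open>\<open>Put\<close> arises only as the second half of a \<open>Push\<close> on a work
  register, and \<open>Init\<close> lays down the bottom markers. \<open>Query\<close> merely loops
  here; the compiled machine replaces the loop by a call of the oracle.\<close>

datatype cmd =
    Skip | Init | Query | Push nat bool | Put nat bool | Pop nat
  | Seq cmd cmd (infixr ";;" 60) | If cond cmd cmd | While cond cmd

type_synonym store = "nat \<Rightarrow> bool list"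

definition bsym :: "bool \<Rightarrow> nat" where "bsym b = (if b then 2 else 1)"

definition sym_at :: "bool list \<Rightarrow> nat \<Rightarrow> nat" where
  "sym_at xs i = (if i < length xs then bsym (xs ! i) else 0)"

fun holds_sym :: "cond \<Rightarrow> (nat \<Rightarrow> nat) \<Rightarrow> bool" where
  "holds_sym (NE j) sc \<longleftrightarrow> sc j = 1 \<or> sc j = 2"
| "holds_sym (TT j) sc \<longleftrightarrow> sc j = 2"

definition stay :: "(nat \<Rightarrow> nat) \<Rightarrow> nat \<Rightarrow> nat \<times> move" where
  "stay sc = (\<lambda>j. (sc j, Go_Nowhere))"

text \<open>Registers below 4 are the interface tapes: the head stands on the first free cell when
  writing and on the next symbol when reading. On a work register the head rests on the top symbol,
  so that a test needs no movement; the price is a second step for \<open>Push\<close>.\<close>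

fun nxt :: "cmd \<Rightarrow> (nat \<Rightarrow> nat) \<Rightarrow> cmd \<times> (nat \<Rightarrow> nat \<times> move)" where
  "nxt Skip sc = (Skip, stay sc)"
| "nxt Init sc = (Skip, \<lambda>j. (if 4 \<le> j then 3 else sc j, Go_Nowhere))"
| "nxt Query sc = (Query, stay sc)"
| "nxt (Push j b) sc =
     (if j < 4 then (Skip, (stay sc)(j := (bsym b, Go_Right)))
      else (Put j b, (stay sc)(j := (sc j, Go_Right))))"
| "nxt (Put j b) sc = (Skip, (stay sc)(j := (bsym b, Go_Nowhere)))"
| "nxt (Pop j) sc =
     (Skip, (stay sc)(j := (if j < 4 then (sc j, Go_Right) else (0, Go_Left))))"
| "nxt (c ;; d) sc = (if c = Skip then (d, stay sc) else (case nxt c sc of (c', a) \<Rightarrow> (c' ;; d, a)))"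
| "nxt (If b c d) sc = (if holds_sym b sc then c else d, stay sc)"
| "nxt (While b c) sc = (if holds_sym b sc then c ;; While b c else Skip, stay sc)"

definition tstep :: "cmd \<times> (nat \<Rightarrow> tape) \<Rightarrow> cmd \<times> (nat \<Rightarrow> tape)" where
  "tstep = (\<lambda>(c, T). case nxt c (\<lambda>j. scan (T j)) of (c', a) \<Rightarrow> (c', \<lambda>j. act (a j) (T j)))"

text \<open>Register 3 has no tape of its own: it is empty before the oracle query and nonempty after it,
  and so tells whether tape 2 is being written or read.\<close>

definition reads :: "bool list \<Rightarrow> tape \<Rightarrow> bool" where
  "reads xs t \<longleftrightarrow> (\<forall>i. fst t (snd t + i) = sym_at xs i)"

definition written :: "bool list \<Rightarrow> tape" where
  "written xs = (sym_at (rev xs), length xs)"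

text \<open>The marker 3 in cell 0 gives the head of an empty stack something to scan that is
  neither a bit nor the blank.\<close>

definition stacked :: "bool list \<Rightarrow> tape" where
  "stacked xs = (case_nat 3 (sym_at (rev xs)), length xs)"

text \<open>A relation and not a function, since a tape being read may hold anything to the left of
  its head.\<close>

definition rep :: "store \<Rightarrow> (nat \<Rightarrow> tape) \<Rightarrow> bool" where
  "rep s T \<longleftrightarrow> reads (s 0) (T 0) \<and> T 1 = written (s 1) \<and>
     (if s 3 = [] then T 2 = written (s 2) else reads (s 2) (T 2)) \<and>
     (\<forall>j\<ge>4. T j = stacked (s j))"

definition writable :: "store \<Rightarrow> nat \<Rightarrow> bool" where
  "writable s j \<longleftrightarrow> j = 1 \<or> j \<ge> 4 \<or> (j = 2 \<and> s 3 = [])"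

definition readable :: "store \<Rightarrow> nat \<Rightarrow> bool" where
  "readable s j \<longleftrightarrow> j = 0 \<or> j \<ge> 4 \<or> (j = 2 \<and> s 3 \<noteq> [])"

lemma writable_simps [simp]:
  "writable s (Suc 0)" "4 \<le> j \<Longrightarrow> writable s j" "writable s 2 \<longleftrightarrow> s 3 = []"
  by (auto simp: writable_def)

lemma readable_simps [simp]:
  "readable s 0" "4 \<le> j \<Longrightarrow> readable s j" "readable s 2 \<longleftrightarrow> s 3 \<noteq> []"
  by (auto simp: readable_def)

text \<open>The final store is exact while \<open>t\<close> is only an upper bound, so times can be
  weakened to convenient expressions at any point.\<close>

definition run :: "cmd \<Rightarrow> store \<Rightarrow> store \<Rightarrow> nat \<Rightarrow> bool" where
  "run c s s' t \<longleftrightarrow>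
     (\<forall>T. rep s T \<longrightarrow> (\<exists>n\<le>t. \<exists>T'. rep s' T' \<and> (tstep ^^ n) (c, T) = (Skip, T')))"

lemma act_stay [simp]: "act (scan t, Go_Nowhere) t = t"
  by (cases t) auto

lemma tstep_simps [simp]:
  "tstep (Skip, T) = (Skip, T)"
  "tstep (Skip ;; d, T) = (d, T)"
  "tstep (If b c d, T) = (if holds_sym b (\<lambda>j. scan (T j)) then c else d, T)"
  "tstep (While b c, T) = (if holds_sym b (\<lambda>j. scan (T j)) then c ;; While b c else Skip, T)"
  by (auto simp: tstep_def stay_def)

lemma tstep_Seq: "c \<noteq> Skip \<Longrightarrow> tstep (c ;; d, T) = (case tstep (c, T) of (c', T') \<Rightarrow> (c' ;; d, T'))"
  by (auto simp: tstep_def split: prod.splits)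

lemma tstep_Skip_iter [simp]: "(tstep ^^ n) (Skip, T) = (Skip, T)"
  by (induction n) auto

lemma tstep_Seq_iter:
  assumes "(tstep ^^ n) (c, T) = (Skip, T')"
  shows "\<exists>n'\<le>n + 1. (tstep ^^ n') (c ;; d, T) = (d, T')"
  using assms
proof (induction n arbitrary: c T)
  case 0
  then show ?case by (intro exI[of _ 1]) simp
next
  case (Suc n)
  obtain c' T1 where s: "tstep (c, T) = (c', T1)" by force
  show ?case
  proof (cases "c = Skip")
    case True
    then show ?thesis using Suc.prems by (intro exI[of _ 1]) (simp add: funpow_swap1)
  next
    case False
    have "(tstep ^^ n) (c', T1) = (Skip, T')"
      using Suc.prems by (simp add: funpow_swap1 s)
    then obtain n' where "n' \<le> n + 1" "(tstep ^^ n') (c' ;; d, T1) = (d, T')"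
      using Suc.IH by blast
    then show ?thesis
      using False s by (intro exI[of _ "Suc n'"]) (auto simp: funpow_swap1 tstep_Seq)
  qed
qed

lemma run_weaken: "run c s s' t \<Longrightarrow> s' = s'' \<Longrightarrow> t \<le> t' \<Longrightarrow> run c s s'' t'"
  unfolding run_def by (meson order_trans)

lemma run_Skip: "run Skip s s 0"
  unfolding run_def by auto

lemma run_Seq:
  assumes "run c s s1 t1" "run d s1 s2 t2"
  shows "run (c ;; d) s s2 (t1 + t2 + 1)"
  unfolding run_def
proof (intro allI impI)
  fix T assume "rep s T"
  then obtain n1 T1 where 1: "n1 \<le> t1" "rep s1 T1" "(tstep ^^ n1) (c, T) = (Skip, T1)"
    using assms(1) unfolding run_def by blast
  then obtain n2 T2 where 2: "n2 \<le> t2" "rep s2 T2" "(tstep ^^ n2) (d, T1) = (Skip, T2)"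
    using assms(2) unfolding run_def by blast
  obtain n' where n': "n' \<le> n1 + 1" "(tstep ^^ n') (c ;; d, T) = (d, T1)"
    using tstep_Seq_iter[OF 1(3)] by blast
  have "(tstep ^^ (n2 + n')) (c ;; d, T) = (Skip, T2)"
    using 2 n' by (simp add: funpow_add)
  then show "\<exists>n\<le>t1 + t2 + 1. \<exists>T'. rep s2 T' \<and> (tstep ^^ n) (c ;; d, T) = (Skip, T')"
    using 1 2 n' by (intro exI[of _ "n2 + n'"]) auto
qed

fun holds :: "cond \<Rightarrow> store \<Rightarrow> bool" where
  "holds (NE j) s \<longleftrightarrow> s j \<noteq> []"
| "holds (TT j) s \<longleftrightarrow> s j \<noteq> [] \<and> hd (s j)"

fun cond_reg :: "cond \<Rightarrow> nat" where
  "cond_reg (NE j) = j"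
| "cond_reg (TT j) = j"

lemma scan_readable:
  assumes "rep s T" "readable s j"
  shows "(s j \<noteq> [] \<longrightarrow> scan (T j) = bsym (hd (s j))) \<and>
         (s j = [] \<longrightarrow> scan (T j) = (if j < 4 then 0 else 3))"
proof (cases "4 \<le> j")
  case True
  then have "T j = stacked (s j)" using assms by (auto simp: rep_def)
  then show ?thesis using True
    by (cases "s j") (auto simp: stacked_def sym_at_def nth_append)
next
  case False
  then have "reads (s j) (T j)"
    using assms by (auto simp: rep_def readable_def split: if_splits)
  then have "fst (T j) (snd (T j)) = sym_at (s j) 0"
    unfolding reads_def by (metis add.right_neutral)
  then show ?thesis using False
    by (cases "T j"; cases "s j") (auto simp: sym_at_def)
qed

lemma holds_sym_iff:
  assumes "rep s T" "readable s (cond_reg b)"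
  shows "holds_sym b (\<lambda>j. scan (T j)) \<longleftrightarrow> holds b s"
  using assms scan_readable[OF assms] by (cases b) (auto simp: bsym_def split: if_splits)

lemma run_If:
  assumes "readable s (cond_reg b)"
    and "holds b s \<Longrightarrow> run c s s' t" "\<not> holds b s \<Longrightarrow> run d s s' t"
  shows "run (If b c d) s s' (t + 1)"
  unfolding run_def
proof (intro allI impI)
  fix T assume T: "rep s T"
  obtain n T' where n: "n \<le> t" "rep s' T'"
    "(tstep ^^ n) (if holds b s then c else d, T) = (Skip, T')"
    using assms T unfolding run_def by (cases "holds b s") auto
  then have "(tstep ^^ Suc n) (If b c d, T) = (Skip, T')"
    using holds_sym_iff[OF T assms(1)] by (simp add: funpow_swap1 del: funpow.simps(2) add: funpow_Suc_right)
  with n show "\<exists>n\<le>t + 1. \<exists>T'. rep s' T' \<and> (tstep ^^ n) (If b c d, T) = (Skip, T')"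
    by (intro exI[of _ "Suc n"]) auto
qed

lemma run_While_end:
  assumes "readable s (cond_reg b)" "\<not> holds b s"
  shows "run (While b c) s s 1"
  unfolding run_def using holds_sym_iff[of s _ b] assms by (auto intro!: exI[of _ 1])

lemma run_While_step:
  assumes "readable s (cond_reg b)" "holds b s" "run c s s1 t1" "run (While b c) s1 s2 t2"
  shows "run (While b c) s s2 (t1 + t2 + 2)"
  unfolding run_def
proof (intro allI impI)
  fix T assume T: "rep s T"
  obtain n T' where n: "n \<le> t1 + t2 + 1" "rep s2 T'"
    "(tstep ^^ n) (c ;; While b c, T) = (Skip, T')"
    using run_Seq[OF assms(3,4)] T unfolding run_def by blast
  then have "(tstep ^^ Suc n) (While b c, T) = (Skip, T')"
    using holds_sym_iff[OF T assms(1)] assms(2) by (simp del: funpow.simps(2) add: funpow_Suc_right)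
  with n show "\<exists>n\<le>t1 + t2 + 2. \<exists>T'. rep s2 T' \<and> (tstep ^^ n) (While b c, T) = (Skip, T')"
    by (intro exI[of _ "Suc n"]) auto
qed

text \<open>A loop is verified by naming the exact store \<open>S i\<close> after \<open>i\<close>
  rounds. The two additional steps per round are the test and the removal of
  \<open>Skip\<close>.\<close>

lemma run_While:
  assumes "\<And>i. i < k \<Longrightarrow> run c (S i) (S (Suc i)) t"
    and "\<And>i. i < k \<Longrightarrow> holds b (S i)" "\<not> holds b (S k)"
    and "\<And>i. i \<le> k \<Longrightarrow> readable (S i) (cond_reg b)"
  shows "run (While b c) (S 0) (S k) (k * (t + 2) + 1)"
proof -
  \<comment> \<open>\<open>j\<close> counts the rounds still to come, as
    \<open>run_While_step\<close> adds a round in front.\<close>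
  have "run (While b c) (S (k - j)) (S k) (j * (t + 2) + 1)" if "j \<le> k" for j
    using that
  proof (induction j)
    case 0
    then show ?case using run_While_end assms(3,4) by auto
  next
    case (Suc j)
    define i where "i = k - Suc j"
    have i: "i < k" "Suc i = k - j" using Suc.prems by (auto simp: i_def)
    have "run (While b c) (S i) (S k) (t + (j * (t + 2) + 1) + 2)"
      using assms i Suc by (intro run_While_step[OF _ _ assms(1)]) auto
    then show ?case by (simp add: i_def algebra_simps)
  qed
  from this[of k] show ?thesis by simp
qed

lemma rep_update:
  assumes "rep s T" "j \<noteq> 3"
    and "j = 0 \<Longrightarrow> reads xs t" "j = 1 \<Longrightarrow> t = written xs"
    and "j = 2 \<Longrightarrow> if s 3 = [] then t = written xs else reads xs t"
    and "4 \<le> j \<Longrightarrow> t = stacked xs"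
  shows "rep (s(j := xs)) (T(j := t))"
  using assms unfolding rep_def by auto

lemma sym_at_snoc: "(sym_at xs)(length xs := bsym b) = sym_at (xs @ [b])"
  by (auto simp: sym_at_def nth_append fun_eq_iff)

lemma run_Push:
  assumes "writable s j"
  shows "run (Push j b) s (s(j := b # s j)) 2"
  unfolding run_def
proof (intro allI impI)
  fix T assume T: "rep s T"
  show "\<exists>n\<le>2. \<exists>T'. rep (s(j := b # s j)) T' \<and> (tstep ^^ n) (Push j b, T) = (Skip, T')"
  proof (cases "4 \<le> j")
    case False
    then have j: "j = 1 \<or> j = 2 \<and> s 3 = []" using assms by (auto simp: writable_def)
    then have t: "T j = written (s j)" using T by (auto simp: rep_def)
    have w: "act (bsym b, Go_Right) (T j) = written (b # s j)"
      using sym_at_snoc[of "rev (s j)" b] by (simp add: t written_def)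
    have "tstep (Push j b, T) = (Skip, T(j := act (bsym b, Go_Right) (T j)))"
      using False by (simp add: tstep_def stay_def fun_eq_iff)
    moreover have "rep (s(j := b # s j)) (T(j := act (bsym b, Go_Right) (T j)))"
      using j w by (intro rep_update[OF T]) auto
    ultimately show ?thesis by (intro exI[of _ 1]) auto
  next
    case True
    then have t: "T j = stacked (s j)" using T by (auto simp: rep_def)
    define T1 where "T1 = T(j := act (scan (T j), Go_Right) (T j))"
    have 1: "tstep (Push j b, T) = (Put j b, T1)"
      using True by (simp add: tstep_def stay_def T1_def fun_eq_iff)
    have 2: "tstep (Put j b, T1) = (Skip, T1(j := act (bsym b, Go_Nowhere) (T1 j)))"
      by (simp add: tstep_def stay_def fun_eq_iff)
    have "act (bsym b, Go_Nowhere) (T1 j) = stacked (b # s j)"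
      by (auto simp: T1_def t stacked_def sym_at_def nth_append fun_eq_iff split: nat.splits)
    then have "rep (s(j := b # s j)) (T1(j := act (bsym b, Go_Nowhere) (T1 j)))"
      unfolding T1_def fun_upd_upd using True by (intro rep_update[OF T]) auto
    then show ?thesis using 1 2
      by (intro exI[of _ 2]) (auto simp: numeral_2_eq_2)
  qed
qed

lemma run_Pop:
  assumes "readable s j" "s j \<noteq> []"
  shows "run (Pop j) s (s(j := tl (s j))) 1"
  unfolding run_def
proof (intro allI impI)
  fix T assume T: "rep s T"
  obtain b xs where bx: "s j = b # xs" using assms(2) by (cases "s j") auto
  define a where "a = (if j < 4 then (scan (T j), Go_Right) else (0, Go_Left))"
  have 1: "tstep (Pop j, T) = (Skip, T(j := act a (T j)))"
    by (simp add: tstep_def stay_def a_def fun_eq_iff)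
  have "rep (s(j := tl (s j))) (T(j := act a (T j)))"
  proof (cases "4 \<le> j")
    case True
    then have "T j = stacked (s j)" using T by (auto simp: rep_def)
    then have "act a (T j) = stacked (tl (s j))"
      using True
      by (auto simp: a_def bx stacked_def sym_at_def nth_append fun_eq_iff split: nat.splits)
    then show ?thesis using True by (intro rep_update[OF T]) auto
  next
    case False
    then have j: "j = 0 \<or> j = 2 \<and> s 3 \<noteq> []" using assms(1) by (auto simp: readable_def)
    then have r: "reads (b # xs) (T j)" using T bx by (auto simp: rep_def)
    have "reads xs (act a (T j))"
      unfolding reads_def
    proof
      fix i
      have "fst (T j) (snd (T j) + Suc i) = sym_at (b # xs) (Suc i)"
        using r unfolding reads_def by blast
      then show "fst (act a (T j)) (snd (act a (T j)) + i) = sym_at xs i"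
        using False by (cases "T j") (auto simp: a_def sym_at_def)
    qed
    then show ?thesis using j bx by (intro rep_update[OF T]) auto
  qed
  with 1 show "\<exists>n\<le>1. \<exists>T'. rep (s(j := tl (s j))) T' \<and> (tstep ^^ n) (Pop j, T) = (Skip, T')"
    by (intro exI[of _ 1]) auto
qed


section \<open>Compilation to Turing machines\<close>

text \<open>The programs that can remain while \<open>c\<close> is executed. There are finitely
  many, and they become the states of the machine: the rest of the program serves as its own program
  counter.\<close>

fun resid :: "cmd \<Rightarrow> cmd set" where
  "resid (c ;; d) = (\<lambda>r. r ;; d) ` resid c \<union> resid d"
| "resid (If b c d) = insert (If b c d) (resid c \<union> resid d)"
| "resid (While b c) = {While b c, Skip} \<union> (\<lambda>r. r ;; While b c) ` resid c"
| "resid (Push j b) = {Push j b, Put j b, Skip}"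
| "resid c = {c, Skip}"

fun cregs :: "cmd \<Rightarrow> nat set" where
  "cregs (c ;; d) = cregs c \<union> cregs d"
| "cregs (If b c d) = insert (cond_reg b) (cregs c \<union> cregs d)"
| "cregs (While b c) = insert (cond_reg b) (cregs c)"
| "cregs (Push j b) = {j}"
| "cregs (Put j b) = {j}"
| "cregs (Pop j) = {j}"
| "cregs c = {}"

lemma finite_resid: "finite (resid c)"
  by (induction c) auto

lemma finite_cregs: "finite (cregs c)"
  by (induction c) auto

lemma self_in_resid: "c \<in> resid c"
  by (induction c) auto

lemma Skip_in_resid: "Skip \<in> resid c"
  by (induction c) auto

lemma nxt_in_resid: "r \<in> resid c \<Longrightarrow> fst (nxt r sc) \<in> resid c"
proof (induction c arbitrary: r)
  case (Seq c d)
  show ?case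
  proof (cases "r \<in> resid d")
    case False
    then obtain r' where r: "r = r' ;; d" "r' \<in> resid c" using Seq.prems by auto
    then show ?thesis
      using Seq.IH(1)[OF r(2)] by (auto simp: self_in_resid split: prod.splits)
  qed (use Seq.IH in auto)
next
  case (While b c)
  show ?case
  proof (cases "r \<in> {While b c, Skip}")
    case False
    then obtain r' where r: "r = r' ;; While b c" "r' \<in> resid c" using While.prems by auto
    then show ?thesis
      using While.IH[OF r(2)] by (auto split: prod.splits)
  qed (auto simp: self_in_resid)
qed (auto simp: self_in_resid)

lemma cregs_resid: "r \<in> resid c \<Longrightarrow> cregs r \<subseteq> cregs c"
  by (induction c arbitrary: r) fastforce+

text \<open>\<open>nxt\<close> is given the symbols of infinitely many registers, the machine sees
  only \<open>k\<close> tapes; registers that the program does not mention cannot influence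
  it.\<close>

lemma nxt_cong:
  assumes "cregs c \<subseteq> {..<k}" "\<And>j. j < k \<Longrightarrow> sc j = sc' j"
  shows "fst (nxt c sc) = fst (nxt c sc') \<and> (\<forall>j<k. snd (nxt c sc) j = snd (nxt c sc') j)"
proof -
  have h: "holds_sym b sc = holds_sym b sc'" if "cond_reg b < k" for b
    using that assms(2) by (cases b) auto
  show ?thesis
    using assms(1) by (induction c) (auto simp: stay_def assms(2) h split: prod.splits)
qed

lemma snd_nxt_symbols: "(\<And>j. sc j < 4) \<Longrightarrow> fst (snd (nxt c sc) j) < 4"
  by (induction c) (auto simp: stay_def bsym_def split: prod.splits)

lemma tape_word_sym_at: "fst t = sym_at xs \<Longrightarrow> tape_word t = xs"
proof -
  assume t: "fst t = sym_at xs"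
  have "(LEAST i. sym_at xs i \<notin> {1, 2}) = length xs"
    by (rule Least_equality) (auto simp: sym_at_def bsym_def split: if_splits)
  then show ?thesis
    by (intro nth_equalityI) (auto simp: tape_word_def t sym_at_def bsym_def)
qed

lemma word_tape_sym_at: "word_tape xs = (sym_at xs, 0)"
  by (auto simp: word_tape_def sym_at_def bsym_def)

text \<open>\<open>d\<close> is \<open>None\<close> for a plain machine and \<open>Some c\<close>
  for one that calls the oracle in front of \<open>c\<close>: the residual \<open>Query ;; c\<close>
  is then the query state and \<open>c\<close> the state of resumption. \<open>e\<close> numbers the
  residuals.\<close>

locale compiled =
  fixes main :: cmd and d :: "cmd option" and k :: nat and e :: "cmd \<Rightarrow> nat"
  assumes k: "4 \<le> k" "cregs main \<subseteq> {..<k}"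
    and e: "bij_betw e (resid main) {..<card (resid main)}"
    and d: "\<And>c. d = Some c \<Longrightarrow> Query ;; c \<in> resid main"
      "\<And>c. d = Some c \<Longrightarrow> c \<in> resid main"
begin

definition M :: machine where
  "M = \<lparr> num_tapes = k, num_states = card (resid main), num_syms = 4,
     start_state = e main, halt_state = e Skip,
     query_state = map_option (\<lambda>c. e (Query ;; c)) d,
     resume_state = (case d of None \<Rightarrow> e Skip | Some c \<Rightarrow> e c),
     delta = (\<lambda>q ss. case nxt (inv_into (resid main) e q) (\<lambda>j. if j < length ss then ss ! j else 0)
       of (c, a) \<Rightarrow> (e c, map a [0..<k])) \<rparr>"

lemma e_less: "c \<in> resid main \<Longrightarrow> e c < card (resid main)"
  using e by (auto simp: bij_betw_def)

lemma e_eq_iff: "c \<in> resid main \<Longrightarrow> c' \<in> resid main \<Longrightarrow> e c = e c' \<longleftrightarrow> c = c'"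
  using e by (auto simp: bij_betw_def inj_on_eq_iff)

lemma inv_e: "c \<in> resid main \<Longrightarrow> inv_into (resid main) e (e c) = c"
  using e by (simp add: bij_betw_inv_into_left)

lemma oracle_machine_M: "oracle_machine M"
proof -
  have "e c < card (resid main) \<and> fst ` a ` {0..<k} \<subseteq> {..<4}"
    if q: "q < card (resid main)" and ss: "set ss \<subseteq> {..<4}"
      and n: "nxt (inv_into (resid main) e q) (\<lambda>j. if j < length ss then ss ! j else 0) = (c, a)"
    for q ss c a
  proof -
    have "inv_into (resid main) e q \<in> resid main"
      using e q by (metis bij_betw_imp_surj_on inv_into_into lessThan_iff)
    then have "c \<in> resid main" using nxt_in_resid n by (metis fst_conv)
    moreover have "fst (a j) < 4" for j
      using snd_nxt_symbols[of "\<lambda>j. if j < length ss then ss ! j else 0" "inv_into (resid main) e q" j]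
        n ss by (fastforce dest: nth_mem)
    ultimately show ?thesis by (auto intro: e_less)
  qed
  then have *: "case delta M q ss of (q', acts) \<Rightarrow>
      q' < num_states M \<and> length acts = num_tapes M \<and> fst ` set acts \<subseteq> {..<num_syms M}"
    if "q < num_states M" "length ss = num_tapes M \<and> set ss \<subseteq> {..<num_syms M}" for q ss
    using that by (auto simp: M_def split: prod.splits) (meson imageI image_subset_iff lessThan_iff atLeastLessThan_iff le0)
  have "start_state M < num_states M" "halt_state M < num_states M" "resume_state M < num_states M"
    using d by (auto simp: M_def self_in_resid Skip_in_resid intro!: e_less split: option.splits)
  then show ?thesis
    unfolding oracle_machine_def using * k by (auto simp: M_def)
qed

lemma step_halt: "step A M (e Skip, ts) = (e Skip, ts)"
  by (simp add: step_def M_def)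

lemma step_halt_iter [simp]: "(step A M ^^ n) (e Skip, ts) = (e Skip, ts)"
  by (induction n) (auto simp: step_halt)

lemma step_tstep:
  assumes c: "c \<in> resid main" "c \<noteq> Skip" "\<And>c'. d = Some c' \<Longrightarrow> c \<noteq> Query ;; c'"
    and t: "tstep (c, T) = (c', T')"
  shows "step A M (e c, map T [0..<k]) = (e c', map T' [0..<k])"
proof -
  have 1: "e c \<noteq> halt_state M"
    using c by (simp add: M_def e_eq_iff Skip_in_resid)
  have 2: "query_state M \<noteq> Some (e c)"
    using c d by (auto simp: M_def e_eq_iff)
  define sc where "sc = (\<lambda>j. if j < k then map (scan \<circ> T) [0..<k] ! j else 0)"
  have n: "fst (nxt c sc) = fst (nxt c (\<lambda>j. scan (T j))) \<and>
      (\<forall>j<k. snd (nxt c sc) j = snd (nxt c (\<lambda>j. scan (T j))) j)"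
    using cregs_resid[OF c(1)] k by (intro nxt_cong) (auto simp: sc_def)
  have "delta M (e c) (map scan (map T [0..<k])) = (e c', map (snd (nxt c (\<lambda>j. scan (T j)))) [0..<k])"
    using n t c(1) unfolding M_def
    by (auto simp: inv_e sc_def tstep_def split: prod.splits)
  then show ?thesis
    using 1 2 t unfolding step_def
    by (auto simp: tstep_def map2_map_map split: prod.splits)
qed

text \<open>At \<open>Skip\<close> and at the query, \<open>tstep\<close> stays put, whereas the
  machine has halted or calls the oracle. The machine is therefore followed only until it first
  arrives there, which is why the number of steps may drop.\<close>

lemma step_iter:
  assumes "(tstep ^^ n) (c, T) = (c', T')" "c \<in> resid main"
    and "c' = Skip \<or> (\<exists>c2. d = Some c2 \<and> c' = Query ;; c2)"
  shows "\<exists>n'\<le>n. (step A M ^^ n') (e c, map T [0..<k]) = (e c', map T' [0..<k])"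
  using assms(1,2)
proof (induction n arbitrary: c T)
  case 0
  then show ?case by auto
next
  case (Suc n)
  obtain c1 T1 where s: "tstep (c, T) = (c1, T1)" by force
  show ?case
  proof (cases "c = Skip \<or> (\<exists>c2. d = Some c2 \<and> c = Query ;; c2)")
    case True
    then have "tstep (c, T) = (c, T)"
      by (auto simp: tstep_def stay_def)
    then have "(tstep ^^ Suc n) (c, T) = (c, T)"
      by (induction n) auto
    with Suc.prems show ?thesis by (intro exI[of _ 0]) simp
  next
    case False
    have "c1 \<in> resid main"
      using nxt_in_resid[OF Suc.prems(2)] s by (auto simp: tstep_def split: prod.splits) (metis fst_conv)
    moreover have "(tstep ^^ n) (c1, T1) = (c', T')"
      using Suc.prems(1) s by (simp add: funpow_swap1)
    ultimately obtain n' where "n' \<le> n" "(step A M ^^ n') (e c1, map T1 [0..<k]) = (e c', map T' [0..<k])"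
      using Suc.IH by blast
    moreover have "step A M (e c, map T [0..<k]) = (e c1, map T1 [0..<k])"
      using False Suc.prems(2) s by (intro step_tstep) auto
    ultimately show ?thesis
      by (intro exI[of _ "Suc n'"]) (auto simp: funpow_swap1)
  qed
qed

end

definition input_store :: "bool list \<Rightarrow> store" where
  "input_store x = (\<lambda>j. if j = 0 then x else [])"

definition input_tapes :: "bool list \<Rightarrow> nat \<Rightarrow> tape" where
  "input_tapes x j = word_tape (if j = 0 then x else [])"

lemma (in compiled) init_config_M: "init_config M x = (e main, map (input_tapes x) [0..<k])"
proof -
  obtain k' where k': "k = Suc k'" using k by (cases k) auto
  show ?thesis
    unfolding init_config_def M_def
    by (auto simp: input_tapes_def k' map_upt_Suc map_replicate_const simp del: upt_Suc)
qed

lemma tstep_Init: "\<exists>T. tstep (Init, input_tapes x) = (Skip, T) \<and> rep (input_store x) T"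
proof -
  have "rep (input_store x) (\<lambda>j. act (if 4 \<le> j then 3 else scan (input_tapes x j), Go_Nowhere) (input_tapes x j))"
    by (auto simp: rep_def input_store_def input_tapes_def word_tape_sym_at reads_def written_def
        stacked_def sym_at_def fun_eq_iff split: nat.splits)
  then show ?thesis by (auto simp: tstep_def)
qed

lemma tstep_start:
  assumes "run c (input_store x) s t"
  shows "\<exists>n\<le>t + 3. \<exists>T. rep s T \<and> (tstep ^^ n) (Init ;; c, input_tapes x) = (Skip, T)"
proof -
  obtain T0 where T0: "tstep (Init, input_tapes x) = (Skip, T0)" "rep (input_store x) T0"
    using tstep_Init by blast
  then obtain n T where n: "n \<le> t" "rep s T" "(tstep ^^ n) (c, T0) = (Skip, T)"
    using assms unfolding run_def by blast
  have "(tstep ^^ 1) (Init, input_tapes x) = (Skip, T0)" using T0 by simp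
  from tstep_Seq_iter[OF this, of c] obtain n' where n': "n' \<le> 2"
    "(tstep ^^ n') (Init ;; c, input_tapes x) = (c, T0)" by (auto simp: numeral_2_eq_2)
  have "(tstep ^^ (n + n')) (Init ;; c, input_tapes x) = (Skip, T)"
    using n n' by (simp add: funpow_add)
  then show ?thesis using n n' by (intro exI[of _ "n + n'"]) auto
qed

lemma ex_compiled:
  assumes "\<And>c. d = Some c \<Longrightarrow> Query ;; c \<in> resid main" "\<And>c. d = Some c \<Longrightarrow> c \<in> resid main"
  shows "\<exists>k e. compiled main d k e"
proof -
  obtain e where "bij_betw e (resid main) {0..<card (resid main)}"
    using ex_bij_betw_finite_nat finite_resid by blast
  moreover obtain k where "cregs main \<subseteq> {..<k}"
    using finite_cregs finite_nat_iff_bounded by blast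
  ultimately show ?thesis
    using assms by (intro exI[of _ "k + 4"] exI[of _ e]) (auto simp: compiled_def atLeast0LessThan)
qed

theorem compile:
  "\<exists>M. turing_machine M \<and> (\<forall>x s t. run c (input_store x) s t \<longrightarrow>
     outputs_within no_oracle M x (rev (s 1)) (t + 3))"
proof -
  obtain k e where "compiled (Init ;; c) None k e" using ex_compiled[of None "Init ;; c"] by auto
  then interpret compiled "Init ;; c" None k e .
  have "outputs_within no_oracle M x (rev (s 1)) (t + 3)" if "run c (input_store x) s t" for x s t
  proof -
    from tstep_start[OF that] obtain n T
      where n: "n \<le> t + 3" "rep s T" "(tstep ^^ n) (Init ;; c, input_tapes x) = (Skip, T)"
      by blast
    obtain n' where n': "n' \<le> n" "(step no_oracle M ^^ n') (init_config M x) = (e Skip, map T [0..<k])"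
      using step_iter[OF n(3) self_in_resid] by (auto simp: init_config_M)
    have "t + 3 = (t + 3 - n') + n'" using n n' by simp
    then have "(step no_oracle M ^^ (t + 3)) (init_config M x) = (e Skip, map T [0..<k])"
      using n' by (metis comp_apply funpow_add step_halt_iter)
    moreover have "fst (T 1) = sym_at (rev (s 1))"
      using n(2) by (auto simp: rep_def written_def)
    ultimately show ?thesis
      using k by (simp add: outputs_within_def M_def tape_word_sym_at)
  qed
  then show ?thesis
    using oracle_machine_M by (intro exI[of _ M]) (auto simp: turing_machine_def M_def)
qed

text \<open>The question is written as a stack and hence reversed, whereas the answer is read from
  its first cell on. Filling register 3 switches tape 2 from the one representation to the
  other.\<close>

theorem compile_oracle:
  "\<exists>M. oracle_machine M \<and> (\<forall>A x s1 t1 s2 t2. run c (input_store x) s1 t1 \<longrightarrow> s1 3 = [] \<longrightarrow>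
     run d (s1(2 := A (rev (s1 2)), 3 := [True])) s2 t2 \<longrightarrow>
     outputs_within A M x (rev (s2 1)) (t1 + t2 + 5))"
proof -
  define main where "main = (Init ;; c) ;; Query ;; d"
  have d: "Query ;; d \<in> resid main" "d \<in> resid main"
    using self_in_resid[of d] by (auto simp: main_def)
  then obtain k e where "compiled main (Some d) k e" using ex_compiled[of "Some d" main] by auto
  then interpret compiled main "Some d" k e .
  have "outputs_within A M x (rev (s2 1)) (t1 + t2 + 5)"
    if c: "run c (input_store x) s1 t1" and s3: "s1 3 = []"
      and r: "run d (s1(2 := A (rev (s1 2)), 3 := [True])) s2 t2" for A x s1 t1 s2 t2
  proof -
    obtain n T where n: "n \<le> t1 + 3" "rep s1 T" "(tstep ^^ n) (Init ;; c, input_tapes x) = (Skip, T)"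
      using tstep_start[OF c] by blast
    obtain n1 where "n1 \<le> n + 1" and n1: "(tstep ^^ n1) (main, input_tapes x) = (Query ;; d, T)"
      using tstep_Seq_iter[OF n(3), of "Query ;; d"] unfolding main_def by blast
    then have le: "n1 \<le> t1 + 4" using n(1) by simp
    obtain n1' where n1': "n1' \<le> t1 + 4" "(step A M ^^ n1') (init_config M x) = (e (Query ;; d), map T [0..<k])"
      using step_iter[OF n1 self_in_resid] le by (auto simp: init_config_M) (meson order_trans)
    define T2 where "T2 = T(2 := word_tape (A (rev (s1 2))))"
    have T2: "tape_word (T 2) = rev (s1 2)"
      using n(2) s3 by (intro tape_word_sym_at) (auto simp: rep_def written_def)
    have "map T [0..<k] ! 2 = T 2" using k by (simp add: numeral_2_eq_2)
    moreover have "(map T [0..<k])[2 := y] = map (T(2 := y)) [0..<k]" for y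
      by (intro nth_equalityI) (auto simp: nth_list_update)
    ultimately have "step A M (e (Query ;; d), map T [0..<k]) = (e d, map T2 [0..<k])"
      using d T2 by (simp add: step_def M_def T2_def e_eq_iff Skip_in_resid)
    then have q: "(step A M ^^ Suc n1') (init_config M x) = (e d, map T2 [0..<k])"
      using n1' by simp
    have "rep (s1(2 := A (rev (s1 2)), 3 := [True])) T2"
      using n(2) by (auto simp: rep_def T2_def reads_def word_tape_sym_at)
    then obtain n2 T3 where n2: "n2 \<le> t2" "rep s2 T3" "(tstep ^^ n2) (d, T2) = (Skip, T3)"
      using r unfolding run_def by blast
    obtain n2' where n2': "n2' \<le> n2" "(step A M ^^ n2') (e d, map T2 [0..<k]) = (e Skip, map T3 [0..<k])"
      using step_iter[OF n2(3) d(2)] by auto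
    have "t1 + t2 + 5 = (t1 + t2 + 5 - (n2' + Suc n1')) + (n2' + Suc n1')" using n1' n2 n2' by simp
    then have "(step A M ^^ (t1 + t2 + 5)) (init_config M x) = (e Skip, map T3 [0..<k])"
      using n2' q by (metis comp_apply funpow_add step_halt_iter)
    moreover have "fst (T3 1) = sym_at (rev (s2 1))"
      using n2(2) by (auto simp: rep_def written_def)
    ultimately show ?thesis
      using k by (simp add: outputs_within_def M_def tape_word_sym_at)
  qed
  then show ?thesis using oracle_machine_M by blast
qed

lemma tstep_grow:
  assumes "(tstep ^^ n) (c, T) = (c', T')"
  shows "snd (T' j) \<le> snd (T j) + n"
  using assms
proof (induction n arbitrary: c' T')
  case (Suc n)
  obtain c1 T1 where 1: "(tstep ^^ n) (c, T) = (c1, T1)" by force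
  have *: "snd (act a t) \<le> Suc (snd t)" for a t
  proof -
    have "move_head m h \<le> Suc h" for m h by (cases m) auto
    then show ?thesis by (cases a; cases t) auto
  qed
  have "snd (T' j) \<le> Suc (snd (T1 j))"
    using Suc.prems by (simp add: 1) (auto simp: tstep_def split: prod.splits simp del: act.simps intro: *)
  with Suc.IH[OF 1] show ?case by simp
qed simp

text \<open>Used to bound the length of an output by the running time of the program that writes it,
  in place of a separate estimate.\<close>

lemma run_grow:
  assumes "run c s s' t" "4 \<le> j"
  shows "length (s' j) \<le> length (s j) + t"
proof -
  \<comment> \<open>\<open>run\<close> says nothing about a store that no tapes represent, so a
    family of tapes for \<open>s\<close> is exhibited.\<close>
  define T where "T i = (if i = 0 \<or> i = 2 \<and> s 3 \<noteq> [] then word_tape (s i)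
    else if i < 3 then written (s i) else stacked (s i))" for i
  have "rep s T"
    by (auto simp: rep_def T_def reads_def word_tape_sym_at)
  then obtain n T' where "n \<le> t" "rep s' T'" "(tstep ^^ n) (c, T) = (Skip, T')"
    using assms(1) unfolding run_def by blast
  with tstep_grow[OF this(3), of j] assms(2) show ?thesis
    by (auto simp: rep_def T_def stacked_def)
qed

section \<open>Program building blocks\<close>

lemma writable_neq: "writable s j \<Longrightarrow> j \<noteq> 3"
  by (auto simp: writable_def)

lemma readable_neq: "readable s j \<Longrightarrow> j \<noteq> 3"
  by (auto simp: readable_def)

lemma access_upd [simp]:
  "j \<noteq> 3 \<Longrightarrow> readable (s(j := xs)) i = readable s i"
  "j \<noteq> 3 \<Longrightarrow> writable (s(j := xs)) i = writable s i"
  by (auto simp: readable_def writable_def)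

lemma fun_upd_fold [simp]: "(\<lambda>a. if a = j then x else s a) = s(j := x)"
  by auto

lemma run_If_true:
  "readable s (cond_reg b) \<Longrightarrow> holds b s \<Longrightarrow> run c s s' t \<Longrightarrow> run (If b c d) s s' (t + 1)"
  by (rule run_If) auto

lemma run_If_false:
  "readable s (cond_reg b) \<Longrightarrow> \<not> holds b s \<Longrightarrow> run d s s' t \<Longrightarrow> run (If b c d) s s' (t + 1)"
  by (rule run_If) auto

abbreviation un :: "nat \<Rightarrow> bool list" where "un n \<equiv> replicate n True"

definition clear :: "nat \<Rightarrow> cmd" where
  "clear a = While (NE a) (Pop a)"

lemma run_clear:
  assumes "4 \<le> a"
  shows "run (clear a) s (s(a := [])) (3 * length (s a) + 1)"
proof -
  define S where "S i = s(a := drop i (s a))" for i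
  have "run (While (NE a) (Pop a)) (S 0) (S (length (s a))) (length (s a) * (1 + 2) + 1)"
  proof (rule run_While[where S = S])
    show "run (Pop a) (S i) (S (Suc i)) 1" if "i < length (s a)" for i
      using run_Pop[of "S i" a] assms that by (simp add: S_def drop_Suc tl_drop)
  qed (use assms in \<open>auto simp: S_def\<close>)
  from run_weaken[OF this] show ?thesis unfolding clear_def by (simp add: S_def)
qed

definition xfer :: "nat \<Rightarrow> nat \<Rightarrow> cmd" where
  "xfer a b = If (TT a) (Push b True) (Push b False) ;; Pop a"

lemma run_xfer:
  assumes "a \<noteq> b" "readable s a" "writable s b" "s a = x # xs"
  shows "run (xfer a b) s (s(a := xs, b := x # s b)) 5"
proof -
  have "run (If (TT a) (Push b True) (Push b False)) s (s(b := x # s b)) (2 + 1)"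
    using assms by (intro run_If) (auto intro: run_weaken[OF run_Push])
  moreover have "run (Pop a) (s(b := x # s b)) (s(a := xs, b := x # s b)) 1"
    using assms writable_neq[OF assms(3)] by (intro run_weaken[OF run_Pop]) auto
  ultimately show ?thesis
    unfolding xfer_def by (intro run_weaken[OF run_Seq]) auto
qed

definition pour :: "nat \<Rightarrow> nat \<Rightarrow> cmd" where
  "pour a b = While (NE a) (xfer a b)"

lemma run_pour:
  assumes "a \<noteq> b" "readable s a" "writable s b"
  shows "run (pour a b) s (s(a := [], b := rev (s a) @ s b)) (7 * length (s a) + 1)"
proof -
  define S where "S i = s(a := drop i (s a), b := rev (take i (s a)) @ s b)" for i
  note n = writable_neq[OF assms(3)] readable_neq[OF assms(2)]
  have "run (While (NE a) (xfer a b)) (S 0) (S (length (s a))) (length (s a) * (5 + 2) + 1)"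
  proof (rule run_While[where S = S])
    show "run (xfer a b) (S i) (S (Suc i)) 5" if "i < length (s a)" for i
      using assms n that
      by (intro run_weaken[OF run_xfer[where x = "s a ! i" and xs = "drop (Suc i) (s a)"]])
        (auto simp: S_def Cons_nth_drop_Suc take_Suc_conv_app_nth)
  qed (use assms n in \<open>auto simp: S_def\<close>)
  moreover have "S 0 = s" using assms(1) by (auto simp: S_def)
  ultimately show ?thesis by (simp add: S_def pour_def mult.commute)
qed

definition xfer2 :: "nat \<Rightarrow> nat \<Rightarrow> nat \<Rightarrow> cmd" where
  "xfer2 t a b = If (TT t) (Push a True ;; Push b True) (Push a False ;; Push b False) ;; Pop t"

lemma run_xfer2:
  assumes "distinct [t, a, b]" "4 \<le> t" "4 \<le> a" "writable s b" "s t = x # xs"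
  shows "run (xfer2 t a b) s (s(t := xs, a := x # s a, b := x # s b)) 8"
proof -
  have "run (Push a x ;; Push b x) s (s(a := x # s a, b := x # s b)) (2 + 2 + 1)" for x
    using assms by (intro run_Seq[OF run_Push] run_weaken[OF run_Push]) auto
  then have "run (If (TT t) (Push a True ;; Push b True) (Push a False ;; Push b False)) s
      (s(a := x # s a, b := x # s b)) ((2 + 2 + 1) + 1)"
    using assms by (intro run_If) auto
  moreover have "run (Pop t) (s(a := x # s a, b := x # s b)) (s(t := xs, a := x # s a, b := x # s b)) 1"
    using assms writable_neq[OF assms(4)] by (intro run_weaken[OF run_Pop]) auto
  ultimately show ?thesis
    unfolding xfer2_def by (intro run_weaken[OF run_Seq]) auto
qed

definition copy :: "nat \<Rightarrow> nat \<Rightarrow> nat \<Rightarrow> cmd" where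
  "copy a b t = pour a t ;; While (NE t) (xfer2 t a b)"

lemma run_copy:
  assumes "distinct [t, a, b]" "4 \<le> t" "4 \<le> a" "writable s b" "s t = []"
  shows "run (copy a b t) s (s(b := s a @ s b)) (17 * length (s a) + 3)"
proof -
  define xs where "xs = rev (s a)"
  define S where "S i = s(t := drop i xs, a := rev (take i xs), b := rev (take i xs) @ s b)" for i
  note n = writable_neq[OF assms(4)]
  have 1: "run (pour a t) s (S 0) (7 * length (s a) + 1)"
    using assms by (intro run_weaken[OF run_pour]) (auto simp: S_def xs_def)
  have "run (While (NE t) (xfer2 t a b)) (S 0) (S (length xs)) (length xs * (8 + 2) + 1)"
  proof (rule run_While[where S = S])
    show "run (xfer2 t a b) (S i) (S (Suc i)) 8" if "i < length xs" for i
      using assms n that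
      by (intro run_weaken[OF run_xfer2[where x = "xs ! i" and xs = "drop (Suc i) xs"]])
        (auto simp: S_def Cons_nth_drop_Suc take_Suc_conv_app_nth)
  qed (use assms n in \<open>auto simp: S_def\<close>)
  from run_Seq[OF 1 this] show ?thesis
    unfolding copy_def using assms by (elim run_weaken) (auto simp: S_def xs_def)
qed

fun pushes :: "nat \<Rightarrow> bool list \<Rightarrow> cmd" where
  "pushes j [] = Skip"
| "pushes j (b # bs) = Push j b ;; pushes j bs"

lemma run_pushes:
  assumes "writable s j"
  shows "run (pushes j bs) s (s(j := rev bs @ s j)) (3 * length bs)"
  using assms
proof (induction bs arbitrary: s)
  case Nil
  then show ?case by (simp add: run_Skip)
next
  case (Cons b bs)
  have "run (pushes j bs) (s(j := b # s j)) (s(j := rev (b # bs) @ s j)) (3 * length bs)"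
    using Cons.prems by (intro run_weaken[OF Cons.IH]) (auto simp: writable_def)
  from run_weaken[OF run_Seq[OF run_Push[OF Cons.prems] this]] show ?case
    by simp
qed

fun seqs :: "cmd list \<Rightarrow> cmd" where
  "seqs [] = Skip"
| "seqs (c # cs) = c ;; seqs cs"

lemma run_seqs:
  assumes "\<And>i. i < length cs \<Longrightarrow> run (cs ! i) (S i) (S (Suc i)) t"
  shows "run (seqs cs) (S 0) (S (length cs)) (length cs * (t + 1))"
  using assms
proof (induction cs arbitrary: S)
  case Nil
  then show ?case by (simp add: run_Skip)
next
  case (Cons c cs)
  have 2: "run (seqs cs) (S (Suc 0)) (S (Suc (length cs))) (length cs * (t + 1))"
    using Cons.prems[of "Suc _"] by (intro Cons.IH[of "\<lambda>i. S (Suc i)"]) auto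
  have "run c (S 0) (S (Suc 0)) t"
    using Cons.prems[of 0] by simp
  from run_Seq[OF this 2] show ?case by (simp add: algebra_simps)
qed

section \<open>Unary arithmetic and polynomial time bounds\<close>

definition add_mul :: "nat \<Rightarrow> nat \<Rightarrow> nat \<Rightarrow> nat \<Rightarrow> nat \<Rightarrow> cmd" where
  "add_mul a b r t u = copy a t u ;; While (NE t) (Pop t ;; copy b r u)"

lemma run_add_mul:
  assumes "distinct [a, b, r, t, u]" "\<forall>i\<in>{a, b, r, t, u}. 4 \<le> i"
    and "s a = un x" "s b = un y" "s t = []" "s u = []"
  shows "run (add_mul a b r t u) s (s(r := un (x * y) @ s r)) (17 * x + 10 + x * (17 * y + 10))"
proof -
  define S where "S i = s(t := un (x - i), r := un (i * y) @ s r)" for i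
  have 1: "run (copy a t u) s (S 0) (17 * x + 3)"
    using assms by (intro run_weaken[OF run_copy]) (auto simp: S_def)
  have "run (While (NE t) (Pop t ;; copy b r u)) (S 0) (S x) (x * ((17 * y + 5) + 2) + 1)"
  proof (rule run_While[where S = S])
    fix i assume i: "i < x"
    have "run (Pop t) (S i) ((S i)(t := un (x - Suc i))) 1"
      using assms i by (intro run_weaken[OF run_Pop]) (auto simp: S_def Suc_diff_Suc[symmetric])
    moreover have "run (copy b r u) ((S i)(t := un (x - Suc i))) (S (Suc i)) (17 * y + 3)"
      using assms by (intro run_weaken[OF run_copy]) (auto simp: S_def fun_eq_iff replicate_add)
    ultimately show "run (Pop t ;; copy b r u) (S i) (S (Suc i)) (17 * y + 5)"
      by (intro run_weaken[OF run_Seq]) auto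
  qed (use assms in \<open>auto simp: S_def\<close>)
  from run_Seq[OF 1 this] show ?thesis
    unfolding add_mul_def using assms by (elim run_weaken) (auto simp: S_def algebra_simps)
qed

text \<open>Running times stay explicit expressions that are merely dominated by some polynomial;
  with \<open>pbound_intros\<close> such claims follow the syntax of the expression.\<close>

definition pbound :: "(nat \<Rightarrow> nat) \<Rightarrow> bool" where
  "pbound f \<longleftrightarrow> (\<exists>p :: nat poly. \<forall>n. f n \<le> poly p n)"

lemma pbound_poly: "pbound (poly p)"
  by (auto simp: pbound_def)

lemma pbound_const: "pbound (\<lambda>_. c)"
  unfolding pbound_def by (intro exI[of _ "[:c:]"]) simp

lemma pbound_id: "pbound (\<lambda>n. n)"
  unfolding pbound_def by (intro exI[of _ "[:0, 1:]"]) simp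

lemma pbound_add: "pbound f \<Longrightarrow> pbound g \<Longrightarrow> pbound (\<lambda>n. f n + g n)"
  unfolding pbound_def by (metis add_mono poly_add)

lemma pbound_mult: "pbound f \<Longrightarrow> pbound g \<Longrightarrow> pbound (\<lambda>n. f n * g n)"
  unfolding pbound_def by (metis mult_le_mono poly_mult)

lemma pbound_power: "pbound f \<Longrightarrow> pbound (\<lambda>n. f n ^ k)"
  unfolding pbound_def by (metis power_mono poly_power zero_le)

lemma pbound_Suc: "pbound f \<Longrightarrow> pbound (\<lambda>n. Suc (f n))"
  using pbound_add[OF _ pbound_const[of 1]] by simp

lemma poly_nat_mono: "m \<le> n \<Longrightarrow> poly p m \<le> poly (p :: nat poly) n"
  by (induction p) (auto intro!: add_mono mult_mono)

lemma pbound_poly_comp: "pbound f \<Longrightarrow> pbound (\<lambda>n. poly p (f n))"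
proof -
  assume "pbound f"
  then obtain q where "\<And>n. f n \<le> poly q n" unfolding pbound_def by blast
  then have "poly p (f n) \<le> poly (pcompose p q) n" for n
    using poly_nat_mono by (simp add: poly_pcompose)
  then show ?thesis unfolding pbound_def by blast
qed

lemmas pbound_intros = pbound_poly pbound_const pbound_id pbound_add pbound_mult pbound_power
  pbound_Suc pbound_poly_comp

fun horner :: "nat list \<Rightarrow> nat \<Rightarrow> nat" where
  "horner [] n = 0"
| "horner (c # cs) n = c + n * horner cs n"

lemma poly_horner: "poly p n = horner (coeffs p) n"
proof -
  have "horner_sum id n cs = horner cs n" for cs
    by (induction cs) auto
  then show ?thesis by (simp add: poly_def)
qed

fun horner_cmd :: "nat list \<Rightarrow> nat \<Rightarrow> nat \<Rightarrow> nat \<Rightarrow> nat \<Rightarrow> nat \<Rightarrow> cmd" where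
  "horner_cmd [] a r t u v = Skip"
| "horner_cmd (c # cs) a r t u v =
     horner_cmd cs a r t u v ;; add_mul a r t u v ;; clear r ;; pour t r ;; pushes r (un c)"

lemma run_horner:
  assumes "distinct [a, r, t, u, v]" "\<forall>i\<in>{a, r, t, u, v}. 4 \<le> i"
  shows "\<exists>f. pbound f \<and> (\<forall>n s. s a = un n \<longrightarrow> s r = [] \<longrightarrow> s t = [] \<longrightarrow> s u = [] \<longrightarrow> s v = [] \<longrightarrow>
    run (horner_cmd cs a r t u v) s (s(r := un (horner cs n))) (f n))"
proof (induction cs)
  case Nil
  have "s = s(r := [])" if "s r = []" for s :: store using that by auto
  then show ?case
    by (intro exI[of _ "\<lambda>_. 0"]) (auto intro: pbound_intros run_weaken[OF run_Skip])
next
  case (Cons c cs)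
  then obtain f where f: "pbound f"
    "\<And>n s. s a = un n \<Longrightarrow> s r = [] \<Longrightarrow> s t = [] \<Longrightarrow> s u = [] \<Longrightarrow> s v = [] \<Longrightarrow>
      run (horner_cmd cs a r t u v) s (s(r := un (horner cs n))) (f n)" by blast
  have h: "pbound (horner cs)"
    by (induction cs) (auto intro!: pbound_intros)
  let ?f = "\<lambda>n. f n + ((17 * n + 10 + n * (17 * horner cs n + 10)) +
    ((3 * horner cs n + 1) + ((7 * (n * horner cs n) + 1) + 3 * c + 1) + 1) + 1) + 1"
  have "run (horner_cmd (c # cs) a r t u v) s (s(r := un (horner (c # cs) n))) (?f n)"
    if s: "s a = un n" "s r = []" "s t = []" "s u = []" "s v = []" for n s
  proof -
    let ?h = "horner cs n"
    have 1: "run (horner_cmd cs a r t u v) s (s(r := un ?h)) (f n)"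
      using f(2) s by blast
    have 2: "run (add_mul a r t u v) (s(r := un ?h)) (s(r := un ?h, t := un (n * ?h)))
        (17 * n + 10 + n * (17 * ?h + 10))"
      using assms s by (intro run_weaken[OF run_add_mul]) auto
    have 3: "run (clear r) (s(r := un ?h, t := un (n * ?h))) (s(t := un (n * ?h))) (3 * ?h + 1)"
      using assms s by (intro run_weaken[OF run_clear]) auto
    have 4: "run (pour t r) (s(t := un (n * ?h))) (s(r := un (n * ?h))) (7 * (n * ?h) + 1)"
      using assms s by (intro run_weaken[OF run_pour]) auto
    have 5: "run (pushes r (un c)) (s(r := un (n * ?h))) (s(r := un (c + n * ?h))) (3 * c)"
      using assms by (intro run_weaken[OF run_pushes]) (auto simp: replicate_add)
    from run_Seq[OF 1 run_Seq[OF 2 run_Seq[OF 3 run_Seq[OF 4 5]]]] show ?thesis by simp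
  qed
  moreover have "pbound ?f"
    by (intro pbound_intros f h)
  ultimately show ?case by blast
qed

lemma run_poly:
  assumes "distinct [a, r, t, u, v]" "\<forall>i\<in>{a, r, t, u, v}. 4 \<le> i"
  shows "\<exists>f. pbound f \<and> (\<forall>n s. s a = un n \<longrightarrow> s r = [] \<longrightarrow> s t = [] \<longrightarrow> s u = [] \<longrightarrow> s v = [] \<longrightarrow>
    run (horner_cmd (coeffs p) a r t u v) s (s(r := un (poly p n))) (f n))"
  using run_horner[OF assms, of "coeffs p"] by (simp add: poly_horner)

subsection \<open>Binary notation\<close>

definition read_word :: "nat \<Rightarrow> nat \<Rightarrow> cmd" where
  "read_word a b = While (TT a) (Pop a ;; xfer a b) ;; Pop a"

lemma enc_word_simps [simp]:
  "enc_word [] = [False]" "enc_word (b # w) = True # b # enc_word w"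
  by (auto simp: enc_word_def enc_list_def)

lemma length_enc_word: "length (enc_word w) = 2 * length w + 1"
  by (induction w) auto

lemma run_read_word:
  assumes "a \<noteq> b" "readable s a" "writable s b" "s a = enc_word w @ xs"
  shows "run (read_word a b) s (s(a := xs, b := rev w @ s b)) (9 * length w + 3)"
proof -
  note n = writable_neq[OF assms(3)] readable_neq[OF assms(2)]
  have "run (While (TT a) (Pop a ;; xfer a b)) s (s(a := False # xs, b := rev w @ s b)) (9 * length w + 1)"
    using assms(2-4)
  proof (induction w arbitrary: s)
    case Nil
    then show ?case by (intro run_weaken[OF run_While_end]) (auto simp: fun_eq_iff)
  next
    case (Cons y w)
    have 1: "run (Pop a ;; xfer a b) s (s(a := enc_word w @ xs, b := y # s b)) (1 + 5 + 1)"
      using Cons.prems assms(1) n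
      by (intro run_Seq[OF run_Pop] run_weaken[OF run_xfer[where x = y and xs = "enc_word w @ xs"]]) auto
    have 2: "run (While (TT a) (Pop a ;; xfer a b)) (s(a := enc_word w @ xs, b := y # s b))
        (s(a := False # xs, b := rev (y # w) @ s b)) (9 * length w + 1)"
      using Cons.prems assms(1) n
      by (intro run_weaken[OF Cons.IH]) (auto simp: fun_eq_iff)
    show ?case
      using Cons.prems by (intro run_weaken[OF run_While_step[OF _ _ 1 2]]) auto
  qed
  moreover have "run (Pop a) (s(a := False # xs, b := rev w @ s b)) (s(a := xs, b := rev w @ s b)) 1"
    using assms n by (intro run_weaken[OF run_Pop]) (auto simp: fun_eq_iff)
  ultimately show ?thesis
    unfolding read_word_def by (intro run_weaken[OF run_Seq]) auto
qed

definition halve :: "nat \<Rightarrow> nat \<Rightarrow> nat \<Rightarrow> nat \<Rightarrow> cmd" where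
  "halve c q f o' = While (NE c) (Pop c ;; If (NE c) (Pop c ;; Push q True) (Push f True)) ;;
     If (NE f) (Pop f ;; Push o' True) (Push o' False) ;; pour q c"

lemma run_halve:
  assumes d: "distinct [c, q, f, o']" and r: "\<forall>i\<in>{c, q, f}. 4 \<le> i" "writable s o'"
    and s: "s c = un x" "s q = []" "s f = []"
  shows "run (halve c q f o') s (s(c := un (x div 2), o' := odd x # s o')) (17 * x + 20)"
proof -
  note n = writable_neq[OF r(2)]
  \<comment> \<open>Each of the \<open>k\<close> rounds takes away two units. For odd
    \<open>x\<close> the last round finds only one, which truncated subtraction absorbs and the flag
    in register \<open>f\<close> records.\<close>
  define k where "k = (x + 1) div 2"
  define S where "S i = s(c := un (x - 2 * i), q := un (min i (x div 2)),
      f := if x < 2 * i then [True] else [])" for i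
  have k: "x \<le> 2 * k" "2 * k \<le> x + 1" by (auto simp: k_def)
  have "run (While (NE c) (Pop c ;; If (NE c) (Pop c ;; Push q True) (Push f True)))
      (S 0) (S k) (k * (7 + 2) + 1)"
  proof (rule run_While[where S = S])
    fix i assume i: "i < k"
    then have i2: "2 * i < x" using k by linarith
    define s1 where "s1 = (S i)(c := un (x - 2 * i - 1))"
    have 1: "run (Pop c) (S i) s1 1"
      using d r i2 by (intro run_weaken[OF run_Pop]) (auto simp: S_def s1_def fun_eq_iff)
    have 2: "run (If (NE c) (Pop c ;; Push q True) (Push f True)) s1 (S (Suc i)) (4 + 1)"
    proof (rule run_If)
      assume "holds (NE c) s1"
      then have i3: "2 * Suc i \<le> x" using i2 by (auto simp: s1_def)
      have "run (Pop c) s1 (s1(c := un (x - 2 * Suc i))) 1"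
        using d r i3 by (intro run_weaken[OF run_Pop]) (auto simp: S_def s1_def fun_eq_iff)
      moreover have "run (Push q True) (s1(c := un (x - 2 * Suc i))) (S (Suc i)) 2"
        using d r i3 n by (intro run_weaken[OF run_Push])
          (auto simp: S_def s1_def fun_eq_iff min_def replicate_Suc[symmetric] simp del: replicate_Suc)
      ultimately show "run (Pop c ;; Push q True) s1 (S (Suc i)) 4"
        by (intro run_weaken[OF run_Seq]) auto
    next
      assume "\<not> holds (NE c) s1"
      then have i3: "x = 2 * i + 1" using i2 by (auto simp: s1_def)
      then show "run (Push f True) s1 (S (Suc i)) 4"
        using d r n by (intro run_weaken[OF run_Push]) (auto simp: S_def s1_def fun_eq_iff min_def)
    qed (use d r n in \<open>auto simp: s1_def\<close>)
    show "run (Pop c ;; If (NE c) (Pop c ;; Push q True) (Push f True)) (S i) (S (Suc i)) 7"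
      by (rule run_weaken[OF run_Seq[OF 1 2]]) auto
  qed (use d r n k in \<open>auto simp: S_def\<close>)
  moreover have "S 0 = s"
    using s d by (auto simp: S_def fun_eq_iff)
  ultimately have 1: "run (While (NE c) (Pop c ;; If (NE c) (Pop c ;; Push q True) (Push f True)))
      s (S k) (9 * k + 1)" by (simp add: mult.commute)
  have Sk: "S k = s(c := [], q := un (x div 2), f := if odd x then [True] else [])"
  proof -
    have "min k (x div 2) = x div 2" "x < 2 * k \<longleftrightarrow> odd x" "x - 2 * k = 0"
      using k by (auto simp: k_def min_def)
    then show ?thesis by (simp add: S_def)
  qed
  let ?s2 = "s(c := [], q := un (x div 2), o' := odd x # s o')"
  have 2: "run (If (NE f) (Pop f ;; Push o' True) (Push o' False)) (S k) ?s2 (4 + 1)"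
  proof (rule run_If)
    assume "holds (NE f) (S k)"
    then have o: "odd x" using d by (auto simp: Sk split: if_splits)
    have "run (Pop f) (S k) (s(c := [], q := un (x div 2))) 1"
      using d r n o s by (intro run_weaken[OF run_Pop]) (auto simp: Sk fun_eq_iff)
    moreover have "run (Push o' True) (s(c := [], q := un (x div 2))) ?s2 2"
      using d r n o by (intro run_weaken[OF run_Push]) auto
    ultimately show "run (Pop f ;; Push o' True) (S k) ?s2 4"
      by (intro run_weaken[OF run_Seq]) auto
  next
    assume "\<not> holds (NE f) (S k)"
    then have "even x" using d by (auto simp: Sk split: if_splits)
    then show "run (Push o' False) (S k) ?s2 4"
      using d r n s by (intro run_weaken[OF run_Push]) (auto simp: Sk fun_eq_iff)
  qed (use d r n in \<open>auto simp: Sk\<close>)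
  have 3: "run (pour q c) ?s2 (s(c := un (x div 2), o' := odd x # s o')) (7 * (x div 2) + 1)"
    using d r n s by (intro run_weaken[OF run_pour]) (auto simp: fun_eq_iff)
  show ?thesis
    unfolding halve_def using run_Seq[OF 1 run_Seq[OF 2 3]] k by (elim run_weaken) auto
qed

text \<open>Repeated halving produces the bits from the least significant one on, which is the order
  in which \<open>enc_nat\<close> lists them.\<close>

definition emit_nat :: "nat \<Rightarrow> nat \<Rightarrow> nat \<Rightarrow> nat \<Rightarrow> cmd" where
  "emit_nat c q f o' = While (NE c) (Push o' True ;; halve c q f o') ;; Push o' False"

lemma bin_Cons: "x \<noteq> 0 \<Longrightarrow> bin x = odd x # bin (x div 2)"
  by (subst bin.simps) simp

lemma bin_0 [simp]: "bin 0 = []"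
  by (subst bin.simps) simp

lemma run_emit_nat:
  assumes d: "distinct [c, q, f, o']" and r: "\<forall>i\<in>{c, q, f}. 4 \<le> i" "writable s o'"
    and s: "s c = un x" "s q = []" "s f = []" and B: "x \<le> B"
  shows "run (emit_nat c q f o') s (s(c := [], o' := rev (enc_nat x) @ s o')) (B * (17 * B + 25) + 4)"
proof -
  note n = writable_neq[OF r(2)]
  let ?w = "While (NE c) (Push o' True ;; halve c q f o')"
  have "run ?w s (s(c := [], o' := rev (concat (map (\<lambda>b. [True, b]) (bin x))) @ s o')) (x * (17 * B + 25) + 1)"
    using s r(2) B
  proof (induction x arbitrary: s rule: less_induct)
    case (less x)
    show ?case
    proof (cases "x = 0")
      case True
      then show ?thesis
        using less.prems r by (intro run_weaken[OF run_While_end]) (auto simp: fun_eq_iff)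
    next
      case False
      let ?s1 = "s(c := un (x div 2), o' := odd x # True # s o')"
      have "run (Push o' True ;; halve c q f o') s ?s1 (2 + (17 * x + 20) + 1)"
        using less.prems d r n by (intro run_Seq[OF run_Push] run_weaken[OF run_halve]) auto
      then have 1: "run (Push o' True ;; halve c q f o') s ?s1 (17 * B + 23)"
        using less.prems(5) by (elim run_weaken) auto
      have 2: "run ?w ?s1 (s(c := [], o' := rev (concat (map (\<lambda>b. [True, b]) (bin x))) @ s o'))
         ((x div 2) * (17 * B + 25) + 1)"
        using less.prems d r n False
        by (intro run_weaken[OF less.IH[of "x div 2"]]) (auto simp: bin_Cons fun_eq_iff)
      have "17 * B + 23 + (x div 2 * (17 * B + 25) + 1) + 2 \<le> x * (17 * B + 25) + 1"
      proof -
        have "x div 2 + 1 \<le> x" using False by simp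
        then have "(x div 2 + 1) * (17 * B + 25) \<le> x * (17 * B + 25)" by (rule mult_le_mono1)
        then show ?thesis by (simp add: algebra_simps)
      qed
      then show ?thesis
        using less.prems False r by (intro run_weaken[OF run_While_step[OF _ _ 1 2]]) auto
    qed
  qed
  moreover have "x * (17 * B + 25) \<le> B * (17 * B + 25)" using B by (rule mult_le_mono1)
  moreover have "run (Push o' False) (s(c := [], o' := rev (concat (map (\<lambda>b. [True, b]) (bin x))) @ s o'))
      (s(c := [], o' := rev (enc_nat x) @ s o')) 2"
    using d r n by (intro run_weaken[OF run_Push]) (auto simp: enc_nat_def enc_word_def enc_list_def)
  ultimately show ?thesis
    unfolding emit_nat_def by (intro run_weaken[OF run_Seq]) auto
qed

section \<open>Computations as tilings\<close>

text \<open>A tile describes one tape cell, on all tapes, at one time. \<open>sy\<close> and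
  \<open>fl\<close> are the symbols and the presence of the heads, \<open>kind\<close> is the column
  capped at 3 (column \<open>h\<close> holds tape cell \<open>h - 1\<close>, column 0 is a border).
  The state \<open>st\<close>, the scanned symbols \<open>scn\<close> and the tests
  \<open>az\<close> for heads at cell 0 are repeated along the whole row, so that every cell knows
  the transition taken.\<close>

datatype tile = Tile (kind: nat) (st: nat) (scn: "nat list") (az: "bool list") (sy: "nat list") (fl: "bool list")

text \<open>Here the values repeated along a row are tied to actual cells: \<open>scn\<close>
  wherever a head is, and \<open>az\<close> in column 1, the column of cell 0.\<close>

definition tiles :: "machine \<Rightarrow> tile set" where
  "tiles M = {x. kind x < 4 \<and> st x < num_states M \<and>
     set (scn x) \<subseteq> {..<num_syms M} \<and> length (scn x) = num_tapes M \<and> length (az x) = num_tapes M \<and>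
     set (sy x) \<subseteq> {..<num_syms M} \<and> length (sy x) = num_tapes M \<and> length (fl x) = num_tapes M \<and>
     (\<forall>j<num_tapes M. fl x ! j \<longrightarrow> sy x ! j = scn x ! j) \<and>
     (kind x = 0 \<longrightarrow> (\<forall>j<num_tapes M. \<not> fl x ! j \<and> sy x ! j = 0)) \<and>
     (kind x = 1 \<longrightarrow> az x = fl x)}"

lemma finite_tiles: "finite (tiles M)"
proof -
  let ?l = "{xs. set xs \<subseteq> {..<num_syms M} \<and> length xs = num_tapes M}"
  let ?b = "{xs. set xs \<subseteq> (UNIV :: bool set) \<and> length xs = num_tapes M}"
  have "tiles M \<subseteq> (\<lambda>(k, q, s, a, y, f). Tile k q s a y f) ` ({..<4} \<times> {..<num_states M} \<times> ?l \<times> ?b \<times> ?l \<times> ?b)"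
  proof
    fix x assume "x \<in> tiles M"
    then show "x \<in> (\<lambda>(k, q, s, a, y, f). Tile k q s a y f) ` ({..<4} \<times> {..<num_states M} \<times> ?l \<times> ?b \<times> ?l \<times> ?b)"
      by (intro image_eqI[of _ _ "(kind x, st x, scn x, az x, sy x, fl x)"]) (auto simp: tiles_def)
  qed
  then show ?thesis
    by (rule finite_subset) (intro finite_imageI finite_cartesian_product finite_lists_length_eq; simp)
qed

text \<open>A halted configuration repeats itself, so that the rows after halting obey the same
  rules.\<close>

definition trans :: "machine \<Rightarrow> nat \<Rightarrow> nat list \<Rightarrow> nat \<times> (nat \<times> move) list" where
  "trans M q ss = (if q = halt_state M then (q, map (\<lambda>s. (s, Go_Nowhere)) ss) else delta M q ss)"

definition wr :: "machine \<Rightarrow> tile \<Rightarrow> nat \<Rightarrow> nat" where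
  "wr M x j = fst (snd (trans M (st x) (scn x)) ! j)"

text \<open>A left move at cell 0 leaves the head where it is; deciding this locally is the purpose
  of \<open>az\<close>.\<close>

definition mv :: "machine \<Rightarrow> tile \<Rightarrow> nat \<Rightarrow> move" where
  "mv M x j = (let m = snd (snd (trans M (st x) (scn x)) ! j) in
     if az x ! j \<and> m = Go_Left then Go_Nowhere else m)"

text \<open>The successor of the last cell of a row is the border of the next row. The first case is
  this wrapped pair, and it is used to keep heads out of the last column.\<close>

definition compat_h :: "machine \<Rightarrow> tile \<Rightarrow> tile \<Rightarrow> bool" where
  "compat_h M x y \<longleftrightarrow>
     (if kind y = 0 then \<forall>j<num_tapes M. \<not> fl x ! j
      else st y = st x \<and> scn y = scn x \<and> az y = az x \<and> kind y = min 3 (kind x + 1))"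

text \<open>As an equality of flags, the condition both carries a head along its move and prevents
  one from appearing out of nowhere.\<close>

definition compat_move :: "machine \<Rightarrow> move \<Rightarrow> tile \<Rightarrow> tile \<Rightarrow> bool" where
  "compat_move M m x y \<longleftrightarrow> (\<forall>j<num_tapes M. mv M x j = m \<longrightarrow> fl y ! j = fl x ! j)"

definition compat_v :: "machine \<Rightarrow> tile \<Rightarrow> tile \<Rightarrow> bool" where
  "compat_v M x y \<longleftrightarrow> st y = fst (trans M (st x) (scn x)) \<and>
     (\<forall>j<num_tapes M. sy y ! j = (if fl x ! j then wr M x j else sy x ! j)) \<and>
     compat_move M Go_Nowhere x y"

text \<open>Codes: 0 left border, 1 inner row, 2 and 7 last row (7 in its last column), 3 to 6 first row
  holding the bit 0, the bit 1, a witness bit, and a blank.\<close>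

definition allowed :: "machine \<Rightarrow> nat \<Rightarrow> tile \<Rightarrow> bool" where
  "allowed M c x \<longleftrightarrow> (kind x = 0 \<longleftrightarrow> c = 0) \<and>
     (c \<in> {3, 4, 5, 6} \<longrightarrow> st x = start_state M \<and> (\<forall>j<num_tapes M. fl x ! j \<longleftrightarrow> kind x = 1) \<and>
        (\<forall>j<num_tapes M. 0 < j \<longrightarrow> sy x ! j = 0) \<and>
        sy x ! 0 \<in> (if c = 3 then {1} else if c = 4 then {2} else if c = 5 then {1, 2} else {0})) \<and>
     (c \<in> {2, 7} \<longrightarrow> (kind x = 1 \<longrightarrow> sy x ! 1 = 2) \<and> (kind x = 2 \<longrightarrow> sy x ! 1 \<notin> {1, 2})) \<and>
     (c = 7 \<longrightarrow> (\<forall>j<num_tapes M. \<not> fl x ! j))"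

lemma allowed_initD:
  assumes "allowed M c x" "c \<in> {3, 4, 5, 6}"
  shows "\<forall>j<num_tapes M. fl x ! j \<longleftrightarrow> kind x = 1" "\<forall>j<num_tapes M. 0 < j \<longrightarrow> sy x ! j = 0"
    "sy x ! 0 \<in> (if c = 3 then {1} else if c = 4 then {2} else if c = 5 then {1, 2} else {0})"
  using assms(1)[unfolded allowed_def, THEN conjunct2, THEN conjunct1, THEN mp, OF assms(2)] by blast+

definition tile_of :: "config \<Rightarrow> nat \<Rightarrow> tile" where
  "tile_of c h = Tile (min 3 h) (fst c) (map scan (snd c)) (map (\<lambda>t. snd t = 0) (snd c))
     (map (\<lambda>t. if h = 0 then 0 else fst t (h - 1)) (snd c)) (map (\<lambda>t. h = Suc (snd t)) (snd c))"

definition valid_config :: "machine \<Rightarrow> config \<Rightarrow> bool" where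
  "valid_config M c \<longleftrightarrow> fst c < num_states M \<and> length (snd c) = num_tapes M \<and>
     (\<forall>t\<in>set (snd c). \<forall>i. fst t i < num_syms M)"

text \<open>Row 0 fixes the input, leaves the witness open and is blank afterwards; the last row
  checks acceptance. The bottom right cell has a code of its own: no border tile follows it, so the
  absence of a head must be demanded there directly.\<close>

definition code :: "bool list \<Rightarrow> nat \<Rightarrow> nat \<Rightarrow> nat \<Rightarrow> nat \<Rightarrow> nat" where
  "code w k G t h =
     (if h = 0 then 0
      else if t = 0 then
        (if h - 1 < length w then (if w ! (h - 1) then 4 else 3) else if h - 1 < length w + k then 5 else 6)
      else if t < G - 1 then 1 else if h < G - 1 then 2 else 7)"

text \<open>Acceptance thereby becomes a condition on two cells, those in columns 1 and 2 of the
  last row. The assumption \<open>fin\<close> excludes a \<open>LEAST\<close> over the empty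
  set.\<close>

lemma tape_word_eq_True: "tape_word t = [True] \<longleftrightarrow> fst t 0 = 2 \<and> fst t 1 \<notin> {1, 2}"
  if fin: "\<exists>i. fst t i \<notin> {1, 2}"
proof -
  define n where "n = (LEAST i. fst t i \<notin> {1, 2})"
  have n: "fst t n \<notin> {1, 2}" "\<And>i. i < n \<Longrightarrow> fst t i \<in> {1, 2}"
    using LeastI_ex[OF fin] not_less_Least[of _ "\<lambda>i. fst t i \<notin> {1, 2}"] by (auto simp: n_def)
  show ?thesis
  proof
    assume t: "tape_word t = [True]"
    then have "n = 1" unfolding tape_word_def n_def[symmetric]
      by (metis length_map length_upt minus_nat.diff_0 length_Cons list.size(3) One_nat_def)
    with t n show "fst t 0 = 2 \<and> fst t 1 \<notin> {1, 2}"
      unfolding tape_word_def n_def[symmetric] by simp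
  next
    assume t: "fst t 0 = 2 \<and> fst t 1 \<notin> {1, 2}"
    have "n = 1"
    proof (rule linorder_cases[of n 1])
      assume "n < 1"
      then show "n = 1" using t n(1) by simp
    next
      assume "1 < n"
      then show "n = 1" using t n(2)[of 1] by blast
    qed
    with t show "tape_word t = [True]"
      unfolding tape_word_def n_def[symmetric] by simp
  qed
qed

text \<open>\<open>T + 4 \<le> G\<close> makes the last row a halted one and keeps every head, which
  is in column \<open>T + 1\<close> at most, away from the last column. The second bound lets input
  and witness fit behind the border.\<close>

locale tableau =
  fixes M :: machine and V :: "bool list \<Rightarrow> bool list" and w :: "bool list" and k T G :: nat
  assumes tm: "turing_machine M"
    and V: "\<And>y. length y = k \<Longrightarrow> outputs_within no_oracle M (w @ y) (V (w @ y)) T"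
    and G: "T + 4 \<le> G" "length w + k + 2 \<le> G"
begin

abbreviation "K \<equiv> num_tapes M"

definition conf :: "bool list \<Rightarrow> nat \<Rightarrow> config" where
  "conf y t = (step no_oracle M ^^ t) (init_config M (w @ y))"

text \<open>The constraints apply to all cells at the given index differences, including pairs that
  wrap round an edge and are no neighbours in the grid. This uniformity is what lets a simple
  program write them down.\<close>

definition tilings :: "(nat \<Rightarrow> tile) set" where
  "tilings = {a \<in> {..<G * G} \<rightarrow>\<^sub>E tiles M.
     (\<forall>t<G. \<forall>h<G. allowed M (code w k G t h) (a (t * G + h))) \<and>
     (\<forall>l. l + 1 < G * G \<longrightarrow> compat_h M (a l) (a (l + 1))) \<and>
     (\<forall>l. l + (G - 1) < G * G \<longrightarrow> compat_move M Go_Left (a l) (a (l + (G - 1)))) \<and>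
     (\<forall>l. l + G < G * G \<longrightarrow> compat_v M (a l) (a (l + G))) \<and>
     (\<forall>l. l + (G + 1) < G * G \<longrightarrow> compat_move M Go_Right (a l) (a (l + (G + 1))))}"

lemma K3: "3 \<le> K" "3 \<le> num_syms M" and no_query: "query_state M = None"
  using tm by (auto simp: turing_machine_def oracle_machine_def)

lemma trans_valid:
  assumes "q < num_states M" "length ss = K" "set ss \<subseteq> {..<num_syms M}"
  shows "fst (trans M q ss) < num_states M" "length (snd (trans M q ss)) = K"
    "j < K \<Longrightarrow> fst (snd (trans M q ss) ! j) < num_syms M"
proof -
  have d: "case delta M q ss of (q', acts) \<Rightarrow>
           q' < num_states M \<and> length acts = num_tapes M \<and> fst ` set acts \<subseteq> {..<num_syms M}"
    using tm assms by (auto simp: turing_machine_def oracle_machine_def)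
  show "fst (trans M q ss) < num_states M" "length (snd (trans M q ss)) = K"
    using d assms by (auto simp: trans_def)
  show "fst (snd (trans M q ss) ! j) < num_syms M" if "j < K"
  proof (cases "q = halt_state M")
    case True
    then show ?thesis using assms that nth_mem[of j ss] by (auto simp: trans_def simp del: nth_mem)
  next
    case False
    then have "snd (trans M q ss) ! j \<in> set (snd (delta M q ss))"
      using d that by (auto simp: trans_def split: prod.splits)
    then show ?thesis using d by (force split: prod.splits)
  qed
qed

lemma step_eq:
  assumes "valid_config M c"
  shows "step no_oracle M c =
    (fst (trans M (fst c) (map scan (snd c))), map2 act (snd (trans M (fst c) (map scan (snd c)))) (snd c))"
proof -
  have "map2 act (map (\<lambda>s. (s, Go_Nowhere)) (map scan ts)) ts = ts" for ts
    by (induction ts) auto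
  then show ?thesis
    by (cases c) (auto simp: step_def trans_def no_query split: prod.splits)
qed

lemma scan_valid: "valid_config M c \<Longrightarrow> set (map scan (snd c)) \<subseteq> {..<num_syms M}"
  by (force simp: valid_config_def)

lemma step_valid:
  assumes v: "valid_config M c"
  shows "valid_config M (step no_oracle M c)"
proof -
  have a: "fst (act b t) i < num_syms M" if "fst b < num_syms M" "fst t i < num_syms M" for b t i
    using that by (cases b; cases t) auto
  note tv = trans_valid[of "fst c" "map scan (snd c)", OF _ _ scan_valid[OF v]]
  have "fst t i < num_syms M"
    if t: "t \<in> set (map2 act (snd (trans M (fst c) (map scan (snd c)))) (snd c))" for t i
  proof -
    obtain j where "j < K" "t = act (snd (trans M (fst c) (map scan (snd c))) ! j) (snd c ! j)"
      using t v tv(2) by (auto simp: in_set_conv_nth valid_config_def simp del: act.simps)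
    then show ?thesis using v tv(3) by (auto simp: valid_config_def simp del: act.simps intro!: a)
  qed
  then show ?thesis
    using v tv(1,2) unfolding step_eq[OF v] valid_config_def by auto
qed

lemma conf_valid: "valid_config M (conf y t)"
proof (induction t)
  case 0
  show ?case
    using tm K3 by (auto simp: conf_def init_config_def valid_config_def word_tape_def turing_machine_def oracle_machine_def)
next
  case (Suc t)
  then show ?case using step_valid by (simp add: conf_def)
qed

lemma conf_SucD:
  assumes "s \<in> set (snd (conf y (Suc t)))"
  obtains a s' where "s = act a s'" "s' \<in> set (snd (conf y t))"
proof -
  have c: "conf y (Suc t) = step no_oracle M (conf y t)" by (simp add: conf_def)
  show ?thesis
    using assms that unfolding c step_eq[OF conf_valid]
    by (auto simp del: act.simps dest: set_zip_rightD)
qed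

lemma conf_head_le: "s \<in> set (snd (conf y t)) \<Longrightarrow> snd s \<le> t"
proof (induction t arbitrary: s)
  case 0
  then show ?case by (auto simp: conf_def init_config_def word_tape_def)
next
  case (Suc t)
  obtain a s' where s: "s = act a s'" "s' \<in> set (snd (conf y t))"
    using Suc.prems by (rule conf_SucD)
  have "move_head m h \<le> Suc h" for m h by (cases m) auto
  then show ?case using s Suc.IH[OF s(2)] by (cases a; cases s') (auto intro: order_trans)
qed

lemma conf_blank: "s \<in> set (snd (conf y t)) \<Longrightarrow> t + length (w @ y) \<le> i \<Longrightarrow> fst s i = 0"
proof (induction t arbitrary: s)
  case 0
  then show ?case by (auto simp: conf_def init_config_def word_tape_def)
next
  case (Suc t)
  obtain a s' where s: "s = act a s'" "s' \<in> set (snd (conf y t))"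
    using Suc.prems(1) by (rule conf_SucD)
  then show ?case
    using Suc.IH[OF s(2)] Suc.prems(2) conf_head_le[OF s(2)] by (cases a; cases s') auto
qed

lemma conf_halted:
  assumes "length y = k" "T \<le> t"
  shows "conf y t = conf y T" "fst (conf y T) = halt_state M" "tape_word (snd (conf y T) ! 1) = V (w @ y)"
proof -
  show h: "fst (conf y T) = halt_state M" "tape_word (snd (conf y T) ! 1) = V (w @ y)"
    using V[OF assms(1)] by (auto simp: outputs_within_def conf_def split: prod.splits)
  show "conf y t = conf y T"
    using assms(2)
  proof (induction t rule: dec_induct)
    case (step n)
    then show ?case using h(1)
      by (cases "conf y T") (auto simp: conf_def step_def)
  qed simp
qed

lemma conf_head: "length y = k \<Longrightarrow> s \<in> set (snd (conf y t)) \<Longrightarrow> snd s \<le> T"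
  using conf_head_le[of s y t] conf_head_le[of s y T] conf_halted[of y t] by (cases "t \<le> T") auto

lemma tile_of_sel [simp]:
  "kind (tile_of c h) = min 3 h" "st (tile_of c h) = fst c" "scn (tile_of c h) = map scan (snd c)"
  "az (tile_of c h) = map (\<lambda>t. snd t = 0) (snd c)"
  "sy (tile_of c h) = map (\<lambda>t. if h = 0 then 0 else fst t (h - 1)) (snd c)"
  "fl (tile_of c h) = map (\<lambda>t. h = Suc (snd t)) (snd c)"
  by (simp_all add: tile_of_def)

lemma tile_of_tiles: "valid_config M c \<Longrightarrow> tile_of c h \<in> tiles M"
proof -
  assume v: "valid_config M c"
  have "scan t = fst t (snd t)" for t by (cases t) auto
  then show ?thesis
    using K3 v scan_valid[OF v] unfolding tiles_def valid_config_def
    by (auto simp: less_Suc_eq_0_disj)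
qed

text \<open>The tile whose \<open>mv\<close> is consulted may stand in any column \<open>h'\<close>,
  because the move depends only on values that are constant along the row.\<close>

lemma tile_of_step:
  assumes v: "valid_config M c" and j: "j < K"
  defines "c' \<equiv> step no_oracle M c"
  shows "st (tile_of c' h) = fst (trans M (fst c) (map scan (snd c)))"
    and "sy (tile_of c' h) ! j = (if fl (tile_of c h) ! j then wr M (tile_of c h) j else sy (tile_of c h) ! j)"
    and "mv M (tile_of c h') j = Go_Nowhere \<Longrightarrow> fl (tile_of c' h) ! j = fl (tile_of c h) ! j"
    and "mv M (tile_of c h') j = Go_Right \<Longrightarrow> fl (tile_of c' (Suc h)) ! j = fl (tile_of c h) ! j"
    and "mv M (tile_of c h') j = Go_Left \<Longrightarrow> fl (tile_of c' h) ! j = fl (tile_of c (Suc h)) ! j"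
proof -
  define acts where "acts = snd (trans M (fst c) (map scan (snd c)))"
  obtain f p where s: "snd c ! j = (f, p)" by force
  obtain b m where a: "acts ! j = (b, m)" by force
  have l: "length acts = K" "length (snd c) = K"
    using trans_valid[of "fst c" "map scan (snd c)"] v scan_valid[OF v] by (auto simp: acts_def valid_config_def)
  have c': "c' = (fst (trans M (fst c) (map scan (snd c))), map2 act acts (snd c))"
    using step_eq[OF v] by (simp add: c'_def acts_def)
  have j': "snd c' ! j = (f(p := b), move_head m p)" "length (snd c') = K"
    using l j s a by (auto simp: c')
  have w: "wr M (tile_of c h) j = b" "mv M (tile_of c h) j = (if p = 0 \<and> m = Go_Left then Go_Nowhere else m)" for h
    using l j s a by (auto simp: wr_def mv_def acts_def[symmetric])
  show "st (tile_of c' h) = fst (trans M (fst c) (map scan (snd c)))" by (simp add: c')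
  show "sy (tile_of c' h) ! j = (if fl (tile_of c h) ! j then wr M (tile_of c h) j else sy (tile_of c h) ! j)"
    using j j' l s by (auto simp: w)
  show "fl (tile_of c' h) ! j = fl (tile_of c h) ! j" if "mv M (tile_of c h') j = Go_Nowhere"
    using that j j' l s by (auto simp: w split: if_splits)
  show "fl (tile_of c' (Suc h)) ! j = fl (tile_of c h) ! j" if "mv M (tile_of c h') j = Go_Right"
    using that j j' l s by (auto simp: w split: if_splits)
  show "fl (tile_of c' h) ! j = fl (tile_of c (Suc h)) ! j" if "mv M (tile_of c h') j = Go_Left"
    using that j j' l s by (auto simp: w split: if_splits)
qed

lemma conf_Suc: "conf y (Suc t) = step no_oracle M (conf y t)"
  by (simp add: conf_def)

lemma length_conf [simp]: "length (snd (conf y t)) = K"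
  using conf_valid by (simp add: valid_config_def)

definition tiling_of :: "bool list \<Rightarrow> nat \<Rightarrow> tile" where
  "tiling_of y = restrict (\<lambda>l. tile_of (conf y (l div G)) (l mod G)) {..<G * G}"

lemma cell_less: "t < G \<Longrightarrow> h < G \<Longrightarrow> t * G + h < G * G"
proof -
  assume "t < G" "h < G"
  then have "t * G + h < Suc t * G" by simp
  also have "\<dots> \<le> G * G" using \<open>t < G\<close> by (intro mult_le_mono1) simp
  finally show ?thesis .
qed

lemma tiling_of_cell: "t < G \<Longrightarrow> h < G \<Longrightarrow> tiling_of y (t * G + h) = tile_of (conf y t) h"
  using cell_less[of t h] by (auto simp: tiling_of_def)

lemma cellE:
  assumes "l < G * G"
  obtains t h where "l = t * G + h" "t < G" "h < G"
proof -
  have "l div G < G" using assms by (simp add: less_mult_imp_div_less)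
  moreover have "l mod G < G" using G by simp
  ultimately show ?thesis using that[of "l div G" "l mod G"] by simp
qed

lemma conf_0: "conf y 0 = (start_state M, word_tape (w @ y) # replicate (K - 1) (word_tape []))"
  by (simp add: conf_def init_config_def)

lemma allowed_tiling_of:
  assumes y: "length y = k" "V (w @ y) = [True]" and th: "t < G" "h < G"
  shows "allowed M (code w k G t h) (tile_of (conf y t) h)"
proof -
  have hd: "h \<noteq> Suc (snd (snd (conf y t) ! j))" if "h = G - 1" "j < K" for j
    using conf_head[OF y(1), of "snd (conf y t) ! j" t] that G(1) by auto
  have c0: "allowed M (code w k G t h) (tile_of (conf y t) h)" if t: "t = 0" "h \<noteq> 0"
  proof -
    have sf: "sy (tile_of (conf y 0) h) ! j = (if j = 0 then fst (word_tape (w @ y)) (h - 1) else 0)"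
      "fl (tile_of (conf y 0) h) ! j \<longleftrightarrow> h = 1" if "j < K" for j
      using that t(2) K3 by (auto simp: conf_0 nth_Cons' word_tape_def)
    have "code w k G 0 h \<in> {3, 4, 5, 6}" using t(2) by (auto simp: code_def)
    moreover have "fst (word_tape (w @ y)) (h - 1) \<in> (let c = code w k G 0 h in
        if c = 3 then {1} else if c = 4 then {2} else if c = 5 then {1, 2} else {0})"
      using t(2) y(1) by (auto simp: code_def word_tape_def nth_append)
    moreover have "min 3 h = 1 \<longleftrightarrow> h = 1" "min 3 h \<noteq> 0" "0 < K" using t(2) K3 by auto
    ultimately show ?thesis
      unfolding t(1) allowed_def using sf by (auto simp: conf_0 Let_def simp del: tile_of_sel(5,6))
  qed
  have "fst (snd (conf y t) ! 1) 0 = 2 \<and> fst (snd (conf y t) ! 1) 1 \<notin> {1, 2}" if "t = G - 1"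
  proof -
    have t: "tape_word (snd (conf y t) ! 1) = [True]"
      using conf_halted[OF y(1), of t] y(2) that G by auto
    have "\<exists>i. fst (snd (conf y t) ! 1) i \<notin> {1, 2}"
      using conf_blank[of "snd (conf y t) ! 1" y t] K3 by (intro exI[of _ "t + length (w @ y)"]) auto
    with t show ?thesis using tape_word_eq_True by blast
  qed
  note last = this
  consider "h = 0" | "t = 0" "h \<noteq> 0" | "h \<noteq> 0" "0 < t" "t < G - 1" |
      "h \<noteq> 0" "t = G - 1" "h < G - 1" | "h \<noteq> 0" "t = G - 1" "h = G - 1"
    using th by linarith
  then show ?thesis
  proof cases
    case 1
    then show ?thesis by (simp add: allowed_def code_def)
  next
    case 2
    then show ?thesis by (rule c0)
  next
    case 3
    then show ?thesis by (simp add: allowed_def code_def)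
  next
    case 4
    then have "code w k G t h = 2" using G by (simp add: code_def)
    then show ?thesis
      using 4 K3 last by (auto simp: allowed_def min_def split: if_splits)
  next
    case 5
    then have "code w k G t h = 7" "3 \<le> h" using G by (simp_all add: code_def)
    then show ?thesis
      using 5 K3 hd by (auto simp: allowed_def)
  qed
qed

text \<open>True neighbours satisfy the constraints by \<open>tile_of_step\<close>; wrapped pairs do
  because neither border column ever holds a head (\<open>nofl\<close>).\<close>

lemma tiling_of_tilings:
  assumes y: "length y = k" "V (w @ y) = [True]"
  shows "tiling_of y \<in> tilings"
proof -
  let ?a = "tiling_of y"
  have nofl: "\<not> fl (tile_of (conf y t) h) ! j" if "h = 0 \<or> G - 1 \<le> h" "j < K" for t h j
    using conf_head[OF y(1), of "snd (conf y t) ! j" t] that G(1) by auto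
  have E: "?a \<in> {..<G * G} \<rightarrow>\<^sub>E tiles M"
    by (auto simp: tiling_of_def intro: tile_of_tiles conf_valid)
  have H: "compat_h M (?a l) (?a (l + 1))" if "l + 1 < G * G" for l
  proof -
    obtain t h where l: "l = t * G + h" "t < G" "h < G" using cellE[of l] \<open>l + 1 < G * G\<close> by auto
    show ?thesis
    proof (cases "Suc h = G")
      case True
      then have l1: "l + 1 = Suc t * G + 0" using l by simp
      have "Suc t < G" using \<open>l + 1 < G * G\<close> unfolding l1 by (metis add.right_neutral mult_less_cancel2)
      then have e: "?a (l + 1) = tile_of (conf y (Suc t)) 0" "?a l = tile_of (conf y t) h"
        unfolding l1 unfolding l(1) using l tiling_of_cell[of "Suc t" 0 y]
        by (auto simp: tiling_of_cell simp del: mult_Suc)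
      show ?thesis
        unfolding e compat_h_def using nofl[of h _ t] True by (auto simp del: tile_of_sel(6))
    next
      case False
      then have l1: "l + 1 = t * G + Suc h" "Suc h < G" using l by auto
      then have e: "?a (l + 1) = tile_of (conf y t) (Suc h)" "?a l = tile_of (conf y t) h"
        unfolding l1(1) unfolding l(1) using l by (auto intro!: tiling_of_cell simp del: add_Suc_right)
      show ?thesis unfolding e compat_h_def by auto
    qed
  qed
  have L: "compat_move M Go_Left (?a l) (?a (l + (G - 1)))" if a: "l + (G - 1) < G * G" for l
  proof -
    obtain t h where l: "l = t * G + h" "t < G" "h < G" using cellE[of l] a by auto
    show ?thesis
    proof (cases h)
      \<comment> \<open>From column 0 the offset \<open>G - 1\<close> leads to the last column of
        the same row, a wrapped pair.\<close>
      case 0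
      then have l1: "l + (G - 1) = t * G + (G - 1)" "G - 1 < G" using l by auto
      then have e: "?a (l + (G - 1)) = tile_of (conf y t) (G - 1)" "?a l = tile_of (conf y t) 0"
        unfolding l1(1) unfolding l(1) using l 0 tiling_of_cell[of t "G - 1" y] tiling_of_cell[of t 0 y] by auto
      show ?thesis
        unfolding e compat_move_def using nofl[of 0 _ t] nofl[of "G - 1" _ t] by (auto simp del: tile_of_sel)
    next
      case (Suc h')
      then have e: "l + (G - 1) = Suc t * G + h'" using l G by simp
      then have "Suc t < G" using a by (metis add_lessD1 mult_less_cancel2)
      then have e': "?a (l + (G - 1)) = tile_of (conf y (Suc t)) h'" "?a l = tile_of (conf y t) (Suc h')"
        unfolding e unfolding l(1) Suc using l Suc by (auto intro!: tiling_of_cell simp del: mult_Suc add_Suc_right)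
      show ?thesis
        unfolding e' compat_move_def using tile_of_step(5)[OF conf_valid, of _ y t]
        by (auto simp: conf_Suc simp del: tile_of_sel)
    qed
  qed
  have N: "compat_v M (?a l) (?a (l + G))" if a: "l + G < G * G" for l
  proof -
    obtain t h where l: "l = t * G + h" "t < G" "h < G" using cellE[of l] a by auto
    then have e: "l + G = Suc t * G + h" by simp
    then have "Suc t < G" using a by (metis add_lessD1 mult_less_cancel2)
    then have e': "?a (l + G) = tile_of (conf y (Suc t)) h" "?a l = tile_of (conf y t) h"
      unfolding e unfolding l(1) using l by (auto intro!: tiling_of_cell simp del: mult_Suc)
    show ?thesis
      unfolding e' compat_v_def compat_move_def
      using tile_of_step(2,3)[OF conf_valid, of _ y t] tile_of_step(1)[OF conf_valid, of 0 y t h] K3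
      by (auto simp: conf_Suc simp del: tile_of_sel(5,6))
  qed
  have R: "compat_move M Go_Right (?a l) (?a (l + (G + 1)))" if a: "l + (G + 1) < G * G" for l
  proof -
    obtain t h where l: "l = t * G + h" "t < G" "h < G" using cellE[of l] a by auto
    show ?thesis
    proof (cases "Suc h = G")
      case True
      \<comment> \<open>From the last column the offset \<open>G + 1\<close> skips a row and leads
        to column 0 of the row after it.\<close>
      then have e: "l + (G + 1) = Suc (Suc t) * G + 0" using l by simp
      then have "Suc (Suc t) < G" using a by (metis add_lessD1 mult_less_cancel2)
      then have e': "?a (l + (G + 1)) = tile_of (conf y (Suc (Suc t))) 0" "?a l = tile_of (conf y t) h"
        unfolding e unfolding l(1) using l tiling_of_cell[of "Suc (Suc t)" 0 y]
        by (auto simp: tiling_of_cell simp del: mult_Suc)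
      show ?thesis
        unfolding e' compat_move_def using nofl[of h _ t] nofl[of 0 _ "Suc (Suc t)"] True
        by (auto simp del: tile_of_sel)
    next
      case False
      then have e: "l + (G + 1) = Suc t * G + Suc h" "Suc h < G" using l by auto
      then have "Suc t < G" using a by (metis add_lessD1 mult_less_cancel2)
      then have e': "?a (l + (G + 1)) = tile_of (conf y (Suc t)) (Suc h)" "?a l = tile_of (conf y t) h"
        unfolding e(1) unfolding l(1) using l e(2) by (auto intro!: tiling_of_cell simp del: mult_Suc add_Suc_right)
      show ?thesis
        unfolding e' compat_move_def using tile_of_step(4)[OF conf_valid, of _ y t]
        by (auto simp: conf_Suc simp del: tile_of_sel)
    qed
  qed
  have A: "allowed M (code w k G t h) (?a (t * G + h))" if "t < G" "h < G" for t h
    using allowed_tiling_of[OF y that] that by (simp add: tiling_of_cell)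
  show ?thesis using E H L N R A by (simp add: tilings_def)
qed

text \<open>The \<open>Suc\<close> accounts for the border. These are the cells with code 5, the
  only ones in row 0 behind the border whose code leaves the input symbol open.\<close>

definition witness :: "(nat \<Rightarrow> tile) \<Rightarrow> bool list" where
  "witness a = map (\<lambda>i. sy (a (Suc (length w + i))) ! 0 = 2) [0..<k]"

lemma witness_tiling_of: "length y = k \<Longrightarrow> witness (tiling_of y) = y"
proof (rule nth_equalityI)
  fix i assume y: "length y = k" and "i < length (witness (tiling_of y))"
  then have i: "i < k" by (simp add: witness_def)
  have "tiling_of y (0 * G + Suc (length w + i)) = tile_of (conf y 0) (Suc (length w + i))"
    using i G by (intro tiling_of_cell) auto
  then show "witness (tiling_of y) ! i = y ! i"
    using i y by (auto simp: witness_def conf_0 word_tape_def nth_append)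
qed (simp add: witness_def)

context
  fixes a assumes a: "a \<in> tilings"
begin

lemma tile_in: "t < G \<Longrightarrow> h < G \<Longrightarrow> a (t * G + h) \<in> tiles M"
  using a cell_less by (auto simp: tilings_def)

lemma tile_allowed: "t < G \<Longrightarrow> h < G \<Longrightarrow> allowed M (code w k G t h) (a (t * G + h))"
  using a by (auto simp: tilings_def)

lemma tile_row_h:
  assumes "t < G" "Suc h < G"
  shows "compat_h M (a (t * G + h)) (a (t * G + Suc h))"
proof -
  have "t * G + h + 1 < G * G" using cell_less[OF assms] by simp
  moreover have "\<forall>l. l + 1 < G * G \<longrightarrow> compat_h M (a l) (a (l + 1))"
    using a unfolding tilings_def by blast
  ultimately show ?thesis by fastforce
qed

lemma tile_kind: "t < G \<Longrightarrow> h < G \<Longrightarrow> kind (a (t * G + h)) = min 3 h"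
proof (induction h)
  case 0
  then show ?case using tile_allowed[of t 0] by (simp add: allowed_def code_def)
next
  case (Suc h)
  have "kind (a (t * G + Suc h)) \<noteq> 0"
    using tile_allowed[of t "Suc h"] Suc.prems by (auto simp: allowed_def code_def split: if_splits)
  then show ?case
    using tile_row_h[of t h] Suc by (auto simp: compat_h_def)
qed

lemma tile_signal:
  assumes "t < G" "h < G" "h' < G"
  shows "st (a (t * G + h)) = st (a (t * G + h'))" "scn (a (t * G + h)) = scn (a (t * G + h'))"
    "az (a (t * G + h)) = az (a (t * G + h'))"
proof -
  have "st (a (t * G + h)) = st (a (t * G + 0)) \<and> scn (a (t * G + h)) = scn (a (t * G + 0)) \<and>
    az (a (t * G + h)) = az (a (t * G + 0))" if "h < G" for h
    using that
  proof (induction h)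
    case (Suc h)
    then show ?case
      using tile_row_h[of t h] tile_kind[of t "Suc h"] assms by (auto simp: compat_h_def)
  qed simp
  from this[OF assms(2)] this[OF assms(3)] show "st (a (t * G + h)) = st (a (t * G + h'))"
    "scn (a (t * G + h)) = scn (a (t * G + h'))" "az (a (t * G + h)) = az (a (t * G + h'))"
    by simp_all
qed

lemma length_witness [simp]: "length (witness a) = k"
  by (simp add: witness_def)

text \<open>A row that agrees with a configuration in symbols, heads and state agrees with it altogether:
  the scanned symbols and the tests for the left end are broadcast along the row.\<close>

lemma row_complete:
  assumes t: "t < G"
    and sf: "\<And>h. h < G \<Longrightarrow> sy (a (t * G + h)) = sy (tile_of (conf (witness a) t) h) \<and>
      fl (a (t * G + h)) = fl (tile_of (conf (witness a) t) h)"
    and q: "st (a (t * G + 1)) = fst (conf (witness a) t)"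
    and h: "h < G"
  shows "a (t * G + h) = tile_of (conf (witness a) t) h"
proof -
  let ?c = "conf (witness a) t"
  have G1: "1 < G" using G by simp
  have "az (a (t * G + 1)) = fl (a (t * G + 1))"
    using tile_in[OF t G1] tile_kind[OF t G1] by (simp add: tiles_def)
  then have az: "az (a (t * G + h)) = az (tile_of ?c h)"
    using tile_signal(3)[OF t h G1] sf[OF G1] by auto
  have scn: "scn (a (t * G + h)) = scn (tile_of ?c h)"
  proof (rule nth_equalityI)
    show "length (scn (a (t * G + h))) = length (scn (tile_of ?c h))"
      using tile_in[OF t h] by (simp add: tiles_def)
    fix j assume "j < length (scn (a (t * G + h)))"
    then have j: "j < K" using tile_in[OF t h] by (simp add: tiles_def)
    obtain f p where s: "snd ?c ! j = (f, p)" by force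
    \<comment> \<open>Cell \<open>p\<close> lies in column \<open>Suc p\<close>, which is inside the
      grid because no head passes cell \<open>T\<close>.\<close>
    have p: "Suc p < G"
      using conf_head[OF length_witness, of "(f, p)" t] G j nth_mem[of j "snd ?c"] s by auto
    have "fl (a (t * G + Suc p)) ! j" using sf[OF p] j s by simp
    then have "sy (a (t * G + Suc p)) ! j = scn (a (t * G + Suc p)) ! j"
      using tile_in[OF t p] j by (simp add: tiles_def)
    moreover have "sy (a (t * G + Suc p)) ! j = f p" using sf[OF p] j s by simp
    ultimately show "scn (a (t * G + h)) ! j = scn (tile_of ?c h) ! j"
      using tile_signal(2)[OF t h p] j s by simp
  qed
  show ?thesis
    using tile_kind[OF t h] tile_signal(1)[OF t h G1] q az scn sf[OF h]
    by (intro tile.expand) simp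
qed

lemma row_0: "h < G \<Longrightarrow> a (0 * G + h) = tile_of (conf (witness a) 0) h"
proof (rule row_complete)
  have G1: "0 < G" "1 < G" using G by auto
  show "0 < G" by fact
  have code0: "code w k G 0 h \<in> {3, 4, 5, 6}" if "h \<noteq> 0" for h
    using that by (auto simp: code_def)
  show "st (a (0 * G + 1)) = fst (conf (witness a) 0)"
    using tile_allowed[OF G1] code0[of 1] by (auto simp: allowed_def conf_0)
  fix h assume h: "h < G"
  have t: "a (0 * G + h) \<in> tiles M" by (rule tile_in[OF G1(1) h])
  have al: "allowed M (code w k G 0 h) (a (0 * G + h))" by (rule tile_allowed[OF G1(1) h])
  have kd: "kind (a (0 * G + h)) = min 3 h" by (rule tile_kind[OF G1(1) h])
  show "sy (a (0 * G + h)) = sy (tile_of (conf (witness a) 0) h) \<and>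
      fl (a (0 * G + h)) = fl (tile_of (conf (witness a) 0) h)"
  proof (cases "h = 0")
    case True
    then show ?thesis
      using t kd by (auto simp: tiles_def list_eq_iff_nth_eq)
  next
    case False
    have f': "\<forall>j<K. fl (a (0 * G + h)) ! j \<longleftrightarrow> kind (a (0 * G + h)) = 1"
        "\<forall>j<K. 0 < j \<longrightarrow> sy (a (0 * G + h)) ! j = 0"
        "sy (a (0 * G + h)) ! 0 \<in> (if code w k G 0 h = 3 then {1} else if code w k G 0 h = 4 then {2}
           else if code w k G 0 h = 5 then {1, 2} else {0})"
      using allowed_initD[OF al code0[OF False]] by simp_all
    have "min 3 h = 1 \<longleftrightarrow> h = 1" by auto
    then have f: "fl (a (0 * G + h)) ! j = (h = 1)" "0 < j \<Longrightarrow> sy (a (0 * G + h)) ! j = 0" if "j < K" for j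
      using f'(1,2) that kd by simp_all
    have "sy (a (0 * G + h)) ! 0 = fst (word_tape (w @ witness a)) (h - 1)"
    proof (cases "h - 1 < length w \<or> length w + k \<le> h - 1")
      case True
      then show ?thesis using f'(3) False by (auto simp: code_def word_tape_def nth_append split: if_splits)
    next
      case h2: False
      then have "code w k G 0 h = 5" using False by (auto simp: code_def)
      then have s12: "sy (a (0 * G + h)) ! 0 \<in> {1, 2}" using f'(3) by simp
      define i where "i = h - Suc (length w)"
      have i: "h = Suc (length w + i)" "i < k" using h2 False unfolding i_def by linarith+
      have "witness a ! i \<longleftrightarrow> sy (a (0 * G + h)) ! 0 = 2" using i by (simp add: witness_def)
      moreover have "fst (word_tape (w @ witness a)) (h - 1) = (if witness a ! i then 2 else 1)"
        unfolding i(1) using i(2) by (simp add: word_tape_def nth_append)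
      ultimately show ?thesis using s12 by auto
    qed
    then have "sy (a (0 * G + h)) ! j = sy (tile_of (conf (witness a) 0) h) ! j" if "j < K" for j
      using f(2)[OF that] that False by (auto simp: conf_0 nth_Cons' word_tape_def)
    moreover have "fl (a (0 * G + h)) ! j = fl (tile_of (conf (witness a) 0) h) ! j" if "j < K" for j
      using f(1)[OF that] that False by (auto simp: conf_0 nth_Cons' word_tape_def)
    ultimately show ?thesis
      using t by (auto simp: tiles_def intro!: nth_equalityI)
  qed
qed

text \<open>Each head flag is inherited from the cell from which the move would bring a head. Where
  that cell does not exist, the flag is excluded otherwise: in column 0 by \<open>tiles\<close>, in
  the last column by \<open>compat_h\<close> with the next border tile or, in the last row, by code
  7.\<close>

lemma row_Suc:
  assumes t: "Suc t < G" and row: "\<And>h. h < G \<Longrightarrow> a (t * G + h) = tile_of (conf (witness a) t) h"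
  shows "h < G \<Longrightarrow> a (Suc t * G + h) = tile_of (conf (witness a) (Suc t)) h"
proof (rule row_complete[OF t])
  let ?c = "conf (witness a) t"
  have G1: "1 < G" using G by auto
  have v: "compat_v M (a (t * G + h)) (a (Suc t * G + h))" if "h < G" for h
  proof -
    have "t * G + h + G < G * G" using cell_less[OF t that] by simp
    moreover have "\<forall>l. l + G < G * G \<longrightarrow> compat_v M (a l) (a (l + G))"
      using a unfolding tilings_def by blast
    moreover have "t * G + h + G = Suc t * G + h" by simp
    ultimately show ?thesis by metis
  qed
  have r: "compat_move M Go_Right (a (t * G + h)) (a (Suc t * G + Suc h))" if "Suc h < G" for h
  proof -
    have "t * G + h + (G + 1) < G * G" using cell_less[OF t that] by simp
    moreover have "\<forall>l. l + (G + 1) < G * G \<longrightarrow> compat_move M Go_Right (a l) (a (l + (G + 1)))"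
      using a unfolding tilings_def by blast
    moreover have "t * G + h + (G + 1) = Suc t * G + Suc h" by simp
    ultimately show ?thesis by metis
  qed
  have l: "compat_move M Go_Left (a (t * G + Suc h)) (a (Suc t * G + h))" if "Suc h < G" for h
  proof -
    have "t * G + Suc h + (G - 1) = Suc t * G + h" using G by simp
    moreover have "Suc t * G + h < G * G" using cell_less[OF t, of h] that by simp
    moreover have "\<forall>l. l + (G - 1) < G * G \<longrightarrow> compat_move M Go_Left (a l) (a (l + (G - 1)))"
      using a unfolding tilings_def by blast
    ultimately show ?thesis by metis
  qed
  show "st (a (Suc t * G + 1)) = fst (conf (witness a) (Suc t))"
    using v[OF G1] row[OF G1] tile_of_step(1)[OF conf_valid, of 0 "witness a" t 0] K3
    by (auto simp: compat_v_def conf_Suc)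
  fix h assume h: "h < G"
  let ?x = "a (Suc t * G + h)" and ?y = "tile_of (conf (witness a) (Suc t)) h"
  have x: "?x \<in> tiles M" by (rule tile_in[OF t h])
  have "sy ?x ! j = sy ?y ! j" if "j < K" for j
    using v[OF h] row[OF h] tile_of_step(2)[OF conf_valid that, of "witness a" t h] that
    by (auto simp: compat_v_def conf_Suc simp del: tile_of_sel)
  moreover have "fl ?x ! j = fl ?y ! j" if j: "j < K" for j
  proof -
    note row' = row[OF h] and st' = tile_of_step(3-5)[OF conf_valid j, of "witness a" t]
    have m: "mv M (tile_of ?c h') j = mv M (tile_of ?c h) j" for h' by (simp add: mv_def)
    have edge: "\<not> fl ?y ! j" if "h = 0 \<or> h = G - 1"
      using conf_head[OF length_witness, of "snd (conf (witness a) (Suc t)) ! j" "Suc t"] that G(1) j by auto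
    show ?thesis
    proof (cases "mv M (tile_of ?c h) j")
      case Go_Nowhere
      then show ?thesis
        using v[OF h] row' st'(1)[of h h] j by (auto simp: compat_v_def compat_move_def conf_Suc simp del: tile_of_sel)
    next
      case Go_Right
      show ?thesis
      proof (cases h)
        case 0
        then have "\<not> fl ?x ! j" using x tile_kind[OF t h] j by (simp add: tiles_def)
        with edge 0 show ?thesis by blast
      next
        case (Suc h')
        then have "fl ?x ! j = fl (tile_of ?c h') ! j"
          using r[of h'] h row[of h'] Go_Right m[of h'] j by (auto simp: compat_move_def simp del: tile_of_sel)
        then show ?thesis using st'(2)[of h h'] Go_Right Suc by (simp add: conf_Suc del: tile_of_sel)
      qed
    next
      case Go_Left
      show ?thesis
      proof (cases "Suc h < G")
        case True
        then have "fl ?x ! j = fl (tile_of ?c (Suc h)) ! j"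
          using l[of h] row[of "Suc h"] Go_Left m[of "Suc h"] j by (auto simp: compat_move_def simp del: tile_of_sel)
        then show ?thesis using st'(3)[of h h] Go_Left by (simp add: conf_Suc del: tile_of_sel)
      next
        case False
        then have h': "h = G - 1" using h by simp
        have "\<not> fl ?x ! j"
        proof (cases "Suc (Suc t) < G")
          case True
          have "Suc t * G + h + 1 = Suc (Suc t) * G + 0" using h' G by simp
          moreover have "Suc (Suc t) * G + 0 < G * G" using cell_less[OF True, of 0] G by simp
          moreover have "\<forall>l. l + 1 < G * G \<longrightarrow> compat_h M (a l) (a (l + 1))"
            using a unfolding tilings_def by blast
          ultimately have "compat_h M ?x (a (Suc (Suc t) * G + 0))" by metis
          then show ?thesis using tile_kind[OF True, of 0] G j by (auto simp: compat_h_def)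
        next
          case False
          then have "code w k G (Suc t) h = 7" using h' t G by (auto simp: code_def)
          then show ?thesis using tile_allowed[OF t h] j by (simp add: allowed_def)
        qed
        with edge h' show ?thesis by blast
      qed
    qed
  qed
  ultimately show "sy ?x = sy ?y \<and> fl ?x = fl ?y"
    using x tile_of_tiles[OF conf_valid, of "witness a" "Suc t" h] unfolding tiles_def
    by (intro conjI nth_equalityI) (auto simp del: tile_of_sel)
qed

lemma rows: "t < G \<Longrightarrow> h < G \<Longrightarrow> a (t * G + h) = tile_of (conf (witness a) t) h"
proof (induction t arbitrary: h)
  case 0
  then show ?case by (intro row_0)
next
  case (Suc t)
  show ?case
    using Suc.prems by (intro row_Suc Suc.IH) auto
qed

lemma tiling_of_witness: "tiling_of (witness a) = a"
proof
  fix l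
  show "tiling_of (witness a) l = a l"
  proof (cases "l < G * G")
    case True
    then obtain t h where "l = t * G + h" "t < G" "h < G" by (rule cellE)
    then show ?thesis by (simp add: tiling_of_cell rows)
  next
    case False
    then show ?thesis using a by (auto simp: tiling_of_def tilings_def PiE_def extensional_def)
  qed
qed

lemma witness_accepted: "V (w @ witness a) = [True]"
proof -
  let ?t = "G - 1"
  have G1: "?t < G" "1 < G" "2 < G" "?t \<noteq> 0" "1 < ?t" "2 < ?t" using G by auto
  have "code w k G ?t 1 = 2" "code w k G ?t 2 = 2" using G1 by (auto simp: code_def)
  then have "sy (a (?t * G + 1)) ! 1 = 2" "sy (a (?t * G + 2)) ! 1 \<notin> {1, 2}"
    using tile_allowed[OF G1(1,2)] tile_allowed[OF G1(1,3)] tile_kind[OF G1(1,2)] tile_kind[OF G1(1,3)]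
    by (auto simp: allowed_def)
  then have "fst (snd (conf (witness a) ?t) ! 1) 0 = 2" "fst (snd (conf (witness a) ?t) ! 1) 1 \<notin> {1, 2}"
    using rows[OF G1(1,2)] rows[OF G1(1,3)] K3 by auto
  then have "tape_word (snd (conf (witness a) ?t) ! 1) = [True]"
    by (subst tape_word_eq_True) auto
  then show ?thesis using conf_halted[OF length_witness, of ?t] G by auto
qed

end

theorem card_tilings: "card {y. length y = k \<and> V (w @ y) = [True]} = card tilings"
proof (rule bij_betw_same_card[of tiling_of], rule bij_betwI[of _ _ _ witness])
  show "tiling_of \<in> {y. length y = k \<and> V (w @ y) = [True]} \<rightarrow> tilings"
    using tiling_of_tilings by auto
  show "witness \<in> tilings \<rightarrow> {y. length y = k \<and> V (w @ y) = [True]}"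
    using witness_accepted length_witness by auto
qed (use witness_tiling_of tiling_of_witness in auto)

end

section \<open>Counting by partition functions\<close>

lemma power_int_sum_list:
  "(x :: rat) \<noteq> 0 \<Longrightarrow> (\<Prod>y\<leftarrow>ys. x powi g y) = x powi (\<Sum>y\<leftarrow>ys. g y)"
  by (induction ys) (auto simp: power_int_add)

lemma density_powi:
  "density m G = 2 powi (\<Sum>(f, w)\<leftarrow>weighted_features m. int (feature_value f G) * w)"
  by (simp add: density_def power_int_sum_list[symmetric] case_prod_unfold)

text \<open>Vertices 0 and 1 share role 0, and \<open>2\<close> to \<open>k - 2\<close> take the
  roles \<open>3\<close> to \<open>k - 1\<close>. From \<open>k - 1\<close> on, the \<open>u\<close>
  and the \<open>v\<close> alternate, so that going to the next index adds 2 independently of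
  \<open>m\<close>.\<close>

definition uvert :: "nat \<Rightarrow> nat \<Rightarrow> nat" where "uvert k i = k - 1 + 2 * i"
definition vvert :: "nat \<Rightarrow> nat \<Rightarrow> nat" where "vvert k i = k + 2 * i"
definition nv :: "nat \<Rightarrow> nat \<Rightarrow> nat" where "nv k m = k - 1 + 2 * m"

definition tup :: "nat \<Rightarrow> nat \<Rightarrow> nat \<Rightarrow> nat \<Rightarrow> nat list" where
  "tup k z i j = z # uvert k i # vvert k j # [2..<k - 1]"

definition role :: "nat \<Rightarrow> nat \<Rightarrow> nat" where
  "role k x = (if x < 2 then 0 else if x < k - 1 then x + 1 else if even (x - (k - 1)) then 1 else 2)"

text \<open>Exceeds the number of vertex pairs (\<open>card_NF\<close>), so that even all
  non-maximal edge sets together cannot make up for a loss of one unit.\<close>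

definition scale :: "nat \<Rightarrow> nat \<Rightarrow> nat" where "scale k m = nv k m * nv k m"

text \<open>The factor \<open>m + 1\<close> at vertex 1 is one more than the total that the weights
  \<open>c\<close> can ever yield (\<open>c_pos\<close>), so spoiling a forced copy never
  pays.\<close>

definition pair_features :: "graph \<Rightarrow> nat \<Rightarrow> (nat \<Rightarrow> nat \<Rightarrow> int) \<Rightarrow> nat \<times> nat \<Rightarrow> (feature \<times> int) list" where
  "pair_features F m c = (\<lambda>(i, j). let k = graph_order F in
     [(Indicator F (tup k 1 i j), int (scale k m * (m + 1))),
      (Indicator F (tup k 0 i j), int (scale k m) * c i j)])"

definition pairs :: "nat \<Rightarrow> nat set set" where
  "pairs n = {e. e \<subseteq> {..<n} \<and> card e = 2}"

lemma finite_pairs: "finite (pairs n)"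
  by (rule finite_subset[of _ "Pow {..<n}"]) (auto simp: pairs_def)

section \<open>From bilinear forms over vertex subsets to partition functions\<close>

text \<open>\<open>c_le\<close> and \<open>c_eq\<close> speak of products of \<open>X\<close> and
  \<open>Y\<close>, the situation once the forced pairs are right. \<open>c_pos\<close> admits an
  arbitrary set of pairs, as may occur when they are not. \<open>c_low\<close> serves to bound the
  denominator of the partition function.\<close>

locale gadget =
  fixes F :: graph and m L :: nat and c :: "nat \<Rightarrow> nat \<Rightarrow> int" and Sol :: "nat set set"
    and ijs :: "(nat \<times> nat) list"
  assumes F: "simple_graph F" "3 \<le> graph_order F"
    and m: "1 \<le> m" and L: "1 \<le> L"
    and ijs: "distinct ijs" "set ijs = {..<m} \<times> {..<m}"
    and Sol: "\<And>X. X \<in> Sol \<Longrightarrow> X \<subseteq> {..<m}"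
    and c_le: "\<And>X Y. X \<subseteq> {..<m} \<Longrightarrow> Y \<subseteq> {..<m} \<Longrightarrow> (\<Sum>i\<in>X. \<Sum>j\<in>Y. c i j) \<le> int L"
    and c_eq: "\<And>X Y. X \<subseteq> {..<m} \<Longrightarrow> Y \<subseteq> {..<m} \<Longrightarrow>
      (\<Sum>i\<in>X. \<Sum>j\<in>Y. c i j) = int L \<longleftrightarrow> X = Y \<and> X \<in> Sol"
    and c_pos: "\<And>Q. (\<Sum>i<m. \<Sum>j<m. if Q i j then c i j else 0) \<le> int m"
    and c_low: "\<And>i j. - int m \<le> c i j"
begin

abbreviation "k \<equiv> graph_order F"
abbreviation "n \<equiv> nv k m"
abbreviation "s \<equiv> scale k m"

definition model :: ergm where
  "model = ERGM n (concat (map (pair_features F m c) ijs))"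

text \<open>Pairs of different roles, whose status can agree with \<open>F\<close> or not. Pairs of
  equal role occur in no tuple and contribute a factor 2 each.\<close>

definition NF :: "nat set set" where "NF = {e \<in> pairs n. card (role k ` e) = 2}"
definition Free :: "nat set set" where "Free = {e \<in> pairs n. card (role k ` e) = 1}"

definition wrong :: "nat set set \<Rightarrow> nat set set" where
  "wrong E = {e \<in> NF. (e \<in> E) \<noteq> (role k ` e \<in> graph_edges F)}"

definition ok :: "nat set set \<Rightarrow> nat \<Rightarrow> nat \<Rightarrow> nat \<Rightarrow> bool" where
  "ok D z i j \<longleftrightarrow> (\<forall>e\<in>D. \<not> e \<subseteq> set (tup k z i j))"

definition En :: "nat set set \<Rightarrow> int" where
  "En D = (\<Sum>i<m. \<Sum>j<m. (if ok D 1 i j then int (s * (m + 1)) else 0) + (if ok D 0 i j then int s * c i j else 0))"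

definition Emax :: nat where "Emax = s * ((m + 1) * (m * m) + L)"

lemma finite_NF: "finite NF" and finite_Free: "finite Free"
  using finite_pairs by (auto simp: NF_def Free_def)

lemma role_tup: "r < k \<Longrightarrow> z < 2 \<Longrightarrow> role k (tup k z i j ! r) = r"
proof -
  assume r: "r < k" and z: "z < 2"
  consider "r = 0" | "r = 1" | "r = 2" | r' where "r = Suc (Suc (Suc r'))"
    by (metis One_nat_def numeral_2_eq_2 not0_implies_Suc)
  then show ?thesis
    using r z F(2) by cases (auto simp: tup_def role_def uvert_def vvert_def)
qed

lemma length_tup: "length (tup k z i j) = k"
  using F(2) by (simp add: tup_def)

lemma set_tup: "i < m \<Longrightarrow> j < m \<Longrightarrow> z < 2 \<Longrightarrow> set (tup k z i j) \<subseteq> {..<n}"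
  using F(2) by (auto simp: tup_def uvert_def vvert_def nv_def)

lemma distinct_tup:
  assumes "z < 2"
  shows "distinct (tup k z i j)"
  unfolding distinct_conv_nth length_tup using role_tup[OF _ assms] by metis

lemma pairs_simple: "simple_graph G \<Longrightarrow> graph_order G = n \<Longrightarrow> graph_edges G \<subseteq> pairs n"
  by (auto simp: simple_graph_def pairs_def)

text \<open>The vertices of a tuple have pairwise different roles, so any two of them form a pair in
  \<open>NF\<close>, and its roles are the positions at which \<open>F\<close> is consulted.\<close>

lemma induces_iff:
  assumes G: "simple_graph G" "graph_order G = n" and ij: "i < m" "j < m" and z: "z < 2"
  shows "induces_copy F (\<lambda>r. tup k z i j ! r) G \<longleftrightarrow> ok (wrong (graph_edges G)) z i j"
proof -
  let ?v = "\<lambda>r. tup k z i j ! r"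
  have v: "?v r \<in> {..<n}" "role k (?v r) = r" if "r < k" for r
    using set_tup[OF ij z] role_tup[OF that z] that nth_mem[of r "tup k z i j"]
    by (auto simp: length_tup simp del: nth_mem)
  have diag: "{a, a} \<notin> graph_edges F" "{a, a} \<notin> graph_edges G" for a
    using F(1) G(1) by (auto simp: simple_graph_def)
  have NF: "{?v a, ?v b} \<in> NF" "role k ` {?v a, ?v b} = {a, b}" if "a < k" "b < k" "a \<noteq> b" for a b
  proof -
    have "?v a \<noteq> ?v b" using v that by metis
    then show "{?v a, ?v b} \<in> NF" "role k ` {?v a, ?v b} = {a, b}"
      using v that by (auto simp: NF_def pairs_def)
  qed
  have "induces_copy F ?v G \<longleftrightarrow>
    (\<forall>a<k. \<forall>b<k. a \<noteq> b \<longrightarrow> {?v a, ?v b} \<notin> wrong (graph_edges G))"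
    unfolding induces_copy_def wrong_def using NF diag by (auto; metis)
  also have "\<dots> \<longleftrightarrow> ok (wrong (graph_edges G)) z i j"
  proof
    assume l: "\<forall>a<k. \<forall>b<k. a \<noteq> b \<longrightarrow> {?v a, ?v b} \<notin> wrong (graph_edges G)"
    show "ok (wrong (graph_edges G)) z i j"
      unfolding ok_def
    proof (intro ballI notI)
      fix e assume e: "e \<in> wrong (graph_edges G)" "e \<subseteq> set (tup k z i j)"
      then have "card e = 2" by (auto simp: wrong_def NF_def pairs_def)
      then obtain x y where "e = {x, y}" "x \<noteq> y" by (auto simp: card_2_iff)
      moreover from this e obtain a b where "a < k" "b < k" "x = ?v a" "y = ?v b"
        by (auto simp: in_set_conv_nth length_tup)
      ultimately show False using l e by blast
    qed
  next
    assume r: "ok (wrong (graph_edges G)) z i j"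
    show "\<forall>a<k. \<forall>b<k. a \<noteq> b \<longrightarrow> {?v a, ?v b} \<notin> wrong (graph_edges G)"
    proof (intro allI impI notI)
      fix a b assume "a < k" "b < k" "{?v a, ?v b} \<in> wrong (graph_edges G)"
      moreover from this have "{?v a, ?v b} \<subseteq> set (tup k z i j)" by (simp add: length_tup)
      ultimately show False using r unfolding ok_def by blast
    qed
  qed
  finally show ?thesis .
qed

lemma density_En:
  assumes "G \<in> graphs_on n"
  shows "density model G = 2 powi En (wrong (graph_edges G))"
proof -
  have G: "simple_graph G" "graph_order G = n" using assms by (auto simp: graphs_on_def)
  let ?t = "\<lambda>(i, j). (if ok (wrong (graph_edges G)) 1 i j then int (s * (m + 1)) else 0) +
    (if ok (wrong (graph_edges G)) 0 i j then int s * c i j else 0)"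
  have s: "sum_list (map f (concat (map g xs))) = (\<Sum>x\<leftarrow>xs. sum_list (map f (g x)))"
    for f :: "feature \<times> int \<Rightarrow> int" and g :: "nat \<times> nat \<Rightarrow> _" and xs
    by (induction xs) auto
  have "(\<Sum>(f, w)\<leftarrow>concat (map (pair_features F m c) ijs). int (feature_value f G) * w) =
      (\<Sum>x\<leftarrow>ijs. \<Sum>(f, w)\<leftarrow>pair_features F m c x. int (feature_value f G) * w)"
    by (rule s)
  also have "\<dots> = (\<Sum>x\<leftarrow>ijs. ?t x)"
  proof (rule arg_cong[where f = sum_list], rule map_cong[OF refl])
    fix x assume "x \<in> set ijs"
    then obtain i j where x: "x = (i, j)" "i < m" "j < m" using ijs by auto
    show "(\<Sum>(f, w)\<leftarrow>pair_features F m c x. int (feature_value f G) * w) = ?t x"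
      using induces_iff[OF G x(2,3)] by (simp add: x(1) pair_features_def Let_def)
  qed
  also have "\<dots> = sum ?t ({..<m} \<times> {..<m})"
    using sum_list_distinct_conv_sum_set[OF ijs(1), of ?t] by (simp only: ijs(2))
  also have "\<dots> = En (wrong (graph_edges G))"
    unfolding En_def sum.cartesian_product by (simp add: case_prod_unfold)
  finally show ?thesis by (simp add: density_powi model_def)
qed

lemma NF_Free: "pairs n = NF \<union> Free" "NF \<inter> Free = {}"
proof -
  have "card (role k ` e) = 1 \<or> card (role k ` e) = 2" if "card e = 2" for e
  proof -
    have "finite e" "e \<noteq> {}" using that by (auto intro: card_ge_0_finite)
    then have "0 < card (role k ` e)" "card (role k ` e) \<le> 2"
      using card_image_le[of e "role k"] that by (auto simp: card_gt_0_iff)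
    then show ?thesis by linarith
  qed
  then show "pairs n = NF \<union> Free" by (auto simp: NF_def Free_def pairs_def)
  show "NF \<inter> Free = {}" by (auto simp: NF_def Free_def)
qed

text \<open>A graph is the same as its set of wrong pairs together with its free edges, and the
  density depends on the former only. The inverse map toggles the pattern of \<open>F\<close> at the
  wrong pairs.\<close>

lemma partition_En: "partition_function model = 2 ^ card Free * (\<Sum>D\<in>Pow NF. 2 powi En D)"
proof -
  let ?f = "\<lambda>G. (wrong (graph_edges G), graph_edges G \<inter> Free)"
  let ?g = "\<lambda>(D, A). Graph n (A \<union> {e \<in> NF. (e \<in> D) \<noteq> (role k ` e \<in> graph_edges F)})"
  have b: "bij_betw ?f (graphs_on n) (Pow NF \<times> Pow Free)"
  proof (rule bij_betwI[of _ _ _ ?g])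
    show "?f \<in> graphs_on n \<rightarrow> Pow NF \<times> Pow Free"
      by (auto simp: wrong_def)
    show "?g \<in> Pow NF \<times> Pow Free \<rightarrow> graphs_on n"
    proof (rule funcsetI, clarify)
      fix D A assume "A \<subseteq> Free"
      then have "A \<union> {e \<in> NF. (e \<in> D) \<noteq> (role k ` e \<in> graph_edges F)} \<subseteq> pairs n"
        using NF_Free(1) by auto
      then show "Graph n (A \<union> {e \<in> NF. (e \<in> D) \<noteq> (role k ` e \<in> graph_edges F)}) \<in> graphs_on n"
        by (simp add: graphs_on_def simple_graph_def pairs_def)
    qed
    fix G assume "G \<in> graphs_on n"
    then have "graph_edges G \<subseteq> NF \<union> Free" "graph_order G = n"
      using pairs_simple NF_Free(1) by (auto simp: graphs_on_def)
    then show "?g (?f G) = G"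
      by (intro graph.expand) (auto simp: wrong_def)
  next
    fix x assume "x \<in> Pow NF \<times> Pow Free"
    then show "?f (?g x) = x"
      using NF_Free(2) by (auto simp: wrong_def) blast
  qed
  have "partition_function model = (\<Sum>G\<in>graphs_on n. 2 powi En (wrong (graph_edges G)))"
  proof -
    have "num_vertices model = n" by (simp add: model_def)
    then show ?thesis unfolding partition_function_def using density_En by (auto intro: sum.cong)
  qed
  also have "\<dots> = (\<Sum>(D, A)\<in>Pow NF \<times> Pow Free. 2 powi En D)"
    using sum.reindex_bij_betw[OF b, of "\<lambda>(D, A). 2 powi En D"] by simp
  also have "\<dots> = (\<Sum>D\<in>Pow NF. of_nat (card (Pow Free)) * 2 powi En D)"
    by (simp add: sum.cartesian_product[symmetric])
  finally show ?thesis
    using finite_Free by (simp add: card_Pow sum_distrib_left)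
qed

lemma vertex_cases:
  assumes "x < n"
  shows "x = 0 \<or> x = Suc 0 \<or> (2 \<le> x \<and> x < k - 1) \<or> (\<exists>i<m. x = uvert k i) \<or> (\<exists>i<m. x = vvert k i)"
proof (cases "x < k - 1")
  case True
  then show ?thesis by (cases "x < 2") (auto simp: less_2_cases_iff)
next
  case False
  define y where "y = x - (k - 1)"
  have y: "x = k - 1 + y" "y < 2 * m" using False assms by (auto simp: y_def nv_def)
  show ?thesis
  proof (cases "even y")
    case True
    then have "y div 2 < m" "x = uvert k (y div 2)" using y by (auto simp: uvert_def)
    then show ?thesis by blast
  next
    case False
    then have "y div 2 < m" "x = vvert k (y div 2)" using y F(2) by (auto simp: vvert_def elim!: oddE)
    then show ?thesis by blast
  qed
qed

lemma in_tup: "x \<in> set (tup k z i j) \<longleftrightarrow> x = z \<or> x = uvert k i \<or> x = vvert k j \<or> (2 \<le> x \<and> x < k - 1)"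
  by (auto simp: tup_def)

lemma role_simps [simp]:
  "role k 0 = 0" "role k (Suc 0) = 0" "role k (uvert k i) = 1" "role k (vvert k i) = 2"
  "2 \<le> x \<Longrightarrow> x < k - 1 \<Longrightarrow> role k x = Suc x"
  using F(2) by (auto simp: role_def uvert_def vvert_def)

lemma vert_simps [simp]:
  "uvert k i = uvert k j \<longleftrightarrow> i = j" "vvert k i = vvert k j \<longleftrightarrow> i = j"
  "uvert k i \<noteq> vvert k j" "vvert k i \<noteq> uvert k j" "uvert k i \<noteq> 0" "vvert k i \<noteq> 0"
  "0 \<noteq> uvert k i" "0 \<noteq> vvert k i"
  "uvert k i \<noteq> Suc 0" "vvert k i \<noteq> Suc 0" "Suc 0 \<noteq> uvert k i" "Suc 0 \<noteq> vvert k i"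
  using F(2) unfolding uvert_def vvert_def by presburger+

lemma vert_less: "i < m \<Longrightarrow> uvert k i < n" "i < m \<Longrightarrow> vvert k i < n" "0 < n" "Suc 0 < n"
  using F(2) m by (auto simp: uvert_def vvert_def nv_def)

text \<open>Consequently, if all copies at vertex 1 are present, only pairs at vertex 0 can be
  wrong.\<close>

lemma NF_avoid_0:
  assumes e: "e \<in> NF" "0 \<notin> e"
  obtains i j where "i < m" "j < m" "e \<subseteq> set (tup k 1 i j)"
proof -
  have "card e = 2" "e \<subseteq> {..<n}" using e by (auto simp: NF_def pairs_def)
  then obtain x y where xy: "e = {x, y}" "x \<noteq> y" "x < n" "y < n" by (auto simp: card_2_iff)
  have r: "role k x \<noteq> role k y" using e by (auto simp: NF_def xy)
  have "0 < m" using m by simp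
  have "x \<noteq> 0" "y \<noteq> 0" using e xy by auto
  have "\<exists>i<m. \<exists>j<m. e \<subseteq> set (tup k 1 i j)"
    using vertex_cases[OF xy(3)] vertex_cases[OF xy(4)] r \<open>x \<noteq> 0\<close> \<open>y \<noteq> 0\<close> \<open>0 < m\<close>
    unfolding xy(1) insert_subset in_tup
    by (elim disjE exE conjE) (simp_all, blast+)
  then show ?thesis using that by blast
qed

definition X_of :: "nat set set \<Rightarrow> nat set" where "X_of D = {i. i < m \<and> {0, uvert k i} \<notin> D}"
definition Y_of :: "nat set set \<Rightarrow> nat set" where "Y_of D = {i. i < m \<and> {0, vvert k i} \<notin> D}"
definition sp :: "nat set set \<Rightarrow> bool" where "sp D \<longleftrightarrow> (\<forall>p. 2 \<le> p \<longrightarrow> p < k - 1 \<longrightarrow> {0, p} \<notin> D)"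

text \<open>A wrong pair inside the tuple of 0 must contain 0; otherwise it would lie in the tuple
  of 1 as well. What remains are three independent tests, for \<open>u\<close>, for \<open>v\<close>
  and for the further roles.\<close>

lemma ok0_iff:
  assumes D: "D \<subseteq> NF" and ok1: "ok D 1 i j" and ij: "i < m" "j < m"
  shows "ok D 0 i j \<longleftrightarrow> sp D \<and> i \<in> X_of D \<and> j \<in> Y_of D"
proof
  assume "ok D 0 i j"
  then show "sp D \<and> i \<in> X_of D \<and> j \<in> Y_of D"
    using ij unfolding ok_def sp_def X_of_def Y_of_def
    by (auto simp: in_tup subset_iff)
next
  assume r: "sp D \<and> i \<in> X_of D \<and> j \<in> Y_of D"
  show "ok D 0 i j"
    unfolding ok_def
  proof (intro ballI notI)
    fix e assume e: "e \<in> D" "e \<subseteq> set (tup k 0 i j)"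
    then have "card e = 2" "card (role k ` e) = 2" using D by (auto simp: NF_def pairs_def)
    then obtain x y where xy: "e = {x, y}" "x \<noteq> y" by (auto simp: card_2_iff)
    have "0 \<in> e"
    proof (rule ccontr)
      assume "0 \<notin> e"
      then have "e \<subseteq> set (tup k 1 i j)" using e by (auto simp: in_tup)
      then show False using ok1 e by (auto simp: ok_def)
    qed
    then obtain x where x: "e = {0, x}" "x \<noteq> 0" using xy by auto
    then have "x = uvert k i \<or> x = vvert k j \<or> (2 \<le> x \<and> x < k - 1)" using e by (auto simp: in_tup)
    then show False using r e x by (auto simp: sp_def X_of_def Y_of_def)
  qed
qed

lemma sum_if_set: "X \<subseteq> {..<m} \<Longrightarrow> (\<Sum>i<m. if i \<in> X then f i else (0 :: int)) = sum f X"
  by (rule sum.mono_neutral_cong_right) auto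

lemma En_all_ok:
  assumes D: "D \<subseteq> NF" and ok1: "\<And>i j. i < m \<Longrightarrow> j < m \<Longrightarrow> ok D 1 i j"
  shows "En D = int s * (int ((m + 1) * (m * m)) +
    (if sp D then \<Sum>i\<in>X_of D. \<Sum>j\<in>Y_of D. c i j else 0))"
proof -
  have "En D = (\<Sum>i<m. \<Sum>j<m. int (s * (m + 1)) +
      int s * (if sp D then if i \<in> X_of D then if j \<in> Y_of D then c i j else 0 else 0 else 0))"
    unfolding En_def using ok1 ok0_iff[OF D ok1] by (intro sum.cong refl) auto
  also have "\<dots> = int (m * m * (s * (m + 1))) + int s * (\<Sum>i<m. \<Sum>j<m.
      (if sp D then if i \<in> X_of D then if j \<in> Y_of D then c i j else 0 else 0 else 0))"
    by (simp add: sum.distrib sum_distrib_left algebra_simps)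
  also have "(\<Sum>i<m. \<Sum>j<m. (if sp D then if i \<in> X_of D then if j \<in> Y_of D then c i j else 0 else 0 else 0)) =
      (if sp D then \<Sum>i\<in>X_of D. \<Sum>j\<in>Y_of D. c i j else 0)"
  proof -
    have "(\<Sum>j<m. if i \<in> X_of D then if j \<in> Y_of D then c i j else 0 else 0) =
        (if i \<in> X_of D then \<Sum>j\<in>Y_of D. c i j else 0)" for i
      by (subst sum_if_set[symmetric]) (auto simp: Y_of_def)
    moreover have "(\<Sum>i<m. if i \<in> X_of D then \<Sum>j\<in>Y_of D. c i j else 0) = (\<Sum>i\<in>X_of D. \<Sum>j\<in>Y_of D. c i j)"
      by (rule sum_if_set) (auto simp: X_of_def)
    ultimately show ?thesis by simp
  qed
  finally show ?thesis by (simp add: algebra_simps)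
qed

text \<open>One lost copy at vertex 1 costs \<open>s * (m + 1)\<close>, while the terms
  \<open>c\<close> bring at most \<open>s * m\<close> in total. The index pairs that count need not
  form a product here, hence the appeal to \<open>c_pos\<close>.\<close>

lemma En_not_ok:
  assumes "i < m" "j < m" "\<not> ok D 1 i j"
  shows "En D \<le> int Emax - int s"
proof -
  have "(\<Sum>i<m. \<Sum>j<m. if ok D 1 i j then int (s * (m + 1)) else 0) =
      (\<Sum>x\<in>{..<m} \<times> {..<m}. if ok D 1 (fst x) (snd x) then int (s * (m + 1)) else 0)"
    by (simp add: sum.cartesian_product case_prod_unfold)
  also have "\<dots> \<le> (\<Sum>x\<in>{..<m} \<times> {..<m}. if x \<noteq> (i, j) then int (s * (m + 1)) else 0)"
    using assms by (intro sum_mono) auto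
  also have "\<dots> = (\<Sum>x\<in>{..<m} \<times> {..<m} - {(i, j)}. int (s * (m + 1)))"
    by (intro sum.mono_neutral_cong_right) auto
  also have "\<dots> = int (m * m - 1) * int (s * (m + 1))"
    using assms by (simp add: card_Diff_singleton)
  finally have 1: "(\<Sum>i<m. \<Sum>j<m. if ok D 1 i j then int (s * (m + 1)) else 0) \<le> int (m * m - 1) * int (s * (m + 1))" .
  have "(\<Sum>i<m. \<Sum>j<m. if ok D 0 i j then int s * c i j else 0) =
      int s * (\<Sum>i<m. \<Sum>j<m. if ok D 0 i j then c i j else 0)"
    unfolding sum_distrib_left by (intro sum.cong refl) auto
  also have "\<dots> \<le> int s * int m"
    using c_pos by (intro mult_left_mono) auto
  finally have 2: "(\<Sum>i<m. \<Sum>j<m. if ok D 0 i j then int s * c i j else 0) \<le> int s * int m" .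
  have "int (m * m - 1) = int (m * m) - 1" using m by (simp add: of_nat_diff)
  note 1 = 1[unfolded this]
  have "int Emax = int s * (int ((m + 1) * (m * m)) + int L)" by (simp add: Emax_def)
  moreover have "int s \<le> int s * int L" using L by (simp add: mult_le_cancel_left1)
  ultimately show ?thesis
    using 1 2 unfolding En_def sum.distrib by (simp add: algebra_simps)
qed

definition D_of :: "nat set \<Rightarrow> nat set set" where
  "D_of X = (\<lambda>i. {0, uvert k i}) ` ({..<m} - X) \<union> (\<lambda>i. {0, vvert k i}) ` ({..<m} - X)"

lemma D_of_NF: "D_of X \<subseteq> NF"
  by (auto simp: D_of_def NF_def pairs_def vert_less)

lemma D_of_ok: "ok (D_of X) 1 i j"
  by (auto simp: ok_def D_of_def in_tup)

lemma D_of_inv: "X \<subseteq> {..<m} \<Longrightarrow> X_of (D_of X) = X" "X \<subseteq> {..<m} \<Longrightarrow> Y_of (D_of X) = X"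
  by (auto simp: X_of_def Y_of_def D_of_def doubleton_eq_iff)

lemma D_of_sp: "sp (D_of X)"
  using F(2) by (auto simp: sp_def D_of_def doubleton_eq_iff uvert_def vvert_def)

text \<open>Energies are multiples of \<open>s\<close>, so whatever misses the maximum misses it by
  at least \<open>s\<close>. Reaching it requires all forced copies, and then \<open>X = Y\<close>
  leaves no freedom in the set of wrong pairs.\<close>

lemma En_le:
  assumes D: "D \<subseteq> NF"
  shows "En D \<le> int Emax - int s \<or> (En D = int Emax \<and> X_of D \<in> Sol \<and> D = D_of (X_of D))"
proof (cases "\<forall>i<m. \<forall>j<m. ok D 1 i j")
  case False
  then show ?thesis using En_not_ok by blast
next
  case True
  let ?q = "if sp D then \<Sum>i\<in>X_of D. \<Sum>j\<in>Y_of D. c i j else 0"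
  have sub: "X_of D \<subseteq> {..<m}" "Y_of D \<subseteq> {..<m}" by (auto simp: X_of_def Y_of_def)
  have En: "En D = int s * (int ((m + 1) * (m * m)) + ?q)"
    using En_all_ok[OF D] True by blast
  have Em: "int Emax = int s * (int ((m + 1) * (m * m)) + int L)" by (simp add: Emax_def)
  show ?thesis
  proof (cases "?q = int L")
    case False
    then have "?q \<le> int L - 1" using c_le[OF sub] L by (auto split: if_splits)
    then have "int s * ?q \<le> int s * (int L - 1)" by (intro mult_left_mono) auto
    then show ?thesis unfolding En Em by (simp add: algebra_simps)
  next
    case q: True
    then have sp: "sp D" using L by (auto split: if_splits)
    then have XY: "X_of D = Y_of D" "X_of D \<in> Sol" using q c_eq[OF sub] by auto
    have "D = D_of (X_of D)"
    proof
      show "D_of (X_of D) \<subseteq> D"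
        using XY(1) unfolding D_of_def by (auto simp: X_of_def Y_of_def)
      show "D \<subseteq> D_of (X_of D)"
      proof
        fix e assume e: "e \<in> D"
        then have NF: "e \<in> NF" using D by blast
        have "0 \<in> e"
        proof (rule ccontr)
          assume "0 \<notin> e"
          with NF obtain i j where "i < m" "j < m" "e \<subseteq> set (tup k 1 i j)" by (rule NF_avoid_0)
          then show False using True e by (auto simp: ok_def)
        qed
        then obtain x where x: "e = {0, x}" "x \<noteq> 0" "x < n"
          using NF by (auto simp: NF_def pairs_def card_2_iff)
        have "x \<noteq> 1" using NF x by (auto simp: NF_def)
        moreover have "\<not> (2 \<le> x \<and> x < k - 1)" using sp e x by (auto simp: sp_def)
        moreover have "i \<notin> X_of D" if "x = uvert k i" for i using that e x by (auto simp: X_of_def)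
        moreover have "i \<notin> X_of D" if "x = vvert k i" for i using that e x XY(1) by (auto simp: Y_of_def)
        ultimately show "e \<in> D_of (X_of D)"
          using x vertex_cases[OF x(3)] by (auto simp: D_of_def)
      qed
    qed
    then show ?thesis using En Em q XY by auto
  qed
qed

lemma En_D_of:
  assumes "X \<in> Sol"
  shows "En (D_of X) = int Emax"
proof -
  have X: "X \<subseteq> {..<m}" using Sol assms .
  then have "(\<Sum>i\<in>X. \<Sum>j\<in>X. c i j) = int L" using c_eq assms by blast
  then show ?thesis
    using En_all_ok[OF D_of_NF D_of_ok] D_of_inv[OF X] D_of_sp by (simp add: Emax_def)
qed

lemma card_NF: "card NF < s"
proof -
  have n: "2 \<le> n" using m F(2) by (simp add: nv_def)
  have "card NF \<le> card (pairs n)" by (intro card_mono finite_pairs) (auto simp: NF_def)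
  also have "\<dots> = n choose 2" using n_subsets[of "{..<n}" 2] by (simp add: pairs_def)
  also have "\<dots> \<le> n * (n - 1)" by (simp add: choose_two)
  also have "\<dots> < n * n" using n by simp
  finally show ?thesis by (simp add: scale_def)
qed

text \<open>There are at most \<open>2 ^ card NF\<close> non-maximal terms, fewer than
  \<open>2 ^ s\<close>, and each is at least a factor \<open>2 ^ s\<close> below the maximum.
  Together they stay below one maximum; \<open>r\<close> is their share of it.\<close>

lemma sum_En:
  "\<exists>r. (\<Sum>D\<in>Pow NF. 2 powi En D) = (of_nat (card Sol) + r) * (2 :: rat) ^ Emax \<and> 0 \<le> r \<and> r < 1"
proof -
  let ?G = "D_of ` Sol"
  have G: "?G \<subseteq> Pow NF" using D_of_NF by auto
  have inj: "inj_on D_of Sol" using D_of_inv(1) Sol by (metis inj_onI)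
  have "(\<Sum>D\<in>Pow NF. 2 powi En D) = (\<Sum>D\<in>?G. 2 powi En D) + (\<Sum>D\<in>Pow NF - ?G. (2 :: rat) powi En D)"
    using sum.subset_diff[OF G, of "\<lambda>D. (2::rat) powi En D"] finite_NF by (simp add: add.commute)
  also have "(\<Sum>D\<in>?G. (2::rat) powi En D) = (\<Sum>X\<in>Sol. 2 ^ Emax)"
    by (subst sum.reindex[OF inj]) (auto simp: En_D_of)
  finally have 1: "(\<Sum>D\<in>Pow NF. 2 powi En D) = of_nat (card Sol) * 2 ^ Emax + (\<Sum>D\<in>Pow NF - ?G. (2 :: rat) powi En D)"
    by simp
  have "(\<Sum>D\<in>Pow NF - ?G. (2 :: rat) powi En D) \<le> (\<Sum>D\<in>Pow NF - ?G. 2 powi (int Emax - int s))"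
  proof (rule sum_mono)
    fix D assume "D \<in> Pow NF - ?G"
    then have "En D \<le> int Emax - int s" using En_le[of D] by auto
    then show "(2::rat) powi En D \<le> 2 powi (int Emax - int s)" by (intro power_int_increasing) auto
  qed
  also have "\<dots> \<le> of_nat (card (Pow NF)) * 2 powi (int Emax - int s)"
    using finite_NF by (auto intro!: mult_right_mono of_nat_mono card_mono)
  also have "\<dots> = 2 powi (int (card NF) + (int Emax - int s))"
    using finite_NF by (simp add: card_Pow power_int_add)
  also have "\<dots> < 2 powi (int Emax)"
    using card_NF by (intro power_int_strict_increasing) auto
  finally have "(\<Sum>D\<in>Pow NF - ?G. (2 :: rat) powi En D) < 2 ^ Emax" by simp
  moreover have "0 \<le> (\<Sum>D\<in>Pow NF - ?G. (2 :: rat) powi En D)" by (intro sum_nonneg) auto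
  ultimately show ?thesis
    using 1 by (intro exI[of _ "(\<Sum>D\<in>Pow NF - ?G. (2 :: rat) powi En D) / 2 ^ Emax"]) (simp add: field_simps)
qed

text \<open>The pair of 0 and 1, and twice \<open>m choose 2\<close> pairs inside the
  \<open>u\<close> and inside the \<open>v\<close>.\<close>

lemma card_Free: "card Free = m * (m - 1) + 1"
proof -
  let ?U = "uvert k ` {..<m}" and ?V = "vvert k ` {..<m}"
  let ?P = "\<lambda>A. {e. e \<subseteq> A \<and> card e = (2 :: nat)}"
  have c: "card (?P A) = card A choose 2" "finite (?P A)" if "finite A" for A :: "nat set"
    using n_subsets[OF that, of 2] that by auto
  have Fr: "Free = {{0, 1}} \<union> (?P ?U \<union> ?P ?V)"
  proof
    show "{{0, 1}} \<union> (?P ?U \<union> ?P ?V) \<subseteq> Free"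
    proof -
      have W: "e \<in> Free" if "e \<in> ?P W" "\<forall>x\<in>W. role k x = q \<and> x < n" for e W q
      proof -
        have "e \<noteq> {}" "e \<subseteq> {..<n}" using that by auto
        moreover have "role k ` e = (\<lambda>_. q) ` e" using that by (intro image_cong) auto
        ultimately show ?thesis using that by (auto simp: Free_def pairs_def image_constant_conv)
      qed
      have "e \<in> Free" if "e \<in> ?P ?U" for e using W[OF that, of 1] by (auto simp: vert_less)
      moreover have "e \<in> Free" if "e \<in> ?P ?V" for e using W[OF that, of 2] by (auto simp: vert_less)
      moreover have "{0, 1} \<in> Free" using F(2) m by (auto simp: Free_def pairs_def nv_def)
      ultimately show ?thesis by blast
    qed
    show "Free \<subseteq> {{0, 1}} \<union> (?P ?U \<union> ?P ?V)"
    proof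
      fix e assume e: "e \<in> Free"
      then obtain x y where xy: "e = {x, y}" "x \<noteq> y" "x < n" "y < n"
        by (auto simp: Free_def pairs_def card_2_iff)
      have "role k x = role k y" by (rule ccontr) (use e in \<open>auto simp: Free_def xy\<close>)
      then show "e \<in> {{0, 1}} \<union> (?P ?U \<union> ?P ?V)"
        using xy(2) unfolding xy(1)
        using vertex_cases[OF xy(3)] vertex_cases[OF xy(4)] by (auto simp: insert_commute)
    qed
  qed
  have d1: "{{0, 1}} \<inter> (?P ?U \<union> ?P ?V) = {}" by auto
  have d2: "?P ?U \<inter> ?P ?V = {}"
  proof -
    have uv: "?U \<inter> ?V = {}" by auto
    have False if e: "e \<in> ?P ?U" "e \<in> ?P ?V" for e
    proof -
      have "e \<subseteq> ?U \<inter> ?V" using e by blast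
      then have "e = {}" using uv by simp
      then show False using e by simp
    qed
    then show ?thesis by blast
  qed
  have f: "finite (?P ?U)" "finite (?P ?V)" by (rule c(2), simp)+
  have "card (A \<union> (B \<union> C)) = card A + (card B + card C)"
    if "finite A" "A \<inter> (B \<union> C) = {}" "B \<inter> C = {}" "finite B" "finite C" for A B C :: "nat set set"
    using that by (simp add: card_Un_disjoint)
  from this[OF _ d1 d2 f] have "card Free = card {{0, 1 :: nat}} + (card (?P ?U) + card (?P ?V))"
    unfolding Fr by simp
  then have "card Free = 1 + (card (?P ?U) + card (?P ?V))" by simp
  also have "\<dots> = 1 + 2 * (m choose 2)"
  proof -
    have "card ?U = m" "card ?V = m" by (simp_all add: card_image inj_on_def)
    then show ?thesis using c(1)[of ?U] c(1)[of ?V] by simp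
  qed
  also have "2 * (m choose 2) = m * (m - 1)"
  proof -
    have "even (m * (m - 1))" by (cases m) auto
    then show ?thesis by (simp add: choose_two)
  qed
  finally show ?thesis by simp
qed

theorem partition_model:
  "\<exists>r. partition_function model = (of_nat (card Sol) + r) * 2 ^ (Emax + (m * (m - 1) + 1)) \<and> 0 \<le> r \<and> r < 1"
  using sum_En by (auto simp: partition_En card_Free power_add)

lemma model_from: "F \<in> S \<Longrightarrow> uses_features_from S model"
  using ijs F(2) set_tup distinct_tup length_tup
  by (fastforce simp: uses_features_from_def model_def pair_features_def Let_def)

lemma En_ge: "- int (s * m * (m * m)) \<le> En D"
proof -
  have "- int (s * m) \<le> int s * c i j" for i j
    using mult_left_mono[OF c_low[of i j], of "int s"] by simp
  then have 1: "- int (s * m) \<le> (if ok D 1 i j then int (s * (m + 1)) else 0) + (if ok D 0 i j then int s * c i j else 0)"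
    for i j by (smt (verit) of_nat_0_le_iff)
  have "(\<Sum>i<m. \<Sum>j<m. - int (s * m)) \<le> En D" unfolding En_def by (intro sum_mono 1)
  then show ?thesis by (simp add: algebra_simps)
qed

text \<open>Negative weights produce a denominator. Its exponent has to be bounded in advance, since
  the time bound of the reduction may not depend on the oracle's answer.\<close>

lemma partition_dyadic: "\<exists>a. partition_function model * 2 ^ (s * m * (m * m)) = of_int a"
proof -
  let ?d = "s * m * (m * m)"
  have "(2 :: rat) powi En D * 2 ^ ?d = of_int (2 ^ nat (En D + int ?d))" for D
  proof -
    have "(2 :: rat) powi En D * 2 ^ ?d = 2 powi (En D + int ?d)" by (simp add: power_int_add del: of_nat_mult)
    then show ?thesis using En_ge[of D] by (simp add: power_int_def del: of_nat_mult)
  qed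
  then have "partition_function model * 2 ^ ?d = of_int (2 ^ card Free * (\<Sum>D\<in>Pow NF. 2 ^ nat (En D + int ?d)))"
    unfolding partition_En mult.assoc sum_distrib_right by simp
  then show ?thesis by blast
qed

lemma card_Sol_le: "card Sol \<le> 2 ^ m"
  using card_mono[of "Pow {..<m}" Sol] Sol by (auto simp: card_Pow)

end

section \<open>Selections of one value per cell under unary and binary constraints\<close>

definition sels :: "nat \<Rightarrow> nat \<Rightarrow> (nat \<Rightarrow> nat \<Rightarrow> bool) \<Rightarrow> (nat \<Rightarrow> nat \<Rightarrow> nat \<Rightarrow> nat \<Rightarrow> bool) \<Rightarrow> (nat \<Rightarrow> nat) set" where
  "sels L R al bad = {a \<in> {..<L} \<rightarrow>\<^sub>E {..<R}. (\<forall>l<L. al l (a l)) \<and>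
     (\<forall>l<L. \<forall>l'<L. l \<noteq> l' \<longrightarrow> \<not> bad l (a l) l' (a l'))}"

text \<open>Index \<open>i\<close> stands for value \<open>i mod R\<close> at cell
  \<open>i div R\<close>. An allowed choice earns 1 on the diagonal; two values at one cell, or a
  conflict, cost \<open>L * R\<close>, at least as much as can ever be earned. \<open>bad\<close> is
  directed, but for \<open>X = Y\<close> both orders of a pair are summed.\<close>

definition cw :: "nat \<Rightarrow> nat \<Rightarrow> (nat \<Rightarrow> nat \<Rightarrow> bool) \<Rightarrow> (nat \<Rightarrow> nat \<Rightarrow> nat \<Rightarrow> nat \<Rightarrow> bool) \<Rightarrow> nat \<Rightarrow> nat \<Rightarrow> int" where
  "cw L R al bad i j =
     (if i div R = j div R then if i = j then if al (i div R) (i mod R) then 1 else 0 else - int (L * R)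
      else if bad (i div R) (i mod R) (j div R) (j mod R) then - int (L * R) else 0)"

definition sel_set :: "nat \<Rightarrow> nat \<Rightarrow> (nat \<Rightarrow> nat) \<Rightarrow> nat set" where
  "sel_set L R a = (\<lambda>l. l * R + a l) ` {..<L}"

context
  fixes L R :: nat and al :: "nat \<Rightarrow> nat \<Rightarrow> bool" and bad :: "nat \<Rightarrow> nat \<Rightarrow> nat \<Rightarrow> nat \<Rightarrow> bool"
  assumes LR: "1 \<le> L" "1 \<le> R"
begin

abbreviation (input) "cc \<equiv> cw L R al bad"

lemma cw_le: "cc i j \<le> (if i = j then 1 else 0)"
  by (auto simp: cw_def)

lemma sum_diag: "finite X \<Longrightarrow> finite Y \<Longrightarrow> (\<Sum>i\<in>X. \<Sum>j\<in>Y. if i = j then 1 else (0 :: int)) = int (card (X \<inter> Y))"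
  by (simp add: sum.delta' sum.inter_restrict[symmetric] cong: sum.cong)

text \<open>If a penalty occurs between \<open>X\<close> and \<open>Y\<close>, the sum is at most
  \<open>card (X \<inter> Y) - L * R \<le> 0\<close>. Otherwise members of \<open>X\<close> and
  \<open>Y\<close> at the same cell coincide, and the sum counts the cells with an allowed choice
  common to both sets, at most \<open>L\<close>.\<close>

lemma sel_set_cases:
  assumes X: "X \<subseteq> {..<L * R}" and Y: "Y \<subseteq> {..<L * R}"
  shows "(\<Sum>i\<in>X. \<Sum>j\<in>Y. cc i j) \<le> int L"
    and "(\<Sum>i\<in>X. \<Sum>j\<in>Y. cc i j) = int L \<longrightarrow> X = Y \<and> X \<in> sel_set L R ` sels L R al bad"
proof -
  let ?S = "\<Sum>i\<in>X. \<Sum>j\<in>Y. cc i j"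
  have fin: "finite X" "finite Y" using X Y finite_subset by blast+
  have "?S \<le> int L \<and> (?S = int L \<longrightarrow> X = Y \<and> X \<in> sel_set L R ` sels L R al bad)"
  proof (cases "\<exists>i\<in>X. \<exists>j\<in>Y. cc i j = - int (L * R)")
    case True
    then obtain p q where pq: "p \<in> X" "q \<in> Y" "cc p q = - int (L * R)" by blast
    moreover have "0 \<le> cc q q" by (simp add: cw_def)
    moreover have "0 < int (L * R)" using LR by (simp add: zero_less_mult_iff)
    ultimately have "p \<noteq> q" by auto
    have "?S \<le> (\<Sum>i\<in>X. \<Sum>j\<in>Y. (if i = j then 1 else 0) + (if i = p \<and> j = q then - int (L * R) else 0))"
    proof (intro sum_mono)
      fix i j show "cc i j \<le> (if i = j then 1 else 0) + (if i = p \<and> j = q then - int (L * R) else 0)"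
        using cw_le[of i j] pq \<open>p \<noteq> q\<close> by auto
    qed
    also have "\<dots> = int (card (X \<inter> Y)) + (\<Sum>i\<in>X. \<Sum>j\<in>Y. if i = p \<and> j = q then - int (L * R) else 0)"
      by (simp only: sum.distrib sum_diag[OF fin])
    also have "(\<Sum>i\<in>X. \<Sum>j\<in>Y. if i = p \<and> j = q then - int (L * R) else 0) = - int (L * R)"
    proof -
      have "(\<Sum>j\<in>Y. if i = p \<and> j = q then - int (L * R) else 0) = (if i = p then - int (L * R) else 0)" for i
        using pq fin by (cases "i = p") (auto simp: sum.delta)
      then show ?thesis using pq fin by (simp add: sum.delta)
    qed
    also have "int (card (X \<inter> Y)) \<le> int (L * R)"
    proof -
      have "card (X \<inter> Y) \<le> card {..<L * R}" using X by (intro card_mono) auto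
      then show ?thesis by (simp del: of_nat_mult)
    qed
    finally have "?S \<le> 0" by simp
    then show ?thesis using LR by auto
  next
    case False
    let ?A = "{i \<in> X \<inter> Y. al (i div R) (i mod R)}"
    have nc: "cc i j \<noteq> - int (L * R)" if "i \<in> X" "j \<in> Y" for i j
      using False that by blast
    have same: "i = j" if "i \<in> X" "j \<in> Y" "i div R = j div R" for i j
      using nc[OF that(1,2)] that(3) by (simp add: cw_def del: of_nat_mult split: if_splits)
    have nbad: "\<not> bad (i div R) (i mod R) (j div R) (j mod R)" if "i \<in> X" "j \<in> Y" "i div R \<noteq> j div R" for i j
      using nc[OF that(1,2)] that(3) by (simp add: cw_def del: of_nat_mult split: if_splits)
    have "?S = (\<Sum>i\<in>X. \<Sum>j\<in>Y. if i = j then if al (i div R) (i mod R) then 1 else 0 else 0)"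
    proof (intro sum.cong refl)
      fix i j assume ij: "i \<in> X" "j \<in> Y"
      show "cc i j = (if i = j then if al (i div R) (i mod R) then 1 else 0 else 0)"
        using same[OF ij] nbad[OF ij] by (auto simp: cw_def)
    qed
    also have "\<dots> = (\<Sum>i\<in>X. if i \<in> Y then if al (i div R) (i mod R) then 1 else 0 else 0)"
      using fin by (simp add: sum.delta)
    also have "\<dots> = (\<Sum>i\<in>?A. 1)"
      using fin by (intro sum.mono_neutral_cong_right) auto
    finally have S: "?S = int (card ?A)" by simp
    have inj: "inj_on (\<lambda>i. i div R) ?A" using same by (auto intro!: inj_onI)
    have im: "(\<lambda>i. i div R) ` ?A \<subseteq> {..<L}"
      using X LR by (auto simp: less_mult_imp_div_less)
    have "card ?A = card ((\<lambda>i. i div R) ` ?A)" using inj by (simp add: card_image)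
    moreover have "card ((\<lambda>i. i div R) ` ?A) \<le> L" using card_mono[OF _ im] by simp
    ultimately have le: "?S \<le> int L" using S by simp
    have "X = Y \<and> X \<in> sel_set L R ` sels L R al bad" if e: "?S = int L"
    proof -
      have "card ((\<lambda>i. i div R) ` ?A) = card {..<L}" using S e \<open>card ?A = _\<close> by simp
      then have surj: "(\<lambda>i. i div R) ` ?A = {..<L}" using im by (intro card_subset_eq) auto
      \<comment> \<open>Every cell now has a representative in \<open>?A\<close>; any further member
        of \<open>X\<close> or \<open>Y\<close> would sit at the cell of such a representative and
        so coincide with it.\<close>
      have XA: "X = ?A"
      proof
        show "X \<subseteq> ?A"
        proof
          fix i assume i: "i \<in> X"
          then have "i div R \<in> (\<lambda>i. i div R) ` ?A" using X surj by (auto simp: less_mult_imp_div_less)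
          then obtain j where "j \<in> ?A" "i div R = j div R" by auto
          then show "i \<in> ?A" using same[of i j] i by auto
        qed
      qed auto
      have YA: "Y = ?A"
      proof
        show "Y \<subseteq> ?A"
        proof
          fix i assume i: "i \<in> Y"
          then have "i div R \<in> (\<lambda>i. i div R) ` ?A" using Y surj by (auto simp: less_mult_imp_div_less)
          then obtain j where "j \<in> ?A" "j div R = i div R" by auto
          then show "i \<in> ?A" using same[of j i] i by auto
        qed
      qed auto
      have XY: "Y = X" using XA YA by metis
      have Xal: "al (i div R) (i mod R)" if "i \<in> X" for i
      proof -
        have "i \<in> ?A" using that XA by blast
        then show ?thesis by blast
      qed
      have "\<exists>i\<in>X. i div R = l" if "l \<in> {..<L}" for l
      proof -
        have "l \<in> (\<lambda>i. i div R) ` ?A" using that surj by blast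
        then show ?thesis by blast
      qed
      then have "\<forall>l\<in>{..<L}. \<exists>i\<in>X. i div R = l" by blast
      then obtain f where f: "\<And>l. l < L \<Longrightarrow> f l \<in> X \<and> f l div R = l" by (metis lessThan_iff)
      define a where "a = restrict (\<lambda>l. f l mod R) {..<L}"
      have fa: "f l = l * R + a l" "a l < R" if "l < L" for l
        using f[OF that] that LR div_mult_mod_eq[of "f l" R] by (auto simp: a_def)
      have "al l (a l)" if "l < L" for l
        using f[OF that] that Xal[of "f l"] unfolding a_def by auto
      moreover have "\<not> bad l (a l) l' (a l')" if "l < L" "l' < L" "l \<noteq> l'" for l l'
        using nbad[of "f l" "f l'"] f[OF that(1)] f[OF that(2)] XY that by (auto simp: a_def)
      moreover have "a \<in> {..<L} \<rightarrow>\<^sub>E {..<R}" using LR by (auto simp: a_def)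
      ultimately have "a \<in> sels L R al bad" by (auto simp: sels_def)
      moreover have "X = sel_set L R a"
      proof
        show "sel_set L R a \<subseteq> X" using f fa by (auto simp: sel_set_def)
        show "X \<subseteq> sel_set L R a"
        proof
          fix i assume i: "i \<in> X"
          then have l: "i div R < L" using X by (auto simp: less_mult_imp_div_less)
          then have "i = f (i div R)" using f[OF l] same[of i "f (i div R)"] i XY by auto
          then show "i \<in> sel_set L R a" using fa(1)[OF l] l by (auto simp: sel_set_def)
        qed
      qed
      ultimately show ?thesis using XY by auto
    qed
    with le show ?thesis by blast
  qed
  then show "?S \<le> int L" "?S = int L \<longrightarrow> X = Y \<and> X \<in> sel_set L R ` sels L R al bad" by auto
qed

lemma sel_set_sum:
  assumes a: "a \<in> sels L R al bad"
  shows "(\<Sum>i\<in>sel_set L R a. \<Sum>j\<in>sel_set L R a. cc i j) = int L"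
proof -
  have aR: "a l < R" if "l < L" for l using a that by (auto simp: sels_def)
  have dm: "(l * R + a l) div R = l" "(l * R + a l) mod R = a l" if "l < L" for l
    using aR[OF that] by auto
  have inj: "inj_on (\<lambda>l. l * R + a l) {..<L}"
  proof (rule inj_onI)
    fix l l' assume l: "l \<in> {..<L}" "l' \<in> {..<L}" "l * R + a l = l' * R + a l'"
    have "l = (l * R + a l) div R" using dm(1)[of l] l by simp
    also have "\<dots> = l'" unfolding l(3) using dm(1)[of l'] l by simp
    finally show "l = l'" .
  qed
  have "cc (l * R + a l) (l' * R + a l') = (if l = l' then 1 else 0)" if "l < L" "l' < L" for l l'
  proof (cases "l = l'")
    case True
    then show ?thesis using a that unfolding cw_def dm[OF that(1)] dm[OF that(2)] by (simp add: sels_def)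
  next
    case False
    then show ?thesis using a that unfolding cw_def dm[OF that(1)] dm[OF that(2)] by (simp add: sels_def)
  qed
  then have "(\<Sum>i\<in>sel_set L R a. \<Sum>j\<in>sel_set L R a. cc i j) = (\<Sum>l<L. \<Sum>l'<L. if l = l' then 1 else 0)"
    unfolding sel_set_def by (simp add: sum.reindex[OF inj])
  then show ?thesis by simp
qed

lemma sel_set_subset: "a \<in> sels L R al bad \<Longrightarrow> sel_set L R a \<subseteq> {..<L * R}"
proof
  fix i assume a: "a \<in> sels L R al bad" and "i \<in> sel_set L R a"
  then obtain l where l: "l < L" "i = l * R + a l" by (auto simp: sel_set_def)
  then have "a l < R" using a by (auto simp: sels_def)
  then have "i < Suc l * R" using l by simp
  also have "\<dots> \<le> L * R" using l by (intro mult_le_mono1) simp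
  finally show "i \<in> {..<L * R}" by simp
qed

lemma inj_sel_set: "inj_on (sel_set L R) (sels L R al bad)"
proof (rule inj_onI)
  fix a b assume a: "a \<in> sels L R al bad" and b: "b \<in> sels L R al bad" and e: "sel_set L R a = sel_set L R b"
  show "a = b"
  proof
    fix l
    show "a l = b l"
    proof (cases "l < L")
      case True
      then have "l * R + a l \<in> sel_set L R b" using e by (auto simp: sel_set_def)
      then obtain l' where l': "l' < L" "l * R + a l = l' * R + b l'" by (auto simp: sel_set_def)
      have ab: "a l < R" "b l' < R" using a b True l' by (auto simp: sels_def)
      have "l = (l * R + a l) div R" using ab by auto
      also have "\<dots> = l'" using l' ab by auto
      finally show ?thesis using l' by auto
    next
      case False
      then show ?thesis using a b by (auto simp: sels_def PiE_def extensional_def)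
    qed
  qed
qed

lemma gadget_sels:
  assumes "simple_graph F" "3 \<le> graph_order F" "distinct ijs" "set ijs = {..<L * R} \<times> {..<L * R}"
  shows "gadget F (L * R) L (cw L R al bad) (sel_set L R ` sels L R al bad) ijs"
proof
  show "1 \<le> L * R" using LR by simp
  fix X Y assume XY: "X \<subseteq> {..<L * R}" "Y \<subseteq> {..<L * R}"
  show "(\<Sum>i\<in>X. \<Sum>j\<in>Y. cc i j) \<le> int L" by (rule sel_set_cases(1)[OF XY])
  show "(\<Sum>i\<in>X. \<Sum>j\<in>Y. cc i j) = int L \<longleftrightarrow> X = Y \<and> X \<in> sel_set L R ` sels L R al bad"
    using sel_set_cases(2)[OF XY] sel_set_sum by auto
next
  fix Q
  have "(\<Sum>i<L * R. \<Sum>j<L * R. if Q i j then cc i j else 0) \<le> (\<Sum>i<L * R. \<Sum>j<L * R. if i = j then 1 else 0)"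
  proof (intro sum_mono)
    fix i j show "(if Q i j then cc i j else 0) \<le> (if i = j then 1 else 0)"
      using cw_le[of i j] by auto
  qed
  also have "\<dots> = int (L * R)" by (simp add: sum_diag)
  finally show "(\<Sum>i<L * R. \<Sum>j<L * R. if Q i j then cc i j else 0) \<le> int (L * R)" .
next
  show "- int (L * R) \<le> cc i j" for i j
    using of_nat_0_le_iff[of "L * R", where 'a = int] by (auto simp: cw_def simp del: of_nat_mult of_nat_0_le_iff)
qed (use assms LR sel_set_subset in auto)

lemma card_sel_sets: "card (sel_set L R ` sels L R al bad) = card (sels L R al bad)"
  by (rule card_image[OF inj_sel_set])

end

subsection \<open>Reading off the count\<close>

lemma drop_bin: "drop e (bin n) = bin (n div 2 ^ e)"
proof (induction e arbitrary: n)
  case (Suc e)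
  then show ?case
    by (cases "n = 0") (auto simp: bin_Cons div_mult2_eq)
qed simp

lemma bin_pow2: "bin (2 ^ d) = replicate d False @ [True]"
  by (induction d) (auto simp: bin_Cons)

lemma length_bin_le: "n < 2 ^ e \<Longrightarrow> length (bin n) \<le> e"
  using arg_cong[OF drop_bin[of e n], of length] by simp

lemma quotient_of_dyadic:
  fixes z :: rat
  assumes z: "z * 2 ^ d = of_int a"
  shows "\<exists>b\<le>d. snd (quotient_of z) = 2 ^ b"
proof -
  obtain p q where pq: "quotient_of z = (p, q)" by force
  then have q: "q > 0" "coprime p q" "z = of_int p / of_int q"
    by (auto intro: quotient_of_denom_pos quotient_of_coprime quotient_of_div)
  have "of_int p = z * of_int q" using q(1,3) by simp
  then have "of_int (p * 2 ^ d) = (z * 2 ^ d) * of_int q" by simp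
  then have "of_int (p * 2 ^ d) = (of_int (a * q) :: rat)" by (simp only: z of_int_mult)
  then have "p * 2 ^ d = a * q" using of_int_eq_iff by blast
  then have "q dvd p * 2 ^ d" by simp
  then have "q dvd 2 ^ d" using q(2) by (simp add: coprime_commute coprime_dvd_mult_right_iff)
  moreover obtain q' where q': "q = int q'" using q(1) by (metis zero_less_imp_eq_int)
  ultimately have "int q' dvd int (2 ^ d)" by simp
  then have "q' dvd 2 ^ d" by (simp only: int_dvd_int_iff)
  then obtain b where "b \<le> d" "q' = 2 ^ b" using divides_primepow_nat[of 2 q' d] by auto
  then have "b \<le> d" "q = 2 ^ b" using q' by simp_all
  then show ?thesis using pq by auto
qed

text \<open>In lowest terms \<open>z\<close> is \<open>p / 2 ^ b\<close>, so \<open>p\<close> is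
  \<open>N + r\<close> shifted by \<open>b + e\<close> places, and \<open>r < 1\<close> lies
  entirely in the bits dropped. As \<open>bin\<close> starts with the least significant bit,
  dropping is division by a power of two.\<close>

lemma extract_count:
  fixes z r :: rat
  assumes z: "z = (of_nat N + r) * 2 ^ e" "0 \<le> r" "r < 1" and d: "z * 2 ^ d = of_int a"
    and N: "N \<le> 2 ^ n"
  shows "\<exists>p b. quotient_of z = (int p, 2 ^ b) \<and> drop (b + e) (bin p) = bin N \<and>
    b \<le> d \<and> length (bin p) \<le> n + 1 + (b + e)"
proof -
  obtain b where b: "b \<le> d" "snd (quotient_of z) = 2 ^ b" using quotient_of_dyadic[OF d] by blast
  define p where "p = fst (quotient_of z)"
  have q: "quotient_of z = (p, 2 ^ b)" by (simp add: p_def b(2)[symmetric])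
  then have zp: "of_int p = (of_nat N + r) * 2 ^ (b + e)"
    using quotient_of_div[OF q] z(1) by (simp add: field_simps power_add)
  have "0 \<le> (of_int p :: rat)" unfolding zp using z(2) by simp
  then have p0: "0 \<le> p" by simp
  have "nat p div 2 ^ (b + e) = N"
  proof -
    have 1: "of_nat (N * 2 ^ (b + e)) \<le> (of_nat (nat p) :: rat)"
      using zp z(2) p0 by (simp add: algebra_simps)
    have "r * 2 ^ (b + e) < 1 * 2 ^ (b + e)" using z(3) by (intro mult_strict_right_mono) auto
    then have 2: "(of_nat (nat p) :: rat) < of_nat ((N + 1) * 2 ^ (b + e))"
      using zp p0 by (simp add: algebra_simps)
    have "N * 2 ^ (b + e) \<le> nat p" "nat p < (N + 1) * 2 ^ (b + e)"
      using 1 2 of_nat_le_iff of_nat_less_iff by blast+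
    then show ?thesis by (intro div_nat_eqI) (auto simp: algebra_simps)
  qed
  moreover from this have "drop (b + e) (bin (nat p)) = bin N" by (simp add: drop_bin)
  moreover have "length (bin N) \<le> n + 1"
  proof (rule length_bin_le)
    show "N < 2 ^ (n + 1)" using N by (simp add: less_le_trans[of _ "2 ^ n + 1"])
  qed
  ultimately have "length (bin (nat p)) - (b + e) \<le> n + 1" by (metis length_drop)
  then show ?thesis
    using q p0 b(1) \<open>drop (b + e) (bin (nat p)) = bin N\<close>
    by (intro exI[of _ "nat p"] exI[of _ b]) auto
qed

section \<open>Writing down the model\<close>

definition tE :: "nat \<Rightarrow> nat" where "tE B = B * (17 * B + 25) + 20 * B + 20"

definition emitr :: "nat \<Rightarrow> nat \<Rightarrow> cmd" where
  "emitr r c = copy r 8 9 ;; pushes 8 (un c) ;; emit_nat 8 9 10 2"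

definition tmp :: "store \<Rightarrow> bool" where
  "tmp s \<longleftrightarrow> s 3 = [] \<and> s 8 = [] \<and> s 9 = [] \<and> s 10 = []"

lemma run_emitr:
  assumes "tmp s" "s r = un v" "v + c \<le> B" "4 \<le> r" "r \<notin> {8, 9, 10}"
  shows "run (emitr r c) s (s(2 := rev (enc_nat (v + c)) @ s 2)) (tE B)"
proof -
  have 1: "run (copy r 8 9) s (s(8 := un v)) (17 * v + 3)"
    using assms by (intro run_weaken[OF run_copy]) (auto simp: tmp_def)
  have 2: "run (pushes 8 (un c)) (s(8 := un v)) (s(8 := un (v + c))) (3 * c)"
    by (intro run_weaken[OF run_pushes]) (auto simp: replicate_add[symmetric] add.commute)
  have 3: "run (emit_nat 8 9 10 2) (s(8 := un (v + c))) (s(2 := rev (enc_nat (v + c)) @ s 2)) (B * (17 * B + 25) + 4)"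
    using assms by (intro run_weaken[OF run_emit_nat[where x = "v + c" and B = B]]) (auto simp: tmp_def fun_eq_iff)
  show ?thesis
    unfolding emitr_def using run_Seq[OF 1 run_Seq[OF 2 3]] assms(3)
    by (elim run_weaken) (auto simp: tE_def)
qed

definition pos_cmd :: "nat \<Rightarrow> cmd" where
  "pos_cmd r = Push 2 False ;; emitr r 0"

lemma run_pos:
  assumes s: "tmp s" "s r = un x" "x \<le> B" "4 \<le> r" "r \<notin> {8, 9, 10}"
  shows "run (pos_cmd r) s (s(2 := rev (enc_int (int x)) @ s 2)) (tE B + 10)"
proof -
  have 1: "run (Push 2 False) s (s(2 := False # s 2)) 2"
    using s by (intro run_Push) (auto simp: tmp_def)
  have 2: "run (emitr r 0) (s(2 := False # s 2)) (s(2 := rev (enc_int (int x)) @ s 2)) (tE B)"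
    using s by (intro run_weaken[OF run_emitr[where v = x and B = B]]) (auto simp: tmp_def enc_int_def)
  show ?thesis unfolding pos_cmd_def using run_Seq[OF 1 2] by (elim run_weaken) auto
qed

text \<open>At vertex 0 only the weights \<open>s\<close>, 0 and \<open>- s * m\<close> occur. They
  are printed from registers 12 and 13; the three cases of \<open>q\<close> are meant as 1, 0 and
  -1.\<close>

definition weight_cmd :: "int \<Rightarrow> cmd" where
  "weight_cmd q = (if q = 1 then pos_cmd 12 else if q = 0 then pushes 2 [False, False]
     else Push 2 True ;; emitr 13 0)"

definition weight :: "nat \<Rightarrow> nat \<Rightarrow> int \<Rightarrow> int" where
  "weight x y q = (if q = 1 then int x else if q = 0 then 0 else - int y)"

lemma run_weight:
  assumes s: "tmp s" "s 12 = un x" "s 13 = un y" "x \<le> B" "y \<le> B" "0 < y"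
  shows "run (weight_cmd q) s (s(2 := rev (enc_int (weight x y q)) @ s 2)) (tE B + 10)"
proof -
  have 1: "run (pos_cmd 12) s (s(2 := rev (enc_int (int x)) @ s 2)) (tE B + 10)"
    using s by (intro run_pos) auto
  have 2: "run (emitr 13 0) (s(2 := True # s 2)) (s(2 := rev (enc_int (- int y)) @ s 2)) (tE B)"
    using s by (intro run_weaken[OF run_emitr[where v = y and B = B]]) (auto simp: tmp_def enc_int_def)
  have 2: "run (Push 2 True ;; emitr 13 0) s (s(2 := rev (enc_int (- int y)) @ s 2)) (2 + tE B + 1)"
    using s by (intro run_Seq[OF run_Push 2]) (auto simp: tmp_def)
  have 3: "run (pushes 2 [False, False]) s (s(2 := rev (enc_int 0) @ s 2)) (3 * 2)"
    using s by (intro run_weaken[OF run_pushes]) (auto simp: tmp_def enc_int_def enc_nat_def)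
  show ?thesis
    unfolding weight_cmd_def weight_def
    using 1 run_weaken[OF 2 refl, of "tE B + 10"] run_weaken[OF 3 refl, of "tE B + 10"]
    by auto
qed

text \<open>A countdown: after \<open>n\<close> pops the top bit is \<open>True\<close> exactly if
  \<open>n = x\<close>. The inner loop thus compares its index with \<open>l + off\<close> by a
  single test, and moving to the next \<open>l\<close> means pushing one
  \<open>False\<close>.\<close>

definition mask :: "nat \<Rightarrow> bool list" where
  "mask x = replicate x False @ [True]"

lemma drop_mask: "drop n (mask x) \<noteq> [] \<and> hd (drop n (mask x)) \<longleftrightarrow> n = x"
  by (auto simp: mask_def hd_append hd_drop_conv_nth nth_append)

lemma length_mask [simp]: "length (mask x) = Suc x"
  by (simp add: mask_def)

lemma mask_Suc: "False # mask x = mask (Suc x)"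
  by (simp add: mask_def)

definition drop1 :: "nat \<Rightarrow> cmd" where
  "drop1 r = If (NE r) (Pop r) Skip"

lemma run_drop1: "4 \<le> r \<Longrightarrow> run (drop1 r) s (s(r := tl (s r))) 2"
proof -
  assume r: "4 \<le> r"
  have "s(r := tl (s r)) = s" if "s r = []" using that by auto
  then have "run (drop1 r) s (s(r := tl (s r))) (1 + 1)"
    unfolding drop1_def using r
    by (intro run_If) (auto intro: run_weaken[OF run_Pop] run_weaken[OF run_Skip])
  then show ?thesis by (simp add: numeral_2_eq_2)
qed

lemma run_xfer':
  assumes "a \<noteq> b" "readable s a" "writable s b" "s a \<noteq> []"
  shows "run (xfer a b) s (s(a := tl (s a), b := hd (s a) # s b)) 5"
  using run_xfer[OF assms(1-3), of "hd (s a)" "tl (s a)"] assms(4) by simp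

lemmas run_steps = run_Seq run_clear run_Push run_pushes run_copy run_xfer' run_Pop run_pour run_drop1

text \<open>The code of a cell is data, while the table of allowed tiles is part of the program
  text; the dispatch turns a code into a choice of program.\<close>

definition code8 :: "(nat \<Rightarrow> cmd) \<Rightarrow> cmd" where
  "code8 f = If (TT 18) (If (TT 19) (If (TT 20) (f 7) (f 3)) (If (TT 20) (f 5) (f 1)))
     (If (TT 19) (If (TT 20) (f 6) (f 2)) (If (TT 20) (f 4) (f 0)))"

definition cbits :: "nat \<Rightarrow> bool list" where
  "cbits c = [odd c, odd (c div 2), odd (c div 4)]"

lemma run_code8:
  assumes c: "c < 8" and s: "s 18 = [odd c]" "s 19 = [odd (c div 2)]" "s 20 = [odd (c div 4)]"
    and f: "run (f c) s s' t"
  shows "run (code8 f) s s' (t + 3)"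
proof -
  consider "c = 0" | "c = 1" | "c = 2" | "c = 3" | "c = 4" | "c = 5" | "c = 6" | "c = 7"
    using c by linarith
  then have "run (code8 f) s s' (((t + 1) + 1) + 1)"
    unfolding code8_def using s f by cases (intro run_If; simp)+
  then show ?thesis by (simp add: numeral_3_eq_3)
qed

text \<open>\<open>F\<close>, \<open>R\<close> and the tables \<open>A\<close>, \<open>C\<close> are
  constants of the program. Registers: 4 and 5 input and its length, 6 and 7 current vertices
  \<open>u\<close> and \<open>v\<close>, 8 to 10 scratch, 11 to 13 weights, 14 number of vertices,
  15 exponent of the shift, 16 number of cells, 17 stack of cell codes, 18 to 20 current code, 21 to
  25 masks, 26 to 30 their working copies, 31 loop counter, 32 to 35 \<open>G - 1\<close>, witness
  length, number of blanks, \<open>G - 2\<close>.\<close>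

locale writer =
  fixes F :: graph and R :: nat and A :: "nat \<Rightarrow> nat \<Rightarrow> bool" and C :: "nat \<Rightarrow> nat \<Rightarrow> nat \<Rightarrow> bool"
  assumes k3: "3 \<le> graph_order F"
begin

abbreviation "k \<equiv> graph_order F"

text \<open>The first bit marks a further entry of the feature list, the second is the tag of
  \<open>Indicator\<close>; the later single bits mark entries of the tuple.\<close>

definition pre :: "nat \<Rightarrow> bool list" where
  "pre z = [True, True] @ enc_graph F @ [True] @ enc_nat z @ [True]"

definition post :: "bool list" where "post = enc_list enc_nat [2..<k - 1]"

definition feat :: "nat \<Rightarrow> nat \<Rightarrow> nat \<Rightarrow> cmd \<Rightarrow> cmd" where
  "feat z x y wc = pushes 2 (pre z) ;; emitr 6 (2 * x) ;; Push 2 True ;; emitr 7 (2 * y) ;; pushes 2 post ;; wc"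

definition enc_wf :: "feature \<times> int \<Rightarrow> bool list" where
  "enc_wf = (\<lambda>(f, w). enc_feature f @ enc_int w)"

definition tF :: "nat \<Rightarrow> nat" where
  "tF B = 3 * length (pre 0) + 3 * length (pre 1) + 3 * length post + 3 * tE B + 30"

lemma run_feat:
  assumes s: "tmp s" "s 6 = un (uvert k i)" "s 7 = un (vvert k j)"
    and B: "uvert k i + 2 * x \<le> B" "vvert k j + 2 * y \<le> B" and z: "z = 0 \<or> z = 1"
    and wc: "\<And>xs. run wc (s(2 := xs)) (s(2 := rev (enc_int w) @ xs)) (tE B + 10)"
  shows "run (feat z x y wc) s
    (s(2 := rev (True # enc_wf (Indicator F (tup k z (i + x) (j + y)), w)) @ s 2)) (tF B)"
proof -
  note ns = assms(1)[unfolded tmp_def]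
  let ?s1 = "s(2 := rev (pre z) @ s 2)"
  let ?u = "uvert k i + 2 * x" and ?v = "vvert k j + 2 * y"
  let ?s2 = "s(2 := rev (enc_nat ?u) @ rev (pre z) @ s 2)"
  let ?s3 = "s(2 := True # rev (enc_nat ?u) @ rev (pre z) @ s 2)"
  let ?s4 = "s(2 := rev (enc_nat ?v) @ True # rev (enc_nat ?u) @ rev (pre z) @ s 2)"
  let ?s5 = "s(2 := rev post @ rev (enc_nat ?v) @ True # rev (enc_nat ?u) @ rev (pre z) @ s 2)"
  have 1: "run (pushes 2 (pre z)) s ?s1 (3 * length (pre z))"
    using ns by (intro run_pushes) auto
  have 2: "run (emitr 6 (2 * x)) ?s1 ?s2 (tE B)"
    using s B by (intro run_weaken[OF run_emitr[where v = "uvert k i" and B = B]]) (auto simp: tmp_def)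
  have 3: "run (Push 2 True) ?s2 ?s3 2"
    using ns by (intro run_weaken[OF run_Push]) auto
  have 4: "run (emitr 7 (2 * y)) ?s3 ?s4 (tE B)"
    using s B by (intro run_weaken[OF run_emitr[where v = "vvert k j" and B = B]]) (auto simp: tmp_def)
  have 5: "run (pushes 2 post) ?s4 ?s5 (3 * length post)"
    using ns by (intro run_weaken[OF run_pushes]) auto
  have e: "?u = uvert k (i + x)" "?v = vvert k (j + y)" by (auto simp: uvert_def vvert_def)
  have "rev (enc_int w) @ rev post @ rev (enc_nat ?v) @ True # rev (enc_nat ?u) @ rev (pre z) @ s 2 =
      rev (True # enc_wf (Indicator F (tup k z (i + x) (j + y)), w)) @ s 2"
    by (simp add: enc_wf_def pre_def post_def tup_def enc_list_def e)
  then have 6: "run wc ?s5 (s(2 := rev (True # enc_wf (Indicator F (tup k z (i + x) (j + y)), w)) @ s 2)) (tE B + 10)"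
    using wc by metis
  have "3 * length (pre z) \<le> 3 * length (pre 0) + 3 * length (pre 1)" using z by auto
  then show ?thesis
    unfolding feat_def using run_Seq[OF 1 run_Seq[OF 2 run_Seq[OF 3 run_Seq[OF 4 run_Seq[OF 5 6]]]]]
    by (elim run_weaken) (auto simp: tF_def)
qed

abbreviation "prs \<equiv> List.product [0..<R] [0..<R]"

text \<open>All features for one pair of cells. \<open>R\<close> is constant, so this is
  straight-line code that depends on the cells only through registers 6 and 7 and the choice of
  \<open>q\<close>.\<close>

definition blk :: "(nat \<Rightarrow> nat \<Rightarrow> int) \<Rightarrow> cmd" where
  "blk q = seqs (map (\<lambda>(x, y). feat 1 x y (pos_cmd 11) ;; feat 0 x y (weight_cmd (q x y))) prs)"

definition wfeats :: "nat \<Rightarrow> nat \<Rightarrow> nat \<Rightarrow> (nat \<Rightarrow> nat \<Rightarrow> int) \<Rightarrow> nat \<Rightarrow> nat \<Rightarrow> (feature \<times> int) list" where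
  "wfeats W x' y' q i j = concat (map (\<lambda>(x, y). [(Indicator F (tup k 1 (i + x) (j + y)), int W),
     (Indicator F (tup k 0 (i + x) (j + y)), weight x' y' (q x y))]) prs)"

definition enc_wfs :: "(feature \<times> int) list \<Rightarrow> bool list" where
  "enc_wfs fs = concat (map (\<lambda>f. True # enc_wf f) fs)"

lemma enc_wfs_append [simp]: "enc_wfs (xs @ ys) = enc_wfs xs @ enc_wfs ys" "enc_wfs [] = []"
  by (auto simp: enc_wfs_def)

definition tB :: "nat \<Rightarrow> nat" where "tB B = R * R * (2 * tF B + 2)"

definition wconsts :: "nat \<Rightarrow> nat \<Rightarrow> nat \<Rightarrow> store \<Rightarrow> bool" where
  "wconsts W x y s \<longleftrightarrow> tmp s \<and> s 11 = un W \<and> s 12 = un x \<and> s 13 = un y"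

lemma run_blk:
  assumes s: "wconsts W x' y' s" "s 6 = un (uvert k i)" "s 7 = un (vvert k j)"
    and B: "uvert k i + 2 * R \<le> B" "vvert k j + 2 * R \<le> B" "W \<le> B" "x' \<le> B" "y' \<le> B" "0 < y'"
  shows "run (blk q) s (s(2 := rev (enc_wfs (wfeats W x' y' q i j)) @ s 2)) (tB B)"
proof -
  let ?f = "\<lambda>(x, y). [(Indicator F (tup k 1 (i + x) (j + y)), int W),
     (Indicator F (tup k 0 (i + x) (j + y)), weight x' y' (q x y))]"
  let ?cs = "map (\<lambda>(x, y). feat 1 x y (pos_cmd 11) ;; feat 0 x y (weight_cmd (q x y))) prs"
  define S where "S n = s(2 := rev (enc_wfs (concat (map ?f (take n prs)))) @ s 2)" for n
  have "run (seqs ?cs) (S 0) (S (length ?cs)) (length ?cs * ((2 * tF B + 1) + 1))"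
  proof (rule run_seqs)
    fix n assume "n < length ?cs"
    then have n: "n < length prs" by simp
    obtain x y where xy: "prs ! n = (x, y)" by force
    then have "(x, y) \<in> set prs" using n by (metis nth_mem)
    then have lt: "x < R" "y < R" by auto
    let ?s1 = "s(2 := rev (True # enc_wf (Indicator F (tup k 1 (i + x) (j + y)), int W)) @ S n 2)"
    have 1: "run (feat 1 x y (pos_cmd 11)) (S n) ?s1 (tF B)"
    proof (rule run_weaken[OF run_feat[where i = i and j = j and w = "int W" and B = B]])
      fix xs
      show "run (pos_cmd 11) ((S n)(2 := xs)) ((S n)(2 := rev (enc_int (int W)) @ xs)) (tE B + 10)"
        using s B by (intro run_weaken[OF run_pos[where x = W and B = B]]) (auto simp: S_def wconsts_def tmp_def)
    qed (use s B lt in \<open>auto simp: S_def wconsts_def tmp_def\<close>)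
    have 2: "run (feat 0 x y (weight_cmd (q x y))) ?s1 (S (Suc n)) (tF B)"
    proof (rule run_weaken[OF run_feat[where i = i and j = j and w = "weight x' y' (q x y)" and B = B]])
      fix xs
      show "run (weight_cmd (q x y)) (?s1(2 := xs)) (?s1(2 := rev (enc_int (weight x' y' (q x y))) @ xs)) (tE B + 10)"
        using s B by (intro run_weaken[OF run_weight[where x = x' and y = y']]) (auto simp: S_def wconsts_def tmp_def)
    qed (use s B lt n xy in \<open>auto simp: S_def wconsts_def tmp_def take_Suc_conv_app_nth enc_wfs_def\<close>)
    show "run (?cs ! n) (S n) (S (Suc n)) (2 * tF B + 1)"
      using run_Seq[OF 1 2] n xy by (simp add: mult_2)
  qed
  moreover have "S 0 = s" by (simp add: S_def)
  ultimately show ?thesis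
    unfolding blk_def wfeats_def using run_weaken[of "seqs ?cs" s "S (length ?cs)"]
    by (simp add: S_def tB_def algebra_simps)
qed

definition qsame :: "nat \<Rightarrow> nat \<Rightarrow> nat \<Rightarrow> int" where
  "qsame u x y = (if x = y then if A u x then 1 else 0 else - 1)"

definition qoff :: "nat \<Rightarrow> nat \<Rightarrow> nat \<Rightarrow> int" where
  "qoff d x y = (if C d x y then 0 else - 1)"

definition cell :: cmd where
  "cell = If (TT 26) (code8 (\<lambda>u. blk (qsame u))) (If (TT 27) (blk (qoff 1)) (If (TT 28) (blk (qoff 2))
     (If (TT 29) (blk (qoff 3)) (If (TT 30) (blk (qoff 4)) (blk (\<lambda>_ _. 0))))))"

definition qcell :: "(nat \<Rightarrow> nat) \<Rightarrow> nat \<Rightarrow> nat \<Rightarrow> nat \<Rightarrow> nat \<Rightarrow> nat \<Rightarrow> int" where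
  "qcell off u l l' = (if l' = l then qsame u else if l' = l + off 1 then qoff 1
     else if l' = l + off 2 then qoff 2 else if l' = l + off 3 then qoff 3
     else if l' = l + off 4 then qoff 4 else (\<lambda>_ _. 0))"

definition inner :: cmd where
  "inner = cell ;; Pop 31 ;; drop1 26 ;; drop1 27 ;; drop1 28 ;; drop1 29 ;; drop1 30 ;; pushes 7 (un (2 * R))"

lemma run_cell:
  assumes s: "wconsts W x' y' s" "s 6 = un (uvert k i)" "s 7 = un (vvert k j)"
    and B: "uvert k i + 2 * R \<le> B" "vvert k j + 2 * R \<le> B" "W \<le> B" "x' \<le> B" "y' \<le> B" "0 < y'"
    and m: "s 26 = drop l' (mask l)" "s 27 = drop l' (mask (l + off 1))" "s 28 = drop l' (mask (l + off 2))"
      "s 29 = drop l' (mask (l + off 3))" "s 30 = drop l' (mask (l + off 4))"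
    and u: "u < 8" "s 18 = [odd u]" "s 19 = [odd (u div 2)]" "s 20 = [odd (u div 4)]"
  shows "run cell s (s(2 := rev (enc_wfs (wfeats W x' y' (qcell off u l l') i j)) @ s 2)) (6 * tB B + 8)"
proof -
  note b = run_blk[OF s B]
  have h: "holds (TT 26) s \<longleftrightarrow> l' = l" "holds (TT 27) s \<longleftrightarrow> l' = l + off 1" "holds (TT 28) s \<longleftrightarrow> l' = l + off 2"
    "holds (TT 29) s \<longleftrightarrow> l' = l + off 3" "holds (TT 30) s \<longleftrightarrow> l' = l + off 4"
    using m drop_mask by simp_all
  define p where "p q = s(2 := rev (enc_wfs (wfeats W x' y' q i j)) @ s 2)" for q
  have b': "run (blk q) s (p q) (tB B)" for q
    unfolding p_def by (rule b)
  have c8: "run (code8 (\<lambda>u. blk (qsame u))) s (p (qsame u)) (tB B + 3)"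
    by (rule run_code8[OF u b'])
  have I: "run (If (TT r) c d) s (p (if P then q1 else q2)) (t1 + t2 + 1)"
    if "4 \<le> r" "holds (TT r) s \<longleftrightarrow> P" "run c s (p q1) t1" "run d s (p q2) t2" for r c d P q1 q2 t1 t2
  proof -
    have 1: "run c s (p q1) (t1 + t2)" "run d s (p q2) (t1 + t2)"
      using that(3,4) by (auto elim!: run_weaken)
    show ?thesis
      using that(1,2) run_If_true[of s "TT r", OF _ _ 1(1)] run_If_false[of s "TT r", OF _ _ 1(2)] by (cases P) simp_all
  qed
  have "run cell s (p (qcell off u l l')) (tB B + 3 + (tB B + (tB B + (tB B + (tB B + tB B + 1) + 1) + 1) + 1) + 1)"
    unfolding cell_def qcell_def by (intro I c8 b' h) simp_all
  then show ?thesis unfolding p_def by (elim run_weaken) simp_all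
qed

definition tI :: "nat \<Rightarrow> nat" where "tI B = 6 * tB B + 6 * R + 40"

lemma run_inner_loop:
  assumes s: "wconsts W x' y' s" "s 6 = un (uvert k i)" "s 7 = un k" "s 31 = un L"
    and B: "uvert k i + 2 * R \<le> B" "vvert k (L * R) + 2 * R \<le> B" "W \<le> B" "x' \<le> B" "y' \<le> B" "0 < y'"
    and m: "s 26 = mask l" "s 27 = mask (l + off 1)" "s 28 = mask (l + off 2)"
      "s 29 = mask (l + off 3)" "s 30 = mask (l + off 4)"
    and u: "u < 8" "s 18 = [odd u]" "s 19 = [odd (u div 2)]" "s 20 = [odd (u div 4)]"
  shows "run (While (NE 31) inner) s (s(31 := [], 26 := drop L (mask l), 27 := drop L (mask (l + off 1)),
      28 := drop L (mask (l + off 2)), 29 := drop L (mask (l + off 3)), 30 := drop L (mask (l + off 4)),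
      7 := un (vvert k (L * R)),
      2 := rev (enc_wfs (concat (map (\<lambda>l'. wfeats W x' y' (qcell off u l l') i (l' * R)) [0..<L]))) @ s 2))
    (L * (tI B + 2) + 1)"
proof -
  define S where "S n = s(31 := un (L - n), 26 := drop n (mask l), 27 := drop n (mask (l + off 1)),
      28 := drop n (mask (l + off 2)), 29 := drop n (mask (l + off 3)), 30 := drop n (mask (l + off 4)),
      7 := un (vvert k (n * R)),
      2 := rev (enc_wfs (concat (map (\<lambda>l'. wfeats W x' y' (qcell off u l l') i (l' * R)) [0..<n]))) @ s 2)" for n
  have "run (While (NE 31) inner) (S 0) (S L) (L * (tI B + 2) + 1)"
  proof (rule run_While[where S = S])
    fix n assume n: "n < L"
    let ?s1 = "(S n)(2 := rev (enc_wfs (wfeats W x' y' (qcell off u l n) i (n * R))) @ S n 2)"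
    have "n * R \<le> L * R" using n by (intro mult_le_mono1) simp
    then have "vvert k (n * R) + 2 * R \<le> B" using B(2) unfolding vvert_def by linarith
    then have 1: "run cell (S n) ?s1 (6 * tB B + 8)"
      using s B u by (intro run_cell) (auto simp: S_def wconsts_def tmp_def)
    have L: "L - n = Suc (L - Suc n)" using n by simp
    have 2: "run (Pop 31 ;; drop1 26 ;; drop1 27 ;; drop1 28 ;; drop1 29 ;; drop1 30 ;; pushes 7 (un (2 * R)))
       ?s1 (S (Suc n)) (6 * R + 20)"
      apply (rule run_weaken)
        apply (rule run_steps | (simp add: S_def L))+
      apply (simp_all add: fun_eq_iff tl_drop drop_Suc vvert_def replicate_add[symmetric] algebra_simps)
      done
    show "run inner (S n) (S (Suc n)) (tI B)"
      unfolding inner_def using run_Seq[OF 1 2] by (elim run_weaken) (auto simp: tI_def)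
  qed (auto simp: S_def)
  moreover have "S 0 = s" using s m by (auto simp: S_def vvert_def fun_eq_iff)
  ultimately show ?thesis by (simp add: S_def)
qed

definition load :: cmd where
  "load = (xfer 17 18 ;; xfer 17 19 ;; xfer 17 20) ;; copy 21 26 8 ;; copy 22 27 8 ;; copy 23 28 8 ;;
     copy 24 29 8 ;; copy 25 30 8 ;; copy 16 31 8 ;; pushes 7 (un k)"

definition unload :: cmd where
  "unload = clear 26 ;; clear 27 ;; clear 28 ;; clear 29 ;; clear 30 ;; clear 7 ;; clear 18 ;; clear 19 ;; clear 20 ;;
     Push 21 False ;; Push 22 False ;; Push 23 False ;; Push 24 False ;; Push 25 False ;; pushes 6 (un (2 * R))"

lemma run_load:
  assumes "s 17 = [a, b, c] @ xs" "s 18 = []" "s 19 = []" "s 20 = []" "s 26 = []" "s 27 = []" "s 28 = []" "s 29 = []"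
    "s 30 = []" "s 31 = []" "s 7 = []" "s 8 = []"
    and B: "length (s 21) \<le> B" "length (s 22) \<le> B" "length (s 23) \<le> B" "length (s 24) \<le> B" "length (s 25) \<le> B"
      "length (s 16) \<le> B"
  shows "run load s (s(17 := xs, 18 := [a], 19 := [b], 20 := [c], 26 := s 21, 27 := s 22, 28 := s 23, 29 := s 24,
      30 := s 25, 31 := s 16, 7 := un k)) (6 * (17 * B + 3) + 3 * k + 30)"
proof -
  have 1: "run (xfer 17 18 ;; xfer 17 19 ;; xfer 17 20) s (s(17 := xs, 18 := [a], 19 := [b], 20 := [c])) (5 + (5 + 5 + 1) + 1)"
    apply (rule run_weaken)
      apply (rule run_Seq run_xfer' | (simp add: assms fun_eq_iff))+
    done
  have 2: "run (copy x y 8) t (t(y := t x)) (17 * B + 3)" if "t y = []" "t 8 = []" "length (t x) \<le> B"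
    "4 \<le> x" "4 \<le> y" "x \<noteq> y" "x \<noteq> 8" "y \<noteq> 8" for x y t
    using that by (intro run_weaken[OF run_copy]) auto
  have 3: "run (pushes 7 (un k)) t (t(7 := un k)) (3 * k)" if "t 7 = []" for t
    using that by (intro run_weaken[OF run_pushes]) auto
  let ?s = "s(17 := xs, 18 := [a], 19 := [b], 20 := [c])"
  have "run (copy 21 26 8 ;; copy 22 27 8 ;; copy 23 28 8 ;; copy 24 29 8 ;; copy 25 30 8 ;; copy 16 31 8 ;; pushes 7 (un k)) ?s
     (?s(26 := s 21, 27 := s 22, 28 := s 23, 29 := s 24, 30 := s 25, 31 := s 16, 7 := un k))
     ((17 * B + 3) + ((17 * B + 3) + ((17 * B + 3) + ((17 * B + 3) + ((17 * B + 3) + ((17 * B + 3) + 3 * k + 1) + 1) + 1) + 1) + 1) + 1)"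
    apply (rule run_weaken)
    apply (rule run_Seq 2 3 | (simp add: assms))+
    done
  from run_Seq[OF 1 this] show ?thesis
    unfolding load_def by (elim run_weaken) auto
qed

lemma run_unload:
  assumes B: "length (s 26) \<le> B" "length (s 27) \<le> B" "length (s 28) \<le> B" "length (s 29) \<le> B" "length (s 30) \<le> B"
      "length (s 7) \<le> B" "length (s 18) \<le> B" "length (s 19) \<le> B" "length (s 20) \<le> B"
  shows "run unload s (s(26 := [], 27 := [], 28 := [], 29 := [], 30 := [], 7 := [], 18 := [], 19 := [], 20 := [],
      21 := False # s 21, 22 := False # s 22, 23 := False # s 23, 24 := False # s 24, 25 := False # s 25,
      6 := un (2 * R) @ s 6)) (27 * B + 6 * R + 100)"
proof -
  have 1: "run (clear a) t (t(a := [])) (3 * B + 1)" if "4 \<le> a" "length (t a) \<le> B" for a t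
    using that by (intro run_weaken[OF run_clear]) auto
  show ?thesis
    unfolding unload_def
    apply (rule run_weaken)
      apply (rule run_Seq 1 run_Push run_pushes | (simp add: assms))+
    done
qed

definition outer :: cmd where
  "outer = load ;; While (NE 31) inner ;; unload"

definition tO :: "nat \<Rightarrow> nat" where
  "tO B = B * (tI B + 2) + 200 * B + 6 * R + 3 * k + 300"

abbreviation encU :: "nat list \<Rightarrow> bool list" where "encU us \<equiv> concat (map cbits us)"

definition row_feats :: "nat \<Rightarrow> nat \<Rightarrow> nat \<Rightarrow> (nat \<Rightarrow> nat) \<Rightarrow> nat list \<Rightarrow> nat \<Rightarrow> nat \<Rightarrow> (feature \<times> int) list" where
  "row_feats W x' y' off us L l =
     concat (map (\<lambda>l'. wfeats W x' y' (qcell off (us ! l) l l') (l * R) (l' * R)) [0..<L])"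

text \<open>Registers above 30 and register 15 are listed as preserved because reading off the
  answer later needs the exponent in 15 and empty registers 40 to 42.\<close>

lemma run_outer_loop:
  assumes s: "wconsts W x' y' s" "s 6 = un (uvert k 0)" "s 16 = un L" "s 17 = encU us"
    and z: "s 7 = []" "s 18 = []" "s 19 = []" "s 20 = []" "s 26 = []" "s 27 = []" "s 28 = []" "s 29 = []"
      "s 30 = []" "s 31 = []"
    and us: "length us = L" "set us \<subseteq> {..<8}"
    and B: "uvert k (L * R) + 2 * R \<le> B" "vvert k (L * R) + 2 * R \<le> B" "W \<le> B" "x' \<le> B" "y' \<le> B" "0 < y'" "L \<le> B"
      "L + off 1 < B" "L + off 2 < B" "L + off 3 < B" "L + off 4 < B"
    and m: "s 21 = mask 0" "s 22 = mask (off 1)" "s 23 = mask (off 2)" "s 24 = mask (off 3)" "s 25 = mask (off 4)"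
  shows "\<exists>s'. run (While (NE 17) outer) s s' (L * (tO B + 2) + 1) \<and> s' 3 = [] \<and>
    s' 2 = rev (enc_wfs (concat (map (row_feats W x' y' off us L) [0..<L]))) @ s 2 \<and>
    (\<forall>j. j < 2 \<or> 26 < j \<or> j = 15 \<longrightarrow> s' j = s j)"
proof -
  define S where "S n = s(17 := encU (drop n us), 21 := mask n, 22 := mask (n + off 1), 23 := mask (n + off 2),
     24 := mask (n + off 3), 25 := mask (n + off 4), 6 := un (uvert k (n * R)),
     2 := rev (enc_wfs (concat (map (row_feats W x' y' off us L) [0..<n]))) @ s 2)" for n
  have "run (While (NE 17) outer) (S 0) (S L) (L * (tO B + 2) + 1)"
  proof (rule run_While[where S = S])
    fix n assume n: "n < L"
    define u where "u = us ! n"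
    have u: "u < 8" "drop n us = u # drop (Suc n) us"
      using n us nth_mem[of n us] by (auto simp: u_def Cons_nth_drop_Suc simp del: nth_mem)
    have nR: "n * R \<le> L * R" using n by (intro mult_le_mono1) simp
    let ?s1 = "(S n)(17 := encU (drop (Suc n) us), 18 := [odd u], 19 := [odd (u div 2)], 20 := [odd (u div 4)],
      26 := mask n, 27 := mask (n + off 1), 28 := mask (n + off 2), 29 := mask (n + off 3), 30 := mask (n + off 4),
      31 := un L, 7 := un k)"
    have 1: "run load (S n) ?s1 (6 * (17 * B + 3) + 3 * k + 30)"
    proof (rule run_weaken[OF run_load[where a = "odd u" and b = "odd (u div 2)" and c = "odd (u div 4)"
          and xs = "encU (drop (Suc n) us)" and B = B]])
      show "S n 17 = [odd u, odd (u div 2), odd (u div 4)] @ encU (drop (Suc n) us)"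
        by (simp add: S_def u cbits_def)
    qed (use s z B n in \<open>simp_all add: S_def wconsts_def tmp_def\<close>)
    let ?s2 = "?s1(31 := [], 26 := drop L (mask n), 27 := drop L (mask (n + off 1)),
      28 := drop L (mask (n + off 2)), 29 := drop L (mask (n + off 3)), 30 := drop L (mask (n + off 4)),
      7 := un (vvert k (L * R)), 2 := rev (enc_wfs (row_feats W x' y' off us L n)) @ S n 2)"
    have 2: "run (While (NE 31) inner) ?s1 ?s2 (L * (tI B + 2) + 1)"
    proof (rule run_weaken[OF run_inner_loop[where i = "n * R" and L = L and l = n and off = off and u = u and B = B]])
      show "uvert k (n * R) + 2 * R \<le> B" using B(1) nR unfolding uvert_def by linarith
    qed (use s B u in \<open>auto simp: S_def wconsts_def tmp_def row_feats_def u_def\<close>)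
    have "1 \<le> B" using B(7) n by simp
    have e: "un (2 * R) @ un (uvert k (n * R)) = un (uvert k (Suc n * R))"
      by (simp add: uvert_def replicate_add[symmetric])
    have 3: "run unload ?s2 (S (Suc n)) (27 * B + 6 * R + 100)"
    proof (rule run_weaken[OF run_unload[where B = B]])
      show "?s2(26 := [], 27 := [], 28 := [], 29 := [], 30 := [], 7 := [], 18 := [], 19 := [], 20 := [],
          21 := False # ?s2 21, 22 := False # ?s2 22, 23 := False # ?s2 23, 24 := False # ?s2 24,
          25 := False # ?s2 25, 6 := un (2 * R) @ ?s2 6) = S (Suc n)"
        using z by (simp add: S_def fun_eq_iff mask_Suc e)
    qed (use B n \<open>1 \<le> B\<close> in simp_all)
    have "L * (tI B + 2) \<le> B * (tI B + 2)" using B(7) by (rule mult_le_mono1)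
    then show "run outer (S n) (S (Suc n)) (tO B)"
      unfolding outer_def using run_Seq[OF 1 run_Seq[OF 2 3]] by (elim run_weaken) (auto simp: tO_def)
  qed (use us in \<open>auto simp: S_def cbits_def neq_Nil_conv Cons_nth_drop_Suc[symmetric]\<close>)
  moreover have "S 0 = s" using s m us by (auto simp: S_def fun_eq_iff)
  moreover have "S L 3 = []" using s by (simp add: S_def wconsts_def tmp_def)
  moreover have "S L 2 = rev (enc_wfs (concat (map (row_feats W x' y' off us L) [0..<L]))) @ s 2"
    by (simp add: S_def)
  moreover have "\<forall>j. j < 2 \<or> 26 < j \<or> j = 15 \<longrightarrow> S L j = s j" by (auto simp: S_def)
  ultimately show ?thesis by metis
qed

section \<open>Laying out the masks and the cell codes\<close>

definition times :: "nat \<Rightarrow> cmd \<Rightarrow> cmd" where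
  "times r c = copy r 9 8 ;; While (NE 9) (Pop 9 ;; c)"

lemma run_times:
  assumes "4 \<le> r" "4 \<le> j" "r \<notin> {8, 9}" "j \<notin> {8, 9}" "s r = un v" "s 8 = []" "s 9 = []"
  shows "run (times r (pushes j bs)) s (s(j := concat (replicate v (rev bs)) @ s j)) (17 * v + v * (3 * length bs + 4) + 10)"
proof -
  define S where "S i = s(9 := un (v - i), j := concat (replicate i (rev bs)) @ s j)" for i
  have 1: "run (copy r 9 8) s (S 0) (17 * v + 3)"
    using assms by (intro run_weaken[OF run_copy]) (auto simp: S_def)
  have "run (While (NE 9) (Pop 9 ;; pushes j bs)) (S 0) (S v) (v * ((3 * length bs + 2) + 2) + 1)"
  proof (rule run_While[where S = S])
    fix i assume i: "i < v"
    have l: "v - i = Suc (v - Suc i)" using i by simp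
    show "run (Pop 9 ;; pushes j bs) (S i) (S (Suc i)) (3 * length bs + 2)"
      apply (rule run_weaken)
        apply (rule run_steps | (use assms in \<open>simp add: S_def l fun_eq_iff\<close>))+
      done
  qed (use assms in \<open>auto simp: S_def\<close>)
  from run_Seq[OF 1 this] show ?thesis
    unfolding times_def using assms by (elim run_weaken) (auto simp: S_def algebra_simps)
qed

text \<open>Register 32 holds \<open>G - 1\<close>; the masks stand for the index differences
  \<open>0\<close>, \<open>1\<close>, \<open>G - 1\<close>, \<open>G\<close> and
  \<open>G + 1\<close>.\<close>

definition build_masks :: cmd where
  "build_masks = Push 21 True ;; pushes 22 [True, False] ;; Push 23 True ;; times 32 (pushes 23 [False]) ;;
     Push 24 True ;; times 32 (pushes 24 [False]) ;; Push 24 False ;;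
     Push 25 True ;; times 32 (pushes 25 [False]) ;; pushes 25 [False, False] ;; pushes 6 (un (k - 1))"

lemma concat_replicate_singleton: "concat (replicate v [x]) = replicate v x"
  by (induction v) auto

lemma run_build_masks:
  assumes "s 32 = un g" "s 8 = []" "s 9 = []" "s 21 = []" "s 22 = []" "s 23 = []" "s 24 = []" "s 25 = []" "s 6 = []"
  shows "run build_masks s (s(21 := mask 0, 22 := mask 1, 23 := mask g, 24 := mask (g + 1), 25 := mask (g + 2),
     6 := un (uvert k 0))) (80 * g + 3 * k + 100)"
proof -
  have T: "run (times 32 (pushes j [False])) t (t(j := replicate g False @ t j)) (24 * g + 10)"
    if "t 32 = un g" "t 8 = []" "t 9 = []" "4 \<le> j" "j \<noteq> 8" "j \<noteq> 9" "j \<noteq> 32" for j t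
    using that by (intro run_weaken[OF run_times[where v = g]]) (auto simp: concat_replicate_singleton)
  show ?thesis
    unfolding build_masks_def
    apply (rule run_weaken)
      apply (rule run_Seq run_Push run_pushes T |
        (simp add: assms fun_eq_iff mask_def uvert_def replicate_append_same))+
    done
qed

definition pushcode :: "nat \<Rightarrow> cmd" where "pushcode c = pushes 17 (rev (cbits c))"

text \<open>Register 17 is a stack, so the codes are pushed from the last cell of the grid back to
  the first. Registers 32 and 35 give \<open>G - 1\<close> and \<open>G - 2\<close>
  repetitions.\<close>

definition build_rows :: cmd where
  "build_rows = pushcode 7 ;; times 35 (pushcode 2) ;; pushcode 0 ;; copy 35 31 8 ;;
     While (NE 31) (Pop 31 ;; times 32 (pushcode 1) ;; pushcode 0)"

definition build_first :: cmd where
  "build_first = times 34 (pushcode 6) ;; times 33 (pushcode 5) ;; pushcode 3 ;;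
     While (NE 4) (If (TT 4) (pushcode 4) (pushcode 3) ;; Pop 4 ;; pushcode 4) ;; pushcode 0"

lemma run_pushcode: "run (pushcode c) s (s(17 := cbits c @ s 17)) 9"
  unfolding pushcode_def by (rule run_weaken[OF run_pushes]) (auto simp: cbits_def)

lemma run_times_pushcode:
  assumes "4 \<le> r" "r \<notin> {8, 9}" "s r = un v" "s 8 = []" "s 9 = []"
  shows "run (times r (pushcode c)) s (s(17 := encU (replicate v c) @ s 17)) (30 * v + 10)"
  unfolding pushcode_def using assms
  by (intro run_weaken[OF run_times[where v = v]]) (auto simp: cbits_def)

lemma run_build_rows:
  assumes "s 32 = un g" "s 35 = un h" "s 8 = []" "s 9 = []" "s 17 = []" "s 31 = []"
  shows "run build_rows s (s(17 := encU (concat (replicate h (0 # replicate g 1)) @ 0 # replicate h 2 @ [7])))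
    (h * (30 * g + 30) + 50 * h + 60)"
proof -
  define S where "S i = s(31 := un (h - i),
     17 := encU (concat (replicate i (0 # replicate g 1)) @ 0 # replicate h 2 @ [7]))" for i
  have "run (While (NE 31) (Pop 31 ;; times 32 (pushcode 1) ;; pushcode 0)) (S 0) (S h) (h * ((30 * g + 28) + 2) + 1)"
  proof (rule run_While[where S = S])
    fix i assume i: "i < h"
    have l: "h - i = Suc (h - Suc i)" using i by simp
    have T: "run (times 32 (pushcode 1)) t (t(17 := encU (replicate g 1) @ t 17)) (30 * g + 10)"
      if "t 32 = un g" "t 8 = []" "t 9 = []" for t
      using that by (intro run_times_pushcode) auto
    show "run (Pop 31 ;; times 32 (pushcode 1) ;; pushcode 0) (S i) (S (Suc i)) (30 * g + 28)"
      apply (rule run_weaken)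
        apply (rule run_Seq run_Pop T run_pushcode | (use assms in \<open>simp add: S_def l fun_eq_iff\<close>))+
      done
  qed (auto simp: S_def)
  note w = this
  have "run build_rows s (S h) (9 + ((30 * h + 10) + (9 + ((17 * h + 3) + (h * ((30 * g + 28) + 2) + 1) + 1) + 1) + 1) + 1)"
    unfolding build_rows_def
  proof (intro run_Seq)
    show "run (pushcode 7) s (s(17 := cbits 7)) 9"
      using assms by (intro run_weaken[OF run_pushcode]) auto
    show "run (times 35 (pushcode 2)) (s(17 := cbits 7)) (s(17 := encU (replicate h 2 @ [7]))) (30 * h + 10)"
      using assms by (intro run_weaken[OF run_times_pushcode]) auto
    show "run (pushcode 0) (s(17 := encU (replicate h 2 @ [7]))) (s(17 := encU (0 # replicate h 2 @ [7]))) 9"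
      by (intro run_weaken[OF run_pushcode]) auto
    show "run (copy 35 31 8) (s(17 := encU (0 # replicate h 2 @ [7]))) (S 0) (17 * h + 3)"
      using assms by (intro run_weaken[OF run_copy]) (auto simp: S_def)
  qed (rule w)
  then show ?thesis using assms by (elim run_weaken) (auto simp: S_def algebra_simps)
qed

end

context writer
begin

definition bitcode :: "bool \<Rightarrow> nat" where "bitcode b = (if b then 4 else 3)"

lemma bitcode_simps [simp]: "bitcode True = 4" "bitcode False = 3"
  by (simp_all add: bitcode_def)

text \<open>Register 4 holds the input reversed, so its bits come out last one first, as is right
  for building \<open>enc_word\<close> on a stack. \<open>y\<close> is the part already
  done.\<close>

lemma run_first_loop:
  assumes "s 4 = rev x" "s 17 = encU (map bitcode (enc_word y)) @ us"
  shows "run (While (NE 4) (If (TT 4) (pushcode 4) (pushcode 3) ;; Pop 4 ;; pushcode 4)) s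
    (s(4 := [], 17 := encU (map bitcode (enc_word (x @ y))) @ us)) (24 * length x + 1)"
  using assms
proof (induction x arbitrary: s y rule: rev_induct)
  case Nil
  then show ?case by (intro run_weaken[OF run_While_end]) (auto simp: fun_eq_iff)
next
  case (snoc b x)
  let ?s1 = "s(4 := rev x, 17 := encU (map bitcode (enc_word (b # y))) @ us)"
  have "run (If (TT 4) (pushcode 4) (pushcode 3)) s (s(17 := cbits (bitcode b) @ s 17)) (9 + 1)"
    using snoc.prems run_pushcode[of 4 s] run_pushcode[of 3 s] by (intro run_If) (auto simp: bitcode_def)
  moreover have "run (Pop 4) (s(17 := cbits (bitcode b) @ s 17)) (s(4 := rev x, 17 := cbits (bitcode b) @ s 17)) 1"
    using snoc.prems by (intro run_weaken[OF run_Pop]) (auto simp: fun_eq_iff)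
  moreover have "run (pushcode 4) (s(4 := rev x, 17 := cbits (bitcode b) @ s 17)) ?s1 9"
    using snoc.prems by (intro run_weaken[OF run_pushcode]) auto
  ultimately have 1: "run (If (TT 4) (pushcode 4) (pushcode 3) ;; Pop 4 ;; pushcode 4) s ?s1 ((9 + 1) + (1 + 9 + 1) + 1)"
    by (intro run_Seq)
  have 2: "run (While (NE 4) (If (TT 4) (pushcode 4) (pushcode 3) ;; Pop 4 ;; pushcode 4)) ?s1
    (s(4 := [], 17 := encU (map bitcode (enc_word ((x @ [b]) @ y))) @ us)) (24 * length x + 1)"
    by (rule run_weaken[OF snoc.IH[of ?s1 "b # y"]]) auto
  show ?case
    using snoc.prems by (intro run_weaken[OF run_While_step[OF _ _ 1 2]]) auto
qed

lemma run_build_first: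
  assumes "s 34 = un b" "s 33 = un p" "s 4 = rev x" "s 8 = []" "s 9 = []"
  shows "run build_first s (s(4 := [],
    17 := encU (0 # map bitcode (enc_word x) @ replicate p 5 @ replicate b 6) @ s 17)) (30 * b + 30 * p + 24 * length x + 60)"
proof -
  have "run build_first s (s(4 := [], 17 := encU (0 # map bitcode (enc_word x) @ replicate p 5 @ replicate b 6) @ s 17))
     ((30 * b + 10) + ((30 * p + 10) + (9 + ((24 * length x + 1) + 9 + 1) + 1) + 1) + 1)"
    unfolding build_first_def
  proof (intro run_Seq)
    show "run (times 34 (pushcode 6)) s (s(17 := encU (replicate b 6) @ s 17)) (30 * b + 10)"
      using assms by (intro run_times_pushcode) auto
    show "run (times 33 (pushcode 5)) (s(17 := encU (replicate b 6) @ s 17))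
        (s(17 := encU (replicate p 5 @ replicate b 6) @ s 17)) (30 * p + 10)"
      using assms by (intro run_weaken[OF run_times_pushcode]) auto
    show "run (pushcode 3) (s(17 := encU (replicate p 5 @ replicate b 6) @ s 17))
        (s(17 := encU (map bitcode (enc_word []) @ replicate p 5 @ replicate b 6) @ s 17)) 9"
      by (intro run_weaken[OF run_pushcode]) (auto simp: bitcode_def)
    show "run (While (NE 4) (If (TT 4) (pushcode 4) (pushcode 3) ;; Pop 4 ;; pushcode 4))
        (s(17 := encU (map bitcode (enc_word []) @ replicate p 5 @ replicate b 6) @ s 17))
        (s(4 := [], 17 := encU (map bitcode (enc_word x) @ replicate p 5 @ replicate b 6) @ s 17)) (24 * length x + 1)"
      using assms
      by (intro run_weaken[OF run_first_loop[where y = "[]" and us = "encU (replicate p 5 @ replicate b 6) @ s 17"]]) auto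
    show "run (pushcode 0) (s(4 := [], 17 := encU (map bitcode (enc_word x) @ replicate p 5 @ replicate b 6) @ s 17))
        (s(4 := [], 17 := encU (0 # map bitcode (enc_word x) @ replicate p 5 @ replicate b 6) @ s 17)) 9"
      by (intro run_weaken[OF run_pushcode]) auto
  qed
  then show ?thesis by (elim run_weaken) auto
qed

definition read_input :: cmd where
  "read_input = While (NE 0) (xfer 0 4 ;; Push 5 True)"

lemma run_read_input:
  "run read_input (input_store x) ((input_store x)(0 := [], 4 := rev x, 5 := un (length x))) (10 * length x + 1)"
proof -
  define S where "S i = (input_store x)(0 := drop i x, 4 := rev (take i x), 5 := un i)" for i
  have "run read_input (S 0) (S (length x)) (length x * ((5 + 2 + 1) + 2) + 1)"
    unfolding read_input_def
  proof (rule run_While[where S = S])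
    fix i assume i: "i < length x"
    have 1: "run (xfer 0 4) (S i) ((S i)(0 := drop (Suc i) x, 4 := x ! i # rev (take i x))) 5"
      using i by (intro run_weaken[OF run_xfer[where x = "x ! i" and xs = "drop (Suc i) x"]])
        (auto simp: S_def Cons_nth_drop_Suc fun_eq_iff)
    have 2: "run (Push 5 True) ((S i)(0 := drop (Suc i) x, 4 := x ! i # rev (take i x))) (S (Suc i)) 2"
      using i by (intro run_weaken[OF run_Push]) (auto simp: S_def fun_eq_iff take_Suc_conv_app_nth)
    show "run (xfer 0 4 ;; Push 5 True) (S i) (S (Suc i)) (5 + 2 + 1)" by (rule run_Seq[OF 1 2])
  qed (auto simp: S_def)
  moreover have "S 0 = input_store x" by (auto simp: S_def input_store_def fun_eq_iff)
  ultimately have "run read_input (input_store x) (S (length x)) (length x * ((5 + 2 + 1) + 2) + 1)" by simp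
  then show ?thesis by (elim run_weaken) (auto simp: S_def)
qed

definition polys :: "(nat poly \<times> nat) list \<Rightarrow> cmd" where
  "polys qs = seqs (map (\<lambda>(q, r). horner_cmd (coeffs q) 5 r 8 9 10) qs)"

lemma run_polys:
  assumes "distinct (map snd qs)" "\<forall>(q, r)\<in>set qs. 11 \<le> r"
  shows "\<exists>f. pbound f \<and> (\<forall>n s. s 5 = un n \<longrightarrow> s 8 = [] \<longrightarrow> s 9 = [] \<longrightarrow> s 10 = [] \<longrightarrow>
    (\<forall>(q, r)\<in>set qs. s r = []) \<longrightarrow> run (polys qs) s (fold (\<lambda>(q, r) s. s(r := un (poly q n))) qs s) (f n))"
  using assms
proof (induction qs)
  case Nil
  show ?case by (intro exI[of _ "\<lambda>_. 0"]) (auto simp: polys_def intro: pbound_intros run_Skip)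
next
  case (Cons qr qs)
  obtain q r where qr: "qr = (q, r)" by force
  obtain f where f: "pbound f" "\<And>n s. s 5 = un n \<Longrightarrow> s 8 = [] \<Longrightarrow> s 9 = [] \<Longrightarrow> s 10 = [] \<Longrightarrow>
    (\<forall>(q, r)\<in>set qs. s r = []) \<Longrightarrow> run (polys qs) s (fold (\<lambda>(q, r) s. s(r := un (poly q n))) qs s) (f n)"
    using Cons.IH Cons.prems by auto
  have r: "distinct [5, r, 8, 9, 10]" "\<forall>i\<in>{5, r, 8, 9, 10}. 4 \<le> i" using Cons.prems(2) qr by auto
  obtain g where g: "pbound g" "\<And>n s. s 5 = un n \<Longrightarrow> s r = [] \<Longrightarrow> s 8 = [] \<Longrightarrow> s 9 = [] \<Longrightarrow> s 10 = [] \<Longrightarrow>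
    run (horner_cmd (coeffs q) 5 r 8 9 10) s (s(r := un (poly q n))) (g n)"
    using run_poly[OF r, of q] by blast
  have "run (polys (qr # qs)) s (fold (\<lambda>(q, r) s. s(r := un (poly q n))) (qr # qs) s) (g n + f n + 1)"
    if s: "s 5 = un n" "s 8 = []" "s 9 = []" "s 10 = []" "\<forall>(q, r)\<in>set (qr # qs). s r = []" for n s
  proof -
    have 1: "run (horner_cmd (coeffs q) 5 r 8 9 10) s (s(r := un (poly q n))) (g n)"
      using s qr by (intro g) auto
    have r': "r \<notin> {5, 8, 9, 10}" "r \<notin> snd ` set qs" using Cons.prems qr by auto
    have "\<forall>(q', r')\<in>set qs. (s(r := un (poly q n))) r' = []" using s(5) r'(2) by (force simp: image_iff)
    then have 2: "run (polys qs) (s(r := un (poly q n))) (fold (\<lambda>(q, r) s. s(r := un (poly q n))) qs (s(r := un (poly q n)))) (f n)"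
      using s r' by (intro f) auto
    show ?thesis using run_Seq[OF 1 2] by (simp add: polys_def qr)
  qed
  moreover have "pbound (\<lambda>n. g n + f n + 1)" by (intro pbound_intros f g)
  ultimately show ?case by (intro exI[of _ "\<lambda>n. g n + f n + 1"]) auto
qed

end

section \<open>Reading the count off the oracle's answer\<close>

definition drop_loop :: "nat \<Rightarrow> nat \<Rightarrow> cmd" where
  "drop_loop a b = While (NE a) (Pop a ;; drop1 b)"

lemma run_drop_loop:
  assumes "4 \<le> a" "4 \<le> b" "a \<noteq> b"
  shows "run (drop_loop a b) s (s(a := [], b := drop (length (s a)) (s b))) (6 * length (s a) + 1)"
proof -
  define S where "S i = s(a := drop i (s a), b := drop i (s b))" for i
  have "run (drop_loop a b) (S 0) (S (length (s a))) (length (s a) * ((1 + 2 + 1) + 2) + 1)"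
    unfolding drop_loop_def
  proof (rule run_While[where S = S])
    fix i assume i: "i < length (s a)"
    have 1: "run (Pop a) (S i) ((S i)(a := drop (Suc i) (s a))) 1"
      using assms i by (intro run_weaken[OF run_Pop]) (auto simp: S_def tl_drop drop_Suc)
    have 2: "run (drop1 b) ((S i)(a := drop (Suc i) (s a))) (S (Suc i)) 2"
      using assms by (intro run_weaken[OF run_drop1]) (auto simp: S_def fun_eq_iff tl_drop drop_Suc)
    show "run (Pop a ;; drop1 b) (S i) (S (Suc i)) (1 + 2 + 1)" by (rule run_Seq[OF 1 2])
  qed (use assms in \<open>auto simp: S_def\<close>)
  moreover have "S 0 = s" using assms by (auto simp: S_def)
  ultimately have "run (drop_loop a b) s (S (length (s a))) (length (s a) * ((1 + 2 + 1) + 2) + 1)" by simp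
  then show ?thesis by (elim run_weaken) (auto simp: S_def)
qed

text \<open>The denominator \<open>2 ^ b\<close> is read into register 41 with its leading 1 on top.
  Once that is popped, the \<open>b\<close> zeros below it serve as a counter for the bits to be
  dropped from the numerator; register 15 supplies the remaining shift.\<close>

definition read_off :: cmd where
  "read_off = Pop 2 ;; read_word 2 40 ;; Pop 2 ;; read_word 2 41 ;; pour 40 42 ;; Pop 41 ;;
     drop_loop 41 42 ;; drop_loop 15 42 ;; pour 42 1"

lemma run_read_off:
  assumes q: "quotient_of z = (int p, 2 ^ b)"
    and s: "s 2 = enc_rat z" "s 3 \<noteq> []" "s 40 = []" "s 41 = []" "s 42 = []" "s 15 = un e" "s 1 = []"
  shows "\<exists>s'. run read_off s s' (40 * (length (bin p) + b + e) + 100) \<and> s' 1 = rev (drop (b + e) (bin p))"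
proof -
  have s2: "s 2 = False # enc_word (bin p) @ False # enc_word (bin (2 ^ b)) @ []"
    using q s(1) by (simp add: enc_rat_def enc_int_def enc_nat_def nat_power_eq)
  have l: "length (bin (2 ^ b)) = Suc b" "rev (bin (2 ^ b)) = True # replicate b False" by (simp_all add: bin_pow2)
  let ?d = "drop e (drop b (bin p))"
  have "run read_off s (s(2 := [], 15 := [], 1 := rev ?d)) (1 + ((9 * length (bin p) + 3) + (1 + ((9 * Suc b + 3) +
     ((7 * length (bin p) + 1) + (1 + ((6 * b + 1) + ((6 * e + 1) + (7 * length (bin p) + 1) + 1) + 1) + 1) + 1) + 1) + 1) + 1) + 1)"
    unfolding read_off_def
  proof (intro run_Seq)
    let ?s1 = "s(2 := enc_word (bin p) @ False # enc_word (bin (2 ^ b)) @ [])"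
    show "run (Pop 2) s ?s1 1" using s(2-7) s2 by (intro run_weaken[OF run_Pop]) auto
    let ?s2 = "s(2 := False # enc_word (bin (2 ^ b)) @ [], 40 := rev (bin p))"
    show "run (read_word 2 40) ?s1 ?s2 (9 * length (bin p) + 3)"
      using s by (intro run_weaken[OF run_read_word[where w = "bin p" and xs = "False # enc_word (bin (2 ^ b)) @ []"]]) auto
    let ?s3 = "s(2 := enc_word (bin (2 ^ b)) @ [], 40 := rev (bin p))"
    show "run (Pop 2) ?s2 ?s3 1" using s by (intro run_weaken[OF run_Pop]) (auto simp: fun_eq_iff)
    let ?s4 = "s(2 := [], 40 := rev (bin p), 41 := True # replicate b False)"
    show "run (read_word 2 41) ?s3 ?s4 (9 * Suc b + 3)"
      using s l by (intro run_weaken[OF run_read_word[where w = "bin (2 ^ b)" and xs = "[]"]]) (auto simp: fun_eq_iff)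
    let ?s5 = "s(2 := [], 42 := bin p, 41 := True # replicate b False)"
    show "run (pour 40 42) ?s4 ?s5 (7 * length (bin p) + 1)"
      using s by (intro run_weaken[OF run_pour]) (auto simp: fun_eq_iff)
    let ?s6 = "s(2 := [], 42 := bin p, 41 := replicate b False)"
    show "run (Pop 41) ?s5 ?s6 1" using s by (intro run_weaken[OF run_Pop]) auto
    let ?s7 = "s(2 := [], 42 := drop b (bin p))"
    show "run (drop_loop 41 42) ?s6 ?s7 (6 * b + 1)"
      using s by (intro run_weaken[OF run_drop_loop]) (auto simp: fun_eq_iff)
    let ?s8 = "s(2 := [], 15 := [], 42 := ?d)"
    show "run (drop_loop 15 42) ?s7 ?s8 (6 * e + 1)"
      using s by (intro run_weaken[OF run_drop_loop]) (auto simp: fun_eq_iff)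
    show "run (pour 42 1) ?s8 (s(2 := [], 15 := [], 1 := rev ?d)) (7 * length (bin p) + 1)"
      using s by (intro run_weaken[OF run_pour]) (auto simp: fun_eq_iff)
  qed
  then have "run read_off s (s(2 := [], 15 := [], 1 := rev ?d)) (40 * (length (bin p) + b + e) + 100)"
    by (elim run_weaken) auto
  then show ?thesis by (intro exI[of _ "s(2 := [], 15 := [], 1 := rev ?d)"]) (auto simp: add.commute)
qed

lemma outputs_within_mono:
  assumes "outputs_within A M x y t" "t \<le> t'"
  shows "outputs_within A M x y t'"
proof -
  obtain ts where 1: "(step A M ^^ t) (init_config M x) = (halt_state M, ts)" "tape_word (ts ! 1) = y"
    using assms(1) by (auto simp: outputs_within_def split: prod.splits)
  have "(step A M ^^ n) (halt_state M, ts) = (halt_state M, ts)" for n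
    by (induction n) (auto simp: step_def)
  moreover have "(step A M ^^ t') (init_config M x) = (step A M ^^ (t' - t)) ((step A M ^^ t) (init_config M x))"
    using assms(2) by (metis add.commute comp_apply funpow_add le_add_diff_inverse)
  ultimately show ?thesis using 1 by (simp add: outputs_within_def)
qed

lemma map_div_mod:
  "map (\<lambda>l. f (l div G) (l mod G)) [0..<T * G] = concat (map (\<lambda>t. map (f t) [0..<G]) [0..<T])"
proof (induction T)
  case (Suc T)
  have "[0..<Suc T * G] = [0..<T * G] @ map (\<lambda>h. T * G + h) [0..<G]"
    using upt_add_eq_append[of 0 "T * G" G] by (simp add: map_add_upt add.commute)
  moreover have "map (\<lambda>l. f (l div G) (l mod G)) (map (\<lambda>h. T * G + h) [0..<G]) = map (f T) [0..<G]"
    by simp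
  ultimately show ?case using Suc by simp
qed simp

text \<open>The layout as the program produces it, row after row, with \<open>g\<close> for
  \<open>G - 2\<close> and \<open>b\<close> for the number of blanks in row 0.\<close>

definition codes :: "bool list \<Rightarrow> nat \<Rightarrow> nat \<Rightarrow> nat \<Rightarrow> nat list" where
  "codes w p b g = 0 # map (\<lambda>b. if b then 4 else 3) w @ replicate p 5 @ replicate b 6 @
     concat (replicate g (0 # replicate (g + 1) 1)) @ 0 # replicate g 2 @ [7]"

lemma codes_code:
  assumes g: "g + 1 = length w + p + b" "1 \<le> g"
  shows "codes w p b g = map (\<lambda>l. code w p (g + 2) (l div (g + 2)) (l mod (g + 2))) [0..<(g + 2) * (g + 2)]"
proof -
  let ?G = "g + 2"
  define row where "row t = map (code w p ?G t) [0..<?G]" for t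
  have rowC: "row t = 0 # map (\<lambda>h. code w p ?G t (Suc h)) [0..<g + 1]" for t
    using map_upt_Suc[of "code w p ?G t" "g + 1"] by (simp add: row_def code_def del: upt_Suc)
  have "map (\<lambda>h. code w p ?G 0 (Suc h)) [0..<g + 1] = map (\<lambda>b. if b then 4 else 3) w @ replicate p 5 @ replicate b 6"
    by (rule nth_equalityI) (use g in \<open>auto simp: code_def nth_append simp del: upt_Suc\<close>)
  then have 0: "row 0 = 0 # map (\<lambda>b. if b then 4 else 3) w @ replicate p 5 @ replicate b 6"
    by (simp add: rowC del: upt_Suc)
  have mid: "row t = 0 # replicate (g + 1) 1" if "1 \<le> t" "t < g + 1" for t
  proof -
    have "map (\<lambda>h. code w p ?G t (Suc h)) [0..<g + 1] = map (\<lambda>_. 1) [0..<g + 1]"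
      using that by (intro map_cong) (auto simp: code_def)
    then show ?thesis by (simp add: rowC map_replicate_const del: upt_Suc)
  qed
  have "map (\<lambda>h. code w p ?G (g + 1) (Suc h)) [0..<g + 1] = replicate g 2 @ [7]"
    by (rule nth_equalityI) (auto simp: code_def nth_append simp del: upt_Suc)
  then have last: "row (g + 1) = 0 # replicate g 2 @ [7]" by (simp add: rowC del: upt_Suc)
  have "[0..<?G] = 0 # [1..<g + 1] @ [g + 1]" using upt_conv_Cons[of 0 "g + 1"] by simp
  then have "concat (map row [0..<?G]) = row 0 @ concat (map row [1..<g + 1]) @ row (g + 1)" by simp
  moreover have "map row [1..<g + 1] = replicate g (0 # replicate (g + 1) 1)"
  proof -
    have "map row [1..<g + 1] = map (\<lambda>_. 0 # replicate (g + 1) 1) [1..<g + 1]"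
      using mid by (intro map_cong) auto
    then show ?thesis by (simp add: map_replicate_const)
  qed
  ultimately have "concat (map row [0..<?G]) = codes w p b g"
    unfolding 0 last by (simp add: codes_def)
  from this[unfolded row_def[abs_def]] show ?thesis unfolding map_div_mod by (rule sym)
qed

definition off4 :: "nat \<Rightarrow> nat \<Rightarrow> nat" where
  "off4 g d = (if d = 1 then 1 else if d = 2 then g + 1 else if d = 3 then g + 2 else g + 3)"

section \<open>Sizes of the model and correctness of the reduction\<close>

locale reduction = writer +
  fixes pp pr :: "nat poly"
  assumes R: "1 \<le> R"
begin

text \<open>The blanks in row 0: the verifier's running time on inputs of length
  \<open>2 * n + 1 + poly pp n\<close>, and 4 to meet \<open>T + 4 \<le> G\<close>.
  \<open>pG2\<close> and \<open>pG1\<close> are then \<open>G - 2\<close> and \<open>G - 1\<close>.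
  All sizes are built upwards, as polynomials over the naturals have no proper subtraction.\<close>

definition pB0 :: "nat poly" where "pB0 = pcompose pr ([:1, 2:] + pp) + [:4:]"
definition pG2 :: "nat poly" where "pG2 = pB0 + pp + [:0, 2:]"
definition pG1 :: "nat poly" where "pG1 = pG2 + 1"
definition pL :: "nat poly" where "pL = (pG2 + [:2:]) * (pG2 + [:2:])"
definition pM :: "nat poly" where "pM = pL * [:R:]"
text \<open>\<open>m - 1\<close> without subtraction, using that \<open>L - 1\<close> is
  \<open>(G - 1) ^ 2 + 2 * (G - 1)\<close>; it is wanted for the number
  \<open>m * (m - 1) + 1\<close> of free pairs in \<open>pE\<close>.\<close>

definition pM1 :: "nat poly" where "pM1 = pL * [:R - 1:] + (pG1 * pG1 + [:2:] * pG1)"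
definition pNV :: "nat poly" where "pNV = [:k - 1:] + [:2:] * pM"
definition pS :: "nat poly" where "pS = pNV * pNV"
definition pW :: "nat poly" where "pW = pS * (pM + 1)"
definition pBS :: "nat poly" where "pBS = pS * pM"
definition pE :: "nat poly" where "pE = pS * ((pM + 1) * (pM * pM) + pL) + (pM * pM1 + 1)"

definition qs :: "(nat poly \<times> nat) list" where
  "qs = [(pW, 11), (pS, 12), (pBS, 13), (pNV, 14), (pE, 15), (pL, 16), (pG1, 32), (pp, 33), (pB0, 34), (pG2, 35)]"

text \<open>The two single bits pushed onto register 2 end the unary number of vertices and the list
  of features.\<close>

definition write_model :: cmd where
  "write_model = read_input ;; polys qs ;; build_rows ;; build_first ;; build_masks ;; pour 14 2 ;; Push 2 False ;;
     While (NE 17) outer ;; Push 2 False"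

definition U :: "bool list \<Rightarrow> nat list" where
  "U x = codes (enc_word x) (poly pp (length x)) (poly pB0 (length x)) (poly pG2 (length x))"

definition feats :: "bool list \<Rightarrow> (feature \<times> int) list" where
  "feats x = concat (map (row_feats (poly pW (length x)) (poly pS (length x)) (poly pBS (length x))
     (off4 (poly pG2 (length x))) (U x) (poly pL (length x))) [0..<poly pL (length x)])"

definition bnd :: "nat \<Rightarrow> nat" where
  "bnd n = poly pW n + poly pS n + poly pBS n + (k + 2 * poly pM n + 2 * R) + (poly pL n + poly pG2 n + 4)"

lemma pG2_eq: "poly pG2 n + 1 = (2 * n + 1) + poly pp n + poly pB0 n" "1 \<le> poly pG2 n"
  by (simp_all add: pG2_def pB0_def)

lemma length_U: "length (U x) = poly pL (length x)"
  unfolding U_def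
  by (subst codes_code) (use pG2_eq in \<open>auto simp: length_enc_word pL_def algebra_simps\<close>)

lemma set_U: "set (U x) \<subseteq> {..<8}"
  by (auto simp: U_def codes_def)

lemma k0: "0 < k" using k3 by simp

lemma run_write_model:
  "\<exists>f. pbound f \<and> (\<forall>x. \<exists>s. run write_model (input_store x) s (f (length x)) \<and> s 3 = [] \<and> s 1 = [] \<and>
     s 40 = [] \<and> s 41 = [] \<and> s 42 = [] \<and> s 15 = un (poly pE (length x)) \<and>
     rev (s 2) = enc_ergm (ERGM (poly pNV (length x)) (feats x)))"
proof -
  obtain fp where fp: "pbound fp" "\<And>n s. s 5 = un n \<Longrightarrow> s 8 = [] \<Longrightarrow> s 9 = [] \<Longrightarrow> s 10 = [] \<Longrightarrow>
    (\<forall>(q, r)\<in>set qs. s r = []) \<Longrightarrow> run (polys qs) s (fold (\<lambda>(q, r) s. s(r := un (poly q n))) qs s) (fp n)"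
    using run_polys[of qs] by (auto simp: qs_def)
  let ?f = "\<lambda>n. (10 * n + 1) + (fp n + ((poly pG2 n * (30 * poly pG1 n + 30) + 50 * poly pG2 n + 60) +
    ((30 * poly pB0 n + 30 * poly pp n + 24 * n + 60) + ((80 * poly pG1 n + 3 * k + 100) + ((7 * poly pNV n + 1) + (2 +
    ((poly pL n * (tO (bnd n) + 2) + 1) + 2 + 1) + 1) + 1) + 1) + 1) + 1) + 1) + 1"
  have "pbound ?f"
    unfolding tO_def tI_def tB_def tF_def tE_def bnd_def by (intro pbound_intros fp)
  moreover have "\<exists>s. run write_model (input_store x) s (?f (length x)) \<and> s 3 = [] \<and> s 1 = [] \<and>
     s 40 = [] \<and> s 41 = [] \<and> s 42 = [] \<and> s 15 = un (poly pE (length x)) \<and>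
     rev (s 2) = enc_ergm (ERGM (poly pNV (length x)) (feats x))" for x
  proof -
    define n where "n = length x"
    let ?g = "poly pG2 n"
    define s1 where "s1 = (input_store x)(0 := [], 4 := rev x, 5 := un n)"
    define s2 where "s2 = s1(11 := un (poly pW n), 12 := un (poly pS n), 13 := un (poly pBS n), 14 := un (poly pNV n),
      15 := un (poly pE n), 16 := un (poly pL n), 32 := un (poly pG1 n), 33 := un (poly pp n), 34 := un (poly pB0 n),
      35 := un ?g)"
    define rows :: "nat list" where "rows = concat (replicate ?g (0 # replicate (poly pG1 n) 1)) @ 0 # replicate ?g 2 @ [7]"
    define s3 where "s3 = s2(17 := encU rows)"
    define s4 where "s4 = s3(4 := [], 17 := encU (U x))"
    define s5 where "s5 = s4(21 := mask 0, 22 := mask 1, 23 := mask (?g + 1), 24 := mask (?g + 2), 25 := mask (?g + 3),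
      6 := un (uvert k 0))"
    define s6 where "s6 = s5(14 := [], 2 := un (poly pNV n))"
    define s7 where "s7 = s6(2 := False # un (poly pNV n))"
    have g1: "poly pG1 n = ?g + 1" by (simp add: pG1_def)
    have 1: "run read_input (input_store x) s1 (10 * n + 1)"
      unfolding s1_def n_def by (rule run_read_input)
    have 2: "run (polys qs) s1 s2 (fp n)"
    proof (rule run_weaken[OF fp(2)])
      show "fold (\<lambda>(q, r) s. s(r := un (poly q n))) qs s1 = s2" by (simp add: qs_def s2_def)
    qed (auto simp: s1_def input_store_def qs_def)
    have 3: "run build_rows s2 s3 (?g * (30 * poly pG1 n + 30) + 50 * ?g + 60)"
      unfolding s3_def rows_def by (rule run_build_rows) (auto simp: s2_def s1_def input_store_def)
    have 4: "run build_first s3 s4 (30 * poly pB0 n + 30 * poly pp n + 24 * n + 60)"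
    proof (rule run_weaken[OF run_build_first[where b = "poly pB0 n" and p = "poly pp n" and x = x]])
      show "s3(4 := [], 17 := encU (0 # map bitcode (enc_word x) @ replicate (poly pp n) 5 @ replicate (poly pB0 n) 6) @ s3 17) = s4"
        by (simp add: s4_def s3_def U_def codes_def rows_def n_def[symmetric] g1 bitcode_def[abs_def])
    qed (auto simp: s3_def s2_def s1_def input_store_def n_def)
    have 5: "run build_masks s4 s5 (80 * poly pG1 n + 3 * k + 100)"
    proof (rule run_weaken[OF run_build_masks[where g = "poly pG1 n"]])
      have "poly pG1 n + 1 = ?g + 2" "poly pG1 n + 2 = ?g + 3" using g1 by simp_all
      then show "s4(21 := mask 0, 22 := mask 1, 23 := mask (poly pG1 n), 24 := mask (poly pG1 n + 1),
          25 := mask (poly pG1 n + 2), 6 := un (uvert k 0)) = s5"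
        unfolding s5_def g1 by (simp only: g1)
    qed (simp_all add: s4_def s3_def s2_def s1_def input_store_def)
    have 6: "run (pour 14 2) s5 s6 (7 * poly pNV n + 1)"
      by (rule run_weaken[OF run_pour]) (auto simp: s6_def s5_def s4_def s3_def s2_def s1_def input_store_def)
    have 7: "run (Push 2 False) s6 s7 2"
      by (rule run_weaken[OF run_Push]) (auto simp: s7_def s6_def s5_def s4_def s3_def s2_def s1_def input_store_def)
    note sd = s7_def s6_def s5_def s4_def s3_def s2_def s1_def input_store_def
    have W0: "0 < poly pBS n"
      using R k0 by (simp add: pBS_def pS_def pNV_def pM_def pL_def)
    obtain s8 where 8: "run (While (NE 17) outer) s7 s8 (poly pL n * (tO (bnd n) + 2) + 1)" "s8 3 = []"
      "s8 2 = rev (enc_wfs (concat (map (row_feats (poly pW n) (poly pS n) (poly pBS n) (off4 ?g) (U x) (poly pL n)) [0..<poly pL n]))) @ s7 2"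
      "\<forall>j. j < 2 \<or> 26 < j \<or> j = 15 \<longrightarrow> s8 j = s7 j"
    proof -
      have "\<exists>s'. run (While (NE 17) outer) s7 s' (poly pL n * (tO (bnd n) + 2) + 1) \<and> s' 3 = [] \<and>
        s' 2 = rev (enc_wfs (concat (map (row_feats (poly pW n) (poly pS n) (poly pBS n) (off4 ?g) (U x) (poly pL n)) [0..<poly pL n]))) @ s7 2 \<and>
        (\<forall>j. j < 2 \<or> 26 < j \<or> j = 15 \<longrightarrow> s' j = s7 j)"
      proof (rule run_outer_loop)
        show "wconsts (poly pW n) (poly pS n) (poly pBS n) s7" by (simp add: wconsts_def tmp_def sd)
        show "length (U x) = poly pL n" by (simp add: length_U n_def)
        show "set (U x) \<subseteq> {..<8}" by (rule set_U)
        show "0 < poly pBS n" by (rule W0)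
        show "uvert k (poly pL n * R) + 2 * R \<le> bnd n" "vvert k (poly pL n * R) + 2 * R \<le> bnd n"
          using k0 by (simp_all add: uvert_def vvert_def bnd_def pM_def mult.commute)
      qed (simp_all add: sd off4_def bnd_def)
      then show ?thesis using that by blast
    qed
    have 9: "run (Push 2 False) s8 (s8(2 := False # s8 2)) 2"
      using 8(2) by (intro run_Push) simp
    have "run write_model (input_store x) (s8(2 := False # s8 2)) (?f n)"
      unfolding write_model_def
      by (rule run_Seq[OF 1 run_Seq[OF 2 run_Seq[OF 3 run_Seq[OF 4 run_Seq[OF 5 run_Seq[OF 6 run_Seq[OF 7 run_Seq[OF 8(1) 9]]]]]]]])
    moreover have "rev (False # s8 2) = enc_ergm (ERGM (poly pNV n) (feats x))"
      by (simp add: 8(3) s7_def enc_ergm_def enc_unary_def enc_list_def feats_def n_def[symmetric] enc_wfs_def enc_wf_def)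
    ultimately show ?thesis
      using 8(2,4) by (intro exI[of _ "s8(2 := False # s8 2)"]) (simp add: sd n_def)
  qed
  ultimately show ?thesis by blast
qed

text \<open>The gadget leaves the order of the index pairs open; this is the order in which the
  program prints them, by pairs of cells and then by pairs of values.\<close>

definition ijs :: "nat \<Rightarrow> (nat \<times> nat) list" where
  "ijs L = concat (map (\<lambda>l. concat (map (\<lambda>l'. map (\<lambda>(x, y). (l * R + x, l' * R + y)) prs) [0..<L])) [0..<L])"

lemma set_ijs: "set (ijs L) = {..<L * R} \<times> {..<L * R}"
proof
  have lt: "l * R + x < L * R" if "l < L" "x < R" for l x
  proof -
    have "l * R + x < Suc l * R" using that by simp
    also have "\<dots> \<le> L * R" using that by (intro mult_le_mono1) simp
    finally show ?thesis .
  qed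
  show "set (ijs L) \<subseteq> {..<L * R} \<times> {..<L * R}" using lt by (auto simp: ijs_def)
  show "{..<L * R} \<times> {..<L * R} \<subseteq> set (ijs L)"
  proof
    fix z assume "z \<in> {..<L * R} \<times> {..<L * R}"
    then obtain i j where z: "z = (i, j)" "i < L * R" "j < L * R" by auto
    then have "i div R < L" "j div R < L" "i mod R < R" "j mod R < R"
      using R by (auto simp: less_mult_imp_div_less)
    moreover have "z = (i div R * R + i mod R, j div R * R + j mod R)" using z by simp
    moreover have "(l * R + x, l' * R + y) \<in> set (ijs L)" if "l < L" "l' < L" "x < R" "y < R" for l l' x y
    proof -
      have 1: "(l * R + x, l' * R + y) \<in> set (map (\<lambda>(x, y). (l * R + x, l' * R + y)) prs)"
        using that by (auto intro!: image_eqI[of _ _ "(x, y)"])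
      have l: "l \<in> set [0..<L]" "l' \<in> set [0..<L]" using that by auto
      have c: "a \<in> set (f y) \<Longrightarrow> y \<in> set ys \<Longrightarrow> a \<in> set (concat (map f ys))"
        for a :: "nat \<times> nat" and f and y :: nat and ys by auto
      show ?thesis
        unfolding ijs_def by (rule c[where y = l], rule c[where y = l'], rule 1, rule l(2), rule l(1))
    qed
    ultimately show "z \<in> set (ijs L)" by metis
  qed
qed

text \<open>The list is as long as the set it covers is large.\<close>

lemma distinct_ijs: "distinct (ijs L)"
proof (rule card_distinct)
  have "length (ijs L) = (L * R) * (L * R)"
    by (simp add: ijs_def length_concat comp_def sum_list_triv algebra_simps)
  then show "card (set (ijs L)) = length (ijs L)" by (simp add: set_ijs card_cartesian_product)
qed

definition al :: "bool list \<Rightarrow> nat \<Rightarrow> nat \<Rightarrow> bool" where "al x l = A (U x ! l)"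

definition bad :: "bool list \<Rightarrow> nat \<Rightarrow> nat \<Rightarrow> nat \<Rightarrow> nat \<Rightarrow> bool" where
  "bad x l a l' b \<longleftrightarrow> (\<exists>d\<in>{1, 2, 3, 4}. l' = l + off4 (poly pG2 (length x)) d \<and> \<not> C d a b)"

text \<open>\<open>1 \<le> pG2\<close> keeps the four offsets distinct, so that the cascade of tests
  in \<open>qcell\<close> and the condition \<open>bad\<close> agree.\<close>

lemma weight_cw:
  assumes "a < R" "b < R"
  shows "weight S (S * (L * R)) (qcell (off4 (poly pG2 (length x))) (U x ! l) l l' a b) =
    int S * cw L R (al x) (bad x) (l * R + a) (l' * R + b)"
proof -
  have d: "(l * R + a) div R = l" "(l * R + a) mod R = a" "(l' * R + b) div R = l'" "(l' * R + b) mod R = b"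
    using assms by auto
  have "l * R + a = l' * R + b \<longleftrightarrow> a = b" if "l = l'" using that by simp
  moreover have "1 \<le> poly pG2 (length x)" by (rule pG2_eq)
  ultimately show ?thesis
    unfolding cw_def d
    by (cases "l' = l") (auto simp: qcell_def qsame_def qoff_def weight_def al_def bad_def off4_def)
qed

lemma poly_vals:
  "poly pM n = poly pL n * R" "poly pNV n = nv k (poly pL n * R)" "poly pS n = scale k (poly pL n * R)"
proof -
  show 1: "poly pM n = poly pL n * R" by (simp add: pM_def)
  show 2: "poly pNV n = nv k (poly pL n * R)" by (simp add: pNV_def nv_def 1)
  show "poly pS n = scale k (poly pL n * R)" by (simp add: pS_def scale_def 2)
qed

lemma feats_eq:
  fixes x defines "L \<equiv> poly pL (length x)"
  shows "feats x = concat (map (pair_features F (L * R) (cw L R (al x) (bad x))) (ijs L))"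
proof -
  define n where "n = length x"
  have v: "poly pS n = scale k (L * R)" "poly pW n = scale k (L * R) * (L * R + 1)" "poly pBS n = scale k (L * R) * (L * R)"
    by (simp_all add: poly_vals pW_def pBS_def L_def n_def)
  have cc: "concat (map f (concat (map g xs))) = concat (map (\<lambda>y. concat (map f (g y))) xs)"
    for f :: "nat \<times> nat \<Rightarrow> (feature \<times> int) list" and g :: "nat \<Rightarrow> _" and xs by (induction xs) auto
  let ?pf = "pair_features F (L * R) (cw L R (al x) (bad x))"
  have "wfeats (poly pW n) (poly pS n) (poly pBS n) (qcell (off4 (poly pG2 n)) (U x ! l) l l') (l * R) (l' * R) =
      concat (map ?pf (map (\<lambda>(x, y). (l * R + x, l' * R + y)) prs))" for l l'
  proof -
    have "(\<lambda>(a, b). [(Indicator F (tup k 1 (l * R + a) (l' * R + b)), int (poly pW n)),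
      (Indicator F (tup k 0 (l * R + a) (l' * R + b)), weight (poly pS n) (poly pBS n) (qcell (off4 (poly pG2 n)) (U x ! l) l l' a b))]) z
      = ?pf ((\<lambda>(x, y). (l * R + x, l' * R + y)) z)" if "z \<in> set prs" for z
      using that by (auto simp: pair_features_def Let_def v weight_cw[of _ _ _ L x, folded n_def])
    then show ?thesis
      unfolding wfeats_def map_map comp_def by (intro arg_cong[where f = concat] map_cong) auto
  qed
  then show ?thesis
    unfolding feats_def row_feats_def ijs_def cc n_def[symmetric] L_def by simp
qed

text \<open>The maxima of the model correspond to the selections counted by \<open>f\<close>;
  \<open>extract_count\<close> recovers their number from the answer, and the length of that answer
  is bounded before it is received.\<close>

theorem reduce:
  assumes F: "simple_graph F" "F \<in> S" and S: "\<forall>F\<in>S. simple_graph F"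
    and f: "\<And>x. f x = card (sels (poly pL (length x)) R (al x) (bad x))"
  shows "poly_time_reducible f (ergm_partition S)"
proof -
  obtain gg where gg: "pbound gg" "\<And>x. \<exists>s. run write_model (input_store x) s (gg (length x)) \<and> s 3 = [] \<and> s 1 = [] \<and>
     s 40 = [] \<and> s 41 = [] \<and> s 42 = [] \<and> s 15 = un (poly pE (length x)) \<and>
     rev (s 2) = enc_ergm (ERGM (poly pNV (length x)) (feats x))"
    using run_write_model by blast
  obtain M where M: "oracle_machine M" "\<And>A x s1 t1 s2 t2. run write_model (input_store x) s1 t1 \<Longrightarrow> s1 3 = [] \<Longrightarrow>
     run read_off (s1(2 := A (rev (s1 2)), 3 := [True])) s2 t2 \<Longrightarrow>
     outputs_within A M x (rev (s2 1)) (t1 + t2 + 5)"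
    using compile_oracle[of write_model read_off] by blast
  \<comment> \<open>The bound of \<open>partition_dyadic\<close> on the exponent of the
    denominator.\<close>
  let ?d = "\<lambda>n. poly pS n * poly pM n * (poly pM n * poly pM n)"
  let ?t = "\<lambda>n. gg n + (40 * ((poly pM n + 1 + (?d n + poly pE n)) + ?d n + poly pE n) + 100) + 5"
  have "pbound ?t" by (intro pbound_intros gg)
  then obtain p where p: "\<And>n. ?t n \<le> poly p n" unfolding pbound_def by blast
  have "outputs_within Or M x (bin (f x)) (poly p (length x))" if Or: "oracle_for (ergm_partition S) Or" for Or x
  proof -
    define n where "n = length x"
    define L where "L = poly pL n"
    have LR: "1 \<le> L" by (simp add: L_def pL_def)
    interpret g: gadget F "L * R" L "cw L R (al x) (bad x)" "sel_set L R ` sels L R (al x) (bad x)" "ijs L"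
      by (rule gadget_sels[OF LR R F(1) k3 distinct_ijs set_ijs])
    have m: "poly pM n = L * R" "poly pS n = scale k (L * R)" "poly pNV n = nv k (L * R)"
      by (simp_all add: poly_vals L_def)
    have model: "ERGM (poly pNV n) (feats x) = g.model"
      unfolding g.model_def m(3) feats_eq n_def[symmetric] L_def[symmetric] ..
    have E: "poly pE n = g.Emax + (L * R * (L * R - 1) + 1)"
    proof -
      have L2: "L = (poly pG1 n + 1) * (poly pG1 n + 1)" by (simp add: L_def pL_def pG1_def algebra_simps)
      have "L * (R - 1) + L = L * R" using R by (cases R) auto
      moreover have "poly pM1 n = L * (R - 1) + (poly pG1 n * poly pG1 n + 2 * poly pG1 n)"
        by (simp add: pM1_def L_def)
      ultimately have "poly pM1 n + 1 = L * R" using L2 by simp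
      then have "poly pM1 n = L * R - 1" by simp
      then show ?thesis by (simp add: pE_def m g.Emax_def L_def[symmetric])
    qed
    let ?Z = "partition_function g.model"
    have fx: "f x = card (sel_set L R ` sels L R (al x) (bad x))"
      unfolding card_sel_sets[OF LR R] f n_def[symmetric] L_def[symmetric] ..
    obtain r where r: "?Z = (of_nat (f x) + r) * 2 ^ (poly pE n)" "0 \<le> r" "r < 1"
      using g.partition_model unfolding E fx by blast
    obtain a where a: "?Z * 2 ^ (?d n) = of_int a" using g.partition_dyadic by (auto simp: m)
    have "f x \<le> 2 ^ poly pM n"
      using g.card_Sol_le unfolding fx m(1) .
    from extract_count[OF r a this] obtain q b where q: "quotient_of ?Z = (int q, 2 ^ b)"
      "drop (b + poly pE n) (bin q) = bin (f x)" "b \<le> ?d n" "length (bin q) \<le> poly pM n + 1 + (b + poly pE n)"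
      by blast
    obtain s where s: "run write_model (input_store x) s (gg n)" "s 3 = []" "s 1 = []"
     "s 40 = []" "s 41 = []" "s 42 = []" "s 15 = un (poly pE n)" "rev (s 2) = enc_ergm g.model"
      using gg(2)[of x] unfolding n_def[symmetric] model by blast
    have u: "uses_features_from S g.model" by (rule g.model_from[OF F(2)])
    then have "(enc_ergm g.model, enc_rat ?Z) \<in> ergm_partition S" unfolding ergm_partition_def by blast
    then have "(enc_ergm g.model, Or (enc_ergm g.model)) \<in> ergm_partition S"
      using Or unfolding oracle_for_def by blast
    \<comment> \<open>The oracle answers for some model with this encoding; injectivity of the
      encoding makes it the intended one.\<close>
    then obtain m' where m': "enc_ergm g.model = enc_ergm m'" "Or (enc_ergm g.model) = enc_rat (partition_function m')"
      "uses_features_from S m'" unfolding ergm_partition_def by blast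
    then have "Or (enc_ergm g.model) = enc_rat ?Z"
      using enc_ergm_inject[OF S u m'(3) m'(1)] by simp
    then obtain s' where s': "run read_off (s(2 := Or (rev (s 2)), 3 := [True])) s' (40 * (length (bin q) + b + poly pE n) + 100)"
      "s' 1 = rev (drop (b + poly pE n) (bin q))"
      using run_read_off[OF q(1), of "s(2 := Or (rev (s 2)), 3 := [True])" "poly pE n"] s by auto
    have le: "40 * (length (bin q) + b + poly pE n) + 100 \<le>
       40 * ((poly pM n + 1 + (?d n + poly pE n)) + ?d n + poly pE n) + 100"
    proof -
      have "40 * (l + b + e) + 100 \<le> 40 * ((u + 1 + (D + e)) + D + e) + 100"
        if "b \<le> D" "l \<le> u + 1 + (b + e)" for b D l u e :: nat using that by simp
      from this[OF q(3,4)] show ?thesis .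
    qed
    from M(2)[where A = Or, OF s(1,2) run_weaken[OF s'(1) refl le]] have "outputs_within Or M x (bin (f x)) (?t n)"
      by (simp only: s'(2) q(2) rev_rev_ident)
    from outputs_within_mono[OF this p] show ?thesis by (simp only: n_def)
  qed
  then show ?thesis unfolding poly_time_reducible_def using M(1) by blast
qed

end

lemma (in tableau) tiles_nonempty: "tiles M \<noteq> {}"
  using tile_of_tiles[OF conf_valid] by blast

theorem sharpP_hard_ergm:
  assumes S: "\<forall>F\<in>S. simple_graph F" and F: "F \<in> S" "3 \<le> graph_order F"
  shows "sharpP_hard (ergm_partition S)"
  unfolding sharpP_hard_def
proof
  fix f assume "f \<in> sharpP"
  then obtain V pp where V: "poly_time_fun V"
    and f: "\<And>x. f x = card {y. length y = poly pp (length x) \<and> V (enc_pair x y) = [True]}"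
    by (auto simp: sharpP_def)
  then obtain M pr where M: "turing_machine M"
    and out: "\<And>x. outputs_within no_oracle M x (V x) (poly pr (length x))"
    by (auto simp: poly_time_fun_def)
  define R where "R = card (tiles M)"
  obtain e where "bij_betw e {0..<R} (tiles M)"
    unfolding R_def using ex_bij_betw_nat_finite[OF finite_tiles] by blast
  then have e: "bij_betw e {..<R} (tiles M)" by (simp add: atLeast0LessThan)
  define A where "A c a = allowed M c (e a)" for c a
  \<comment> \<open>The four tables belong to the offsets \<open>1\<close>, \<open>G - 1\<close>,
    \<open>G\<close> and \<open>G + 1\<close>, in the order of \<open>off4\<close>.\<close>
  define C where "C d a b = (if d = 1 then compat_h M (e a) (e b) else if d = 2 then compat_move M Go_Left (e a) (e b)
     else if d = 3 then compat_v M (e a) (e b) else compat_move M Go_Right (e a) (e b))" for d a b :: nat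
  \<comment> \<open>The side of the grid is the running time plus 4, enlarged so that encoded input
    and witness fit beside the border.\<close>
  have tab: "tableau M V (enc_word x) (poly pp (length x)) (poly pr (2 * length x + 1 + poly pp (length x)))
     (poly pr (2 * length x + 1 + poly pp (length x)) + 4 + poly pp (length x) + 2 * length x + 2)" for x
  proof
    fix y :: "bool list" assume "length y = poly pp (length x)"
    moreover have "length (enc_word x) = 2 * length x + 1" by (induction x) auto
    ultimately show "outputs_within no_oracle M (enc_word x @ y) (V (enc_word x @ y)) (poly pr (2 * length x + 1 + poly pp (length x)))"
      using out[of "enc_word x @ y"] by simp
  next
    have "length (enc_word x) = 2 * length x + 1" by (induction x) auto
    then show "length (enc_word x) + poly pp (length x) + 2
      \<le> poly pr (2 * length x + 1 + poly pp (length x)) + 4 + poly pp (length x) + 2 * length x + 2" by simp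
  qed (use M in auto)
  have "tiles M \<noteq> {}" by (rule tableau.tiles_nonempty[OF tab])
  then have R: "1 \<le> R" using finite_tiles[of M] by (simp add: R_def Suc_le_eq card_gt_0_iff)
  interpret reduction F R A C pp pr
    by unfold_locales (use F R in auto)
  show "poly_time_reducible f (ergm_partition S)"
  proof (rule reduce[OF _ F(1) S])
    show "simple_graph F" using S F by blast
    fix x :: "bool list"
    define n where "n = length x"
    define G where "G = poly pr (2 * n + 1 + poly pp n) + 4 + poly pp n + 2 * n + 2"
    have "poly [:1, 2:] n + poly pp n = 2 * n + 1 + poly pp n" by simp
    then have "poly pB0 n = poly pr (2 * n + 1 + poly pp n) + 4"
      by (simp only: pB0_def poly_add poly_pcompose) simp
    then have G: "G = poly pG2 n + 2" by (simp add: G_def pG2_def)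
    have L: "poly pL n = G * G" by (simp add: G pL_def algebra_simps)
    interpret T: tableau M V "enc_word x" "poly pp n" "poly pr (2 * n + 1 + poly pp n)" G
      using tab[of x] by (simp add: n_def G_def)
    have U: "U x ! l = code (enc_word x) (poly pp n) G (l div G) (l mod G)" if "l < G * G" for l
    proof -
      have "U x = map (\<lambda>l. code (enc_word x) (poly pp n) G (l div G) (l mod G)) [0..<G * G]"
        unfolding U_def n_def[symmetric] G
        by (rule codes_code) (use pG2_eq[of n] length_enc_word[of x] in \<open>auto simp: n_def\<close>)
      then show ?thesis using that by simp
    qed
    let ?f = "\<lambda>a. restrict (\<lambda>l. e (a l)) {..<G * G}"
    let ?g = "\<lambda>b. restrict (\<lambda>l. inv_into {..<R} e (b l)) {..<G * G}"
    have eR: "a < R \<Longrightarrow> e a \<in> tiles M" for a using e by (auto simp: bij_betw_def)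
    have ie: "b \<in> tiles M \<Longrightarrow> e (inv_into {..<R} e b) = b \<and> inv_into {..<R} e b < R" for b
      using e by (metis bij_betw_def f_inv_into_f inv_into_into lessThan_iff)
    have ei: "a < R \<Longrightarrow> inv_into {..<R} e (e a) = a" for a
      using e by (simp add: bij_betw_inv_into_left)
    have off: "off4 (poly pG2 n) 1 = 1" "off4 (poly pG2 n) 2 = G - 1" "off4 (poly pG2 n) 3 = G" "off4 (poly pG2 n) 4 = G + 1"
      by (simp_all add: off4_def G)
    have G4: "4 \<le> G" by (simp add: G_def)
    have main: "?f a \<in> T.tilings \<longleftrightarrow> a \<in> sels (G * G) R (al x) (bad x)" if a: "a \<in> {..<G * G} \<rightarrow>\<^sub>E {..<R}" for a
    proof -
      have 1: "(\<forall>t<G. \<forall>h<G. allowed M (code (enc_word x) (poly pp n) G t h) (?f a (t * G + h))) \<longleftrightarrow>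
          (\<forall>l<G * G. al x l (a l))"
      proof
        assume l: "\<forall>t<G. \<forall>h<G. allowed M (code (enc_word x) (poly pp n) G t h) (?f a (t * G + h))"
        show "\<forall>l<G * G. al x l (a l)"
        proof (intro allI impI)
          fix l assume lt: "l < G * G"
          then have "l div G < G" "l mod G < G" using G4 by (auto simp: less_mult_imp_div_less)
          with l have "allowed M (code (enc_word x) (poly pp n) G (l div G) (l mod G)) (?f a (l div G * G + l mod G))" by blast
          then show "al x l (a l)" using lt U[OF lt] by (simp add: al_def A_def)
        qed
      next
        assume r: "\<forall>l<G * G. al x l (a l)"
        show "\<forall>t<G. \<forall>h<G. allowed M (code (enc_word x) (poly pp n) G t h) (?f a (t * G + h))"
        proof (intro allI impI)
          fix t h assume th: "t < G" "h < G"
          then have lt: "t * G + h < G * G" by (rule T.cell_less)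
          then show "allowed M (code (enc_word x) (poly pp n) G t h) (?f a (t * G + h))"
            using r U[OF lt] th by (auto simp: al_def A_def)
        qed
      qed
      have 2: "(\<forall>l<G * G. \<forall>l'<G * G. l \<noteq> l' \<longrightarrow> \<not> bad x l (a l) l' (a l')) \<longleftrightarrow>
        (\<forall>l. l + 1 < G * G \<longrightarrow> compat_h M (?f a l) (?f a (l + 1))) \<and>
        (\<forall>l. l + (G - 1) < G * G \<longrightarrow> compat_move M Go_Left (?f a l) (?f a (l + (G - 1)))) \<and>
        (\<forall>l. l + G < G * G \<longrightarrow> compat_v M (?f a l) (?f a (l + G))) \<and>
        (\<forall>l. l + (G + 1) < G * G \<longrightarrow> compat_move M Go_Right (?f a l) (?f a (l + (G + 1))))"
        (is "?l \<longleftrightarrow> ?r")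
      proof -
        have "?l \<longleftrightarrow> (\<forall>d\<in>{1, 2, 3, 4}. \<forall>l. l + off4 (poly pG2 n) d < G * G \<longrightarrow> C d (a l) (a (l + off4 (poly pG2 n) d)))"
        proof -
          \<comment> \<open>Positive offsets make the condition \<open>l \<noteq> l'\<close> in
            \<open>sels\<close> automatic.\<close>
          have "0 < off4 (poly pG2 n) d" if "d \<in> {1, 2, 3, 4}" for d using that by (auto simp: off4_def)
          then show ?thesis unfolding bad_def n_def[symmetric]
            by (smt (verit) add_lessD1 less_add_same_cancel1 nat_less_le)
        qed
        also have "\<dots> \<longleftrightarrow> ?r"
          using G4 by (auto simp: off off(1)[unfolded One_nat_def] C_def)
        finally show ?thesis .
      qed
      have 3: "?f a \<in> {..<G * G} \<rightarrow>\<^sub>E tiles M" using a eR by (auto simp: PiE_def Pi_def)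
      show ?thesis
        unfolding T.tilings_def sels_def mem_Collect_eq using a 1 2 3 by blast
    qed
    have "bij_betw ?f (sels (G * G) R (al x) (bad x)) T.tilings"
    proof (rule bij_betwI[of _ _ _ ?g])
      show "?f \<in> sels (G * G) R (al x) (bad x) \<rightarrow> T.tilings"
        using main by (auto simp: sels_def)
      have tE: "b \<in> {..<G * G} \<rightarrow>\<^sub>E tiles M" if "b \<in> T.tilings" for b
        using that by (simp add: T.tilings_def)
      have fg: "?f (?g b) = b" if b: "b \<in> T.tilings" for b
      proof
        fix l
        show "?f (?g b) l = b l"
          using ie[of "b l"] PiE_mem[OF tE[OF b], of l] PiE_arb[OF tE[OF b], of l] by (cases "l < G * G") simp_all
      qed
      have gE: "?g b \<in> {..<G * G} \<rightarrow>\<^sub>E {..<R}" if b: "b \<in> T.tilings" for b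
        using ie PiE_mem[OF tE[OF b]] by simp
      show "?g \<in> T.tilings \<rightarrow> sels (G * G) R (al x) (bad x)"
        using main[OF gE] fg by auto
      show "?f (?g b) = b" if "b \<in> T.tilings" for b using fg that .
      show "?g (?f a) = a" if "a \<in> sels (G * G) R (al x) (bad x)" for a
      proof
        have aE: "a \<in> {..<G * G} \<rightarrow>\<^sub>E {..<R}" using that by (simp add: sels_def)
        fix l
        show "?g (?f a) l = a l"
          using ei[of "a l"] PiE_mem[OF aE, of l] PiE_arb[OF aE, of l] by (cases "l < G * G") simp_all
      qed
    qed
    then have "card (sels (G * G) R (al x) (bad x)) = card T.tilings" by (rule bij_betw_same_card)
    also have "\<dots> = card {y. length y = poly pp n \<and> V (enc_word x @ y) = [True]}"
      by (rule T.card_tilings[symmetric])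
    finally show "f x = card (sels (poly pL (length x)) R (al x) (bad x))"
      by (simp add: f enc_pair_def n_def[symmetric] L)
  qed
qed

section \<open>Models with features on at most two vertices\<close>

fun fgraph :: "feature \<Rightarrow> graph" where
  "fgraph (Indicator F vs) = F"
| "fgraph (Count F) = F"

definition ebit :: "feature \<Rightarrow> bool" where
  "ebit f \<longleftrightarrow> {0, 1} \<in> graph_edges (fgraph f)"

fun relv :: "nat set \<Rightarrow> feature \<Rightarrow> bool" where
  "relv e (Indicator F vs) \<longleftrightarrow> graph_order F = 2 \<and> set vs = e"
| "relv e (Count F) \<longleftrightarrow> graph_order F = 2"

text \<open>The part of a feature's value that no edge influences. For order 0 it is 1 even for a
  count, as the empty vertex set is the one copy.\<close>

fun cnum :: "nat \<Rightarrow> feature \<Rightarrow> nat" where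
  "cnum n (Indicator F vs) = (if graph_order F = 2 then 0 else 1)"
| "cnum n (Count F) = (if graph_order F = 2 then 0 else if graph_order F = 1 then n else 1)"

definition small_feature :: "nat \<Rightarrow> feature \<Rightarrow> bool" where
  "small_feature n f \<longleftrightarrow> simple_graph (fgraph f) \<and> graph_order (fgraph f) < 3 \<and>
     (case f of Indicator F vs \<Rightarrow> length vs = graph_order F \<and> distinct vs \<and> set vs \<subseteq> {..<n} | Count F \<Rightarrow> True)"

lemma singleton_not_edge: "simple_graph G \<Longrightarrow> {a} \<notin> graph_edges G"
  by (auto simp: simple_graph_def)

lemma induces_small:
  assumes "simple_graph F" "simple_graph G"
  shows "graph_order F = 0 \<Longrightarrow> induces_copy F v G" "graph_order F = 1 \<Longrightarrow> induces_copy F v G"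
    "graph_order F = 2 \<Longrightarrow> induces_copy F v G \<longleftrightarrow> ({v 0, v 1} \<in> graph_edges G \<longleftrightarrow> {0, 1} \<in> graph_edges F)"
  using singleton_not_edge[OF assms(1)] singleton_not_edge[OF assms(2)]
  by (auto simp: induces_copy_def less_Suc_eq numeral_2_eq_2 insert_commute)

text \<open>Without loops, a graph on at most one vertex is induced everywhere, and one on two
  vertices prescribes the status of a single pair. So a feature is a constant plus a sum over
  pairs.\<close>

lemma feature_value_small:
  assumes f: "small_feature n f" and G: "simple_graph G" "graph_order G = n"
  shows "feature_value f G = cnum n f + card {e \<in> pairs n. relv e f \<and> (e \<in> graph_edges G \<longleftrightarrow> ebit f)}"
proof (cases f)
  case (Indicator F vs)
  then have F: "simple_graph F" "graph_order F < 3" "length vs = graph_order F" "distinct vs" "set vs \<subseteq> {..<n}"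
    using f by (auto simp: small_feature_def)
  consider "graph_order F = 0" | "graph_order F = 1" | "graph_order F = 2" using F(2) by linarith
  then show ?thesis
  proof cases
    case 3
    then obtain a b where vs: "vs = [a, b]" using F(3) by (auto simp: length_Suc_conv numeral_2_eq_2)
    then have ab: "{a, b} \<in> pairs n" using F by (auto simp: pairs_def)
    have "{e \<in> pairs n. relv e f \<and> (e \<in> graph_edges G \<longleftrightarrow> ebit f)} =
        (if {a, b} \<in> graph_edges G \<longleftrightarrow> ebit f then {{a, b}} else {})"
      using ab 3 by (auto simp: Indicator vs)
    then show ?thesis
      using induces_small(3)[OF F(1) G(1) 3, of "\<lambda>i. vs ! i"] 3 by (auto simp: Indicator vs ebit_def)
  qed (use induces_small[OF F(1) G(1)] in \<open>auto simp: Indicator\<close>)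
next
  case (Count F)
  then have F: "simple_graph F" "graph_order F < 3" using f by (auto simp: small_feature_def)
  let ?S = "{U. U \<subseteq> {..<graph_order G} \<and> (\<exists>v. bij_betw v {..<graph_order F} U \<and> induces_copy F v G)}"
  consider "graph_order F = 0" | "graph_order F = 1" | "graph_order F = 2" using F(2) by linarith
  then show ?thesis
  proof cases
    case 1
    then have "?S = {{}}" using induces_small(1)[OF F(1) G(1)] by (auto simp: bij_betw_def)
    then show ?thesis using 1 by (simp add: Count)
  next
    case 2
    have "?S = (\<lambda>i. {i}) ` {..<n}"
    proof
      show "?S \<subseteq> (\<lambda>i. {i}) ` {..<n}" using 2 G by (auto simp: bij_betw_def lessThan_Suc)
      show "(\<lambda>i. {i}) ` {..<n} \<subseteq> ?S"
      proof
        fix U assume "U \<in> (\<lambda>i. {i}) ` {..<n}"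
        then obtain i where i: "U = {i}" "i < n" by auto
        then have "bij_betw (\<lambda>_. i) {..<graph_order F} U" using 2 by (auto simp: bij_betw_def lessThan_Suc)
        then show "U \<in> ?S" using induces_small(2)[OF F(1) G(1) 2] i G by auto
      qed
    qed
    then show ?thesis using 2 by (simp add: Count card_image inj_on_def)
  next
    case 3
    have two: "{..<graph_order F} = {0, 1}" using 3 by auto
    have "?S = {e \<in> pairs n. e \<in> graph_edges G \<longleftrightarrow> ebit f}"
    proof
      show "?S \<subseteq> {e \<in> pairs n. e \<in> graph_edges G \<longleftrightarrow> ebit f}"
      proof
        fix U assume "U \<in> ?S"
        then obtain v where v: "U \<subseteq> {..<n}" "bij_betw v {0, 1} U" "induces_copy F v G" using two G by auto
        then have "U = {v 0, v 1}" "card U = 2" by (auto simp: bij_betw_def card_image)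
        then show "U \<in> {e \<in> pairs n. e \<in> graph_edges G \<longleftrightarrow> ebit f}"
          using v induces_small(3)[OF F(1) G(1) 3, of v] by (auto simp: pairs_def ebit_def Count)
      qed
      show "{e \<in> pairs n. e \<in> graph_edges G \<longleftrightarrow> ebit f} \<subseteq> ?S"
      proof
        fix e assume e: "e \<in> {e \<in> pairs n. e \<in> graph_edges G \<longleftrightarrow> ebit f}"
        then obtain a b where ab: "e = {a, b}" "a \<noteq> b" by (auto simp: pairs_def card_2_iff)
        let ?v = "\<lambda>i::nat. if i = 0 then a else b"
        have "bij_betw ?v {..<graph_order F} e" unfolding two using ab by (auto simp: bij_betw_def)
        moreover have "induces_copy F ?v G"
          using induces_small(3)[OF F(1) G(1) 3, of ?v] e ab by (auto simp: ebit_def Count)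
        ultimately show "e \<in> ?S" using e G by (auto simp: pairs_def)
      qed
    qed
    then show ?thesis using 3 by (simp add: Count)
  qed
qed

definition negs :: "nat set \<Rightarrow> (feature \<times> int) list \<Rightarrow> (feature \<times> int) list" where
  "negs e fs = filter (\<lambda>(f, w). relv e f \<and> w < 0) fs"

text \<open>For every negative weight \<open>w\<close>, a factor \<open>2 powi w\<close> is put in
  front of the pair's sum, and \<open>nat \<bar>w\<bar>\<close> is added in the alternative where
  the feature does not hold. Both alternatives then have natural exponents, and no signed addition
  is needed.\<close>

definition addw :: "bool \<Rightarrow> nat set \<Rightarrow> (feature \<times> int) list \<Rightarrow> nat" where
  "addw b e fs = (\<Sum>(f, w)\<leftarrow>fs. if relv e f \<and> (ebit f \<noteq> (w < 0)) = b then nat \<bar>w\<bar> else 0)"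

definition pair_ess :: "(feature \<times> int) list \<Rightarrow> nat set \<Rightarrow> int list list" where
  "pair_ess fs e = map (\<lambda>(f, w). [w]) (negs e fs) @ [[int (addw True e fs), int (addw False e fs)]]"

definition const_ess :: "nat \<Rightarrow> (feature \<times> int) list \<Rightarrow> int list list" where
  "const_ess n fs = concat (map (\<lambda>(f, w). replicate (cnum n f) [w]) fs)"

definition ess_of :: "nat \<Rightarrow> (feature \<times> int) list \<Rightarrow> int list list" where
  "ess_of n fs = const_ess n fs @ concat (map (\<lambda>v. concat (map (\<lambda>u. pair_ess fs {u, v}) [0..<v])) [0..<n])"

lemma factored_append [simp]:
  "factored_value (xs @ ys) = factored_value xs * factored_value ys" "factored_value [] = 1"
  by (auto simp: factored_value_def)

lemma factored_concat: "factored_value (concat xss) = (\<Prod>xs\<leftarrow>xss. factored_value xs)"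
  by (induction xss) auto

lemma powi_sum_list: "(\<Prod>y\<leftarrow>ys. (2 :: rat) powi g y) = 2 powi (\<Sum>y\<leftarrow>ys. g y)"
  by (induction ys) (auto simp: power_int_add)

lemma powi_sum: "finite A \<Longrightarrow> (2 :: rat) powi (\<Sum>x\<in>A. g x) = (\<Prod>x\<in>A. 2 powi g x)"
  by (induction A rule: finite_induct) (auto simp: power_int_add)

lemma factored_const: "factored_value (const_ess n fs) = 2 powi (\<Sum>(f, w)\<leftarrow>fs. int (cnum n f) * w)"
proof (induction fs)
  case (Cons fw fs)
  have "factored_value (replicate k [w]) = 2 powi (int k * w)" for k w
    by (induction k) (auto simp: factored_value_def power_int_add algebra_simps)
  then show ?case using Cons by (auto simp: const_ess_def power_int_add split: prod.splits)
qed (simp add: const_ess_def)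

definition pw :: "(feature \<times> int) list \<Rightarrow> nat set \<Rightarrow> bool \<Rightarrow> int" where
  "pw fs e b = (\<Sum>(f, w)\<leftarrow>fs. if relv e f \<and> b = ebit f then w else 0)"

lemma factored_pair: "factored_value (pair_ess fs e) = 2 powi pw fs e True + 2 powi pw fs e False"
proof -
  have n: "factored_value (map (\<lambda>(f, w). [w]) (negs e fs)) = 2 powi (\<Sum>(f, w)\<leftarrow>fs. if relv e f \<and> w < 0 then w else 0)"
  proof (induction fs)
    case (Cons fw fs)
    then show ?case
      by (cases "relv e (fst fw) \<and> snd fw < 0")
        (auto simp: negs_def factored_value_def power_int_add case_prod_unfold)
  qed (simp add: negs_def)
  have eq: "(\<Sum>(f, w)\<leftarrow>fs. if relv e f \<and> w < 0 then w else 0) + int (addw b e fs) = pw fs e b" for b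
    by (induction fs) (auto simp: addw_def pw_def)
  have "(2 :: rat) powi (\<Sum>(f, w)\<leftarrow>fs. if relv e f \<and> w < 0 then w else 0) * 2 powi int (addw b e fs) = 2 powi pw fs e b" for b
    unfolding eq[symmetric] by (rule power_int_add[symmetric]) simp
  moreover have "factored_value [[int (addw True e fs), int (addw False e fs)]] =
      2 powi int (addw True e fs) + 2 powi int (addw False e fs)" by (simp add: factored_value_def)
  ultimately show ?thesis
    unfolding pair_ess_def factored_append n by (simp only: distrib_left)
qed

text \<open>Choosing a set means choosing one summand in every factor. This is the point where the
  independence of the vertex pairs turns the sum over graphs into a product.\<close>

lemma sum_Pow_prod:
  fixes f g :: "'a \<Rightarrow> rat"
  assumes "finite A"
  shows "(\<Sum>E\<in>Pow A. \<Prod>e\<in>A. if e \<in> E then f e else g e) = (\<Prod>e\<in>A. f e + g e)"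
  using assms
proof (induction A rule: finite_induct)
  case (insert a A)
  have "(\<Sum>E\<in>Pow (insert a A). \<Prod>e\<in>insert a A. if e \<in> E then f e else g e) =
      (\<Sum>E\<in>Pow A. \<Prod>e\<in>insert a A. if e \<in> E then f e else g e) +
      (\<Sum>E\<in>insert a ` Pow A. \<Prod>e\<in>insert a A. if e \<in> E then f e else g e)"
    unfolding Pow_insert using insert by (intro sum.union_disjoint) auto
  also have "(\<Sum>E\<in>insert a ` Pow A. \<Prod>e\<in>insert a A. if e \<in> E then f e else g e) =
      (\<Sum>E\<in>Pow A. \<Prod>e\<in>insert a A. if e \<in> insert a E then f e else g e)"
    using insert by (intro sum.reindex_cong[of "insert a"]) (auto simp: inj_on_def)
  also have "\<dots> = (\<Sum>E\<in>Pow A. f a * (\<Prod>e\<in>A. if e \<in> E then f e else g e))"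
    using insert by (intro sum.cong refl) (auto intro!: prod.cong arg_cong[where f = "\<lambda>x. f a * x"])
  also have "(\<Sum>E\<in>Pow A. \<Prod>e\<in>insert a A. if e \<in> E then f e else g e) =
      (\<Sum>E\<in>Pow A. g a * (\<Prod>e\<in>A. if e \<in> E then f e else g e))"
    using insert by (intro sum.cong refl) auto
  finally show ?case
    using insert by (simp add: sum_distrib_left[symmetric] algebra_simps)
qed simp

lemma prod_pairs: "(\<Prod>e\<in>pairs n. h e) = (\<Prod>v<n. \<Prod>u<v. h {u, v :: nat})"
  for h :: "nat set \<Rightarrow> rat"
proof (induction n)
  case 0
  have "pairs 0 = {}" by (auto simp: pairs_def)
  then show ?case by simp
next
  case (Suc n)
  have "pairs (Suc n) = pairs n \<union> (\<lambda>u. {u, n}) ` {..<n}"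
  proof
    show "pairs (Suc n) \<subseteq> pairs n \<union> (\<lambda>u. {u, n}) ` {..<n}"
    proof
      fix e assume e: "e \<in> pairs (Suc n)"
      then obtain a b where ab: "e = {a, b}" "a < b" "b < Suc n"
        by (auto simp: pairs_def card_2_iff) (metis insert_commute linorder_neqE_nat)
      then show "e \<in> pairs n \<union> (\<lambda>u. {u, n}) ` {..<n}" by (cases "b = n") (auto simp: pairs_def)
    qed
  qed (auto simp: pairs_def)
  moreover have "pairs n \<inter> (\<lambda>u. {u, n}) ` {..<n} = {}" by (auto simp: pairs_def)
  moreover have "inj_on (\<lambda>u. {u, n}) {..<n}" by (auto simp: inj_on_def doubleton_eq_iff)
  ultimately show ?case
    using Suc finite_pairs[of n] by (simp add: prod.union_disjoint prod.reindex)
qed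

theorem factored_ess_of:
  assumes "\<forall>(f, w)\<in>set fs. small_feature n f"
  shows "factored_value (ess_of n fs) = partition_function (ERGM n fs)"
proof -
  let ?c = "\<Sum>(f, w)\<leftarrow>fs. int (cnum n f) * w"
  have dens: "density (ERGM n fs) (Graph n E) = 2 powi ?c * (\<Prod>e\<in>pairs n. if e \<in> E then 2 powi pw fs e True else 2 powi pw fs e False)"
    if E: "E \<in> Pow (pairs n)" for E
  proof -
    have G: "simple_graph (Graph n E)" "graph_order (Graph n E) = n" using E by (auto simp: simple_graph_def pairs_def)
    have "(\<Sum>(f, w)\<leftarrow>fs. int (feature_value f (Graph n E)) * w) = ?c + (\<Sum>e\<in>pairs n. pw fs e (e \<in> E))"
      using assms
    proof (induction fs)
      case (Cons fw fs)
      obtain f w where fw: "fw = (f, w)" by force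
      have "int (feature_value f (Graph n E)) =
          int (cnum n f) + int (card {e \<in> pairs n. relv e f \<and> (e \<in> E \<longleftrightarrow> ebit f)})"
        using feature_value_small[of n f "Graph n E"] Cons.prems G fw by auto
      also have "int (card {e \<in> pairs n. relv e f \<and> (e \<in> E \<longleftrightarrow> ebit f)}) =
          (\<Sum>e\<in>pairs n. if relv e f \<and> (e \<in> E) = ebit f then 1 else 0)"
        using finite_pairs by (simp add: sum.If_cases Int_def)
      finally have "int (feature_value f (Graph n E)) * w = int (cnum n f) * w +
          (\<Sum>e\<in>pairs n. if relv e f \<and> (e \<in> E) = ebit f then w else 0)"
        by (simp add: algebra_simps sum_distrib_left if_distrib cong: if_cong)
      then show ?case using Cons by (simp add: fw pw_def sum.distrib)
    qed (simp add: pw_def)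
    then have "density (ERGM n fs) (Graph n E) = 2 powi ?c * 2 powi (\<Sum>e\<in>pairs n. pw fs e (e \<in> E))"
      by (simp add: density_def case_prod_unfold powi_sum_list power_int_add)
    also have "(2 :: rat) powi (\<Sum>e\<in>pairs n. pw fs e (e \<in> E)) = (\<Prod>e\<in>pairs n. 2 powi pw fs e (e \<in> E))"
      by (rule powi_sum[OF finite_pairs])
    also have "\<dots> = (\<Prod>e\<in>pairs n. if e \<in> E then 2 powi pw fs e True else 2 powi pw fs e False)"
      by (intro prod.cong refl) auto
    finally show ?thesis .
  qed
  have "graphs_on n = Graph n ` Pow (pairs n)"
  proof
    show "graphs_on n \<subseteq> Graph n ` Pow (pairs n)"
    proof
      fix G assume "G \<in> graphs_on n"
      then have "G = Graph n (graph_edges G)" "graph_edges G \<in> Pow (pairs n)"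
        by (auto simp: graphs_on_def simple_graph_def pairs_def)
      then show "G \<in> Graph n ` Pow (pairs n)" by blast
    qed
    show "Graph n ` Pow (pairs n) \<subseteq> graphs_on n"
      unfolding graphs_on_def simple_graph_def pairs_def by (intro image_subsetI) simp
  qed
  then have "partition_function (ERGM n fs) = (\<Sum>E\<in>Pow (pairs n). density (ERGM n fs) (Graph n E))"
    by (simp add: partition_function_def sum.reindex inj_on_def)
  also have "\<dots> = 2 powi ?c * (\<Sum>E\<in>Pow (pairs n). \<Prod>e\<in>pairs n. if e \<in> E then 2 powi pw fs e True else 2 powi pw fs e False)"
    unfolding sum_distrib_left by (intro sum.cong refl dens)
  also have "\<dots> = 2 powi ?c * (\<Prod>e\<in>pairs n. factored_value (pair_ess fs e))"
    by (simp only: sum_Pow_prod[OF finite_pairs] factored_pair)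
  also have "\<dots> = factored_value (ess_of n fs)"
  proof -
    have "(\<Prod>x\<leftarrow>map h [0..<m]. x) = (\<Prod>i<m. h i)" for h :: "nat \<Rightarrow> rat" and m
      by (induction m) (auto simp: mult.commute)
    then have l: "prod_list (map h [0..<m]) = (\<Prod>i<m. h i)" for h :: "nat \<Rightarrow> rat" and m by simp
    show ?thesis
      by (simp add: ess_of_def factored_const factored_concat prod_pairs l comp_def)
  qed
  finally show ?thesis by simp
qed

section \<open>Binary arithmetic\<close>

text \<open>Horner evaluation from the leading digit; since \<open>bin\<close> starts with the least
  significant bit, it applies to reversed words, as they come off a stack.\<close>

fun msb_val :: "nat \<Rightarrow> bool list \<Rightarrow> nat" where
  "msb_val a [] = a"
| "msb_val a (b # bs) = msb_val (2 * a + of_bool b) bs"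

lemma msb_val_append: "msb_val a (xs @ ys) = msb_val (msb_val a xs) ys"
  by (induction xs arbitrary: a) auto

lemma msb_val_bin: "msb_val 0 (rev (bin n)) = n"
proof (induction n rule: less_induct)
  case (less n)
  show ?case
  proof (cases "n = 0")
    case False
    then have "msb_val 0 (rev (bin n)) = 2 * (n div 2) + of_bool (odd n)"
      using less[of "n div 2"] by (simp add: bin_Cons msb_val_append)
    then show ?thesis by simp
  qed simp
qed

lemma msb_val_ge: "a \<le> msb_val a bs"
proof (induction bs arbitrary: a)
  case (Cons b bs)
  show ?case using Cons[of "2 * a + of_bool b"] by simp
qed simp

text \<open>Takes time polynomial in the value and not in its length, so it is applied only to
  numbers with a bound on the value itself.\<close>

definition to_unary :: "nat \<Rightarrow> nat \<Rightarrow> cmd" where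
  "to_unary r u = While (NE r) (pour u 8 ;; While (NE 8) (Pop 8 ;; Push u True ;; Push u True) ;;
     If (TT r) (Push u True) Skip ;; Pop r)"

lemma run_double:
  assumes "4 \<le> u" "u \<noteq> 8" "s 8 = un m" "s u = un a"
  shows "run (While (NE 8) (Pop 8 ;; Push u True ;; Push u True)) s (s(8 := [], u := un (2 * m + a))) (9 * m + 1)"
proof -
  define S where "S i = s(8 := un (m - i), u := un (2 * i + a))" for i
  have "run (While (NE 8) (Pop 8 ;; Push u True ;; Push u True)) (S 0) (S m) (m * (7 + 2) + 1)"
  proof (rule run_While[where S = S])
    fix i assume i: "i < m"
    have l: "m - i = Suc (m - Suc i)" using i by simp
    have "run (Pop 8 ;; Push u True ;; Push u True) (S i) (S (Suc i)) (1 + (2 + 2 + 1) + 1)"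
    proof (intro run_Seq)
      show "run (Pop 8) (S i) ((S i)(8 := un (m - Suc i))) 1"
        using assms by (intro run_weaken[OF run_Pop]) (auto simp: S_def l fun_eq_iff)
      show "run (Push u True) ((S i)(8 := un (m - Suc i))) ((S i)(8 := un (m - Suc i), u := un (Suc (2 * i + a)))) 2"
        using assms by (intro run_weaken[OF run_Push]) (auto simp: S_def)
      show "run (Push u True) ((S i)(8 := un (m - Suc i), u := un (Suc (2 * i + a)))) (S (Suc i)) 2"
        using assms by (intro run_weaken[OF run_Push]) (auto simp: S_def fun_eq_iff)
    qed
    then show "run (Pop 8 ;; Push u True ;; Push u True) (S i) (S (Suc i)) 7" by simp
  qed (use assms in \<open>auto simp: S_def\<close>)
  moreover have "S 0 = s" using assms by (auto simp: S_def fun_eq_iff)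
  ultimately have "run (While (NE 8) (Pop 8 ;; Push u True ;; Push u True)) s (S m) (m * (7 + 2) + 1)" by simp
  then show ?thesis by (elim run_weaken) (auto simp: S_def)
qed

lemma run_to_unary:
  assumes "4 \<le> u" "4 \<le> r" "u \<noteq> 8" "r \<noteq> 8" "u \<noteq> r" "s 8 = []" "s u = un a" "msb_val a (s r) \<le> B"
  shows "run (to_unary r u) s (s(r := [], u := un (msb_val a (s r)))) (length (s r) * (16 * B + 20) + 1)"
  using assms(6-)
proof (induction "s r" arbitrary: s a)
  case Nil
  then show ?case
    unfolding to_unary_def using assms by (intro run_weaken[OF run_While_end]) (auto simp: fun_eq_iff)
next
  case (Cons b bs)
  have r: "s r = b # bs" using Cons.hyps(2) by simp
  have aB: "2 * a + of_bool b \<le> B"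
    using Cons.prems(3) msb_val_ge[of "2 * a + of_bool b" bs] by (simp add: r)
  let ?s1 = "s(u := un (2 * a + of_bool b), r := bs)"
  have "run (pour u 8 ;; While (NE 8) (Pop 8 ;; Push u True ;; Push u True) ;; If (TT r) (Push u True) Skip ;; Pop r) s ?s1
     ((7 * a + 1) + ((9 * a + 1) + ((2 + 1) + 1 + 1) + 1) + 1)"
  proof (intro run_Seq)
    show "run (pour u 8) s (s(u := [], 8 := un a)) (7 * a + 1)"
      using assms Cons.prems by (intro run_weaken[OF run_pour]) auto
    show "run (While (NE 8) (Pop 8 ;; Push u True ;; Push u True)) (s(u := [], 8 := un a)) (s(u := un (2 * a))) (9 * a + 1)"
      using assms Cons.prems by (intro run_weaken[OF run_double[where m = a and a = 0]]) (auto simp: fun_eq_iff)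
    show "run (If (TT r) (Push u True) Skip) (s(u := un (2 * a))) (s(u := un (2 * a + of_bool b))) (2 + 1)"
    proof (rule run_If)
      show "run (Push u True) (s(u := un (2 * a))) (s(u := un (2 * a + of_bool b))) 2" if "holds (TT r) (s(u := un (2 * a)))"
        using that assms r by (intro run_weaken[OF run_Push]) auto
      show "run Skip (s(u := un (2 * a))) (s(u := un (2 * a + of_bool b))) 2" if "\<not> holds (TT r) (s(u := un (2 * a)))"
        using that assms r by (intro run_weaken[OF run_Skip]) auto
    qed (use assms in simp)
    show "run (Pop r) (s(u := un (2 * a + of_bool b))) ?s1 1"
      using assms r by (intro run_weaken[OF run_Pop]) auto
  qed
  then have 1: "run (pour u 8 ;; While (NE 8) (Pop 8 ;; Push u True ;; Push u True) ;; If (TT r) (Push u True) Skip ;; Pop r) s ?s1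
     (16 * B + 18)" using aB by (elim run_weaken) auto
  have "run (to_unary r u) ?s1 (?s1(r := [], u := un (msb_val (2 * a + of_bool b) (?s1 r)))) (length (?s1 r) * (16 * B + 20) + 1)"
    using assms Cons.prems r by (intro Cons.hyps(1)) auto
  then have 2: "run (to_unary r u) ?s1 (s(r := [], u := un (msb_val a (s r)))) (length bs * (16 * B + 20) + 1)"
    using assms r by (elim run_weaken) (auto simp: fun_eq_iff)
  show ?case
    unfolding to_unary_def using assms r
    by (intro run_weaken[OF run_While_step[OF _ _ 1 2[unfolded to_unary_def]]]) auto
qed

text \<open>The default \<open>False\<close> supplies leading zeros once an operand is
  exhausted.\<close>

definition tophd :: "bool list \<Rightarrow> bool" where "tophd xs \<longleftrightarrow> xs \<noteq> [] \<and> hd xs"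

definition flag :: "bool \<Rightarrow> bool list" where "flag b = (if b then [True] else [])"

lemma tophd_simps [simp]: "tophd (flag b) = b" "tophd (b # bs) = b" "\<not> tophd []"
  by (auto simp: tophd_def flag_def)

text \<open>One column of a bit-serial operation on the registers \<open>x\<close> and \<open>y\<close> with carry in register 28;
  the result bits are stacked in register 9.\<close>

definition colstep :: "(bool \<Rightarrow> bool \<Rightarrow> bool \<Rightarrow> bool) \<Rightarrow> bool \<Rightarrow> bool \<Rightarrow> bool \<Rightarrow> cmd" where
  "colstep f a b c = Push 9 ((a \<noteq> b) \<noteq> c) ;;
     (if f a b c = c then Skip else if c then Pop 28 else Push 28 True)"

definition col :: "(bool \<Rightarrow> bool \<Rightarrow> bool \<Rightarrow> bool) \<Rightarrow> nat \<Rightarrow> nat \<Rightarrow> cmd" where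
  "col f x y = If (TT x)
     (If (TT y) (If (TT 28) (colstep f True True True) (colstep f True True False))
                (If (TT 28) (colstep f True False True) (colstep f True False False)))
     (If (TT y) (If (TT 28) (colstep f False True True) (colstep f False True False))
                (If (TT 28) (colstep f False False True) (colstep f False False False)))"

lemma run_colstep:
  assumes "s 28 = flag c"
  shows "run (colstep f a b c) s (s(9 := ((a \<noteq> b) \<noteq> c) # s 9, 28 := flag (f a b c))) 5"
proof -
  have "run (Push 9 ((a \<noteq> b) \<noteq> c)) s (s(9 := ((a \<noteq> b) \<noteq> c) # s 9)) 2" by (rule run_Push) simp
  moreover have "run (if f a b c = c then Skip else if c then Pop 28 else Push 28 True) (s(9 := ((a \<noteq> b) \<noteq> c) # s 9))
     (s(9 := ((a \<noteq> b) \<noteq> c) # s 9, 28 := flag (f a b c))) 2"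
  proof (cases "f a b c = c")
    case True
    then show ?thesis using assms by (auto intro!: run_weaken[OF run_Skip] simp: fun_eq_iff)
  next
    case False
    then show ?thesis
    proof (cases c)
      case True
      then show ?thesis using False assms run_weaken[OF run_Pop[of "s(9 := ((a \<noteq> b) \<noteq> c) # s 9)" 28]]
        by (auto simp: flag_def)
    next
      case c: False
      then show ?thesis using False assms run_weaken[OF run_Push[of "s(9 := ((a \<noteq> b) \<noteq> c) # s 9)" 28 True]]
        by (auto simp: flag_def)
    qed
  qed
  ultimately show ?thesis unfolding colstep_def by (intro run_weaken[OF run_Seq]) auto
qed

lemma run_col:
  assumes "4 \<le> x" "4 \<le> y" "s 28 = flag c"
  shows "run (col f x y) s (s(9 := ((tophd (s x) \<noteq> tophd (s y)) \<noteq> c) # s 9, 28 := flag (f (tophd (s x)) (tophd (s y)) c))) 8"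
proof -
  let ?p = "\<lambda>a b c. s(9 := ((a \<noteq> b) \<noteq> c) # s 9, 28 := flag (f a b c))"
  have i: "run (If (TT j) d e) s t (n + 1)"
    if "4 \<le> j" "tophd (s j) \<Longrightarrow> run d s t n" "\<not> tophd (s j) \<Longrightarrow> run e s t n" for j d e t n
    using that by (intro run_If) (auto simp: tophd_def)
  have "run (col f x y) s (?p (tophd (s x)) (tophd (s y)) c) (5 + 1 + 1 + 1)"
    unfolding col_def
    by (intro i; (simp add: assms)?; insert run_colstep[where a = True and b = True and f = f, of s c, OF assms(3)] run_colstep[where a = True and b = False and f = f, of s c, OF assms(3)]
      run_colstep[where a = False and b = True and f = f, of s c, OF assms(3)] run_colstep[where a = False and b = False and f = f, of s c, OF assms(3)]; simp add: assms(3))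
  then show ?thesis by simp
qed

definition serial :: "(bool \<Rightarrow> bool \<Rightarrow> bool \<Rightarrow> bool) \<Rightarrow> nat \<Rightarrow> nat \<Rightarrow> cmd" where
  "serial f x y = While (NE x) (col f x y ;; drop1 x ;; drop1 y) ;;
     While (NE y) (col f x y ;; drop1 x ;; drop1 y)"

text \<open>Addition and subtraction share the digit, the exclusive or of three bits, and differ
  only in the carry \<open>f\<close>. The result is stacked, hence has its leading digit in
  front.\<close>

function ser :: "(bool \<Rightarrow> bool \<Rightarrow> bool \<Rightarrow> bool) \<Rightarrow> bool \<Rightarrow> bool list \<Rightarrow> bool list \<Rightarrow> bool list \<Rightarrow> bool list \<times> bool" where
  "ser f c xs ys zs = (if xs = [] \<and> ys = [] then (zs, c)
     else ser f (f (tophd xs) (tophd ys) c) (tl xs) (tl ys) (((tophd xs \<noteq> tophd ys) \<noteq> c) # zs))"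
  by pat_completeness auto
termination
proof (relation "measure (\<lambda>(f, c, xs, ys, zs). length xs + length ys)", goal_cases)
  case (2 f c xs ys zs)
  then show ?case by (cases xs; cases ys) auto
qed simp

declare ser.simps [simp del]

text \<open>A condition inspects one register only, so a second loop treats the digits by which
  \<open>y\<close> is longer.\<close>

lemma run_serial:
  assumes xy: "4 \<le> x" "4 \<le> y" "distinct [x, y, 9, 28]" "s 28 = flag c"
  shows "run (serial f x y) s (s(x := [], y := [], 9 := fst (ser f c (s x) (s y) (s 9)),
    28 := flag (snd (ser f c (s x) (s y) (s 9))))) (16 * (length (s x) + length (s y)) + 3)"
proof -
  let ?b = "col f x y ;; drop1 x ;; drop1 y"
  let ?n = "\<lambda>s c. s(x := tl (s x), y := tl (s y), 9 := ((tophd (s x) \<noteq> tophd (s y)) \<noteq> c) # s 9,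
     28 := flag (f (tophd (s x)) (tophd (s y)) c))"
  have body: "run ?b s (?n s c) (8 + (2 + 2 + 1) + 1)" if "s 28 = flag c" for s c
  proof (intro run_Seq)
    let ?s1 = "s(9 := ((tophd (s x) \<noteq> tophd (s y)) \<noteq> c) # s 9, 28 := flag (f (tophd (s x)) (tophd (s y)) c))"
    show "run (col f x y) s ?s1 8" using that xy by (intro run_col) auto
    show "run (drop1 x) ?s1 (?s1(x := tl (s x))) 2" using xy by (intro run_weaken[OF run_drop1]) auto
    show "run (drop1 y) (?s1(x := tl (s x))) (?n s c) 2"
      using xy by (intro run_weaken[OF run_drop1]) (auto simp: fun_eq_iff)
  qed
  have two: "run (While (NE y) ?b) s (s(y := [], 9 := fst (ser f c [] (s y) (s 9)), 28 := flag (snd (ser f c [] (s y) (s 9)))))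
      (16 * length (s y) + 1)" if "s 28 = flag c" "s x = []" for s c
    using that
  proof (induction "length (s y)" arbitrary: s c)
    case 0
    then show ?case
      using xy by (intro run_weaken[OF run_While_end]) (auto simp: ser.simps[of f c "[]" "[]"] fun_eq_iff)
  next
    case (Suc l)
    then have ne: "s y \<noteq> []" by auto
    let ?s = "?n s c"
    have nx: "run (While (NE y) ?b) ?s (?s(y := [], 9 := fst (ser f (f (tophd (s x)) (tophd (s y)) c) [] (?s y) (?s 9)),
       28 := flag (snd (ser f (f (tophd (s x)) (tophd (s y)) c) [] (?s y) (?s 9))))) (16 * length (?s y) + 1)"
      using Suc xy by (intro Suc.hyps(1)) auto
    have rd: "readable s (cond_reg (NE y))" "holds (NE y) s" using xy ne by auto
    from run_While_step[OF rd body[of s c, OF Suc.prems(1)] nx] show ?case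
      using xy ne Suc.prems Suc.hyps(2)
      by (elim run_weaken) (auto simp: ser.simps[of f c "[]" "s y"] fun_eq_iff)
  qed
  have one: "\<exists>s' c'. run (While (NE x) ?b) s s' (16 * length (s x) + 1) \<and> s' x = [] \<and> s' 28 = flag c' \<and> length (s' y) \<le> length (s y) \<and>
      ser f c (s x) (s y) (s 9) = ser f c' [] (s' y) (s' 9) \<and> (\<forall>j. j \<notin> {x, y, 9, 28} \<longrightarrow> s' j = s j)"
    if "s 28 = flag c" for s c
    using that
  proof (induction "length (s x)" arbitrary: s c)
    case 0
    then show ?case
      using xy by (intro exI[of _ s] exI[of _ c]) (auto intro!: run_weaken[OF run_While_end])
  next
    case (Suc l)
    then have ne: "s x \<noteq> []" by auto
    let ?s = "?n s c"
    have "l = length (?s x)" "?s 28 = flag (f (tophd (s x)) (tophd (s y)) c)" using Suc xy by auto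
    from Suc.hyps(1)[OF this] obtain s' c' where s': "run (While (NE x) ?b) ?s s' (16 * length (?s x) + 1)" "s' x = []"
      "s' 28 = flag c'" "length (s' y) \<le> length (?s y)"
      "ser f (f (tophd (s x)) (tophd (s y)) c) (?s x) (?s y) (?s 9) = ser f c' [] (s' y) (s' 9)"
      "\<forall>j. j \<notin> {x, y, 9, 28} \<longrightarrow> s' j = ?s j" by blast
    have "run (While (NE x) ?b) s s' (16 * length (s x) + 1)"
      using xy ne Suc.hyps(2) by (intro run_weaken[OF run_While_step[OF _ _ body[of s c, OF Suc.prems] s'(1)]]) auto
    then show ?case
      using s' xy ne by (intro exI[of _ s'] exI[of _ c']) (auto simp: ser.simps[of f c "s x"])
  qed
  from one[of s c, OF xy(4)] obtain s' c' where s': "run (While (NE x) ?b) s s' (16 * length (s x) + 1)" "s' x = []" "s' 28 = flag c'"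
    "length (s' y) \<le> length (s y)" "ser f c (s x) (s y) (s 9) = ser f c' [] (s' y) (s' 9)"
    "\<forall>j. j \<notin> {x, y, 9, 28} \<longrightarrow> s' j = s j" by blast
  have eq: "s'(y := [], 9 := fst (ser f c (s x) (s y) (s 9)), 28 := flag (snd (ser f c (s x) (s y) (s 9)))) =
     s(x := [], y := [], 9 := fst (ser f c (s x) (s y) (s 9)), 28 := flag (snd (ser f c (s x) (s y) (s 9))))"
    using s' xy by (auto simp: fun_eq_iff)
  show ?thesis
    unfolding serial_def using run_Seq[OF s'(1) two[of s' c', OF s'(3,2)]] s'(4) unfolding s'(5)[symmetric] eq
    by (elim run_weaken) auto
qed

definition maj :: "bool \<Rightarrow> bool \<Rightarrow> bool \<Rightarrow> bool" where "maj a b c \<longleftrightarrow> a \<and> b \<or> a \<and> c \<or> b \<and> c"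
definition borrow :: "bool \<Rightarrow> bool \<Rightarrow> bool \<Rightarrow> bool" where "borrow a b c \<longleftrightarrow> \<not> a \<and> (b \<or> c) \<or> b \<and> c"

lemma tophd_bin [simp]: "tophd (bin n) = odd n"
  by (cases "n = 0") (auto simp: bin_Cons)

lemma tl_bin [simp]: "tl (bin n) = bin (n div 2)"
  by (cases "n = 0") (auto simp: bin_Cons)

lemma bin_Nil_iff [simp]: "bin n = [] \<longleftrightarrow> n = 0"
  by (cases "n = 0") (auto simp: bin_Cons)

text \<open>The digits end with the longer operand, whose leading digit is 1; a remaining carry is
  the one further digit. So no leading zero arises and the outcome is literally a
  \<open>bin\<close>.\<close>

lemma ser_add: "\<exists>zs' c'. ser maj c (bin x) (bin y) zs = (zs', c') \<and> rev zs' @ (if c' then [True] else []) = rev zs @ bin (x + y + of_bool c)"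
proof (induction "x + y" arbitrary: x y c zs rule: less_induct)
  case less
  show ?case
  proof (cases "x = 0 \<and> y = 0")
    case True
    then show ?thesis by (cases c) (auto simp: ser.simps bin_Cons)
  next
    case False
    let ?c = "maj (odd x) (odd y) c"
    let ?o = "(odd x \<noteq> odd y) \<noteq> c"
    have "x div 2 + y div 2 < x + y" using False by linarith
    from less[OF this, of ?c "?o # zs"] obtain zs' c' where
      z: "ser maj ?c (bin (x div 2)) (bin (y div 2)) (?o # zs) = (zs', c')"
        "rev zs' @ (if c' then [True] else []) = rev zs @ ?o # bin (x div 2 + y div 2 + of_bool ?c)" by auto
    have "x div 2 + y div 2 + of_bool ?c = (x + y + of_bool c) div 2" "odd (x + y + of_bool c) = ?o"
      by (cases c; cases "even x"; cases "even y"; auto simp: maj_def elim!: evenE oddE)+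
    then have "bin (x + y + of_bool c) = ?o # bin (x div 2 + y div 2 + of_bool ?c)"
      using False bin_Cons[of "x + y + of_bool c"] by auto
    then show ?thesis using z False by (subst ser.simps) auto
  qed
qed

lemma msb_val_snoc_rev: "msb_val 0 (z # zs) = of_bool z * 2 ^ length zs + msb_val 0 zs"
proof -
  have "msb_val a zs = a * 2 ^ length zs + msb_val 0 zs" for a
  proof (induction zs arbitrary: a)
    case (Cons z zs)
    show ?case using Cons[of "2 * a + of_bool z"] Cons[of "of_bool z"] by (simp add: algebra_simps)
  qed simp
  from this[of "of_bool z"] show ?thesis by simp
qed

text \<open>A difference may begin with zeros and, after a final borrow, is known only modulo
  \<open>2 ^ length zs'\<close>. Hence the claim is about values and not about
  \<open>bin\<close>.\<close>

lemma ser_sub: "\<exists>zs' c'. ser borrow c (bin x) (bin y) zs = (zs', c') \<and> length zs' \<le> length zs + length (bin x) + length (bin y) \<and>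
   int (msb_val 0 zs') - of_bool c' * 2 ^ length zs' = int (msb_val 0 zs) + 2 ^ length zs * (int x - int y - of_bool c)"
proof (induction "x + y" arbitrary: x y c zs rule: less_induct)
  case less
  show ?case
  proof (cases "x = 0 \<and> y = 0")
    case True
    then show ?thesis by (cases c) (auto simp: ser.simps)
  next
    case False
    let ?c = "borrow (odd x) (odd y) c"
    let ?o = "(odd x \<noteq> odd y) \<noteq> c"
    have "x div 2 + y div 2 < x + y" using False by linarith
    from less[OF this, of ?c "?o # zs"] obtain zs' c' where
      z: "ser borrow ?c (bin (x div 2)) (bin (y div 2)) (?o # zs) = (zs', c')"
        "length zs' \<le> Suc (length zs) + length (bin (x div 2)) + length (bin (y div 2))"
        "int (msb_val 0 zs') - of_bool c' * 2 ^ length zs' =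
          int (msb_val 0 (?o # zs)) + 2 ^ Suc (length zs) * (int (x div 2) - int (y div 2) - of_bool ?c)" by auto
    have "of_bool ?o + 2 * (int (x div 2) - int (y div 2) - of_bool ?c) = int x - int y - of_bool c"
      by (cases c; cases "even x"; cases "even y"; auto simp: borrow_def elim!: evenE oddE)
    then have "int (msb_val 0 (?o # zs)) + 2 ^ Suc (length zs) * (int (x div 2) - int (y div 2) - of_bool ?c) =
        int (msb_val 0 zs) + 2 ^ length zs * (int x - int y - of_bool c)"
    proof -
      have "int (msb_val 0 (b # zs)) + 2 ^ Suc (length zs) * D = int (msb_val 0 zs) + 2 ^ length zs * (of_bool b + 2 * D)"
        for b D unfolding msb_val_snoc_rev by (simp add: algebra_simps)
      then show ?thesis using \<open>of_bool ?o + 2 * _ = _\<close> by simp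
    qed
    moreover have "Suc (length zs) + length (bin (x div 2)) + length (bin (y div 2)) \<le> length zs + length (bin x) + length (bin y)"
      using False by (cases "x = 0"; cases "y = 0") (auto simp: bin_Cons)
    ultimately show ?thesis using z False by (subst ser.simps) auto
  qed
qed

text \<open>The digits stand for a value below \<open>2 ^ length zs\<close>, so the final borrow is
  present exactly if the difference is negative: subtraction also compares.\<close>

lemma ser_sub_0:
  obtains zs where "ser borrow False (bin x) (bin y) [] = (zs, x < y)" "length zs \<le> length (bin x) + length (bin y)"
    "y \<le> x \<Longrightarrow> msb_val 0 zs = x - y"
proof -
  obtain zs c where z: "ser borrow False (bin x) (bin y) [] = (zs, c)" "length zs \<le> length (bin x) + length (bin y)"
    "int (msb_val 0 zs) - of_bool c * 2 ^ length zs = int x - int y"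
    using ser_sub[of False x y "[]"] by auto
  have lt: "msb_val 0 zs < 2 ^ length zs"
    by (induction zs) (auto simp: msb_val_snoc_rev simp del: msb_val.simps(2))
  then have L: "int (msb_val 0 zs) < 2 ^ length zs" by (metis of_nat_less_iff of_nat_numeral of_nat_power)
  have "x < y" if c
  proof -
    have "int (msb_val 0 zs) - 2 ^ length zs = int x - int y" using z(3) that by simp
    with L have "int x < int y" by linarith
    then show ?thesis by simp
  qed
  moreover have "\<not> x < y" if "\<not> c" using z(3) that by simp
  ultimately have "c \<longleftrightarrow> x < y" by blast
  then show ?thesis using that[of zs] z by auto
qed

definition add_to :: "nat \<Rightarrow> cmd" where
  "add_to d = serial maj 8 d ;; If (TT 28) (Push 9 True ;; Pop 28) Skip ;; pour 9 d"

lemma run_add_to: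
  assumes d: "4 \<le> d" "d \<notin> {8, 9, 28}" and s: "s 8 = bin x" "s d = bin y" "s 9 = []" "s 28 = []"
  shows "run (add_to d) s (s(8 := [], d := bin (x + y))) (25 * (length (bin x) + length (bin y)) + 40)"
proof -
  obtain zs c where z: "ser maj False (bin x) (bin y) [] = (zs, c)" "rev zs @ (if c then [True] else []) = bin (x + y)"
    using ser_add[of False x y "[]"] by auto
  have lz: "length zs \<le> length (bin x) + length (bin y)"
  proof -
    have "length (fst (ser f c xs ys zs)) \<le> length zs + length xs + length ys" for f c xs ys zs
    proof (induction f c xs ys zs rule: ser.induct)
      case (1 f c xs ys zs)
      then show ?case by (subst ser.simps) (cases xs; cases ys; fastforce)
    qed
    from this[of maj False "bin x" "bin y" "[]"] show ?thesis using z(1) by simp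
  qed
  let ?s1 = "s(8 := [], d := [], 9 := zs, 28 := flag c)"
  have 1: "run (serial maj 8 d) s ?s1 (16 * (length (bin x) + length (bin y)) + 3)"
    using d s z(1) by (intro run_weaken[OF run_serial[where c = False]]) (auto simp: flag_def)
  let ?s2 = "s(8 := [], d := [], 9 := rev (bin (x + y)))"
  have r: "rev (bin (x + y)) = (if c then True # zs else zs)" using z(2)[symmetric] by auto
  have 2: "run (If (TT 28) (Push 9 True ;; Pop 28) Skip) ?s1 ?s2 (4 + 1)"
  proof (rule run_If)
    assume "holds (TT 28) ?s1"
    then have c: c using d by (auto simp: flag_def split: if_splits)
    have "run (Push 9 True ;; Pop 28) ?s1 ?s2 (2 + 1 + 1)"
    proof (rule run_Seq)
      show "run (Push 9 True) ?s1 (?s1(9 := True # zs)) 2" using d by (intro run_weaken[OF run_Push]) auto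
      show "run (Pop 28) (?s1(9 := True # zs)) ?s2 1"
        using d c s r by (intro run_weaken[OF run_Pop]) (auto simp: flag_def fun_eq_iff)
    qed
    then show "run (Push 9 True ;; Pop 28) ?s1 ?s2 4" by simp
  next
    assume "\<not> holds (TT 28) ?s1"
    then have c: "\<not> c" using d by (auto simp: flag_def split: if_splits)
    then show "run Skip ?s1 ?s2 4"
      using d s r by (intro run_weaken[OF run_Skip]) (auto simp: flag_def fun_eq_iff)
  qed (use d in simp)
  have 3: "run (pour 9 d) ?s2 (s(8 := [], d := bin (x + y))) (7 * length (bin (x + y)) + 1)"
    using d s by (intro run_weaken[OF run_pour]) (auto simp: fun_eq_iff)
  have "length (bin (x + y)) \<le> length (bin x) + length (bin y) + 1"
    using arg_cong[OF r, of length] lz by (simp split: if_splits)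
  then show ?thesis
    unfolding add_to_def using run_Seq[OF 1 run_Seq[OF 2 3]] by (elim run_weaken) auto
qed

section \<open>Parsing features and printing the product over vertex pairs\<close>

section \<open>The factored partition function\<close>

definition emitw :: "nat \<Rightarrow> cmd" where
  "emitw r = pour r 8 ;; While (NE 8) (Push 7 True ;; xfer2 8 r 7) ;; Push 7 False"

lemma enc_word_eq: "enc_word w = concat (map (\<lambda>b. [True, b]) w) @ [False]"
  by (induction w) auto

lemma run_emitw:
  assumes "4 \<le> r" "r \<notin> {7, 8}" "s 8 = []"
  shows "run (emitw r) s (s(7 := rev (enc_word (rev (s r))) @ s 7)) (20 * length (s r) + 10)"
proof -
  define xs where "xs = rev (s r)"
  define S where "S i = s(8 := drop i xs, r := rev (take i xs), 7 := rev (concat (map (\<lambda>b. [True, b]) (take i xs))) @ s 7)" for i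
  have 1: "run (pour r 8) s (S 0) (7 * length xs + 1)"
    using assms by (intro run_weaken[OF run_pour]) (auto simp: S_def xs_def)
  have 2: "run (While (NE 8) (Push 7 True ;; xfer2 8 r 7)) (S 0) (S (length xs)) (length xs * (11 + 2) + 1)"
  proof (rule run_While[where S = S])
    fix i assume i: "i < length xs"
    have "run (Push 7 True) (S i) ((S i)(7 := True # S i 7)) 2" by (rule run_Push) simp
    moreover have "run (xfer2 8 r 7) ((S i)(7 := True # S i 7)) (S (Suc i)) 8"
      using assms i by (intro run_weaken[OF run_xfer2[where x = "xs ! i" and xs = "drop (Suc i) xs"]])
        (auto simp: S_def Cons_nth_drop_Suc take_Suc_conv_app_nth fun_eq_iff)
    ultimately show "run (Push 7 True ;; xfer2 8 r 7) (S i) (S (Suc i)) 11"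
      by (intro run_weaken[OF run_Seq]) auto
  qed (use assms in \<open>auto simp: S_def\<close>)
  have 3: "run (Push 7 False) (S (length xs)) (s(7 := rev (enc_word xs) @ s 7)) 2"
    using assms by (intro run_weaken[OF run_Push]) (auto simp: S_def enc_word_eq xs_def fun_eq_iff)
  show ?thesis
    unfolding emitw_def using run_Seq[OF 1 run_Seq[OF 2 3]] by (elim run_weaken) (auto simp: xs_def)
qed

definition enc1 :: "int list \<Rightarrow> bool list" where "enc1 es = True # enc_list enc_int es"

definition emit1 :: cmd where
  "emit1 = pushes 7 [True, True] ;; If (TT 18) (Push 7 True) (Push 7 False) ;; emitw 19 ;; Push 7 False"

lemma run_emit1:
  assumes "s 8 = []" "s 18 = flag (w < 0)" "s 19 = rev (bin (nat \<bar>w\<bar>))" "length (s 19) \<le> B"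
  shows "run emit1 s (s(7 := rev (enc1 [w]) @ s 7)) (20 * B + 40)"
proof -
  have "run emit1 s (s(7 := rev (enc1 [w]) @ s 7)) (3 * 2 + ((2 + 1) + ((20 * length (s 19) + 10) + 2 + 1) + 1) + 1)"
    unfolding emit1_def
  proof (intro run_Seq)
    show "run (pushes 7 [True, True]) s (s(7 := True # True # s 7)) (3 * 2)"
      by (intro run_weaken[OF run_pushes]) auto
    show "run (If (TT 18) (Push 7 True) (Push 7 False)) (s(7 := True # True # s 7)) (s(7 := (w < 0) # True # True # s 7)) (2 + 1)"
      using assms by (intro run_If) (auto intro!: run_weaken[OF run_Push] simp: flag_def split: if_splits)
    show "run (emitw 19) (s(7 := (w < 0) # True # True # s 7))
       (s(7 := rev (enc_word (bin (nat \<bar>w\<bar>))) @ (w < 0) # True # True # s 7)) (20 * length (s 19) + 10)"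
      using assms by (intro run_weaken[OF run_emitw]) auto
    show "run (Push 7 False) (s(7 := rev (enc_word (bin (nat \<bar>w\<bar>))) @ (w < 0) # True # True # s 7)) (s(7 := rev (enc1 [w]) @ s 7)) 2"
      by (intro run_weaken[OF run_Push]) (auto simp: enc1_def enc_list_def enc_int_def enc_nat_def)
  qed
  then show ?thesis using assms(4) by (elim run_weaken) auto
qed

definition getflag :: "nat \<Rightarrow> cmd" where
  "getflag b = If (TT 6) (Push b True) Skip ;; Pop 6"

lemma run_getflag:
  assumes "4 \<le> b" "b \<noteq> 6" "s 6 = x # xs" "s b = []"
  shows "run (getflag b) s (s(6 := xs, b := flag x)) 5"
proof -
  have "run (If (TT 6) (Push b True) Skip) s (s(b := flag x)) (2 + 1)"
  proof (rule run_If)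
    show "run (Push b True) s (s(b := flag x)) 2" if "holds (TT 6) s"
      using that assms by (intro run_weaken[OF run_Push]) (auto simp: flag_def)
    show "run Skip s (s(b := flag x)) 2" if "\<not> holds (TT 6) s"
      using that assms by (intro run_weaken[OF run_Skip]) (auto simp: flag_def fun_eq_iff)
  qed simp
  moreover have "run (Pop 6) (s(b := flag x)) (s(6 := xs, b := flag x)) 1"
    using assms by (intro run_weaken[OF run_Pop]) auto
  ultimately show ?thesis unfolding getflag_def by (intro run_weaken[OF run_Seq]) auto
qed

text \<open>Keeps the last two entries of the vertex list, all that a small feature can have. The
  default 0 for missing entries is harmless, as the pair is consulted only for order 2.\<close>

fun vfold :: "nat \<times> nat \<Rightarrow> nat list \<Rightarrow> nat \<times> nat" where
  "vfold x [] = x"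
| "vfold x (v # vs) = vfold (v, fst x) vs"

definition vloop :: cmd where
  "vloop = While (TT 6) (Pop 6 ;; clear 16 ;; pour 15 16 ;; read_word 6 17 ;; to_unary 17 15) ;; Pop 6"

definition tV :: "nat \<Rightarrow> nat" where "tV B = B * (16 * B + 20) + 30 * B + 30"

lemma run_vloop:
  assumes "s 6 = enc_list enc_nat vs @ xs" "s 15 = un (fst pq)" "s 16 = un (snd pq)" "s 17 = []" "s 8 = []"
    and "\<forall>v\<in>set vs. v \<le> B \<and> length (bin v) \<le> B" "fst pq \<le> B" "snd pq \<le> B"
  shows "run vloop s (s(6 := xs, 15 := un (fst (vfold pq vs)), 16 := un (snd (vfold pq vs)))) (length vs * (tV B + 2) + 3)"
proof -
  let ?c = "Pop 6 ;; clear 16 ;; pour 15 16 ;; read_word 6 17 ;; to_unary 17 15"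
  have "run (While (TT 6) ?c) s (s(6 := False # xs, 15 := un (fst (vfold pq vs)), 16 := un (snd (vfold pq vs)))) (length vs * (tV B + 2) + 1)"
    using assms
  proof (induction vs arbitrary: s pq)
    case Nil
    then show ?case by (intro run_weaken[OF run_While_end]) (auto simp: enc_list_def fun_eq_iff)
  next
    case (Cons v vs)
    have s6: "s 6 = True # enc_word (bin v) @ enc_list enc_nat vs @ xs"
      using Cons.prems(1) by (simp add: enc_list_def enc_nat_def)
    let ?s1 = "s(6 := enc_list enc_nat vs @ xs, 15 := un v, 16 := un (fst pq))"
    have "run ?c s ?s1 (1 + ((3 * snd pq + 1) + ((7 * fst pq + 1) + ((9 * length (bin v) + 3) + (length (bin v) * (16 * B + 20) + 1) + 1) + 1) + 1) + 1)"
    proof (intro run_Seq)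
      let ?t1 = "s(6 := enc_word (bin v) @ enc_list enc_nat vs @ xs)"
      show "run (Pop 6) s ?t1 1" using s6 by (intro run_weaken[OF run_Pop]) auto
      show "run (clear 16) ?t1 (?t1(16 := [])) (3 * snd pq + 1)" using Cons.prems by (intro run_weaken[OF run_clear]) auto
      let ?t2 = "?t1(15 := [], 16 := un (fst pq))"
      show "run (pour 15 16) (?t1(16 := [])) ?t2 (7 * fst pq + 1)" using Cons.prems by (intro run_weaken[OF run_pour]) auto
      let ?t3 = "s(6 := enc_list enc_nat vs @ xs, 15 := [], 16 := un (fst pq), 17 := rev (bin v))"
      show "run (read_word 6 17) ?t2 ?t3 (9 * length (bin v) + 3)"
        using Cons.prems by (intro run_weaken[OF run_read_word[where w = "bin v" and xs = "enc_list enc_nat vs @ xs"]])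
          (auto simp: fun_eq_iff)
      show "run (to_unary 17 15) ?t3 ?s1 (length (bin v) * (16 * B + 20) + 1)"
        using Cons.prems by (intro run_weaken[OF run_to_unary[where a = 0 and B = B]]) (auto simp: msb_val_bin fun_eq_iff)
    qed
    note r = this
    have p: "length (bin v) * (16 * B + 20) \<le> B * (16 * B + 20)" using Cons.prems(6) by (intro mult_le_mono1) simp
    have aux: "1 + ((3 * b + 1) + ((7 * a + 1) + ((9 * l + 3) + (p + 1) + 1) + 1) + 1) + 1 \<le> q + 30 * B + 30"
      if "p \<le> q" "l \<le> B" "a \<le> B" "b \<le> B" for p q l a b :: nat using that by simp
    have 1: "run ?c s ?s1 (tV B)"
      unfolding tV_def using Cons.prems(6-8) by (intro run_weaken[OF r refl] aux[OF p]) auto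
    have 2: "run (While (TT 6) ?c) ?s1 (s(6 := False # xs, 15 := un (fst (vfold pq (v # vs))), 16 := un (snd (vfold pq (v # vs)))))
       (length vs * (tV B + 2) + 1)"
      using Cons.prems by (intro run_weaken[OF Cons.IH[of _ "(v, fst pq)"]]) (auto simp: fun_eq_iff)
    show ?case
      using s6 by (intro run_weaken[OF run_While_step[OF _ _ 1 2]]) auto
  qed
  moreover have "run (Pop 6) (s(6 := False # xs, 15 := un (fst (vfold pq vs)), 16 := un (snd (vfold pq vs))))
    (s(6 := xs, 15 := un (fst (vfold pq vs)), 16 := un (snd (vfold pq vs)))) 1"
    by (intro run_weaken[OF run_Pop]) (auto simp: fun_eq_iff)
  ultimately show ?thesis unfolding vloop_def by (intro run_weaken[OF run_Seq]) auto
qed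

fun fverts :: "feature \<Rightarrow> nat list" where
  "fverts (Indicator F vs) = vs"
| "fverts (Count F) = []"

definition is_ind :: "feature \<Rightarrow> bool" where "is_ind f \<longleftrightarrow> (\<exists>F vs. f = Indicator F vs)"
abbreviation ford :: "feature \<Rightarrow> nat" where "ford f \<equiv> graph_order (fgraph f)"

text \<open>The effect of a handler is stated between two \<open>parsed\<close> stores, so only its
  changes to the other registers need to be described.\<close>

definition parsed :: "feature \<Rightarrow> int \<Rightarrow> store \<Rightarrow> store" where
  "parsed f w s = s(11 := flag (is_ind f), 12 := flag (1 \<le> ford f), 13 := flag (ford f = 2), 14 := flag (ford f = 2 \<and> ebit f),
     15 := un (fst (vfold (0, 0) (fverts f))), 16 := un (snd (vfold (0, 0) (fverts f))),
     18 := flag (w < 0), 19 := rev (bin (nat \<bar>w\<bar>)))"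

definition parse_graph :: cmd where
  "parse_graph = If (TT 6) (Pop 6 ;; Push 12 True ;; If (TT 6) (Pop 6 ;; Push 13 True ;; Pop 6 ;; getflag 14) (Pop 6)) (Pop 6)"

definition parse :: cmd where
  "parse = getflag 11 ;; parse_graph ;; If (TT 11) vloop Skip ;; getflag 18 ;; read_word 6 19"

lemma enc_graph_small:
  "graph_order F = 0 \<Longrightarrow> enc_graph F = [False]" "graph_order F = 1 \<Longrightarrow> enc_graph F = [True, False]"
  "graph_order F = 2 \<Longrightarrow> enc_graph F = [True, True, False, {0, 1} \<in> graph_edges F]"
  by (auto simp: enc_graph_def enc_unary_def upt_rec numeral_2_eq_2)

lemma run_parse_graph:
  assumes F: "graph_order F < 3" and s: "s 6 = enc_graph F @ xs" "s 12 = []" "s 13 = []" "s 14 = []"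
  shows "run parse_graph s (s(6 := xs, 12 := flag (1 \<le> graph_order F), 13 := flag (graph_order F = 2),
    14 := flag (graph_order F = 2 \<and> {0, 1} \<in> graph_edges F))) 20"
proof -
  let ?t = "s(6 := xs, 12 := flag (1 \<le> graph_order F), 13 := flag (graph_order F = 2),
    14 := flag (graph_order F = 2 \<and> {0, 1} \<in> graph_edges F))"
  consider "graph_order F = 0" | "graph_order F = 1" | "graph_order F = 2" using F by linarith
  then show ?thesis
  proof cases
    case 1
    then have "run (Pop 6) s ?t 1"
      using s by (intro run_weaken[OF run_Pop]) (auto simp: enc_graph_small flag_def fun_eq_iff)
    then have "run parse_graph s ?t (1 + 1)"
      unfolding parse_graph_def using 1 s by (intro run_If_false) (auto simp: enc_graph_small)
    then show ?thesis by (elim run_weaken) auto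
  next
    case 2
    let ?s1 = "s(6 := False # xs)" let ?s2 = "s(6 := False # xs, 12 := [True])"
    have a: "run (Pop 6) s ?s1 1" using s 2 by (intro run_weaken[OF run_Pop]) (auto simp: enc_graph_small)
    have b: "run (Push 12 True) ?s1 ?s2 2" using s by (intro run_weaken[OF run_Push]) auto
    have "run (Pop 6) ?s2 ?t 1" using s 2 by (intro run_weaken[OF run_Pop]) (auto simp: flag_def fun_eq_iff)
    then have c: "run (If (TT 6) (Pop 6 ;; Push 13 True ;; Pop 6 ;; getflag 14) (Pop 6)) ?s2 ?t (1 + 1)"
      by (intro run_If_false) auto
    have "run parse_graph s ?t ((1 + (2 + (1 + 1) + 1) + 1) + 1)"
      unfolding parse_graph_def using s 2 run_Seq[OF a run_Seq[OF b c]] by (intro run_If_true) (auto simp: enc_graph_small)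
    then show ?thesis by (elim run_weaken) auto
  next
    case 3
    let ?e = "{0, 1} \<in> graph_edges F"
    let ?s1 = "s(6 := [True, False, ?e] @ xs)" let ?s2 = "s(6 := [True, False, ?e] @ xs, 12 := [True])"
    have a: "run (Pop 6) s ?s1 1" using s 3 by (intro run_weaken[OF run_Pop]) (auto simp: enc_graph_small)
    have b: "run (Push 12 True) ?s1 ?s2 2" using s by (intro run_weaken[OF run_Push]) auto
    have "run (Pop 6 ;; Push 13 True ;; Pop 6 ;; getflag 14) ?s2 ?t (1 + (2 + (1 + 5 + 1) + 1) + 1)"
    proof (intro run_Seq)
      show "run (Pop 6) ?s2 (s(6 := [False, ?e] @ xs, 12 := [True])) 1" by (intro run_weaken[OF run_Pop]) (auto simp: fun_eq_iff)
      show "run (Push 13 True) (s(6 := [False, ?e] @ xs, 12 := [True])) (s(6 := [False, ?e] @ xs, 12 := [True], 13 := [True])) 2"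
        using s by (intro run_weaken[OF run_Push]) (auto simp: fun_eq_iff)
      show "run (Pop 6) (s(6 := [False, ?e] @ xs, 12 := [True], 13 := [True])) (s(6 := ?e # xs, 12 := [True], 13 := [True])) 1"
        by (intro run_weaken[OF run_Pop]) (auto simp: fun_eq_iff)
      show "run (getflag 14) (s(6 := ?e # xs, 12 := [True], 13 := [True])) ?t 5"
        using s 3 by (intro run_weaken[OF run_getflag]) (auto simp: flag_def fun_eq_iff)
    qed
    then have c: "run (If (TT 6) (Pop 6 ;; Push 13 True ;; Pop 6 ;; getflag 14) (Pop 6)) ?s2 ?t ((1 + (2 + (1 + 5 + 1) + 1) + 1) + 1)"
      by (intro run_If_true) auto
    have "run parse_graph s ?t ((1 + (2 + ((1 + (2 + (1 + 5 + 1) + 1) + 1) + 1) + 1) + 1) + 1)"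
      unfolding parse_graph_def using s 3 run_Seq[OF a run_Seq[OF b c]] by (intro run_If_true) (auto simp: enc_graph_small)
    then show ?thesis by (elim run_weaken) auto
  qed
qed

definition clean :: "store \<Rightarrow> bool" where
  "clean s \<longleftrightarrow> (\<forall>j\<in>{8, 9, 10, 11, 12, 13, 14, 15, 16, 17, 18, 19}. s j = [])"

definition tPa :: "nat \<Rightarrow> nat" where "tPa B = 2 * (tV B + 2) + 9 * B + 60"

lemma run_parse:
  assumes f: "small_feature n f" and s: "clean s" "s 6 = enc_feature f @ enc_int w @ xs"
    and B: "\<forall>v\<in>set (fverts f). v \<le> B \<and> length (bin v) \<le> B" "length (bin (nat \<bar>w\<bar>)) \<le> B"
  shows "run parse s (parsed f w (s(6 := xs))) (tPa B)"
proof -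
  note c = s(1)[unfolded clean_def]
  define F where "F = fgraph f"
  define ys where "ys = (if is_ind f then enc_list enc_nat (fverts f) else []) @ enc_int w @ xs"
  have s6: "s 6 = is_ind f # enc_graph F @ ys"
    using s(2) by (cases f) (auto simp: is_ind_def F_def ys_def)
  have F: "graph_order F < 3" using f by (simp add: small_feature_def F_def)
  have lv: "length (fverts f) \<le> 2" using f by (cases f) (auto simp: small_feature_def)
  let ?s1 = "s(6 := enc_graph F @ ys, 11 := flag (is_ind f))"
  have 1: "run (getflag 11) s ?s1 5" using c s6 by (intro run_getflag) auto
  let ?s2 = "?s1(6 := ys, 12 := flag (1 \<le> ford f), 13 := flag (ford f = 2), 14 := flag (ford f = 2 \<and> ebit f))"
  have 2: "run parse_graph ?s1 ?s2 20"
    using c F by (intro run_weaken[OF run_parse_graph[of F _ ys]]) (auto simp: F_def ebit_def)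
  let ?s3 = "?s2(6 := enc_int w @ xs, 15 := un (fst (vfold (0, 0) (fverts f))), 16 := un (snd (vfold (0, 0) (fverts f))))"
  have 3: "run (If (TT 11) vloop Skip) ?s2 ?s3 ((2 * (tV B + 2) + 3) + 1)"
  proof (rule run_If)
    assume "holds (TT 11) ?s2"
    then have i: "is_ind f" by (auto simp: flag_def split: if_splits)
    have "length (fverts f) * (tV B + 2) \<le> 2 * (tV B + 2)" using lv by (rule mult_le_mono1)
    then show "run vloop ?s2 ?s3 (2 * (tV B + 2) + 3)"
      using c B i by (intro run_weaken[OF run_vloop[of _ "fverts f" "enc_int w @ xs" "(0, 0)" B]]) (auto simp: ys_def fun_eq_iff)
  next
    assume "\<not> holds (TT 11) ?s2"
    then have "\<not> is_ind f" by (auto simp: flag_def split: if_splits)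
    moreover from this have "fverts f = []" by (cases f) (auto simp: is_ind_def)
    ultimately show "run Skip ?s2 ?s3 (2 * (tV B + 2) + 3)"
      using c by (intro run_weaken[OF run_Skip]) (auto simp: ys_def fun_eq_iff)
  qed simp
  let ?s4 = "?s3(6 := enc_word (bin (nat \<bar>w\<bar>)) @ xs, 18 := flag (w < 0))"
  have 4: "run (getflag 18) ?s3 ?s4 5"
    using c by (intro run_weaken[OF run_getflag[where x = "w < 0" and xs = "enc_word (bin (nat \<bar>w\<bar>)) @ xs"]])
      (auto simp: enc_int_def enc_nat_def)
  have 5: "run (read_word 6 19) ?s4 (parsed f w (s(6 := xs))) (9 * length (bin (nat \<bar>w\<bar>)) + 3)"
    using c by (intro run_weaken[OF run_read_word[where w = "bin (nat \<bar>w\<bar>)" and xs = xs]])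
      (auto simp: parsed_def fun_eq_iff)
  show ?thesis
    unfolding parse_def using run_Seq[OF 1 run_Seq[OF 2 run_Seq[OF 3 run_Seq[OF 4 5]]]] B(2)
    by (elim run_weaken) (auto simp: tPa_def)
qed

definition clearp :: cmd where
  "clearp = clear 11 ;; clear 12 ;; clear 13 ;; clear 14 ;; clear 15 ;; clear 16 ;; clear 18 ;; clear 19"

lemma run_clearp:
  assumes c: "clean s" and l: "fst (vfold (0, 0) (fverts f)) \<le> B" "snd (vfold (0, 0) (fverts f)) \<le> B" "length (bin (nat \<bar>w\<bar>)) \<le> B"
  shows "run clearp (parsed f w s) s (24 * B + 50)"
proof -
  let ?k = "3 * B + 4" let ?p = "parsed f w s"
  have 1: "run (clear a) t (t(a := [])) ?k" if "4 \<le> a" "length (t a) \<le> B + 1" for a t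
    using that by (intro run_weaken[OF run_clear]) auto
  have "run clearp ?p (?p(11 := [], 12 := [], 13 := [], 14 := [], 15 := [], 16 := [], 18 := [], 19 := []))
    (?k + (?k + (?k + (?k + (?k + (?k + (?k + ?k + 1) + 1) + 1) + 1) + 1) + 1) + 1)"
    unfolding clearp_def
    apply (intro run_Seq)
           apply (rule 1; use l in \<open>simp add: parsed_def flag_def\<close>)+
    done
  then show ?thesis using c by (elim run_weaken) (auto simp: clean_def fun_eq_iff parsed_def)
qed

abbreviation enc_wf :: "feature \<times> int \<Rightarrow> bool list" where
  "enc_wf \<equiv> \<lambda>(f, w). enc_feature f @ enc_int w"

text \<open>Bounding the total length of the weights, and not just each one, also bounds every sum
  of weights, since binary length is subadditive.\<close>

definition fbounded :: "nat \<Rightarrow> nat \<Rightarrow> (feature \<times> int) list \<Rightarrow> bool" where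
  "fbounded B n fs \<longleftrightarrow> n \<le> B \<and> length fs \<le> B \<and> length (enc_list enc_wf fs) \<le> B \<and>
     (\<forall>(f, w)\<in>set fs. small_feature n f) \<and> (\<Sum>(f, w)\<leftarrow>fs. length (bin (nat \<bar>w\<bar>))) \<le> B"

lemma length_bin_less: "x < 2 ^ length (bin x)"
proof (induction x rule: less_induct)
  case (less x)
  show ?case
  proof (cases "x = 0")
    case False
    then show ?thesis using less[of "x div 2"] by (simp add: bin_Cons)
  qed simp
qed

text \<open>From \<open>x + y < (x + 1) * (y + 1)\<close>.\<close>

lemma length_bin_add: "length (bin (x + y)) \<le> length (bin x) + length (bin y)"
proof (rule length_bin_le)
  have "(x + 1) * (y + 1) \<le> 2 ^ length (bin x) * 2 ^ length (bin y)"
    using length_bin_less[of x] length_bin_less[of y] by (intro mult_le_mono) auto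
  then show "x + y < 2 ^ (length (bin x) + length (bin y))" by (simp add: power_add)
qed

lemma length_bin_self: "length (bin x) \<le> x"
  by (rule length_bin_le) (rule less_exp)

lemma length_bin_mono: "x \<le> y \<Longrightarrow> length (bin x) \<le> length (bin y)"
  using length_bin_less[of y] by (intro length_bin_le) auto

lemma length_bin_addw: "length (bin (addw b e fs)) \<le> (\<Sum>(f, w)\<leftarrow>fs. length (bin (nat \<bar>w\<bar>)))"
proof (induction fs)
  case (Cons fw fs)
  obtain f w where fw: "fw = (f, w)" by force
  define x where "x = (if relv e f \<and> (ebit f \<noteq> (w < 0)) = b then nat \<bar>w\<bar> else 0)"
  have "addw b e (fw # fs) = x + addw b e fs" by (simp add: addw_def fw x_def)
  moreover have "length (bin x) \<le> length (bin (nat \<bar>w\<bar>))" by (simp add: x_def)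
  ultimately show ?case using Cons length_bin_add[of x "addw b e fs"] by (simp add: fw)
qed (simp add: addw_def)

lemma sum_list_take_le: "(\<Sum>x\<leftarrow>take i xs. g x) \<le> (\<Sum>x\<leftarrow>xs. g x :: nat)"
proof -
  have "(\<Sum>x\<leftarrow>xs. g x) = (\<Sum>x\<leftarrow>take i xs. g x) + (\<Sum>x\<leftarrow>drop i xs. g x)"
    by (metis append_take_drop_id map_append sum_list_append)
  then show ?thesis by simp
qed

lemma fboundedD:
  assumes "fbounded B n fs"
  shows "n \<le> B" "length fs \<le> B" "length (enc_list enc_wf fs) \<le> B"
    "(f, w) \<in> set fs \<Longrightarrow> small_feature n f"
    "(f, w) \<in> set fs \<Longrightarrow> \<forall>v\<in>set (fverts f). v \<le> B \<and> length (bin v) \<le> B"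
    "(f, w) \<in> set fs \<Longrightarrow> length (bin (nat \<bar>w\<bar>)) \<le> B"
    "(f, w) \<in> set fs \<Longrightarrow> fst (vfold (0, 0) (fverts f)) \<le> B \<and> snd (vfold (0, 0) (fverts f)) \<le> B"
    "length (bin (addw b e (take i fs))) \<le> B"
proof -
  show 1: "n \<le> B" "length fs \<le> B" "length (enc_list enc_wf fs) \<le> B" using assms by (auto simp: fbounded_def)
  show 2: "small_feature n f" if "(f, w) \<in> set fs" using assms that by (auto simp: fbounded_def)
  show 3: "\<forall>v\<in>set (fverts f). v \<le> B \<and> length (bin v) \<le> B" if "(f, w) \<in> set fs"
  proof
    fix v assume "v \<in> set (fverts f)"
    then have "v < n" using 2[OF that] by (cases f) (auto simp: small_feature_def)
    then show "v \<le> B \<and> length (bin v) \<le> B" using 1(1) length_bin_self[of v] by simp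
  qed
  have s: "(\<Sum>(f, w)\<leftarrow>fs. length (bin (nat \<bar>w\<bar>))) \<le> B" using assms by (simp add: fbounded_def)
  show "length (bin (nat \<bar>w\<bar>)) \<le> B" if "(f, w) \<in> set fs"
  proof -
    have "length (bin (nat \<bar>w\<bar>)) \<le> (\<Sum>(f, w)\<leftarrow>fs. length (bin (nat \<bar>w\<bar>)))"
      using that by (intro member_le_sum_list) force+
    then show ?thesis using s by simp
  qed
  show "fst (vfold (0, 0) (fverts f)) \<le> B \<and> snd (vfold (0, 0) (fverts f)) \<le> B" if "(f, w) \<in> set fs"
  proof -
    have "fst (vfold x vs) \<le> B \<and> snd (vfold x vs) \<le> B" if "\<forall>v\<in>set vs. v \<le> B" "fst x \<le> B" "snd x \<le> B" for x vs
      using that by (induction vs arbitrary: x) auto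
    then show ?thesis using 3[OF that] by simp
  qed
  show "length (bin (addw b e (take i fs))) \<le> B"
    using length_bin_addw[of b e "take i fs"] sum_list_take_le[of "\<lambda>(f, w). length (bin (nat \<bar>w\<bar>))" i fs] s by linarith
qed

text \<open>Every pass parses the feature list anew and hands one decoded feature at a time to
  \<open>H\<close>; the registers of a decoded feature are too few to hold more.\<close>

definition scan_features :: "cmd \<Rightarrow> cmd" where
  "scan_features H = While (TT 6) (Pop 6 ;; parse ;; H ;; clearp) ;; Pop 6"

definition tS :: "nat \<Rightarrow> nat \<Rightarrow> nat" where "tS B h = B * (tPa B + h + 24 * B + 60) + 5"

lemma clean_upd [simp]: "j \<notin> {8, 9, 10, 11, 12, 13, 14, 15, 16, 17, 18, 19} \<Longrightarrow> clean (s(j := x)) = clean s"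
  by (auto simp: clean_def)

text \<open>\<open>S i\<close> is the store between two features; its register 6 is overwritten
  throughout, as that is where the unread list sits.\<close>

lemma run_scan_features:
  assumes b: "fbounded B n fs" and c: "\<And>i. i \<le> length fs \<Longrightarrow> clean (S i)"
    and H: "\<And>i f w xs. i < length fs \<Longrightarrow> fs ! i = (f, w) \<Longrightarrow>
      run H (parsed f w ((S i)(6 := xs))) (parsed f w ((S (Suc i))(6 := xs))) h"
  shows "run (scan_features H) ((S 0)(6 := enc_list enc_wf fs)) ((S (length fs))(6 := [])) (tS B h)"
proof -
  define R where "R i = (S i)(6 := enc_list enc_wf (drop i fs))" for i
  let ?b = "1 + (tPa B + (h + (24 * B + 50) + 1) + 1) + 1"
  have "run (While (TT 6) (Pop 6 ;; parse ;; H ;; clearp)) (R 0) (R (length fs)) (length fs * (?b + 2) + 1)"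
  proof (rule run_While[where S = R])
    fix i assume i: "i < length fs"
    obtain f w where fw: "fs ! i = (f, w)" by force
    let ?xs = "enc_list enc_wf (drop (Suc i) fs)"
    have m: "(f, w) \<in> set fs" using i fw by (metis nth_mem)
    have R6: "R i 6 = True # enc_feature f @ enc_int w @ ?xs"
      using i fw by (simp add: R_def enc_list_def Cons_nth_drop_Suc[symmetric])
    show "run (Pop 6 ;; parse ;; H ;; clearp) (R i) (R (Suc i)) ?b"
    proof (intro run_Seq)
      show "run (Pop 6) (R i) ((S i)(6 := enc_feature f @ enc_int w @ ?xs)) 1"
        using R6 by (intro run_weaken[OF run_Pop]) (auto simp: R_def)
      show "run parse ((S i)(6 := enc_feature f @ enc_int w @ ?xs)) (parsed f w ((S i)(6 := ?xs))) (tPa B)"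
        using fboundedD(4-6)[OF b m] c[of i] i by (intro run_weaken[OF run_parse[where xs = ?xs]]) auto
      show "run H (parsed f w ((S i)(6 := ?xs))) (parsed f w ((S (Suc i))(6 := ?xs))) h"
        by (rule H[OF i fw])
      show "run clearp (parsed f w ((S (Suc i))(6 := ?xs))) (R (Suc i)) (24 * B + 50)"
        unfolding R_def using fboundedD(6,7)[OF b m] c[of "Suc i"] i by (intro run_clearp) auto
    qed
    show "holds (TT 6) (R i)" using R6 by simp
  qed (auto simp: R_def enc_list_def)
  moreover have "run (Pop 6) (R (length fs)) ((S (length fs))(6 := [])) 1"
    by (intro run_weaken[OF run_Pop]) (auto simp: R_def enc_list_def)
  ultimately have r: "run (scan_features H) (R 0) ((S (length fs))(6 := [])) (length fs * (?b + 2) + 1 + 1 + 1)"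
    unfolding scan_features_def by (rule run_Seq)
  have "length fs * (?b + 2) \<le> B * (tPa B + h + 24 * B + 60)"
    using fboundedD(2)[OF b] by (intro mult_le_mono) auto
  then have "length fs * (?b + 2) + 1 + 1 + 1 \<le> tS B h" unfolding tS_def by linarith
  then show ?thesis using run_weaken[OF r refl] by (simp add: R_def)
qed

definition hconst :: cmd where
  "hconst = If (TT 13) Skip (If (TT 12) (If (TT 11) emit1 (copy 5 9 8 ;; While (NE 9) (Pop 9 ;; emit1))) emit1)"

definition tC :: "nat \<Rightarrow> nat" where "tC B = B * (20 * B + 50) + 50 * B + 60"

lemma run_emit_many:
  assumes "s 8 = []" "s 9 = []" "s 5 = un n" "s 18 = flag (w < 0)" "s 19 = rev (bin (nat \<bar>w\<bar>))" "length (s 19) \<le> B" "n \<le> B"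
  shows "run (copy 5 9 8 ;; While (NE 9) (Pop 9 ;; emit1)) s (s(7 := rev (concat (replicate n (enc1 [w]))) @ s 7)) (B * (20 * B + 50) + 20 * B + 10)"
proof -
  define R where "R i = s(9 := un (n - i), 7 := rev (concat (replicate i (enc1 [w]))) @ s 7)" for i
  have 1: "run (copy 5 9 8) s (R 0) (17 * n + 3)"
    using assms by (intro run_weaken[OF run_copy]) (auto simp: R_def fun_eq_iff)
  have rs: "concat (replicate (Suc i) x) = concat (replicate i x) @ x" for i and x :: "bool list"
    by (induction i) auto
  have 2: "run (While (NE 9) (Pop 9 ;; emit1)) (R 0) (R n) (n * ((1 + (20 * B + 40) + 1) + 2) + 1)"
  proof (rule run_While[where S = R])
    fix i assume i: "i < n"
    show "run (Pop 9 ;; emit1) (R i) (R (Suc i)) (1 + (20 * B + 40) + 1)"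
    proof (intro run_Seq)
      show "run (Pop 9) (R i) ((R i)(9 := un (n - Suc i))) 1"
        using i by (intro run_weaken[OF run_Pop]) (auto simp: R_def fun_eq_iff)
      show "run emit1 ((R i)(9 := un (n - Suc i))) (R (Suc i)) (20 * B + 40)"
        using assms by (intro run_weaken[OF run_emit1[where w = w]]) (auto simp: R_def rs fun_eq_iff simp del: replicate_Suc)
    qed
  qed (auto simp: R_def)
  have n: "n * ((1 + (20 * B + 40) + 1) + 2) \<le> B * (20 * B + 50)" using assms(7) by (intro mult_le_mono) auto
  have R: "R n = s(7 := rev (concat (replicate n (enc1 [w]))) @ s 7)" using assms by (auto simp: R_def fun_eq_iff)
  have "17 * n + 3 + (n * ((1 + (20 * B + 40) + 1) + 2) + 1) + 1 \<le> B * (20 * B + 50) + 20 * B + 10"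
    using n assms(7) by linarith
  then show ?thesis using run_weaken[OF run_Seq[OF 1 2] R] by simp
qed

lemma run_hconst:
  assumes f: "small_feature n f" and c: "clean s" "s 5 = un n" and B: "length (bin (nat \<bar>w\<bar>)) \<le> B" "n \<le> B"
  shows "run hconst (parsed f w s) (parsed f w (s(7 := rev (concat (replicate (cnum n f) (enc1 [w]))) @ s 7))) (tC B)"
proof -
  let ?p = "parsed f w s" let ?q = "parsed f w (s(7 := rev (concat (replicate (cnum n f) (enc1 [w]))) @ s 7))"
  have s8: "s 8 = []" "s 9 = []" using c(1) by (auto simp: clean_def)
  have e1: "run emit1 ?p ?q (B * (20 * B + 50) + 50 * B + 50)" if "cnum n f = 1"
    using that B s8 by (intro run_weaken[OF run_emit1[where w = w and B = B]]) (auto simp: parsed_def fun_eq_iff)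
  have "run hconst ?p ?q ((B * (20 * B + 50) + 50 * B + 50) + 1 + 1 + 1)"
    unfolding hconst_def
  proof (intro run_If)
    show "run Skip ?p ?q ((B * (20 * B + 50) + 50 * B + 50) + 1 + 1)" if "holds (TT 13) ?p"
      using that by (intro run_weaken[OF run_Skip]) (cases f, auto simp: parsed_def fun_eq_iff flag_def split: if_splits)
    show "run emit1 ?p ?q (B * (20 * B + 50) + 50 * B + 50)" if "\<not> holds (TT 13) ?p" "holds (TT 12) ?p" "holds (TT 11) ?p"
      using that by (intro e1) (cases f, auto simp: parsed_def flag_def is_ind_def split: if_splits)
    show "run emit1 ?p ?q (B * (20 * B + 50) + 50 * B + 50 + 1)" if "\<not> holds (TT 13) ?p" "\<not> holds (TT 12) ?p"
      using that by (intro run_weaken[OF e1]) (cases f, auto simp: parsed_def flag_def is_ind_def split: if_splits)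
    assume h: "\<not> holds (TT 13) ?p" "holds (TT 12) ?p" "\<not> holds (TT 11) ?p"
    then have "cnum n f = n" using f
      by (cases f) (auto simp: parsed_def flag_def is_ind_def small_feature_def split: if_splits)
    then show "run (copy 5 9 8 ;; While (NE 9) (Pop 9 ;; emit1)) ?p ?q (B * (20 * B + 50) + 50 * B + 50)"
      using B s8 c(2) by (intro run_weaken[OF run_emit_many[where w = w and B = B and n = n]]) (auto simp: parsed_def fun_eq_iff)
  qed (auto simp: parsed_def)
  then show ?thesis by (elim run_weaken) (auto simp: tC_def)
qed

lemma run_const_pass:
  assumes b: "fbounded B n fs" and c: "clean s" "s 5 = un n" "s 6 = enc_list enc_wf fs"
  shows "run (scan_features hconst) s (s(6 := [], 7 := rev (concat (map enc1 (const_ess n fs))) @ s 7)) (tS B (tC B))"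
proof -
  define S where "S i = s(7 := rev (concat (map enc1 (const_ess n (take i fs)))) @ s 7)" for i
  have "run (scan_features hconst) ((S 0)(6 := enc_list enc_wf fs)) ((S (length fs))(6 := [])) (tS B (tC B))"
  proof (rule run_scan_features[OF b])
    fix i f w xs assume i: "i < length fs" and fw: "fs ! i = (f, w)"
    have m: "(f, w) \<in> set fs" using i fw by (metis nth_mem)
    have t: "const_ess n (take (Suc i) fs) = const_ess n (take i fs) @ replicate (cnum n f) [w]"
      using i fw by (simp add: const_ess_def take_Suc_conv_app_nth)
    show "run hconst (parsed f w ((S i)(6 := xs))) (parsed f w ((S (Suc i))(6 := xs))) (tC B)"
      using c fboundedD(1,4,6)[OF b] m
      by (intro run_weaken[OF run_hconst[where n = n and B = B]]) (auto simp: S_def t fun_eq_iff parsed_def)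
  qed (use c in \<open>auto simp: S_def\<close>)
  moreover have "(S 0)(6 := enc_list enc_wf fs) = s" using c by (auto simp: S_def const_ess_def)
  moreover have "(S (length fs))(6 := []) = s(6 := [], 7 := rev (concat (map enc1 (const_ess n fs))) @ s 7)"
    by (auto simp: S_def)
  ultimately show ?thesis by simp
qed

section \<open>The factor of a single vertex pair\<close>

text \<open>The distance is added to register \<open>f\<close>, so several comparisons can
  accumulate there; if \<open>f\<close> starts empty, it stays empty exactly if all of them
  hold.\<close>

definition diff :: "nat \<Rightarrow> nat \<Rightarrow> nat \<Rightarrow> cmd" where
  "diff a b f = copy a 8 10 ;; copy b 9 10 ;; While (NE 8) (Pop 8 ;; If (NE 9) (Pop 9) (Push f True)) ;; pour 9 f"

lemma run_diff:
  assumes d: "4 \<le> a" "4 \<le> b" "4 \<le> f" "{a, b, f} \<inter> {8, 9, 10} = {}" "f \<noteq> a" "f \<noteq> b"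
    and s: "s 8 = []" "s 9 = []" "s 10 = []" "s a = un x" "s b = un y" "s f = un k" and B: "x \<le> B" "y \<le> B"
  shows "run (diff a b f) s (s(f := un ((y - x) + (x - y) + k))) (60 * B + 20)"
proof -
  define R where "R i = s(8 := un (x - i), 9 := un (y - i), f := un (i - y + k))" for i
  have 1: "run (copy a 8 10) s (s(8 := un x)) (17 * x + 3)"
    using d s by (intro run_weaken[OF run_copy]) auto
  have 2: "run (copy b 9 10) (s(8 := un x)) (R 0) (17 * y + 3)"
    using d s by (intro run_weaken[OF run_copy]) (auto simp: R_def fun_eq_iff)
  have 3: "run (While (NE 8) (Pop 8 ;; If (NE 9) (Pop 9) (Push f True))) (R 0) (R x) (x * ((1 + (2 + 1) + 1) + 2) + 1)"
  proof (rule run_While[where S = R])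
    fix i assume i: "i < x"
    show "run (Pop 8 ;; If (NE 9) (Pop 9) (Push f True)) (R i) (R (Suc i)) (1 + (2 + 1) + 1)"
    proof (intro run_Seq run_If)
      let ?t = "(R i)(8 := un (x - Suc i))"
      show "run (Pop 8) (R i) ?t 1" using d i by (intro run_weaken[OF run_Pop]) (auto simp: R_def fun_eq_iff)
      show "run (Pop 9) ?t (R (Suc i)) 2" if "holds (NE 9) ?t"
        using d that by (intro run_weaken[OF run_Pop]) (auto simp: R_def fun_eq_iff)
      show "run (Push f True) ?t (R (Suc i)) 2" if "\<not> holds (NE 9) ?t"
        using d that by (intro run_weaken[OF run_Push]) (auto simp: R_def fun_eq_iff Suc_diff_le)
    qed auto
  qed (use d in \<open>auto simp: R_def\<close>)
  have 4: "run (pour 9 f) (R x) (s(f := un ((y - x) + (x - y) + k))) (7 * y + 1)"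
    using d s by (intro run_weaken[OF run_pour]) (auto simp: R_def fun_eq_iff replicate_add)
  show ?thesis
    unfolding diff_def using run_Seq[OF 1 run_Seq[OF 2 run_Seq[OF 3 4]]] B by (elim run_weaken) auto
qed

definition addreg :: "nat \<Rightarrow> cmd" where
  "addreg d = copy 19 9 10 ;; pour 9 8 ;; add_to d"

lemma run_addreg:
  assumes d: "d \<in> {20, 21, 32, 33}" and s: "s 8 = []" "s 9 = []" "s 10 = []" "s 28 = []" "s 19 = rev (bin x)" "s d = bin y"
    and B: "length (bin x) \<le> B" "length (bin y) \<le> B"
  shows "run (addreg d) s (s(d := bin (x + y))) (80 * B + 60)"
proof -
  have "run (addreg d) s (s(d := bin (x + y))) ((17 * length (bin x) + 3) + ((7 * length (bin x) + 1) + (25 * (length (bin x) + length (bin y)) + 40) + 1) + 1)"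
    unfolding addreg_def
  proof (intro run_Seq)
    show "run (copy 19 9 10) s (s(9 := rev (bin x))) (17 * length (bin x) + 3)"
      using s by (intro run_weaken[OF run_copy]) auto
    show "run (pour 9 8) (s(9 := rev (bin x))) (s(8 := bin x)) (7 * length (bin x) + 1)"
      using s by (intro run_weaken[OF run_pour]) (auto simp: fun_eq_iff)
    show "run (add_to d) (s(8 := bin x)) (s(d := bin (x + y))) (25 * (length (bin x) + length (bin y)) + 40)"
      using s d by (intro run_weaken[OF run_add_to[where x = x and y = y]]) (auto simp: fun_eq_iff)
  qed
  then show ?thesis using B by (elim run_weaken) auto
qed

definition accumulate :: cmd where
  "accumulate = If (TT 14) (If (TT 18) (addreg 21 ;; emit1) (addreg 20)) (If (TT 18) (addreg 20 ;; emit1) (addreg 21))"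

lemma run_accumulate:
  assumes s: "s 8 = []" "s 9 = []" "s 10 = []" "s 28 = []" "s 14 = flag e" "s 18 = flag (w < 0)" "s 19 = rev (bin (nat \<bar>w\<bar>))"
      "s 20 = bin a" "s 21 = bin b"
    and B: "length (bin (nat \<bar>w\<bar>)) \<le> B" "length (bin a) \<le> B" "length (bin b) \<le> B"
  shows "run accumulate s (s(7 := (if w < 0 then rev (enc1 [w]) else []) @ s 7,
    20 := bin ((if e \<noteq> (w < 0) then nat \<bar>w\<bar> else 0) + a), 21 := bin ((if e = (w < 0) then nat \<bar>w\<bar> else 0) + b))) (100 * B + 110)"
    (is "run _ s ?t _")
proof -
  have A: "run (addreg 20) s (s(20 := bin (nat \<bar>w\<bar> + a))) (80 * B + 60)" using s B by (intro run_addreg) auto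
  have B': "run (addreg 21) s (s(21 := bin (nat \<bar>w\<bar> + b))) (80 * B + 60)" using s B by (intro run_addreg) auto
  have E: "run emit1 (s(d := x)) (s(d := x, 7 := rev (enc1 [w]) @ s 7)) (20 * B + 40)" if "d \<in> {20, 21}" for d x
    using s B that by (intro run_weaken[OF run_emit1[where w = w and B = B]]) auto
  have "run accumulate s ?t ((100 * B + 105) + 1 + 1)"
    unfolding accumulate_def
  proof (intro run_If)
    show "run (addreg 21 ;; emit1) s ?t (100 * B + 105)" if "holds (TT 14) s" "holds (TT 18) s"
      using s that by (intro run_weaken[OF run_Seq[OF B' E]]) (auto simp: flag_def fun_eq_iff split: if_splits)
    show "run (addreg 20) s ?t (100 * B + 105)" if "holds (TT 14) s" "\<not> holds (TT 18) s"
      using s that by (intro run_weaken[OF A]) (auto simp: flag_def fun_eq_iff split: if_splits)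
    show "run (addreg 20 ;; emit1) s ?t (100 * B + 105)" if "\<not> holds (TT 14) s" "holds (TT 18) s"
      using s that by (intro run_weaken[OF run_Seq[OF A E]]) (auto simp: flag_def fun_eq_iff split: if_splits)
    show "run (addreg 21) s ?t (100 * B + 105)" if "\<not> holds (TT 14) s" "\<not> holds (TT 18) s"
      using s that by (intro run_weaken[OF B']) (auto simp: flag_def fun_eq_iff split: if_splits)
  qed auto
  then show ?thesis by (elim run_weaken) auto
qed

text \<open>Registers 26 and 27 test the two orders in which the vertices of the feature can match
  the current pair, as in \<open>doubleton_dist\<close>; one success suffices.\<close>

definition hpair :: cmd where
  "hpair = If (TT 13) (If (TT 11)
     (diff 15 22 26 ;; diff 16 23 26 ;; diff 15 23 27 ;; diff 16 22 27 ;;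
      If (NE 26) (If (NE 27) Skip accumulate) accumulate ;; clear 26 ;; clear 27) accumulate) Skip"

lemma doubleton_dist:
  fixes a b u v :: nat
  shows "{a, b} = {u, v} \<longleftrightarrow> (u - b) + (b - u) + ((v - a) + (a - v)) = 0 \<or> (v - b) + (b - v) + ((u - a) + (a - u)) = 0"
  by (auto simp: doubleton_eq_iff)

lemma run_hpair:
  assumes f: "small_feature n f" and c: "clean s" "s 22 = un u" "s 23 = un v" "s 26 = []" "s 27 = []" "s 28 = []"
    and ab: "s 20 = bin a" "s 21 = bin b"
    and B: "length (bin (nat \<bar>w\<bar>)) \<le> B" "length (bin a) \<le> B" "length (bin b) \<le> B" "n \<le> B" "u \<le> B" "v \<le> B"
  shows "run hpair (parsed f w s) (parsed f w (s(7 := (if relv {u, v} f \<and> w < 0 then rev (enc1 [w]) else []) @ s 7,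
    20 := bin ((if relv {u, v} f \<and> (ebit f \<noteq> (w < 0)) then nat \<bar>w\<bar> else 0) + a),
    21 := bin ((if relv {u, v} f \<and> (ebit f = (w < 0)) then nat \<bar>w\<bar> else 0) + b)))) (400 * B + 300)"
    (is "run _ ?p ?q _")
proof -
  have s0: "s 8 = []" "s 9 = []" "s 10 = []" using c(1) by (auto simp: clean_def)
  define eff where "eff r t = t(7 := (if r \<and> w < 0 then rev (enc1 [w]) else []) @ s 7,
    20 := bin ((if r \<and> (ebit f \<noteq> (w < 0)) then nat \<bar>w\<bar> else 0) + a),
    21 := bin ((if r \<and> (ebit f = (w < 0)) then nat \<bar>w\<bar> else 0) + b))" for r and t :: store
  have acc: "run accumulate (?p(26 := x, 27 := y)) (eff True (?p(26 := x, 27 := y))) (100 * B + 110)" if "ford f = 2" for x y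
    using s0 c ab B that by (intro run_weaken[OF run_accumulate[where a = a and b = b and w = w and e = "ebit f" and B = B]])
      (auto simp: parsed_def eff_def fun_eq_iff)
  have noacc: "?p(26 := x, 27 := y) = eff False (?p(26 := x, 27 := y))" for x y
    using ab by (auto simp: eff_def parsed_def fun_eq_iff)
  have p0: "?p(26 := [], 27 := []) = ?p" using c by (auto simp: parsed_def fun_eq_iff)
  let ?T = "400 * B + 250"
  have "run hpair ?p ?q (?T + 1 + 1)"
    unfolding hpair_def
  proof (intro run_If)
    show "run Skip ?p ?q (?T + 1)" if "\<not> holds (TT 13) ?p"
    proof -
      have "\<not> relv {u, v} f" using that by (cases f) (auto simp: parsed_def flag_def split: if_splits)
      then show ?thesis using ab by (intro run_weaken[OF run_Skip]) (auto simp: parsed_def fun_eq_iff)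
    qed
    show "run accumulate ?p ?q ?T" if "holds (TT 13) ?p" "\<not> holds (TT 11) ?p"
    proof -
      have "ford f = 2" "relv {u, v} f" using that by (cases f; auto simp: parsed_def flag_def is_ind_def split: if_splits)+
      then show ?thesis by (intro run_weaken[OF acc[of "[]" "[]", unfolded p0]]) (auto simp: eff_def parsed_def fun_eq_iff)
    qed
    assume h: "holds (TT 13) ?p" "holds (TT 11) ?p"
    then obtain F vs where fF: "f = Indicator F vs" "graph_order F = 2"
      by (cases f) (auto simp: parsed_def flag_def is_ind_def split: if_splits)
    then have "length vs = 2" "set vs \<subseteq> {..<n}" using f by (auto simp: small_feature_def)
    then obtain x y where vs: "vs = [x, y]" "x < n" "y < n"
      by (auto simp: numeral_2_eq_2 length_Suc_conv)
    have vf: "vfold (0, 0) (fverts f) = (y, x)" by (simp add: fF vs)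
    define k where "k = (u - y) + (y - u)" define k2 where "k2 = (v - x) + (x - v) + k"
    define l where "l = (v - y) + (y - v)" define l2 where "l2 = (u - x) + (x - u) + l"
    have rel: "relv {u, v} f \<longleftrightarrow> k2 = 0 \<or> l2 = 0"
      by (simp add: fF vs doubleton_dist k_def k2_def l_def l2_def add.commute)
    have bd: "k2 \<le> 2 * B" "l2 \<le> 2 * B" using B vs unfolding k_def k2_def l_def l2_def by linarith+
    let ?r = "relv {u, v} f"
    let ?D = "60 * B + 20"
    note P = parsed_def vf
    show "run (diff 15 22 26 ;; diff 16 23 26 ;; diff 15 23 27 ;; diff 16 22 27 ;;
      If (NE 26) (If (NE 27) Skip accumulate) accumulate ;; clear 26 ;; clear 27) ?p ?q ?T"
    proof (rule run_weaken)
      show "run (diff 15 22 26 ;; diff 16 23 26 ;; diff 15 23 27 ;; diff 16 22 27 ;;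
        If (NE 26) (If (NE 27) Skip accumulate) accumulate ;; clear 26 ;; clear 27) ?p ?q
        (?D + (?D + (?D + (?D + (((100 * B + 110) + 1 + 1) + ((6 * B + 1) + (6 * B + 1) + 1) + 1) + 1) + 1) + 1) + 1)"
      proof (intro run_Seq)
        show "run (diff 15 22 26) ?p (?p(26 := un k)) ?D"
          using s0 c B vs by (intro run_weaken[OF run_diff[where x = y and y = u and k = 0 and B = B]]) (auto simp: P k_def)
        show "run (diff 16 23 26) (?p(26 := un k)) (?p(26 := un k2)) ?D"
          using s0 c B vs by (intro run_weaken[OF run_diff[where x = x and y = v and k = k and B = B]]) (auto simp: P k2_def)
        show "run (diff 15 23 27) (?p(26 := un k2)) (?p(26 := un k2, 27 := un l)) ?D"
          using s0 c B vs by (intro run_weaken[OF run_diff[where x = y and y = v and k = 0 and B = B]]) (auto simp: P l_def)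
        let ?p1 = "?p(26 := un k2, 27 := un l2)"
        show "run (diff 16 22 27) (?p(26 := un k2, 27 := un l)) ?p1 ?D"
          using s0 c B vs by (intro run_weaken[OF run_diff[where x = x and y = u and k = l and B = B]]) (auto simp: P l2_def)
        show "run (If (NE 26) (If (NE 27) Skip accumulate) accumulate) ?p1 (eff ?r ?p1) ((100 * B + 110) + 1 + 1)"
        proof (intro run_If)
          show "run Skip ?p1 (eff ?r ?p1) (100 * B + 110)" if "holds (NE 26) ?p1" "holds (NE 27) ?p1"
          proof -
            have "\<not> ?r" using that by (simp add: rel)
            then show ?thesis using noacc by (intro run_weaken[OF run_Skip]) auto
          qed
          show "run accumulate ?p1 (eff ?r ?p1) (100 * B + 110)" if "\<not> holds (NE 27) ?p1"
          proof -
            have ?r using that by (simp add: rel)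
            then show ?thesis using fF by (intro run_weaken[OF acc]) auto
          qed
          show "run accumulate ?p1 (eff ?r ?p1) (100 * B + 110 + 1)" if "\<not> holds (NE 26) ?p1"
          proof -
            have ?r using that by (simp add: rel)
            then show ?thesis using fF by (intro run_weaken[OF acc]) auto
          qed
        qed auto
        show "run (clear 26) (eff ?r ?p1) ((eff ?r ?p1)(26 := [])) (6 * B + 1)"
          using bd by (intro run_weaken[OF run_clear]) (auto simp: eff_def)
        show "run (clear 27) ((eff ?r ?p1)(26 := [])) ?q (6 * B + 1)"
          using bd c by (intro run_weaken[OF run_clear]) (auto simp: eff_def parsed_def fun_eq_iff)
      qed
    qed auto
  qed (auto simp: parsed_def)
  then show ?thesis by (elim run_weaken) auto
qed

lemma run_pair_pass:
  assumes b: "fbounded B n fs" and c: "clean s" "s 6 = enc_list enc_wf fs" "s 22 = un u" "s 23 = un v"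
      "s 20 = []" "s 21 = []" "s 26 = []" "s 27 = []" "s 28 = []" and uv: "u < n" "v < n"
  shows "run (scan_features hpair) s (s(6 := [], 7 := rev (concat (map enc1 (map (\<lambda>(f, w). [w]) (negs {u, v} fs)))) @ s 7,
    20 := bin (addw True {u, v} fs), 21 := bin (addw False {u, v} fs))) (tS B (400 * B + 300))" (is "run _ s ?t _")
proof -
  define S where "S i = s(7 := rev (concat (map enc1 (map (\<lambda>(f, w). [w]) (negs {u, v} (take i fs))))) @ s 7,
    20 := bin (addw True {u, v} (take i fs)), 21 := bin (addw False {u, v} (take i fs)))" for i
  have "run (scan_features hpair) ((S 0)(6 := enc_list enc_wf fs)) ((S (length fs))(6 := [])) (tS B (400 * B + 300))"
  proof (rule run_scan_features[OF b])
    fix i f w xs assume i: "i < length fs" and fw: "fs ! i = (f, w)"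
    have m: "(f, w) \<in> set fs" using i fw by (metis nth_mem)
    have t: "take (Suc i) fs = take i fs @ [(f, w)]" using i fw by (simp add: take_Suc_conv_app_nth)
    have eq: "S (Suc i) = (S i)(7 := (if relv {u, v} f \<and> w < 0 then rev (enc1 [w]) else []) @ S i 7,
      20 := bin ((if relv {u, v} f \<and> (ebit f \<noteq> (w < 0)) then nat \<bar>w\<bar> else 0) + addw True {u, v} (take i fs)),
      21 := bin ((if relv {u, v} f \<and> (ebit f = (w < 0)) then nat \<bar>w\<bar> else 0) + addw False {u, v} (take i fs)))"
      by (auto simp: S_def t negs_def addw_def add.commute fun_eq_iff)
    show "run hpair (parsed f w ((S i)(6 := xs))) (parsed f w ((S (Suc i))(6 := xs))) (400 * B + 300)"
      unfolding eq using c uv fboundedD(1,4,6,8)[OF b] m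
      by (intro run_weaken[OF run_hpair[where n = n and u = u and v = v and a = "addw True {u, v} (take i fs)" and b = "addw False {u, v} (take i fs)" and B = B]])
        (auto simp: S_def fun_eq_iff parsed_def intro: order_trans less_imp_le)
  qed (use c in \<open>auto simp: S_def\<close>)
  moreover have "(S 0)(6 := enc_list enc_wf fs) = s" using c by (auto simp: S_def negs_def addw_def)
  moreover have "(S (length fs))(6 := []) = ?t" by (auto simp: S_def fun_eq_iff)
  ultimately show ?thesis by simp
qed

definition emit_word :: "nat \<Rightarrow> nat \<Rightarrow> cmd" where
  "emit_word r d = While (NE r) (Push d True ;; xfer r d) ;; Push d False"

lemma run_emit_word:
  assumes d: "4 \<le> r" "r \<noteq> d" "writable s d" "d \<noteq> 0"
  shows "run (emit_word r d) s (s(r := [], d := rev (enc_word (s r)) @ s d)) (10 * length (s r) + 5)"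
proof -
  note n = writable_neq[OF d(3)]
  define R where "R i = s(r := drop i (s r), d := rev (concat (map (\<lambda>b. [True, b]) (take i (s r)))) @ s d)" for i
  have "run (While (NE r) (Push d True ;; xfer r d)) (R 0) (R (length (s r))) (length (s r) * ((2 + 5 + 1) + 2) + 1)"
  proof (rule run_While[where S = R])
    fix i assume i: "i < length (s r)"
    show "run (Push d True ;; xfer r d) (R i) (R (Suc i)) (2 + 5 + 1)"
    proof (intro run_Seq)
      show "run (Push d True) (R i) ((R i)(d := True # R i d)) 2" using d n by (intro run_Push) (auto simp: R_def)
      show "run (xfer r d) ((R i)(d := True # R i d)) (R (Suc i)) 5"
        using d n i by (intro run_weaken[OF run_xfer[where x = "s r ! i" and xs = "drop (Suc i) (s r)"]])
          (auto simp: R_def Cons_nth_drop_Suc take_Suc_conv_app_nth fun_eq_iff)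
    qed
  qed (use d n in \<open>auto simp: R_def\<close>)
  moreover have "run (Push d False) (R (length (s r))) (s(r := [], d := rev (enc_word (s r)) @ s d)) 2"
    using d n by (intro run_weaken[OF run_Push]) (auto simp: R_def enc_word_eq fun_eq_iff)
  moreover have "R 0 = s" using d by (auto simp: R_def)
  ultimately show ?thesis unfolding emit_word_def by (intro run_weaken[OF run_Seq]) auto
qed

definition emit_pair :: cmd where
  "emit_pair = pushes 7 [True, True, False] ;; emit_word 20 7 ;; pushes 7 [True, False] ;; emit_word 21 7 ;; Push 7 False"

lemma run_emit_pair:
  assumes s: "s 20 = bin a" "s 21 = bin b" and B: "length (bin a) \<le> B" "length (bin b) \<le> B"
  shows "run emit_pair s (s(20 := [], 21 := [], 7 := rev (enc1 [int a, int b]) @ s 7)) (20 * B + 40)"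
proof -
  let ?o1 = "[False, True, True] @ s 7"
  let ?o2 = "rev (enc_word (bin a)) @ ?o1"
  let ?o3 = "[False, True] @ ?o2"
  let ?o4 = "rev (enc_word (bin b)) @ ?o3"
  have "run emit_pair s (s(20 := [], 21 := [], 7 := rev (enc1 [int a, int b]) @ s 7))
    (9 + ((10 * length (bin a) + 5) + (6 + ((10 * length (bin b) + 5) + 2 + 1) + 1) + 1) + 1)"
    unfolding emit_pair_def
  proof (intro run_Seq)
    show "run (pushes 7 [True, True, False]) s (s(7 := ?o1)) 9" by (intro run_weaken[OF run_pushes]) auto
    show "run (emit_word 20 7) (s(7 := ?o1)) (s(20 := [], 7 := ?o2)) (10 * length (bin a) + 5)"
      using s by (intro run_weaken[OF run_emit_word]) (auto simp: fun_eq_iff)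
    show "run (pushes 7 [True, False]) (s(20 := [], 7 := ?o2)) (s(20 := [], 7 := ?o3)) 6"
      by (intro run_weaken[OF run_pushes]) auto
    show "run (emit_word 21 7) (s(20 := [], 7 := ?o3)) (s(20 := [], 21 := [], 7 := ?o4)) (10 * length (bin b) + 5)"
      using s by (intro run_weaken[OF run_emit_word]) (auto simp: fun_eq_iff)
    show "run (Push 7 False) (s(20 := [], 21 := [], 7 := ?o4)) (s(20 := [], 21 := [], 7 := rev (enc1 [int a, int b]) @ s 7)) 2"
      by (intro run_weaken[OF run_Push]) (auto simp: enc1_def enc_list_def enc_int_def enc_nat_def)
  qed
  then show ?thesis using B by (elim run_weaken) auto
qed

text \<open>The store between two phases: \<open>out\<close> is the reversed output and \<open>{u, v}\<close> the current pair of vertices.\<close>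

definition base :: "nat \<Rightarrow> (feature \<times> int) list \<Rightarrow> bool list \<Rightarrow> nat \<Rightarrow> nat \<Rightarrow> bool list \<Rightarrow> bool list \<Rightarrow> store" where
  "base n fs out u v d e = (\<lambda>_. [])(4 := enc_list enc_wf fs, 5 := un n, 7 := out, 22 := un u, 23 := un v, 24 := d, 25 := e)"

definition pair_body :: cmd where
  "pair_body = copy 4 6 8 ;; scan_features hpair ;; emit_pair ;; Push 22 True"

definition tI :: "nat \<Rightarrow> nat" where "tI B = tS B (400 * B + 300) + 40 * B + 50"

lemma run_pair_body:
  assumes b: "fbounded B n fs" and uv: "u < n" "v < n"
  shows "run pair_body (base n fs out u v d e) (base n fs (rev (concat (map enc1 (pair_ess fs {u, v}))) @ out) (Suc u) v d e) (tI B)"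
proof -
  let ?s = "base n fs out u v d e"
  let ?o = "rev (concat (map enc1 (map (\<lambda>(f, w). [w]) (negs {u, v} fs)))) @ out"
  let ?s2 = "?s(7 := ?o, 20 := bin (addw True {u, v} fs), 21 := bin (addw False {u, v} fs))"
  let ?o3 = "rev (concat (map enc1 (pair_ess fs {u, v}))) @ out"
  have "run pair_body ?s (base n fs ?o3 (Suc u) v d e)
    ((17 * B + 3) + (tS B (400 * B + 300) + ((20 * B + 40) + 2 + 1) + 1) + 1)"
    unfolding pair_body_def
  proof (intro run_Seq)
    show "run (copy 4 6 8) ?s (?s(6 := enc_list enc_wf fs)) (17 * B + 3)"
      using fboundedD(3)[OF b] by (intro run_weaken[OF run_copy]) (auto simp: base_def)
    show "run (scan_features hpair) (?s(6 := enc_list enc_wf fs)) ?s2 (tS B (400 * B + 300))"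
      using uv by (intro run_weaken[OF run_pair_pass[OF b, where u = u and v = v]]) (auto simp: base_def clean_def fun_eq_iff)
    show "run emit_pair ?s2 (?s(7 := ?o3)) (20 * B + 40)"
      using fboundedD(8)[OF b, of _ _ "length fs"]
      by (intro run_weaken[OF run_emit_pair[where a = "addw True {u, v} fs" and b = "addw False {u, v} fs" and B = B]])
        (auto simp: base_def pair_ess_def fun_eq_iff)
    show "run (Push 22 True) (?s(7 := ?o3)) (base n fs ?o3 (Suc u) v d e) 2"
      by (intro run_weaken[OF run_Push]) (auto simp: base_def fun_eq_iff)
  qed
  then show ?thesis by (elim run_weaken) (auto simp: tI_def)
qed

definition outer_body :: cmd where
  "outer_body = copy 23 25 8 ;; While (NE 25) (Pop 25 ;; pair_body) ;; clear 22 ;; Push 23 True"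

definition row_ess :: "(feature \<times> int) list \<Rightarrow> nat \<Rightarrow> nat \<Rightarrow> int list list" where
  "row_ess fs v k = concat (map (\<lambda>u. pair_ess fs {u, v}) [0..<k])"

definition tO :: "nat \<Rightarrow> nat" where "tO B = B * (tI B + 4) + 30 * B + 20"

lemma run_outer_body:
  assumes b: "fbounded B n fs" and v: "v < n"
  shows "run outer_body (base n fs out 0 v d []) (base n fs (rev (concat (map enc1 (row_ess fs v v))) @ out) 0 (Suc v) d []) (tO B)"
proof -
  define R where "R u = base n fs (rev (concat (map enc1 (row_ess fs v u))) @ out) u v d (un (v - u))" for u
  have vB: "v \<le> B" using v fboundedD(1)[OF b] by simp
  have r: "run outer_body (base n fs out 0 v d []) (base n fs (rev (concat (map enc1 (row_ess fs v v))) @ out) 0 (Suc v) d [])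
    ((17 * v + 3) + ((v * ((1 + tI B + 1) + 2) + 1) + ((3 * v + 1) + 2 + 1) + 1) + 1)"
    unfolding outer_body_def
  proof (intro run_Seq)
    show "run (copy 23 25 8) (base n fs out 0 v d []) (R 0) (17 * v + 3)"
      by (intro run_weaken[OF run_copy]) (auto simp: base_def R_def row_ess_def fun_eq_iff)
    show "run (While (NE 25) (Pop 25 ;; pair_body)) (R 0) (R v) (v * ((1 + tI B + 1) + 2) + 1)"
    proof (rule run_While[where S = R])
      fix u assume u: "u < v"
      show "run (Pop 25 ;; pair_body) (R u) (R (Suc u)) (1 + tI B + 1)"
      proof (intro run_Seq)
        show "run (Pop 25) (R u) (base n fs (rev (concat (map enc1 (row_ess fs v u))) @ out) u v d (un (v - Suc u))) 1"
          using u by (intro run_weaken[OF run_Pop]) (auto simp: R_def base_def fun_eq_iff)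
        show "run pair_body (base n fs (rev (concat (map enc1 (row_ess fs v u))) @ out) u v d (un (v - Suc u))) (R (Suc u)) (tI B)"
          using u v by (intro run_weaken[OF run_pair_body[OF b]]) (auto simp: R_def row_ess_def)
      qed
    qed (auto simp: R_def base_def)
    show "run (clear 22) (R v) (base n fs (rev (concat (map enc1 (row_ess fs v v))) @ out) 0 v d []) (3 * v + 1)"
      by (intro run_weaken[OF run_clear]) (auto simp: R_def base_def fun_eq_iff)
    show "run (Push 23 True) (base n fs (rev (concat (map enc1 (row_ess fs v v))) @ out) 0 v d [])
      (base n fs (rev (concat (map enc1 (row_ess fs v v))) @ out) 0 (Suc v) d []) 2"
      by (intro run_weaken[OF run_Push]) (auto simp: base_def fun_eq_iff)
  qed
  have p: "v * ((1 + tI B + 1) + 2) \<le> B * (tI B + 4)" using vB by (intro mult_le_mono) auto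
  have aux: "(17 * v + 3) + ((p + 1) + ((3 * v + 1) + 2 + 1) + 1) + 1 \<le> q + 30 * B + 20" if "p \<le> q" for p q
    using that vB by simp
  show ?thesis unfolding tO_def by (rule run_weaken[OF r refl aux[OF p]])
qed

definition factor :: cmd where
  "factor = pour 0 8 ;; pour 8 4 ;; While (TT 4) (Pop 4 ;; Push 5 True) ;; Pop 4 ;; copy 4 6 8 ;; scan_features hconst ;;
     copy 5 24 8 ;; While (NE 24) (Pop 24 ;; outer_body) ;; Push 7 False"

definition tF :: "nat \<Rightarrow> nat" where
  "tF B = B * (tO B + 4) + tS B (tC B) + 60 * B + 40"

lemma enc_list_ess: "enc_list (enc_list enc_int) ess = concat (map enc1 ess) @ [False]"
  by (induction ess) (auto simp: enc1_def enc_list_def)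

lemma run_factor:
  assumes b: "fbounded B n fs" and x: "x = enc_unary n @ enc_list enc_wf fs" "length x \<le> B"
  shows "run factor (input_store x) (base n fs (rev (enc_list (enc_list enc_int) (ess_of n fs))) 0 n [] []) (tF B)"
proof -
  let ?e = "enc_list enc_wf fs"
  have nB: "n \<le> B" by (rule fboundedD(1)[OF b])
  define U :: "nat \<Rightarrow> store" where "U i = (\<lambda>_. [])(4 := un (n - i) @ False # ?e, 5 := un i)" for i
  let ?c = "rev (concat (map enc1 (const_ess n fs)))"
  let ?rows = "\<lambda>k. concat (map (\<lambda>v. row_ess fs v v) [0..<k])"
  define R where "R k = base n fs (rev (concat (map enc1 (const_ess n fs @ ?rows k)))) 0 k (un (n - k)) []" for k
  have r: "run factor (input_store x) (base n fs (rev (enc_list (enc_list enc_int) (ess_of n fs))) 0 n [] [])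
    ((7 * B + 1) + ((7 * B + 1) + ((n * ((1 + 2 + 1) + 2) + 1) + (1 + ((17 * B + 3) + (tS B (tC B) + ((17 * n + 3) +
      ((n * ((1 + tO B + 1) + 2) + 1) + 2 + 1) + 1) + 1) + 1) + 1) + 1) + 1) + 1)"
    unfolding factor_def
  proof (intro run_Seq)
    show "run (pour 0 8) (input_store x) ((\<lambda>_::nat. [])(8 := rev x)) (7 * B + 1)"
      using x(2) by (intro run_weaken[OF run_pour]) (auto simp: input_store_def fun_eq_iff)
    show "run (pour 8 4) ((\<lambda>_::nat. [])(8 := rev x)) (U 0) (7 * B + 1)"
      using x by (intro run_weaken[OF run_pour]) (auto simp: U_def fun_eq_iff enc_unary_def)
    show "run (While (TT 4) (Pop 4 ;; Push 5 True)) (U 0) (U n) (n * ((1 + 2 + 1) + 2) + 1)"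
    proof (rule run_While[where S = U])
      fix i assume i: "i < n"
      have l: "n - i = Suc (n - Suc i)" using i by simp
      show "run (Pop 4 ;; Push 5 True) (U i) (U (Suc i)) (1 + 2 + 1)"
      proof (intro run_Seq)
        show "run (Pop 4) (U i) ((U i)(4 := un (n - Suc i) @ False # ?e)) 1"
          by (intro run_weaken[OF run_Pop]) (auto simp: U_def l fun_eq_iff)
        show "run (Push 5 True) ((U i)(4 := un (n - Suc i) @ False # ?e)) (U (Suc i)) 2"
          by (intro run_weaken[OF run_Push]) (auto simp: U_def fun_eq_iff)
      qed
      show "holds (TT 4) (U i)" using l by (simp add: U_def)
    qed (auto simp: U_def)
    show "run (Pop 4) (U n) (base n fs [] 0 0 [] []) 1"
      by (intro run_weaken[OF run_Pop]) (auto simp: U_def base_def fun_eq_iff)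
    show "run (copy 4 6 8) (base n fs [] 0 0 [] []) ((base n fs [] 0 0 [] [])(6 := ?e)) (17 * B + 3)"
      using fboundedD(3)[OF b] by (intro run_weaken[OF run_copy]) (auto simp: base_def)
    show "run (scan_features hconst) ((base n fs [] 0 0 [] [])(6 := ?e)) (base n fs ?c 0 0 [] []) (tS B (tC B))"
      by (intro run_weaken[OF run_const_pass[OF b]]) (auto simp: base_def clean_def fun_eq_iff)
    show "run (copy 5 24 8) (base n fs ?c 0 0 [] []) (R 0) (17 * n + 3)"
      by (intro run_weaken[OF run_copy]) (auto simp: base_def R_def fun_eq_iff)
    show "run (While (NE 24) (Pop 24 ;; outer_body)) (R 0) (R n) (n * ((1 + tO B + 1) + 2) + 1)"
    proof (rule run_While[where S = R])
      fix v assume v: "v < n"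
      let ?o = "rev (concat (map enc1 (const_ess n fs @ ?rows v)))"
      show "run (Pop 24 ;; outer_body) (R v) (R (Suc v)) (1 + tO B + 1)"
      proof (intro run_Seq)
        show "run (Pop 24) (R v) (base n fs ?o 0 v (un (n - Suc v)) []) 1"
          using v by (intro run_weaken[OF run_Pop]) (auto simp: R_def base_def fun_eq_iff)
        show "run outer_body (base n fs ?o 0 v (un (n - Suc v)) []) (R (Suc v)) (tO B)"
          using v by (intro run_weaken[OF run_outer_body[OF b]]) (auto simp: R_def)
      qed
    qed (auto simp: R_def base_def)
    show "run (Push 7 False) (R n) (base n fs (rev (enc_list (enc_list enc_int) (ess_of n fs))) 0 n [] []) 2"
      by (intro run_weaken[OF run_Push]) (auto simp: R_def base_def enc_list_ess ess_of_def row_ess_def fun_eq_iff)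
  qed
  have p: "n * ((1 + tO B + 1) + 2) \<le> B * (tO B + 4)" using nB by (intro mult_le_mono) auto
  have aux: "(7 * B + 1) + ((7 * B + 1) + ((n * ((1 + 2 + 1) + 2) + 1) + (1 + ((17 * B + 3) + (t + ((17 * n + 3) +
      ((p + 1) + 2 + 1) + 1) + 1) + 1) + 1) + 1) + 1) + 1 \<le> q + t + 60 * B + 40" if "p \<le> q" for p q t
    using that nB by simp
  show ?thesis unfolding tF_def by (rule run_weaken[OF r refl aux[OF p]])
qed

lemma fbounded_ergm:
  assumes "\<forall>(f, w)\<in>set fs. small_feature n f"
  shows "fbounded (length (enc_unary n @ enc_list enc_wf fs)) n fs"
proof -
  have 1: "(\<Sum>(f, w)\<leftarrow>fs. length (bin (nat \<bar>w\<bar>))) \<le> length (enc_list enc_wf fs)"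
  proof (induction fs)
    case (Cons fw fs)
    obtain f w where fw: "fw = (f, w)" by force
    have "length w \<le> length (enc_word w)" for w by (induction w) auto
    from this[of "bin (nat \<bar>w\<bar>)"] show ?case using Cons by (simp add: fw enc_list_def enc_int_def enc_nat_def)
  qed simp
  have 2: "length fs \<le> length (enc_list enc_wf fs)"
    by (induction fs) (auto simp: enc_list_def)
  show ?thesis unfolding fbounded_def using 1 2 assms by (auto simp: enc_unary_def)
qed

lemma pbound_tF: "pbound tF"
  unfolding tF_def tO_def tI_def tS_def tC_def tPa_def tV_def by (intro pbound_intros)

lemma small_features:
  assumes "\<forall>F\<in>S. simple_graph F" "\<not> (\<exists>F\<in>S. 3 \<le> graph_order F)" "uses_features_from S (ERGM n fs)"
  shows "\<forall>(f, w)\<in>set fs. small_feature n f"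
proof -
  have "small_feature n f" if "(f, w) \<in> set fs" for f w
  proof -
    have "feature_from S n f" using assms(3) that by (auto simp: uses_features_from_def)
    then show ?thesis using assms(1,2) by (cases f) (auto simp: small_feature_def not_le)
  qed
  then show ?thesis by blast
qed

theorem poly_time_factored:
  assumes S: "\<forall>F\<in>S. simple_graph F" "\<not> (\<exists>F\<in>S. 3 \<le> graph_order F)"
  shows "poly_time_solvable (ergm_partition_factored S)"
proof -
  \<comment> \<open>Register 7 holds the output with its end on top; pouring twice keeps this
    orientation on the output tape.\<close>
  let ?c = "factor ;; pour 7 8 ;; pour 8 1"
  obtain M where M: "turing_machine M"
    "\<And>x s t. run ?c (input_store x) s t \<Longrightarrow> outputs_within no_oracle M x (rev (s 1)) (t + 3)"
    using compile[of ?c] by blast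
  have "pbound (\<lambda>B. tF B + ((7 * tF B + 1) + (7 * tF B + 1) + 1) + 1 + 3)"
    by (intro pbound_intros pbound_tF)
  then obtain p where p: "\<And>B. tF B + ((7 * tF B + 1) + (7 * tF B + 1) + 1) + 1 + 3 \<le> poly p B"
    unfolding pbound_def by blast
  have "\<exists>y. (x, y) \<in> ergm_partition_factored S \<and> outputs_within no_oracle M x y (poly p (length x))"
    if "x \<in> Domain (ergm_partition_factored S)" for x
  proof -
    obtain n fs where m: "x = enc_ergm (ERGM n fs)" "uses_features_from S (ERGM n fs)"
      using \<open>x \<in> _\<close> unfolding ergm_partition_factored_def by (auto, metis ergm.exhaust)
    note sf = small_features[OF S m(2)]
    have x: "x = enc_unary n @ enc_list enc_wf fs" using m(1) by (simp add: enc_ergm_def)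
    let ?y = "enc_list (enc_list enc_int) (ess_of n fs)"
    define B where "B = length x"
    let ?s = "base n fs (rev ?y) 0 n [] []"
    have 1: "run factor (input_store x) ?s (tF B)"
      using fbounded_ergm[OF sf] x by (intro run_factor) (auto simp: B_def)
    have ly: "length ?y \<le> tF B" using run_grow[OF 1, of 7] by (simp add: base_def input_store_def)
    have 2: "run (pour 7 8) ?s (?s(7 := [], 8 := ?y)) (7 * tF B + 1)"
      using ly by (intro run_weaken[OF run_pour]) (auto simp: base_def fun_eq_iff)
    have 3: "run (pour 8 1) (?s(7 := [], 8 := ?y)) (?s(7 := [], 1 := rev ?y)) (7 * tF B + 1)"
      using ly by (intro run_weaken[OF run_pour]) (auto simp: base_def fun_eq_iff)
    have "outputs_within no_oracle M x ?y (tF B + ((7 * tF B + 1) + (7 * tF B + 1) + 1) + 1 + 3)"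
      using M(2)[OF run_Seq[OF 1 run_Seq[OF 2 3]]] by simp
    then have "outputs_within no_oracle M x ?y (poly p (length x))"
      using p outputs_within_mono unfolding B_def by blast
    moreover have "(x, ?y) \<in> ergm_partition_factored S"
      unfolding ergm_partition_factored_def using m factored_ess_of[OF sf] by blast
    ultimately show ?thesis by blast
  qed
  then show ?thesis unfolding poly_time_solvable_def using M(1) by blast
qed

section \<open>The exact value, with powers of two split off\<close>

text \<open>The triple stands for \<open>2 ^ k * p / 2 ^ l\<close> with odd \<open>p\<close>. For
  \<open>a \<noteq> b\<close> the factor is \<open>2 ^ min a b\<close> times an odd number; for
  \<open>a = b\<close> it is a pure power of two, and treating it as such is what keeps
  \<open>p\<close> odd.\<close>

fun acc :: "int list \<Rightarrow> nat \<times> nat \<times> nat \<Rightarrow> nat \<times> nat \<times> nat" where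
  "acc [w] (k, l, p) = (if w < 0 then (k, nat \<bar>w\<bar> + l, p) else (nat \<bar>w\<bar> + k, l, p))"
| "acc [a, b] (k, l, p) =
     (if a = b then (1 + (nat a + k), l, p) else (nat (min a b) + k, l, 2 ^ nat \<bar>a - b\<bar> * p + p))"
| "acc _ x = x"

text \<open>The only shapes that \<open>ess_of\<close> produces: negative exponents occur alone, and
  sums have natural exponents.\<close>

definition tame :: "int list \<Rightarrow> bool" where
  "tame es \<longleftrightarrow> (\<exists>w. es = [w]) \<or> (\<exists>a b. es = [int a, int b])"

fun dyadic :: "nat \<times> nat \<times> nat \<Rightarrow> rat" where
  "dyadic (k, l, p) = 2 ^ k * of_nat p / 2 ^ l"

lemma tame_ess_of: "es \<in> set (ess_of n fs) \<Longrightarrow> tame es"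
  by (auto simp: ess_of_def const_ess_def pair_ess_def tame_def)

lemma dyadic_acc: "tame es \<Longrightarrow> dyadic (acc es x) = (\<Sum>e\<leftarrow>es. 2 powi e) * dyadic x"
proof -
  assume "tame es"
  obtain k l p where x: "x = (k, l, p)" by (cases x)
  consider w where "es = [w]" | a b where "es = [int a, int b]" using \<open>tame es\<close> by (auto simp: tame_def)
  then show ?thesis
  proof cases
    case (1 w)
    show ?thesis
    proof (cases "w < 0")
      case True
      then have "(2 :: rat) powi w = 1 / 2 ^ nat \<bar>w\<bar>" by (simp add: power_int_def field_simps)
      then show ?thesis using True by (simp add: 1 x power_add)
    next
      case False
      then have "(2 :: rat) powi w = 2 ^ nat \<bar>w\<bar>" by (simp add: power_int_def)
      then show ?thesis using False by (simp add: 1 x power_add)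
    qed
  next
    case (2 a b)
    have e: "(2 :: rat) ^ (nat (min (int a) (int b)) + k) * of_nat (2 ^ nat \<bar>int a - int b\<bar> * p + p) = (2 ^ a + 2 ^ b) * (2 ^ k * of_nat p)"
    proof (cases "a \<le> b")
      case True
      then have "nat \<bar>int a - int b\<bar> = b - a" by simp
      moreover have "(2 :: rat) ^ b = 2 ^ a * 2 ^ (b - a)" using True by (simp add: power_add[symmetric])
      ultimately show ?thesis using True by (simp add: power_add algebra_simps)
    next
      case False
      then have "nat \<bar>int a - int b\<bar> = a - b" by simp
      moreover have "(2 :: rat) ^ a = 2 ^ b * 2 ^ (a - b)" using False by (simp add: power_add[symmetric])
      ultimately show ?thesis using False by (simp add: power_add algebra_simps)
    qed
    show ?thesis
    proof (cases "a = b")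
      case True
      then show ?thesis by (simp add: 2 x power_add)
    next
      case False
      then show ?thesis using e by (simp add: 2 x)
    qed
  qed
qed

lemma dyadic_fold: "\<forall>es\<in>set ess. tame es \<Longrightarrow> dyadic (fold acc ess x) = factored_value ess * dyadic x"
proof (induction ess arbitrary: x)
  case Nil
  then show ?case by simp
next
  case (Cons es ess)
  then show ?case using dyadic_acc[of es x] by (simp add: factored_value_def)
qed

lemma odd_acc: "tame es \<Longrightarrow> odd (snd (snd x)) \<Longrightarrow> odd (snd (snd (acc es x)))"
  by (cases x) (auto simp: tame_def split: if_splits)

lemma odd_fold: "\<forall>es\<in>set ess. tame es \<Longrightarrow> odd (snd (snd x)) \<Longrightarrow> odd (snd (snd (fold acc ess x)))"
  by (induction ess arbitrary: x) (simp_all add: odd_acc)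

lemma acc_mono: "snd (snd x) \<le> snd (snd (acc es x))"
  by (cases "(es, x)" rule: acc.cases) auto

text \<open>The odd part only grows, so its final value bounds all intermediate ones; this makes
  multiplying out affordable.\<close>

lemma fold_acc_mono: "snd (snd x) \<le> snd (snd (fold acc ess x))"
proof (induction ess arbitrary: x)
  case (Cons es ess)
  have "snd (snd (acc es x)) \<le> snd (snd (fold acc ess (acc es x)))" by (rule Cons.IH)
  with acc_mono[of x es] show ?case by (simp only: fold_simps)
qed simp

definition idle :: "store \<Rightarrow> bool" where
  "idle s \<longleftrightarrow> (\<forall>j\<in>{8, 9, 10, 15, 17, 18, 19, 20, 21, 26, 28, 29, 30}. s j = [])"

definition shift :: "nat \<Rightarrow> cmd" where
  "shift r = While (NE 15) (Pop 15 ;; Push r False)"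

lemma run_shift:
  assumes "4 \<le> r" "r \<noteq> 15" "s 15 = un d"
  shows "run (shift r) s (s(15 := [], r := replicate d False @ s r)) (6 * d + 1)"
proof -
  define R where "R i = s(15 := un (d - i), r := replicate i False @ s r)" for i
  have r: "run (While (NE 15) (Pop 15 ;; Push r False)) (R 0) (R d) (d * ((1 + 2 + 1) + 2) + 1)"
  proof (rule run_While[where S = R])
    fix i assume i: "i < d"
    show "run (Pop 15 ;; Push r False) (R i) (R (Suc i)) (1 + 2 + 1)"
    proof (intro run_Seq)
      show "run (Pop 15) (R i) ((R i)(15 := un (d - Suc i))) 1"
        using assms i by (intro run_weaken[OF run_Pop]) (auto simp: R_def fun_eq_iff)
      show "run (Push r False) ((R i)(15 := un (d - Suc i))) (R (Suc i)) 2"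
        using assms by (intro run_weaken[OF run_Push]) (auto simp: R_def fun_eq_iff)
    qed
  qed (use assms in \<open>auto simp: R_def\<close>)
  have "R 0 = s" using assms by (auto simp: R_def)
  from run_weaken[OF r[unfolded this]] show ?thesis unfolding shift_def by (simp add: R_def)
qed

lemma bin_shift: "0 < p \<Longrightarrow> bin (2 ^ d * p) = replicate d False @ bin p"
  by (induction d) (auto simp: bin_Cons)

definition sub2 :: "nat \<Rightarrow> nat \<Rightarrow> nat \<Rightarrow> nat \<Rightarrow> cmd" where
  "sub2 x y p q = copy x p 10 ;; copy y q 10 ;; serial borrow p q"

lemma run_sub2:
  assumes d: "4 \<le> x" "4 \<le> y" "x \<noteq> y" "{x, y} \<inter> {8, 9, 10, 15, 26, 28, 29, 30} = {}" "(p, q) = (29, 30) \<or> (p, q) = (30, 29)"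
    and s: "s 10 = []" "s 28 = []" "s 9 = []" "s p = []" "s q = []" "s x = bin a" "s y = bin b" and B: "length (bin a) \<le> B" "length (bin b) \<le> B"
  obtains zs where "run (sub2 x y p q) s (s(9 := zs, 28 := flag (a < b))) (70 * B + 20)" "length zs \<le> 2 * B" "b \<le> a \<Longrightarrow> msb_val 0 zs = a - b"
proof -
  obtain zs where z: "ser borrow False (bin a) (bin b) [] = (zs, a < b)" "length zs \<le> length (bin a) + length (bin b)"
    "b \<le> a \<Longrightarrow> msb_val 0 zs = a - b" using ser_sub_0[of a b] by blast
  have "run (sub2 x y p q) s (s(9 := zs, 28 := flag (a < b)))
    ((17 * length (bin a) + 3) + ((17 * length (bin b) + 3) + (16 * (length (bin a) + length (bin b)) + 3) + 1) + 1)"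
    unfolding sub2_def
  proof (intro run_Seq)
    show "run (copy x p 10) s (s(p := bin a)) (17 * length (bin a) + 3)"
      using d s by (intro run_weaken[OF run_copy]) auto
    show "run (copy y q 10) (s(p := bin a)) (s(p := bin a, q := bin b)) (17 * length (bin b) + 3)"
      using d s by (intro run_weaken[OF run_copy]) auto
    show "run (serial borrow p q) (s(p := bin a, q := bin b)) (s(9 := zs, 28 := flag (a < b))) (16 * (length (bin a) + length (bin b)) + 3)"
      using d s z(1) by (intro run_weaken[OF run_serial[where c = False]]) (auto simp: flag_def fun_eq_iff)
  qed
  then have "run (sub2 x y p q) s (s(9 := zs, 28 := flag (a < b))) (70 * B + 20)" using B by (elim run_weaken) auto
  then show ?thesis using that z B by simp
qed

text \<open>If the first subtraction ends with a borrow, it is repeated with exchanged operands and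
  register 26 records this. The unary result presupposes that the difference, and not only its
  length, is small.\<close>

definition absdiff :: "nat \<Rightarrow> nat \<Rightarrow> cmd" where
  "absdiff x y = sub2 x y 29 30 ;;
     If (TT 28) (Pop 28 ;; Push 26 True ;; clear 9 ;; sub2 y x 29 30) Skip ;; to_unary 9 15"

definition tD :: "nat \<Rightarrow> nat" where "tD B = 2 * B * (16 * B + 20) + 200 * B + 100"

lemma run_absdiff:
  assumes d: "4 \<le> x" "4 \<le> y" "x \<noteq> y" "{x, y} \<inter> {8, 9, 10, 15, 26, 28, 29, 30} = {}"
    and s: "\<forall>j\<in>{8, 9, 10, 15, 26, 28, 29, 30}. s j = []" "s x = bin a" "s y = bin b"
    and B: "length (bin a) \<le> B" "length (bin b) \<le> B" "(a - b) + (b - a) \<le> B"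
  shows "run (absdiff x y) s (s(15 := un ((a - b) + (b - a)), 26 := flag (a < b))) (tD B)"
proof -
  let ?S = "70 * B + 20"
  have s': "s 10 = []" "s 28 = []" "s 9 = []" "s 29 = []" "s 30 = []" "s 8 = []" "s 15 = []" "s 26 = []" using s(1) by auto
  obtain zs where z: "run (sub2 x y 29 30) s (s(9 := zs, 28 := flag (a < b))) ?S" "length zs \<le> 2 * B" "b \<le> a \<Longrightarrow> msb_val 0 zs = a - b"
    using run_sub2[of x y 29 30 s a b B] d s' s B by auto
  obtain zs' where z': "run (sub2 y x 29 30) (s(26 := [True])) (s(26 := [True], 9 := zs', 28 := flag (b < a))) ?S" "length zs' \<le> 2 * B" "a \<le> b \<Longrightarrow> msb_val 0 zs' = b - a"
    using run_sub2[of y x 29 30 "s(26 := [True])" b a B] d s' s B by auto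
  define ws where "ws = (if a < b then zs' else zs)"
  have ws: "length ws \<le> 2 * B" "msb_val 0 ws = (a - b) + (b - a)" using z z' by (auto simp: ws_def)
  let ?t = "s(9 := ws, 26 := flag (a < b))"
  have 2: "run (If (TT 28) (Pop 28 ;; Push 26 True ;; clear 9 ;; sub2 y x 29 30) Skip) (s(9 := zs, 28 := flag (a < b))) ?t
    ((1 + (2 + ((6 * B + 1) + ?S + 1) + 1) + 1) + 1)"
  proof (rule run_If)
    assume "holds (TT 28) (s(9 := zs, 28 := flag (a < b)))"
    then have ab: "a < b" by (auto simp: flag_def split: if_splits)
    show "run (Pop 28 ;; Push 26 True ;; clear 9 ;; sub2 y x 29 30) (s(9 := zs, 28 := flag (a < b))) ?t (1 + (2 + ((6 * B + 1) + ?S + 1) + 1) + 1)"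
    proof (intro run_Seq)
      show "run (Pop 28) (s(9 := zs, 28 := flag (a < b))) (s(9 := zs)) 1"
        using ab s' by (intro run_weaken[OF run_Pop]) (auto simp: flag_def fun_eq_iff)
      show "run (Push 26 True) (s(9 := zs)) (s(9 := zs, 26 := [True])) 2"
        using s' by (intro run_weaken[OF run_Push]) auto
      show "run (clear 9) (s(9 := zs, 26 := [True])) (s(26 := [True])) (6 * B + 1)"
        using s' z(2) by (intro run_weaken[OF run_clear]) (auto simp: fun_eq_iff)
      show "run (sub2 y x 29 30) (s(26 := [True])) ?t ?S"
        using s' ab by (intro run_weaken[OF z'(1)]) (auto simp: ws_def flag_def fun_eq_iff)
    qed
  next
    assume "\<not> holds (TT 28) (s(9 := zs, 28 := flag (a < b)))"
    then have ab: "\<not> a < b" by (auto simp: flag_def split: if_splits)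
    then show "run Skip (s(9 := zs, 28 := flag (a < b))) ?t (1 + (2 + ((6 * B + 1) + ?S + 1) + 1) + 1)"
      using s' by (intro run_weaken[OF run_Skip]) (auto simp: ws_def flag_def fun_eq_iff)
  qed simp
  have 3: "run (to_unary 9 15) ?t (s(15 := un ((a - b) + (b - a)), 26 := flag (a < b))) (length ws * (16 * B + 20) + 1)"
    using s' ws B by (intro run_weaken[OF run_to_unary[where a = 0 and B = B]]) (auto simp: fun_eq_iff)
  have p: "length ws * (16 * B + 20) \<le> 2 * B * (16 * B + 20)" using ws(1) by (rule mult_le_mono1)
  have aux: "?S + (((1 + (2 + ((6 * B + 1) + ?S + 1) + 1) + 1) + 1) + (p + 1) + 1) + 1 \<le> q + 200 * B + 100" if "p \<le> q" for p q
    using that by simp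
  show ?thesis
    unfolding tD_def absdiff_def by (rule run_weaken[OF run_Seq[OF z(1) run_Seq[OF 2 3]] refl aux[OF p]])
qed

definition eval_pair :: cmd where
  "eval_pair = absdiff 20 21 ;; If (TT 26) (Pop 26 ;; copy 20 8 10) (copy 21 8 10) ;; add_to 32 ;; clear 20 ;; clear 21 ;;
     If (NE 15) (copy 31 8 10 ;; shift 8 ;; add_to 31) (Push 8 True ;; add_to 32)"

definition tEv :: "nat \<Rightarrow> nat" where "tEv B = tD B + 400 * B + 400"

lemma run_eval_pair:
  assumes s: "\<forall>j\<in>{8, 9, 10, 15, 26, 28, 29, 30}. s j = []" "s 20 = bin a" "s 21 = bin b" "s 31 = bin p" "s 32 = bin k" "s 33 = bin l"
    and B: "length (bin a) \<le> B" "length (bin b) \<le> B" "(a - b) + (b - a) \<le> B" "length (bin k) \<le> B" "length (bin p) \<le> B"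
    and p: "0 < p" and A: "acc [int a, int b] (k, l, p) = (k', l', p')"
  shows "run eval_pair s (s(20 := [], 21 := [], 31 := bin p', 32 := bin k', 33 := bin l')) (tEv B)"
proof -
  have s': "s 10 = []" "s 28 = []" "s 9 = []" "s 8 = []" "s 15 = []" "s 26 = []" using s(1) by auto
  let ?d = "(a - b) + (b - a)"
  let ?s1 = "s(15 := un ?d, 26 := flag (a < b))"
  let ?s2 = "s(15 := un ?d, 8 := bin (min a b))"
  let ?s3 = "s(15 := un ?d, 32 := bin (min a b + k))"
  have lk: "length (bin (min a b + k)) \<le> 2 * B" 
  proof -
    have "length (bin (min a b)) \<le> B" using B by (simp add: min_def)
    then show ?thesis using length_bin_add[of "min a b" k] B by linarith
  qed
  let ?T = "(17 * B + 3) + ((6 * B + 1) + (75 * B + 70) + 1) + 1"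
  have "run eval_pair s (s(20 := [], 21 := [], 31 := bin p', 32 := bin k', 33 := bin l'))
    (tD B + (((1 + (17 * B + 3) + 1) + 1) + ((50 * B + 40) + ((3 * B + 1) + ((3 * B + 1) + (?T + 1) + 1) + 1) + 1) + 1) + 1)"
    unfolding eval_pair_def
  proof (intro run_Seq)
    show "run (absdiff 20 21) s ?s1 (tD B)" using s B by (intro run_absdiff) auto
    show "run (If (TT 26) (Pop 26 ;; copy 20 8 10) (copy 21 8 10)) ?s1 ?s2 ((1 + (17 * B + 3) + 1) + 1)"
    proof (rule run_If)
      assume "holds (TT 26) ?s1"
      then have ab: "a < b" by (auto simp: flag_def split: if_splits)
      show "run (Pop 26 ;; copy 20 8 10) ?s1 ?s2 (1 + (17 * B + 3) + 1)"
      proof (intro run_Seq)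
        show "run (Pop 26) ?s1 (s(15 := un ?d)) 1" using s' ab by (intro run_weaken[OF run_Pop]) (auto simp: flag_def fun_eq_iff)
        show "run (copy 20 8 10) (s(15 := un ?d)) ?s2 (17 * B + 3)"
          using s s' ab B by (intro run_weaken[OF run_copy]) (auto simp: fun_eq_iff)
      qed
    next
      assume "\<not> holds (TT 26) ?s1"
      then have ab: "\<not> a < b" by (auto simp: flag_def split: if_splits)
      then show "run (copy 21 8 10) ?s1 ?s2 (1 + (17 * B + 3) + 1)"
        using s s' B by (intro run_weaken[OF run_copy]) (auto simp: fun_eq_iff flag_def)
    qed simp
    have "length (bin (min a b)) \<le> B" using B by (simp add: min_def)
    then show "run (add_to 32) ?s2 ?s3 (50 * B + 40)"
      using s s' B by (intro run_weaken[OF run_add_to[where x = "min a b" and y = k]]) (auto simp: fun_eq_iff)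
    show "run (clear 20) ?s3 (?s3(20 := [])) (3 * B + 1)" using s B by (intro run_weaken[OF run_clear]) auto
    let ?s4 = "?s3(20 := [], 21 := [])"
    show "run (clear 21) (?s3(20 := [])) ?s4 (3 * B + 1)" using s B by (intro run_weaken[OF run_clear]) auto
    let ?t = "s(20 := [], 21 := [], 31 := bin p', 32 := bin k', 33 := bin l')"
    show "run (If (NE 15) (copy 31 8 10 ;; shift 8 ;; add_to 31) (Push 8 True ;; add_to 32)) ?s4 ?t (?T + 1)"
    proof (rule run_If)
      assume "holds (NE 15) ?s4"
      then have ab: "a \<noteq> b" by auto
      then have kl: "k' = min a b + k" "l' = l" and p': "p' = 2 ^ ?d * p + p"
        using A by (auto simp: nat_abs_int_diff min_def split: if_splits)
      have l8: "length (bin (2 ^ ?d * p)) \<le> 2 * B" using B p by (simp add: bin_shift)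
      show "run (copy 31 8 10 ;; shift 8 ;; add_to 31) ?s4 ?t ?T"
      proof (intro run_Seq)
        show "run (copy 31 8 10) ?s4 (?s4(8 := bin p)) (17 * B + 3)" using s s' B by (intro run_weaken[OF run_copy]) auto
        show "run (shift 8) (?s4(8 := bin p)) (?s4(15 := [], 8 := bin (2 ^ ?d * p))) (6 * B + 1)"
          using s s' B p by (intro run_weaken[OF run_shift[where d = "?d"]]) (auto simp: bin_shift)
        show "run (add_to 31) (?s4(15 := [], 8 := bin (2 ^ ?d * p))) ?t (75 * B + 70)"
          using s s' l8 B by (intro run_weaken[OF run_add_to[where x = "2 ^ ?d * p" and y = p]]) (auto simp: fun_eq_iff kl p')
      qed
    next
      assume "\<not> holds (NE 15) ?s4"
      then have ab: "a = b" by auto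
      then have kl: "k' = 1 + (min a b + k)" "l' = l" and p': "p' = p" using A by auto
      have b1: "bin 1 = [True]" by (simp add: bin_Cons)
      have "run (Push 8 True ;; add_to 32) ?s4 ?t (2 + (50 * B + 65) + 1)"
      proof (intro run_Seq)
        show "run (Push 8 True) ?s4 (?s4(8 := bin 1)) 2" unfolding b1 using s' by (intro run_weaken[OF run_Push]) auto
        show "run (add_to 32) (?s4(8 := bin 1)) ?t (50 * B + 65)"
          using s s' lk ab by (intro run_weaken[OF run_add_to[where x = 1 and y = "min a b + k"]]) (auto simp: fun_eq_iff kl p' b1[simplified])
      qed
      then show "run (Push 8 True ;; add_to 32) ?s4 ?t ?T" by (elim run_weaken) auto
    qed simp
  qed
  then show ?thesis by (elim run_weaken) (auto simp: tEv_def)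
qed

definition eval_body :: cmd where
  "eval_body = Pop 6 ;; Pop 6 ;; getflag 18 ;; read_word 6 19 ;;
     If (TT 6) (Pop 6 ;; Pop 6 ;; read_word 6 17 ;; Pop 6 ;; pour 19 20 ;; pour 17 21 ;; eval_pair)
       (Pop 6 ;; If (TT 18) (addreg 33) (addreg 32) ;; clear 18 ;; clear 19)"

lemma idleD: "idle s \<Longrightarrow> j \<in> {8, 9, 10, 15, 17, 18, 19, 20, 21, 26, 28, 29, 30} \<Longrightarrow> s j = []"
  by (auto simp: idle_def)

lemma length_bin_pow2_le: "2 ^ d \<le> x \<Longrightarrow> d \<le> length (bin x)"
proof -
  assume "2 ^ d \<le> x"
  then have "(2 :: nat) ^ d < 2 ^ length (bin x)" using length_bin_less[of x] by (rule le_less_trans)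
  then show ?thesis by simp
qed

lemma enc1_simps:
  "enc1 (w # es) = True # True # (w < 0) # enc_word (bin (nat \<bar>w\<bar>)) @ enc_list enc_int es"
  "enc_list enc_int [] = [False]"
  "enc_list enc_int [int b] = True # False # enc_word (bin b) @ [False]"
  by (auto simp: enc1_def enc_list_def enc_int_def enc_nat_def)

text \<open>A factor lengthens an exponent by no more than its own encoding; the extra bit for equal
  exponents is covered by the marker bits.\<close>

lemma length_bin_acc:
  assumes "tame es" "acc es (k, l, p) = (k', l', p')"
  shows "length (bin k') \<le> length (bin k) + length (enc1 es)" "length (bin l') \<le> length (bin l) + length (enc1 es)"
proof -
  have n: "length (bin (nat \<bar>w\<bar> + k)) \<le> length (bin k) + length (enc1 (w # fs))" for w k fs
    using length_bin_add[of "nat \<bar>w\<bar>" k] by (simp add: enc1_simps length_enc_word)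
  have m: "Suc (length (bin (nat a + k))) \<le> length (bin k) + length (enc1 [a, b]) \<and> length (bin (nat (min a b) + k)) \<le> length (bin k) + length (enc1 [a, b])"
    if "0 \<le> a" "0 \<le> b" for a b
  proof -
    have "length (bin (nat (min a b))) \<le> length (bin (nat a))" by (rule length_bin_mono) simp
    then show ?thesis using that length_bin_add[of "nat a" k] length_bin_add[of "nat (min a b)" k]
      by (simp add: enc1_simps length_enc_word)
  qed
  have o: "length (bin (Suc x)) \<le> Suc (length (bin x))" for x
    using length_bin_add[of 1 x] by (simp add: bin_Cons)
  consider w where "es = [w]" | a b where "es = [int a, int b]" using assms(1) by (auto simp: tame_def)
  then have "length (bin k') \<le> length (bin k) + length (enc1 es) \<and> length (bin l') \<le> length (bin l) + length (enc1 es)"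
  proof cases
    case (1 w)
    then show ?thesis using assms(2) n[of w k "[]"] n[of w l "[]"] by (auto split: if_splits)
  next
    case (2 a b)
    then show ?thesis using assms(2) m[of "int a" "int b"] o[of "a + k"] by (auto split: if_splits)
  qed
  then show "length (bin k') \<le> length (bin k) + length (enc1 es)" "length (bin l') \<le> length (bin l) + length (enc1 es)" by auto
qed

definition tB :: "nat \<Rightarrow> nat" where "tB B = tEv B + 200 * B + 200"

lemma run_eval_body:
  assumes i: "idle s" and s: "s 6 = enc1 es @ xs" "s 31 = bin p" "s 32 = bin k" "s 33 = bin l"
    and t: "tame es" "0 < p" and A: "acc es (k, l, p) = (k', l', p')"
    and B: "length (bin k) + length (enc1 es) \<le> B" "length (bin l) + length (enc1 es) \<le> B" "length (bin p') \<le> B"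
  shows "run eval_body s (s(6 := xs, 31 := bin p', 32 := bin k', 33 := bin l')) (tB B)"
proof -
  note i0 = idleD[OF i]
  have i': "s 8 = []" "s 9 = []" "s 10 = []" "s 15 = []" "s 17 = []" "s 18 = []" "s 19 = []" "s 20 = []" "s 21 = []" "s 26 = []" "s 28 = []" "s 29 = []" "s 30 = []"
    by (rule i0; simp)+
  obtain w fs where es: "es = w # fs" using t(1) by (auto simp: tame_def)
  let ?W = "bin (nat \<bar>w\<bar>)"
  have lw: "length ?W \<le> B" using B(1) by (simp add: es enc1_simps length_enc_word)
  let ?ys = "enc_list enc_int fs @ xs"
  let ?s1 = "s(6 := ?ys, 18 := flag (w < 0), 19 := rev ?W)"
  let ?t = "s(6 := xs, 31 := bin p', 32 := bin k', 33 := bin l')"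
  let ?I = "tEv B + 100 * B + 150"
  have "run (If (TT 6) (Pop 6 ;; Pop 6 ;; read_word 6 17 ;; Pop 6 ;; pour 19 20 ;; pour 17 21 ;; eval_pair)
       (Pop 6 ;; If (TT 18) (addreg 33) (addreg 32) ;; clear 18 ;; clear 19)) ?s1 ?t (?I + 1)"
  proof (rule run_If)
    assume "holds (TT 6) ?s1"
    then obtain a b where ab: "w = int a" "fs = [int b]"
      using t(1) by (auto simp: tame_def es enc1_simps)
    have la: "length (bin a) \<le> B" "length (bin b) \<le> B" "length (bin k) \<le> B"
      using B(1) by (simp_all add: es ab enc1_simps length_enc_word)
    \<comment> \<open>For different exponents the new odd part is at least 2 to the power of their
      distance, so the distance is bounded by the length of \<open>p'\<close>.\<close>
    have d: "(a - b) + (b - a) \<le> B"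
    proof (cases "a = b")
      case False
      then have "p' = 2 ^ ((a - b) + (b - a)) * p + p"
        using A by (auto simp: es ab nat_abs_int_diff split: if_splits)
      moreover have "2 ^ ((a - b) + (b - a)) * 1 \<le> 2 ^ ((a - b) + (b - a)) * p" using t(2) by (intro mult_le_mono) auto
      ultimately show ?thesis using length_bin_pow2_le[of "(a - b) + (b - a)" p'] B(3) by linarith
    qed simp
    have lp: "length (bin p) \<le> B"
      using acc_mono[of "(k, l, p)" es] A length_bin_mono[of p p'] B(3) by simp
    let ?s2 = "s(19 := rev (bin a))"
    show "run (Pop 6 ;; Pop 6 ;; read_word 6 17 ;; Pop 6 ;; pour 19 20 ;; pour 17 21 ;; eval_pair) ?s1 ?t ?I"
    proof (rule run_weaken)
      show "run (Pop 6 ;; Pop 6 ;; read_word 6 17 ;; Pop 6 ;; pour 19 20 ;; pour 17 21 ;; eval_pair) ?s1 ?t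
        (1 + (1 + ((9 * B + 3) + (1 + ((7 * B + 1) + ((7 * B + 1) + tEv B + 1) + 1) + 1) + 1) + 1) + 1)"
      proof (intro run_Seq)
        show "run (Pop 6) ?s1 (?s2(6 := False # enc_word (bin b) @ False # xs)) 1"
          using i' by (intro run_weaken[OF run_Pop]) (auto simp: ab enc1_simps flag_def fun_eq_iff)
        show "run (Pop 6) (?s2(6 := False # enc_word (bin b) @ False # xs)) (?s2(6 := enc_word (bin b) @ False # xs)) 1"
          by (intro run_weaken[OF run_Pop]) auto
        show "run (read_word 6 17) (?s2(6 := enc_word (bin b) @ False # xs)) (?s2(6 := False # xs, 17 := rev (bin b))) (9 * B + 3)"
          using i' la by (intro run_weaken[OF run_read_word[where w = "bin b" and xs = "False # xs"]]) auto
        show "run (Pop 6) (?s2(6 := False # xs, 17 := rev (bin b))) (?s2(6 := xs, 17 := rev (bin b))) 1"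
          by (intro run_weaken[OF run_Pop]) (auto simp: fun_eq_iff)
        show "run (pour 19 20) (?s2(6 := xs, 17 := rev (bin b))) (s(6 := xs, 17 := rev (bin b), 20 := bin a)) (7 * B + 1)"
          using i' la by (intro run_weaken[OF run_pour]) (auto simp: fun_eq_iff)
        show "run (pour 17 21) (s(6 := xs, 17 := rev (bin b), 20 := bin a)) (s(6 := xs, 20 := bin a, 21 := bin b)) (7 * B + 1)"
          using i' la by (intro run_weaken[OF run_pour]) (auto simp: fun_eq_iff)
        show "run eval_pair (s(6 := xs, 20 := bin a, 21 := bin b)) ?t (tEv B)"
          using i' s la d lp t(2) A unfolding es ab
          by (intro run_weaken[OF run_eval_pair[where a = a and b = b and p = p and k = k and l = l and B = B and p' = p' and k' = k' and l' = l']])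
            (auto simp: fun_eq_iff simp del: acc.simps)
      qed
    qed auto
  next
    assume "\<not> holds (TT 6) ?s1"
    then have fs: "fs = []" using t(1) by (auto simp: tame_def es enc1_simps)
    have A': "(k', l', p') = (if w < 0 then (k, nat \<bar>w\<bar> + l, p) else (nat \<bar>w\<bar> + k, l, p))"
      using A by (simp add: es fs)
    let ?s2 = "s(6 := xs, 18 := flag (w < 0), 19 := rev ?W)"
    let ?s3 = "?s2(31 := bin p', 32 := bin k', 33 := bin l')"
    show "run (Pop 6 ;; If (TT 18) (addreg 33) (addreg 32) ;; clear 18 ;; clear 19) ?s1 ?t ?I"
    proof (rule run_weaken)
      show "run (Pop 6 ;; If (TT 18) (addreg 33) (addreg 32) ;; clear 18 ;; clear 19) ?s1 ?t
        (1 + (((80 * B + 60) + 1) + (4 + (3 * B + 1) + 1) + 1) + 1)"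
      proof (intro run_Seq)
        show "run (Pop 6) ?s1 ?s2 1" by (intro run_weaken[OF run_Pop]) (auto simp: fs enc1_simps fun_eq_iff)
        show "run (If (TT 18) (addreg 33) (addreg 32)) ?s2 ?s3 ((80 * B + 60) + 1)"
        proof (rule run_If)
          show "run (addreg 33) ?s2 ?s3 (80 * B + 60)" if "holds (TT 18) ?s2"
            using that i' s lw B A' by (intro run_weaken[OF run_addreg[where x = "nat \<bar>w\<bar>" and y = l and B = B]])
              (auto simp: flag_def fun_eq_iff split: if_splits)
          show "run (addreg 32) ?s2 ?s3 (80 * B + 60)" if "\<not> holds (TT 18) ?s2"
            using that i' s lw B A' by (intro run_weaken[OF run_addreg[where x = "nat \<bar>w\<bar>" and y = k and B = B]])
              (auto simp: flag_def fun_eq_iff split: if_splits)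
        qed simp
        show "run (clear 18) ?s3 (?s3(18 := [])) 4" by (intro run_weaken[OF run_clear]) (auto simp: flag_def)
        show "run (clear 19) (?s3(18 := [])) ?t (3 * B + 1)"
          using i' lw by (intro run_weaken[OF run_clear]) (auto simp: fun_eq_iff)
      qed
    qed auto
  qed simp
  note 5 = this
  let ?u = "\<lambda>ys. s(6 := ys)"
  have 1: "run (Pop 6) s (?u (True # (w < 0) # enc_word ?W @ ?ys)) 1"
    using s(1) by (intro run_weaken[OF run_Pop]) (auto simp: es enc1_simps)
  have 2: "run (Pop 6) (?u (True # (w < 0) # enc_word ?W @ ?ys)) (?u ((w < 0) # enc_word ?W @ ?ys)) 1"
    by (intro run_weaken[OF run_Pop]) auto
  have 3: "run (getflag 18) (?u ((w < 0) # enc_word ?W @ ?ys)) (s(6 := enc_word ?W @ ?ys, 18 := flag (w < 0))) 5"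
    using i' by (intro run_weaken[OF run_getflag[where x = "w < 0" and xs = "enc_word ?W @ ?ys"]]) auto
  have 4: "run (read_word 6 19) (s(6 := enc_word ?W @ ?ys, 18 := flag (w < 0))) ?s1 (9 * B + 3)"
    using i' lw by (intro run_weaken[OF run_read_word[where w = ?W and xs = ?ys]]) (auto simp: fun_eq_iff)
  show ?thesis
    unfolding eval_body_def tB_def
    by (rule run_weaken[OF run_Seq[OF 1 run_Seq[OF 2 run_Seq[OF 3 run_Seq[OF 4 5]]]]]) auto
qed

text \<open>The length of each exponent plus that of the unread factors does not increase, by
  \<open>length_bin_acc\<close>; the odd part is bounded by its final value, by
  monotonicity.\<close>

lemma run_eval_loop:
  assumes "idle s" "s 6 = enc_list (enc_list enc_int) ess" "s 31 = bin p" "s 32 = bin k" "s 33 = bin l"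
    and "\<forall>es\<in>set ess. tame es" "0 < p" "fold acc ess (k, l, p) = (k', l', p')"
    and "length (bin k) + length (s 6) \<le> B" "length (bin l) + length (s 6) \<le> B" "length (bin p') \<le> B"
  shows "run (While (TT 6) eval_body) s (s(6 := [False], 31 := bin p', 32 := bin k', 33 := bin l')) (length ess * (tB B + 2) + 1) \<and>
    length (bin k') \<le> B \<and> length (bin l') \<le> B"
  using assms
proof (induction ess arbitrary: s k l p)
  case Nil
  then show ?case by (auto intro!: run_weaken[OF run_While_end] simp: enc_list_def fun_eq_iff)
next
  case (Cons es ess)
  obtain k1 l1 p1 where 1: "acc es (k, l, p) = (k1, l1, p1)" by (cases "acc es (k, l, p)")
  have f: "fold acc ess (k1, l1, p1) = (k', l', p')" using Cons.prems(8) by (simp add: 1 del: acc.simps)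
  have p: "p \<le> p1" "p1 \<le> p'" using acc_mono[of "(k, l, p)" es] 1 fold_acc_mono[of "(k1, l1, p1)" ess] f by auto
  have t: "tame es" using Cons.prems(6) by simp
  let ?xs = "enc_list (enc_list enc_int) ess"
  have s6: "s 6 = enc1 es @ ?xs" using Cons.prems(2) by (simp add: enc_list_ess)
  let ?s1 = "s(6 := ?xs, 31 := bin p1, 32 := bin k1, 33 := bin l1)"
  have 2: "run eval_body s ?s1 (tB B)"
    using Cons.prems(9-11) length_bin_mono[OF p(2)]
    by (intro run_eval_body[OF Cons.prems(1) s6 Cons.prems(3-5) t Cons.prems(7) 1]) (auto simp: s6)
  have 3: "run (While (TT 6) eval_body) ?s1 (?s1(6 := [False], 31 := bin p', 32 := bin k', 33 := bin l')) (length ess * (tB B + 2) + 1) \<and>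
    length (bin k') \<le> B \<and> length (bin l') \<le> B"
  proof (rule Cons.IH[OF _ _ _ _ _ _ _ f])
    show "idle ?s1" using Cons.prems(1) by (auto simp: idle_def)
    show "length (bin k1) + length (?s1 6) \<le> B" "length (bin l1) + length (?s1 6) \<le> B"
      using length_bin_acc[OF t 1] Cons.prems(9,10) by (auto simp: s6)
  qed (use Cons.prems p in auto)
  have "run (While (TT 6) eval_body) s (?s1(6 := [False], 31 := bin p', 32 := bin k', 33 := bin l')) (tB B + (length ess * (tB B + 2) + 1) + 2)"
    using 3 by (intro run_While_step[OF _ _ 2]) (auto simp: s6 enc1_def)
  then have "run (While (TT 6) eval_body) s (s(6 := [False], 31 := bin p', 32 := bin k', 33 := bin l')) (length (es # ess) * (tB B + 2) + 1)"
    by (elim run_weaken) (auto simp: fun_eq_iff)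
  then show ?case using 3 by simp
qed

definition finish :: cmd where
  "finish = absdiff 32 33 ;; Push 20 True ;; If (TT 26) (shift 20) (shift 31) ;;
     Push 1 False ;; emit_word 31 1 ;; Push 1 False ;; emit_word 20 1"

definition tG :: "nat \<Rightarrow> nat" where "tG B = tD B + 40 * B + 60"

lemma run_finish:
  assumes i: "idle s" and s: "s 1 = []" "s 31 = bin p" "s 32 = bin k" "s 33 = bin l" and p: "0 < p"
    and B: "length (bin k) \<le> B" "length (bin l) \<le> B" "(k - l) + (l - k) \<le> B"
      "length (bin (2 ^ (k - l) * p)) \<le> B" "length (bin (2 ^ (l - k))) \<le> B"
  shows "\<exists>s'. run finish s s' (tG B) \<and> rev (s' 1) = False # enc_nat (2 ^ (k - l) * p) @ False # enc_nat (2 ^ (l - k))"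
proof -
  note i0 = idleD[OF i]
  have i': "s 8 = []" "s 9 = []" "s 10 = []" "s 15 = []" "s 20 = []" "s 26 = []" "s 28 = []" "s 29 = []" "s 30 = []"
    by (rule i0; simp)+
  let ?d = "(k - l) + (l - k)"
  let ?N = "bin (2 ^ (k - l) * p)" let ?D = "bin (2 ^ (l - k))"
  let ?s1 = "s(15 := un ?d, 26 := flag (k < l))"
  let ?s3 = "s(26 := flag (k < l), 31 := ?N, 20 := ?D)"
  have bp: "?D = replicate (l - k) False @ [True]"
    using bin_shift[of 1 "l - k"] by (simp add: bin_Cons)
  have b1: "bin (Suc 0) = [True]" by (simp add: bin_Cons)
  have 1: "run (absdiff 32 33) s ?s1 (tD B)" using i' s B by (intro run_absdiff) auto
  have 2: "run (Push 20 True) ?s1 (?s1(20 := [True])) 2" using i' by (intro run_weaken[OF run_Push]) auto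
  have 3: "run (If (TT 26) (shift 20) (shift 31)) (?s1(20 := [True])) ?s3 ((6 * B + 1) + 1)"
  proof (rule run_If)
    show "run (shift 20) (?s1(20 := [True])) ?s3 (6 * B + 1)" if "holds (TT 26) (?s1(20 := [True]))"
    proof -
      have "k < l" using that by (auto simp: flag_def split: if_splits)
      then show ?thesis using i' s B by (intro run_weaken[OF run_shift[where d = ?d]]) (auto simp: bp fun_eq_iff)
    qed
    show "run (shift 31) (?s1(20 := [True])) ?s3 (6 * B + 1)" if "\<not> holds (TT 26) (?s1(20 := [True]))"
    proof -
      have "\<not> k < l" using that by (auto simp: flag_def split: if_splits)
      then show ?thesis using i' s B p by (intro run_weaken[OF run_shift[where d = ?d]]) (auto simp: b1 bin_shift fun_eq_iff)
    qed
  qed simp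
  have 4: "run (Push 1 False) ?s3 (?s3(1 := [False])) 2" using s by (intro run_weaken[OF run_Push]) auto
  have 5: "run (emit_word 31 1) (?s3(1 := [False])) (?s3(31 := [], 1 := rev (enc_word ?N) @ [False])) (10 * B + 5)"
    using B by (intro run_weaken[OF run_emit_word]) (auto simp: fun_eq_iff)
  have 6: "run (Push 1 False) (?s3(31 := [], 1 := rev (enc_word ?N) @ [False])) (?s3(31 := [], 1 := False # rev (enc_word ?N) @ [False])) 2"
    by (intro run_weaken[OF run_Push]) auto
  have 7: "run (emit_word 20 1) (?s3(31 := [], 1 := False # rev (enc_word ?N) @ [False]))
     (?s3(31 := [], 20 := [], 1 := rev (enc_word ?D) @ False # rev (enc_word ?N) @ [False])) (10 * B + 5)"
    using B by (intro run_weaken[OF run_emit_word]) (auto simp: fun_eq_iff)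
  have r: "run finish s (?s3(31 := [], 20 := [], 1 := rev (enc_word ?D) @ False # rev (enc_word ?N) @ [False])) (tG B)"
    unfolding finish_def tG_def
    by (rule run_weaken[OF run_Seq[OF 1 run_Seq[OF 2 run_Seq[OF 3 run_Seq[OF 4 run_Seq[OF 5 run_Seq[OF 6 7]]]]]]]) auto
  show ?thesis by (rule exI, rule conjI, rule r) (simp add: enc_nat_def)
qed

text \<open>One of the two truncated differences is 0 and \<open>p\<close> is odd, so the fraction
  is already reduced.\<close>

lemma enc_rat_dyadic:
  assumes "odd p"
  shows "enc_rat (dyadic (k, l, p)) = False # enc_nat (2 ^ (k - l) * p) @ False # enc_nat (2 ^ (l - k))"
proof -
  let ?n = "int (2 ^ (k - l) * p)" let ?d = "int (2 ^ (l - k))"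
  have "coprime (int p) ?d" using assms by simp
  then have c: "coprime ?n ?d" by (cases "k \<le> l") auto
  have "dyadic (k, l, p) = Fract ?n ?d"
  proof (cases "k \<le> l")
    case True
    then have "(2 :: rat) ^ l = 2 ^ k * 2 ^ (l - k)" by (simp add: power_add[symmetric])
    then show ?thesis using True by (simp add: Fract_of_int_quotient)
  next
    case False
    then have "(2 :: rat) ^ k = 2 ^ l * 2 ^ (k - l)" by (simp add: power_add[symmetric])
    then show ?thesis using False by (simp add: Fract_of_int_quotient)
  qed
  then have "quotient_of (dyadic (k, l, p)) = (?n, ?d)"
    using c by (simp only: quotient_of_Fract) (rule normalize_stable; simp)
  moreover have "enc_int (int m) = False # enc_nat m" for m by (simp add: enc_int_def)
  ultimately show ?thesis by (simp only: enc_rat_def prod.case append_Cons)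
qed

theorem output_poly_time_partition:
  assumes S: "\<forall>F\<in>S. simple_graph F" "\<not> (\<exists>F\<in>S. 3 \<le> graph_order F)"
  shows "output_poly_time_solvable (ergm_partition S)"
proof -
  let ?c = "factor ;; pour 7 6 ;; Push 31 True ;; While (TT 6) eval_body ;; finish"
  obtain M where M: "turing_machine M"
    "\<And>x s t. run ?c (input_store x) s t \<Longrightarrow> outputs_within no_oracle M x (rev (s 1)) (t + 3)"
    using compile[of ?c] by blast
  obtain q where q: "\<And>B. tF B \<le> poly q B" using pbound_tF unfolding pbound_def by blast
  define b where "b N = poly q N + N + 1" for N
  define T where "T N = b N + ((7 * b N + 1) + (2 + ((b N * (tB (b N) + 2) + 1) + tG (b N) + 1) + 1) + 1) + 1 + 3" for N
  have "pbound T"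
    unfolding T_def b_def tB_def tG_def tEv_def tD_def by (intro pbound_intros)
  then obtain r where r: "\<And>N. T N \<le> poly r N" unfolding pbound_def by blast
  have "\<exists>y. (x, y) \<in> ergm_partition S \<and> outputs_within no_oracle M x y (poly r (length x + length y))"
    if "x \<in> Domain (ergm_partition S)" for x
  proof -
    obtain n fs where m: "x = enc_ergm (ERGM n fs)" "uses_features_from S (ERGM n fs)"
      using \<open>x \<in> _\<close> unfolding ergm_partition_def by (auto, metis ergm.exhaust)
    note sf = small_features[OF S m(2)]
    have x: "x = enc_unary n @ enc_list enc_wf fs" using m(1) by (simp add: enc_ergm_def)
    define ess where "ess = ess_of n fs"
    define y where "y = enc_rat (partition_function (ERGM n fs))"
    \<comment> \<open>The bound may involve the length of the output \<open>y\<close>, which can be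
      exponentially longer than the input.\<close>
    define N where "N = length x + length y" define B where "B = b N"
    obtain k l p where klp: "fold acc ess (0, 0, 1) = (k, l, p)" by (cases "fold acc ess (0, 0, 1)")
    have tm: "\<forall>es\<in>set ess. tame es" using tame_ess_of by (auto simp: ess_def)
    have val: "partition_function (ERGM n fs) = dyadic (k, l, p)"
      using dyadic_fold[OF tm, of "(0, 0, 1)"] factored_ess_of[OF sf] klp by (simp add: ess_def)
    have op: "odd p" using odd_fold[OF tm, of "(0, 0, 1)"] klp by simp
    then have p0: "0 < p" by (auto intro: Nat.gr0I)
    have y: "y = False # enc_nat (2 ^ (k - l) * p) @ False # enc_nat (2 ^ (l - k))"
      unfolding y_def val by (rule enc_rat_dyadic[OF op])
    have ly: "length (bin (2 ^ (k - l) * p)) \<le> length y" "length (bin (2 ^ (l - k))) \<le> length y"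
      by (simp_all add: y enc_nat_def length_enc_word)
    have NB: "length y \<le> B" by (simp add: B_def b_def N_def)
    \<comment> \<open>The odd part is a factor of the printed numerator and hence no longer than
      it.\<close>
    have lp: "length (bin p) \<le> B"
      using length_bin_mono[of p "2 ^ (k - l) * p"] ly(1) NB by simp
    \<comment> \<open>The remaining power of two is at most the numerator or equals the denominator,
      so the difference of the exponents, needed in unary, is at most the length of
      \<open>y\<close>.\<close>
    have "2 ^ (k - l) * 1 \<le> 2 ^ (k - l) * p" using p0 by (intro mult_le_mono) auto
    then have ld: "(k - l) + (l - k) \<le> B"
      using length_bin_pow2_le[of "k - l" "2 ^ (k - l) * p"] length_bin_pow2_le[of "l - k" "2 ^ (l - k)"] ly NB
      by (cases "k \<le> l") auto
    let ?e = "enc_list (enc_list enc_int) ess"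
    let ?s = "base n fs (rev ?e) 0 n [] []"
    have "tF (length x) \<le> poly q (length x)" by (rule q)
    also have "\<dots> \<le> poly q N" by (rule poly_nat_mono) (simp add: N_def)
    finally have tB: "tF (length x) \<le> B" "tF (length x) + 1 \<le> B" by (auto simp: B_def b_def)
    have 1: "run factor (input_store x) ?s B"
    proof (rule run_weaken)
      show "run factor (input_store x) ?s (tF (length x))"
        unfolding ess_def using fbounded_ergm[OF sf] x by (intro run_factor) auto
    qed (use tB in auto)
    have le: "length ?e \<le> B" using run_grow[OF 1, of 7] by (simp add: base_def input_store_def)
    let ?s1 = "?s(7 := [], 6 := ?e)" let ?s2 = "?s1(31 := bin 1)"
    have 2: "run (pour 7 6) ?s ?s1 (7 * B + 1)" using le by (intro run_weaken[OF run_pour]) (auto simp: base_def)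
    have 3: "run (Push 31 True) ?s1 ?s2 2" by (intro run_weaken[OF run_Push]) (auto simp: base_def bin_Cons)
    let ?s3 = "?s2(6 := [False], 31 := bin p, 32 := bin k, 33 := bin l)"
    have 4: "run (While (TT 6) eval_body) ?s2 ?s3 (length ess * (tB B + 2) + 1) \<and> length (bin k) \<le> B \<and> length (bin l) \<le> B"
      using le lp by (intro run_eval_loop[where k = 0 and l = 0 and p = 1, OF _ _ _ _ _ tm _ klp]) (auto simp: base_def idle_def)
    have "length ess \<le> length ?e" by (induction ess) (auto simp: enc_list_def)
    then have "length ess * (tB B + 2) \<le> B * (tB B + 2)" using le by (intro mult_le_mono1) linarith
    then have loop: "run (While (TT 6) eval_body) ?s2 ?s3 (B * (tB B + 2) + 1)"
      using 4 by (auto intro: run_weaken)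
    obtain s' where 5: "run finish ?s3 s' (tG B)" "rev (s' 1) = y"
      using run_finish[of ?s3 p k l B] 4 p0 ld ly NB unfolding y by (auto simp: base_def idle_def)
    have "outputs_within no_oracle M x y (T N)"
      using M(2)[OF run_Seq[OF 1 run_Seq[OF 2 run_Seq[OF 3 run_Seq[OF loop 5(1)]]]]] unfolding 5(2) T_def B_def .
    then have "outputs_within no_oracle M x y (poly r (length x + length y))"
      using r outputs_within_mono unfolding N_def by blast
    moreover have "(x, y) \<in> ergm_partition S"
      unfolding ergm_partition_def y_def using m by blast
    ultimately show ?thesis by blast
  qed
  then show ?thesis unfolding output_poly_time_solvable_def using M(1) by blast
qed

theorem theorem4:
  fixes S :: "graph set"
  assumes "\<forall>F\<in>S. simple_graph F"
  shows "((\<exists>F\<in>S. 3 \<le> graph_order F) \<longrightarrow> sharpP_hard (ergm_partition S)) \<and>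
         (\<not> (\<exists>F\<in>S. 3 \<le> graph_order F) \<longrightarrow>
            output_poly_time_solvable (ergm_partition S) \<and>
            poly_time_solvable (ergm_partition_factored S))"
  using assms sharpP_hard_ergm output_poly_time_partition poly_time_factored by blast

end
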